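(* Let $S=[0,\infty)$ or $S=\mathbb{R}$ and let $(\mathbb{P}_x)_{x\in S}$ be a Feller family on $S$ which is self-similar of index $\gamma>0$ and whose semigroup admits transition densities $p_s(\cdot,\cdot)$, $s>0$, with respect to a $\sigma$-finite measure $\mu$ on $S$. Assume that $(s,y)\mapsto p_s(x,y)$ is continuous for all $x\in S$, and that $p_t(x,y)=\int p_{t-s}(x,z)p_s(z,y)\,\mu(dz)$ for all $x,y\in S$ and $0<s<t$ such that $p_t(x,y)>0$. Let $c\in S$ be such that $p_1(0,c)>0$, let $$\mathscr{Z}_c=\{t\in(0,1]: X_{t-}=ct^{1/\gamma}\},$$ and let $g_c=\sup\mathscr{Z}_c$ if $\mathscr{Z}_c\neq\varnothing$, $g_c=0$ otherwise. If $g_c>0$ $\mathbb{P}_0$-almost surely, then the law under $\mathbb{P}_0$ of the process $(Y_t)_{t\in[0,1]}$ given by $$Y_t=\begin{cases} g_c^{-1/\gamma}\,X_{t\cdot g_c}, & t<1,\\ c,& t= 1,\end{cases}$$ is $\mathbb{P}^1_{0,c}$.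
   Context: $D_\infty$ (resp. $D_t$) is the Skorohod space of càdlàg functions from $[0,\infty)$ (resp. $[0,t]$) to $S$, $X$ is the canonical process, $\mathscr{F}$ the $\sigma$-field generated by $X$ and $\mathscr{F}_s=\sigma(X_r:r\le s)$; $\theta_sf(r)=f(s+r)$. A Markovian family on $S$ is a collection $(\mathbb{P}_x)_{x\in S}$ of probability measures on $D_\infty$ such that $\mathbb{P}_x(X_0=x)=1$, $x\mapsto\mathbb{E}_x(F)$ is measurable for all bounded $\mathscr{F}$-measurable $F$, and $\mathbb{E}_x(F\cdot G\circ\theta_s)=\mathbb{E}_x(F\cdot\mathbb{E}_{X_s}(G))$ for bounded $F\in\mathscr{F}_s$, $G\in\mathscr{F}$. It is a Feller family if $P_sf(x)=\mathbb{E}_x(f(X_s))$ maps the space of continuous functions vanishing at infinity into itself and $\lim_{s\downarrow0}\|P_sf-f\|_\infty=0$ for each such $f$. Transition densities with respect to $\mu$ means $P_sf(x)=\int f(y)p_s(x,y)\,\mu(dy)$ for bounded measurable $f$. The family is self-similar of index $\gamma$ if for every $x\in S$ and $v>0$ the image of $\mathbb{P}_x$ under the scaling operator $S^\gamma_vf(t)=v^{1/\gamma}f(t/v)$ on $D_\infty$ is $\mathbb{P}_{v^{1/\gamma}x}$. Bridge laws: for $t>0$ and $x,y\in S$ with $p_t(x,y)>0$, $\mathbb{P}^t_{x,y}$ is the weak limit on $D_t$, as $\delta\to0$, of $\mathbb{P}_x(\,\cdot\mid X_t\in B_\delta(y))$ (laws of $(X_s)_{s\le t}$), where $B_\delta(y)$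 is the ball of radius $\delta$ around $y$. *)

theory Defs
  imports "HOL-Probability.Probability"
begin

section \<open>Path space\<close>

text \<open>Paths on a time interval \<open>I\<close> (either \<open>{0..}\<close> or \<open>{0..t}\<close>) are extensional functions on
  \<open>I\<close>. The state space \<open>S\<close> is closed in all applications, so left limits belong to \<open>S\<close>.\<close>

definition cadlag_paths :: "real set \<Rightarrow> real set \<Rightarrow> (real \<Rightarrow> real) set" where
  "cadlag_paths S I = {f \<in> I \<rightarrow>\<^sub>E S.
     (\<forall>s\<in>I. continuous (at s within I \<inter> {s..}) f) \<and>
     (\<forall>s\<in>I. 0 < s \<longrightarrow> (\<exists>l. (f \<longlongrightarrow> l) (at_left s)))}"

text \<open>The paths on \<open>I\<close> with the \<open>\<sigma>\<close>-field generated by the coordinates with index in \<open>J\<close>.\<close>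

definition coord_algebra :: "real set \<Rightarrow> real set \<Rightarrow> real set \<Rightarrow> (real \<Rightarrow> real) measure" where
  "coord_algebra S I J = sigma (cadlag_paths S I)
     {{f \<in> cadlag_paths S I. f r \<in> B} | r B. r \<in> J \<and> B \<in> sets borel}"

abbreviation path_space :: "real set \<Rightarrow> real set \<Rightarrow> (real \<Rightarrow> real) measure" where
  "path_space S I \<equiv> coord_algebra S I I"

definition path_shift :: "real \<Rightarrow> (real \<Rightarrow> real) \<Rightarrow> (real \<Rightarrow> real)" where
  "path_shift s f = (\<lambda>r\<in>{0..}. f (s + r))"

definition path_scaling :: "real \<Rightarrow> real \<Rightarrow> (real \<Rightarrow> real) \<Rightarrow> (real \<Rightarrow> real)" where
  "path_scaling \<gamma> v f = (\<lambda>t\<in>{0..}. v powr (1 / \<gamma>) * f (t / v))"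

section \<open>Self-similar Feller families\<close>

definition bounded_measurable :: "'a measure \<Rightarrow> ('a \<Rightarrow> real) \<Rightarrow> bool" where
  "bounded_measurable M F \<longleftrightarrow> F \<in> borel_measurable M \<and> bounded (F ` space M)"

definition markovian_family :: "real set \<Rightarrow> (real \<Rightarrow> (real \<Rightarrow> real) measure) \<Rightarrow> bool" where
  "markovian_family S P \<longleftrightarrow>
     (\<forall>x\<in>S. prob_space (P x) \<and> sets (P x) = sets (path_space S {0..}) \<and>
            measure (P x) {f \<in> cadlag_paths S {0..}. f 0 = x} = 1) \<and>
     (\<forall>F. bounded_measurable (path_space S {0..}) F \<longrightarrow>
            (\<lambda>x. \<integral>f. F f \<partial>P x) \<in> borel_measurable (restrict_space borel S)) \<and>
     (\<forall>x\<in>S. \<forall>s\<ge>0. \<forall>F G.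
        bounded_measurable (coord_algebra S {0..} {0..s}) F \<longrightarrow>
        bounded_measurable (path_space S {0..}) G \<longrightarrow>
        (\<integral>f. F f * G (path_shift s f) \<partial>P x) = (\<integral>f. F f * (\<integral>g. G g \<partial>P (f s)) \<partial>P x))"

definition transition_semigroup ::
  "(real \<Rightarrow> (real \<Rightarrow> real) measure) \<Rightarrow> real \<Rightarrow> (real \<Rightarrow> real) \<Rightarrow> real \<Rightarrow> real" where
  "transition_semigroup P s f x = (\<integral>\<omega>. f (\<omega> s) \<partial>P x)"

definition C0 :: "real set \<Rightarrow> (real \<Rightarrow> real) set" where
  "C0 S = {f. continuous_on S f \<and> (\<forall>e>0. compact {x\<in>S. e \<le> \<bar>f x\<bar>})}"

definition feller_family :: "real set \<Rightarrow> (real \<Rightarrow> (real \<Rightarrow> real) measure) \<Rightarrow> bool" where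
  "feller_family S P \<longleftrightarrow> markovian_family S P \<and>
     (\<forall>f\<in>C0 S. (\<forall>s\<ge>0. transition_semigroup P s f \<in> C0 S) \<and>
        ((\<lambda>s. SUP x\<in>S. \<bar>transition_semigroup P s f x - f x\<bar>) \<longlongrightarrow> 0) (at_right 0))"

definition self_similar :: "real set \<Rightarrow> real \<Rightarrow> (real \<Rightarrow> (real \<Rightarrow> real) measure) \<Rightarrow> bool" where
  "self_similar S \<gamma> P \<longleftrightarrow>
     (\<forall>x\<in>S. \<forall>v>0. distr (P x) (path_space S {0..}) (path_scaling \<gamma> v) = P (v powr (1 / \<gamma>) * x))"

definition transition_densities ::
  "real set \<Rightarrow> (real \<Rightarrow> (real \<Rightarrow> real) measure) \<Rightarrow> real measure \<Rightarrow>
   (real \<Rightarrow> real \<Rightarrow> real \<Rightarrow> real) \<Rightarrow> bool" where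
  "transition_densities S P \<mu> p \<longleftrightarrow>
     (\<forall>s>0. \<forall>x\<in>S. (\<forall>y\<in>S. 0 \<le> p s x y) \<and>
        (\<forall>f. bounded_measurable (restrict_space borel S) f \<longrightarrow>
           transition_semigroup P s f x = (\<integral>y. f y * p s x y \<partial>\<mu>)))"

section \<open>Skorohod topology on paths over \<open>[0,t]\<close>\<close>

definition time_changes :: "real \<Rightarrow> (real \<Rightarrow> real) set" where
  "time_changes t = {l. strict_mono_on {0..t} l \<and> l ` {0..t} = {0..t}}"

definition skorohod_close :: "real \<Rightarrow> (real \<Rightarrow> real) \<Rightarrow> (real \<Rightarrow> real) \<Rightarrow> real \<Rightarrow> bool" where
  "skorohod_close t f g e \<longleftrightarrow>
     (\<exists>l\<in>time_changes t. \<forall>s\<in>{0..t}. \<bar>l s - s\<bar> \<le> e \<and> \<bar>f s - g (l s)\<bar> \<le> e)"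

text \<open>The value off the path space is irrelevant; it is fixed because \<^locale>\<open>Metric_space\<close>
  requires a function that is nonnegative everywhere.\<close>

definition skorohod_dist :: "real set \<Rightarrow> real \<Rightarrow> (real \<Rightarrow> real) \<Rightarrow> (real \<Rightarrow> real) \<Rightarrow> real" where
  "skorohod_dist S t f g =
     (if f \<in> cadlag_paths S {0..t} \<and> g \<in> cadlag_paths S {0..t}
      then Inf {e. 0 < e \<and> skorohod_close t f g e} else 0)"

lemma time_changes_id: "(\<lambda>s. s) \<in> time_changes t"
  by (auto simp: time_changes_def strict_mono_on_def)

lemma time_changes_comp:
  assumes "l \<in> time_changes t" "m \<in> time_changes t"
  shows "(\<lambda>s. m (l s)) \<in> time_changes t"
proof -
  have "l s \<in> {0..t}" if "s \<in> {0..t}" for s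
    using assms(1) that by (auto simp: time_changes_def)
  moreover have "(\<lambda>s. m (l s)) ` {0..t} = m ` (l ` {0..t})" by (simp add: image_image)
  ultimately show ?thesis
    using assms unfolding time_changes_def strict_mono_on_def by simp
qed

lemma time_changes_inv:
  assumes "l \<in> time_changes t"
  shows "inv_into {0..t} l \<in> time_changes t"
proof -
  let ?k = "inv_into {0..t} l"
  have mono: "strict_mono_on {0..t} l" and im: "l ` {0..t} = {0..t}"
    using assms by (auto simp: time_changes_def)
  have inj: "inj_on l {0..t}" using mono by (rule strict_mono_on_imp_inj_on)
  have k: "?k s \<in> {0..t}" "l (?k s) = s" if "s \<in> {0..t}" for s
    using that im by (metis inv_into_into, metis f_inv_into_f)
  have "?k r < ?k s" if "r \<in> {0..t}" "s \<in> {0..t}" "r < s" for r s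
  proof (rule ccontr)
    assume "\<not> ?k r < ?k s"
    then have "l (?k s) \<le> l (?k r)"
      using mono k(1)[OF that(1)] k(1)[OF that(2)]
      by (metis linorder_not_less order_less_le strict_mono_onD)
    with k(2)[OF that(1)] k(2)[OF that(2)] that(3) show False by simp
  qed
  moreover have "?k ` {0..t} = {0..t}"
    using inj im by (metis inv_into_image_cancel order_refl)
  ultimately show ?thesis by (auto simp: time_changes_def strict_mono_on_def)
qed

lemma time_changes_end:
  assumes "l \<in> time_changes t" "0 \<le> t"
  shows "l t = t"
proof -
  have mono: "strict_mono_on {0..t} l" and im: "l ` {0..t} = {0..t}"
    using assms by (auto simp: time_changes_def)
  obtain s where s: "s \<in> {0..t}" "l s = t" using im assms(2)
    by (metis atLeastAtMost_iff imageE order_refl)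
  have "l t \<in> {0..t}" using im assms(2) by auto
  moreover have "s < t \<Longrightarrow> l s < l t" using mono s(1) assms(2)
    by (auto simp: strict_mono_on_def)
  ultimately show ?thesis using s by (cases "s = t") auto
qed

lemma skorohod_close_sym:
  assumes "skorohod_close t f g e"
  shows "skorohod_close t g f e"
proof -
  obtain l where l: "l \<in> time_changes t"
    and e: "\<And>s. s \<in> {0..t} \<Longrightarrow> \<bar>l s - s\<bar> \<le> e \<and> \<bar>f s - g (l s)\<bar> \<le> e"
    using assms unfolding skorohod_close_def by blast
  let ?k = "inv_into {0..t} l"
  have "\<bar>?k s - s\<bar> \<le> e \<and> \<bar>g s - f (?k s)\<bar> \<le> e" if "s \<in> {0..t}" for s
  proof -
    have "s \<in> l ` {0..t}" using l that by (auto simp: time_changes_def)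
    then have "?k s \<in> {0..t}" "l (?k s) = s" by (metis inv_into_into, metis f_inv_into_f)
    with e[of "?k s"] show ?thesis by (simp add: abs_minus_commute)
  qed
  with time_changes_inv[OF l] show ?thesis unfolding skorohod_close_def by blast
qed

lemma skorohod_close_trans:
  assumes "skorohod_close t f g e" "skorohod_close t g h e'"
  shows "skorohod_close t f h (e + e')"
proof -
  obtain l where l: "l \<in> time_changes t"
    and e: "\<And>s. s \<in> {0..t} \<Longrightarrow> \<bar>l s - s\<bar> \<le> e \<and> \<bar>f s - g (l s)\<bar> \<le> e"
    using assms(1) unfolding skorohod_close_def by blast
  obtain m where m: "m \<in> time_changes t"
    and e': "\<And>s. s \<in> {0..t} \<Longrightarrow> \<bar>m s - s\<bar> \<le> e' \<and> \<bar>g s - h (m s)\<bar> \<le> e'"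
    using assms(2) unfolding skorohod_close_def by blast
  have "\<bar>m (l s) - s\<bar> \<le> e + e' \<and> \<bar>f s - h (m (l s))\<bar> \<le> e + e'" if s: "s \<in> {0..t}" for s
  proof -
    have "l s \<in> {0..t}" using l s by (auto simp: time_changes_def)
    from e[OF s] e'[OF this] show ?thesis by linarith
  qed
  with time_changes_comp[OF l m] show ?thesis unfolding skorohod_close_def
    by (intro bexI[where x = "\<lambda>s. m (l s)"]) auto
qed

lemma cadlag_locally_bounded:
  assumes f: "f \<in> cadlag_paths S {0..t}" and s: "s \<in> {0..t}"
  shows "\<exists>d>0. \<exists>B. \<forall>r\<in>{0..t}. \<bar>r - s\<bar> < d \<longrightarrow> \<bar>f r\<bar> \<le> B"
proof -
  have "(f \<longlongrightarrow> f s) (at s within {0..t} \<inter> {s..})"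
    using f s by (auto simp: cadlag_paths_def continuous_within)
  then have "\<forall>\<^sub>F r in at s within {0..t} \<inter> {s..}. dist (f r) (f s) < 1"
    by (rule tendstoD) simp
  then obtain d1 where d1: "d1 > 0"
    "\<And>r. r \<in> {0..t} \<Longrightarrow> s < r \<Longrightarrow> \<bar>r - s\<bar> < d1 \<Longrightarrow> \<bar>f r - f s\<bar> < 1"
    unfolding eventually_at by (auto simp: dist_real_def)
  have "\<exists>d2>0. \<exists>l. \<forall>r\<in>{0..t}. r < s \<longrightarrow> \<bar>r - s\<bar> < d2 \<longrightarrow> \<bar>f r - l\<bar> < 1"
  proof (cases "0 < s")
    case True
    then obtain l where "(f \<longlongrightarrow> l) (at_left s)"
      using f s by (auto simp: cadlag_paths_def)
    then have "\<forall>\<^sub>F r in at_left s. dist (f r) l < 1" by (rule tendstoD) simp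
    then show ?thesis unfolding eventually_at by (auto simp: dist_real_def)
  next
    case False
    then show ?thesis by (intro exI[of _ 1]) auto
  qed
  then obtain d2 l where d2: "d2 > 0"
    "\<And>r. r \<in> {0..t} \<Longrightarrow> r < s \<Longrightarrow> \<bar>r - s\<bar> < d2 \<Longrightarrow> \<bar>f r - l\<bar> < 1" by blast
  have "\<bar>f r\<bar> \<le> \<bar>f s\<bar> + \<bar>l\<bar> + 1" if "r \<in> {0..t}" "\<bar>r - s\<bar> < min d1 d2" for r
    using d1(2)[OF that(1)] d2(2)[OF that(1)] that(2)
    by (cases r s rule: linorder_cases) auto
  then show ?thesis using d1(1) d2(1) by (metis min_less_iff_conj)
qed

lemma cadlag_bounded:
  assumes f: "f \<in> cadlag_paths S {0..t}"
  shows "\<exists>B. \<forall>s\<in>{0..t}. \<bar>f s\<bar> \<le> B"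
proof -
  have "\<forall>s\<in>{0..t}. \<exists>d B. d > 0 \<and> (\<forall>r\<in>{0..t}. \<bar>r - s\<bar> < d \<longrightarrow> \<bar>f r\<bar> \<le> B)"
    using cadlag_locally_bounded[OF f] by blast
  then obtain d B where dB: "\<And>s. s \<in> {0..t} \<Longrightarrow> d s > 0"
    "\<And>s r. s \<in> {0..t} \<Longrightarrow> r \<in> {0..t} \<Longrightarrow> \<bar>r - s\<bar> < d s \<Longrightarrow> \<bar>f r\<bar> \<le> B s"
    by metis
  have cov: "{0..t} \<subseteq> (\<Union>s\<in>{0..t}. ball s (d s))" using dB(1) by force
  obtain C where C: "C \<subseteq> {0..t}" "finite C" "{0..t} \<subseteq> (\<Union>s\<in>C. ball s (d s))"
    using compactE_image[OF compact_Icc, of "{0..t}" "\<lambda>s. ball s (d s)" 0 t] cov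
    by (metis open_ball)
  have "\<bar>f r\<bar> \<le> (\<Sum>s\<in>C. \<bar>B s\<bar>)" if r: "r \<in> {0..t}" for r
  proof -
    obtain s where s: "s \<in> C" "\<bar>r - s\<bar> < d s"
      using C(3) r by (auto simp: dist_real_def abs_minus_commute)
    have "\<bar>f r\<bar> \<le> \<bar>B s\<bar>" using dB(2)[of s r] s r C(1) by fastforce
    also have "\<dots> \<le> (\<Sum>s\<in>C. \<bar>B s\<bar>)" using s(1) C(2) by (intro member_le_sum) auto
    finally show ?thesis .
  qed
  then show ?thesis by blast
qed

lemma skorohod_close_ex:
  assumes "f \<in> cadlag_paths S {0..t}" "g \<in> cadlag_paths S {0..t}"
  shows "\<exists>e>0. skorohod_close t f g e"
proof -
  obtain A B where "\<And>s. s \<in> {0..t} \<Longrightarrow> \<bar>f s\<bar> \<le> A" "\<And>s. s \<in> {0..t} \<Longrightarrow> \<bar>g s\<bar> \<le> B"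
    using assms cadlag_bounded by metis
  then have "\<forall>s\<in>{0..t}. \<bar>s - s\<bar> \<le> \<bar>A\<bar> + \<bar>B\<bar> + 1 \<and> \<bar>f s - g s\<bar> \<le> \<bar>A\<bar> + \<bar>B\<bar> + 1" by force
  then have "skorohod_close t f g (\<bar>A\<bar> + \<bar>B\<bar> + 1)"
    unfolding skorohod_close_def by (intro bexI[OF _ time_changes_id])
  then show ?thesis by (intro exI[of _ "\<bar>A\<bar> + \<bar>B\<bar> + 1"]) auto
qed

lemma skorohod_close_all_imp_eq:
  assumes f: "f \<in> cadlag_paths S {0..t}" and g: "g \<in> cadlag_paths S {0..t}"
    and close: "\<And>e. 0 < e \<Longrightarrow> skorohod_close t f g e"
  shows "f = g"
proof -
  have right: "(h \<longlongrightarrow> h s) (at_right s)"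
    if "h \<in> cadlag_paths S {0..t}" "0 \<le> s" "s < t" for h s
  proof -
    have "(h \<longlongrightarrow> h s) (at s within {0..t} \<inter> {s..})"
      using that by (auto simp: cadlag_paths_def continuous_within)
    moreover have "at s within {0..t} \<inter> {s..} = at_right s"
    proof -
      have "at s within {0..t} \<inter> {s..} = at s within {s..t}"
        using that by (intro arg_cong[of _ _ "at_within s"]) auto
      then show ?thesis using that(3) by (simp add: at_within_Icc_at_right)
    qed
    ultimately show ?thesis by simp
  qed
  have near: "\<exists>r\<in>{0..t}. \<bar>r - s\<bar> \<le> e \<and> \<bar>f s - g r\<bar> \<le> e" if s: "s \<in> {0..t}" "0 < e" for s e
  proof -
    obtain l where "l \<in> time_changes t" "\<bar>l s - s\<bar> \<le> e \<and> \<bar>f s - g (l s)\<bar> \<le> e"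
      using close[OF s(2)] s(1) unfolding skorohod_close_def by blast
    moreover from this(1) s(1) have "l s \<in> {0..t}" by (auto simp: time_changes_def)
    ultimately show ?thesis by blast
  qed
  have "f s = g s" if s: "0 \<le> s" "s < t" for s
  proof (rule ccontr)
    assume ne: "f s \<noteq> g s"
    define e where "e = \<bar>f s - g s\<bar> / 4"
    have e: "0 < e" using ne by (simp add: e_def)
    have "\<forall>\<^sub>F r in at_right s. dist (f r) (f s) < e \<and> dist (g r) (g s) < e"
      using tendstoD[OF right[OF f s] e] tendstoD[OF right[OF g s] e] by eventually_elim auto
    then obtain b where b: "s < b"
      "\<And>r. s < r \<Longrightarrow> r < b \<Longrightarrow> \<bar>f r - f s\<bar> < e \<and> \<bar>g r - g s\<bar> < e"
      unfolding eventually_at_right_field by (auto simp: dist_real_def)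
    define u where "u = (s + min b t) / 2"
    have u: "s < u" "u < b" "u < t" using b(1) s by (auto simp: u_def min_def field_simps)
    define h where "h = min e (min (u - s) (b - u) / 2)"
    have h: "0 < h" "h \<le> e" "h < u - s" "h < b - u" using e u by (auto simp: h_def min_def)
    obtain r where r: "\<bar>r - u\<bar> \<le> h" "\<bar>f u - g r\<bar> \<le> h"
      using near[of u h] u s h(1) by auto
    have "s < r" "r < b" using r(1) h by auto
    then have "\<bar>g r - g s\<bar> < e" using b(2) by blast
    moreover have "\<bar>f u - f s\<bar> < e" using b(2) u by blast
    ultimately have "\<bar>f s - g s\<bar> < 4 * e" using r(2) h(2) by linarith
    then show False by (simp add: e_def)
  qed
  moreover have "f t = g t" if "0 \<le> t"
  proof -
    have "\<bar>f t - g t\<bar> \<le> e" if e: "0 < e" for e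
    proof -
      obtain l where "l \<in> time_changes t" "\<bar>f t - g (l t)\<bar> \<le> e"
        using close[OF e] \<open>0 \<le> t\<close> unfolding skorohod_close_def by auto
      then show ?thesis using time_changes_end \<open>0 \<le> t\<close> by metis
    qed
    then show ?thesis by (metis abs_le_zero_iff eq_iff_diff_eq_0 field_le_epsilon add_0)
  qed
  ultimately have "f s = g s" if "s \<in> {0..t}" for s
    using that by (cases "s = t") auto
  then show ?thesis
    using f g by (intro PiE_ext[of f "{0..t}" "\<lambda>_. S" g]) (auto simp: cadlag_paths_def)
qed

lemma Metric_space_skorohod: "Metric_space (cadlag_paths S {0..t}) (skorohod_dist S t)"
proof
  let ?D = "cadlag_paths S {0..t}"
  let ?E = "\<lambda>f g. {e. 0 < e \<and> skorohod_close t f g e}"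
  have ne: "?E f g \<noteq> {}" if "f \<in> ?D" "g \<in> ?D" for f g
    using skorohod_close_ex[OF that] by blast
  have bdd: "bdd_below (?E f g)" for f g by (rule bdd_belowI[of _ 0]) auto
  show "0 \<le> skorohod_dist S t f g" for f g
    using ne by (auto simp: skorohod_dist_def intro!: cInf_greatest)
  show "skorohod_dist S t f g = skorohod_dist S t g f" for f g
  proof -
    have "?E f g = ?E g f" using skorohod_close_sym by blast
    then show ?thesis by (simp add: skorohod_dist_def)
  qed
  show "skorohod_dist S t f g = 0 \<longleftrightarrow> f = g" if fg: "f \<in> ?D" "g \<in> ?D" for f g
  proof
    assume d: "skorohod_dist S t f g = 0"
    show "f = g"
    proof (rule skorohod_close_all_imp_eq[OF fg])
      fix e :: real assume "0 < e"
      moreover have "Inf (?E f g) = 0" using d fg by (simp add: skorohod_dist_def)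
      ultimately obtain e' where e': "e' < e" "skorohod_close t f g e'"
        using cInf_lessD[OF ne[OF fg]] by (metis (no_types, lifting) mem_Collect_eq)
      then show "skorohod_close t f g e"
        unfolding skorohod_close_def by (meson less_imp_le order_trans)
    qed
  next
    assume "f = g"
    then have E: "?E f g = {0<..}"
      using time_changes_id unfolding skorohod_close_def by force
    then show "skorohod_dist S t f g = 0" using fg by (simp add: skorohod_dist_def E)
  qed
  show "skorohod_dist S t f h \<le> skorohod_dist S t f g + skorohod_dist S t g h"
    if fgh: "f \<in> ?D" "g \<in> ?D" "h \<in> ?D" for f g h
  proof -
    have "Inf (?E f h) \<le> Inf (?E f g) + Inf (?E g h)"
    proof (rule field_le_epsilon)
      fix e :: real assume e: "0 < e"
      obtain a where a: "a \<in> ?E f g" "a < Inf (?E f g) + e / 2"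
        using cInf_lessD[OF ne[OF fgh(1,2)], of "Inf (?E f g) + e / 2"] e by auto
      obtain b where b: "b \<in> ?E g h" "b < Inf (?E g h) + e / 2"
        using cInf_lessD[OF ne[OF fgh(2,3)], of "Inf (?E g h) + e / 2"] e by auto
      have "a + b \<in> ?E f h" using a(1) b(1) skorohod_close_trans by auto
      then have "Inf (?E f h) \<le> a + b" using bdd by (rule cInf_lower)
      then show "Inf (?E f h) \<le> Inf (?E f g) + Inf (?E g h) + e" using a(2) b(2) by linarith
    qed
    then show ?thesis using fgh by (simp add: skorohod_dist_def)
  qed
qed

abbreviation skorohod_topology :: "real set \<Rightarrow> real \<Rightarrow> (real \<Rightarrow> real) topology" where
  "skorohod_topology S t \<equiv> Metric_space.mtopology (cadlag_paths S {0..t}) (skorohod_dist S t)"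

section \<open>Bridges\<close>

text \<open>The law of \<open>(X\<^sub>s)\<^sub>s\<^sub>\<le>\<^sub>t\<close> under \<open>P x\<close> given that \<open>X\<^sub>t\<close> lies in the ball of radius \<open>\<delta>\<close> around
  \<open>y\<close>.\<close>

definition pinned_law ::
  "real set \<Rightarrow> (real \<Rightarrow> (real \<Rightarrow> real) measure) \<Rightarrow> real \<Rightarrow> real \<Rightarrow> real \<Rightarrow> real \<Rightarrow>
   (real \<Rightarrow> real) measure" where
  "pinned_law S P t x y \<delta> =
     distr (uniform_measure (P x) {f \<in> cadlag_paths S {0..}. f t \<in> ball y \<delta>})
       (path_space S {0..t}) (\<lambda>f. restrict f {0..t})"

text \<open>\<open>Q\<close> is the weak limit of the pinned laws with respect to the Skorohod topology, whose Borel
  \<open>\<sigma>\<close>-field is the one generated by the coordinates.\<close>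

definition is_bridge_law ::
  "real set \<Rightarrow> (real \<Rightarrow> (real \<Rightarrow> real) measure) \<Rightarrow> real \<Rightarrow> real \<Rightarrow> real \<Rightarrow>
   (real \<Rightarrow> real) measure \<Rightarrow> bool" where
  "is_bridge_law S P t x y Q \<longleftrightarrow>
     prob_space Q \<and> sets Q = sets (path_space S {0..t}) \<and>
     (\<forall>F. continuous_map (skorohod_topology S t) euclideanreal F \<longrightarrow>
          bounded (F ` cadlag_paths S {0..t}) \<longrightarrow>
          ((\<lambda>\<delta>. \<integral>f. F f \<partial>pinned_law S P t x y \<delta>) \<longlongrightarrow> (\<integral>f. F f \<partial>Q)) (at_right 0))"

section \<open>Last passage along the curve \<open>t \<mapsto> c t\<^bsup>1/\<gamma>\<^esup>\<close>\<close>

definition hit_times :: "real \<Rightarrow> real \<Rightarrow> (real \<Rightarrow> real) \<Rightarrow> real set" where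
  "hit_times \<gamma> c f = {t \<in> {0<..1}. Lim (at_left t) f = c * t powr (1 / \<gamma>)}"

text \<open>The supremum need not be measurable for the \<open>\<sigma>\<close>-field generated by the coordinates, only for
  its completion, so laws of functionals of it are to be taken under the completed measure.\<close>

definition last_hit :: "real \<Rightarrow> real \<Rightarrow> (real \<Rightarrow> real) \<Rightarrow> real" where
  "last_hit \<gamma> c f = (if hit_times \<gamma> c f \<noteq> {} then Sup (hit_times \<gamma> c f) else 0)"

definition rescaled_path :: "real \<Rightarrow> real \<Rightarrow> (real \<Rightarrow> real) \<Rightarrow> (real \<Rightarrow> real)" where
  "rescaled_path \<gamma> c f = (\<lambda>t\<in>{0..1}.
     if t < 1 then last_hit \<gamma> c f powr (- 1 / \<gamma>) * f (t * last_hit \<gamma> c f) else c)"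

end

theory Submission
  imports Defs
begin

text \<open>
  Write \<open>g\<close> for the last hitting time and \<open>S\<^sub>tX\<close> for the path rescaled from \<open>[0, t]\<close> to \<open>[0, 1]\<close>. For \<open>G\<close> bounded and
  measurable with respect to the path before a time \<open>s < 1\<close>, the density assumptions (with Scheffe's lemma) yield a
  version of \<open>y \<mapsto> E(G | X\<^sub>1 = y)\<close> that is continuous at \<open>c\<close>, with value \<open>L\<close> there. Approximate \<open>g\<close> from the left by the
  points of the grid of mesh \<open>1/N\<close>. Whether the grid point \<open>t\<close> is the last one before \<open>g\<close> depends only on the path after
  \<open>t\<close>, and then \<open>X\<^sub>t\<close> is close to \<open>c t\<^bsup>1/\<gamma>\<^esup>\<close>; so by the Markov property at \<open>t\<close> and self-similarity the expectation of
  \<open>G(S\<^sub>tX)\<close> on this event is nearly \<open>L\<close> times its probability. Letting \<open>N \<rightarrow> \<infinity>\<close> identifies the law of \<open>Y\<close> before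
  each time \<open>s < 1\<close>, and \<open>Y\<close> has left limit \<open>c\<close> at 1.

  Weak convergence on the whole of \<open>[0, 1]\<close> also needs that, under \<open>P\<^sub>0(\<cdot> | X\<^sub>1 \<in> B\<^sub>\<delta>(c))\<close>, the path is unlikely to
  leave a neighbourhood of \<open>c\<close> shortly before time 1, uniformly in small \<open>\<delta>\<close>. For \<open>c \<noteq> 0\<close> this is transferred by scaling
  from bridges of nearby lengths. For \<open>c = 0\<close> a path ending in \<open>B\<^sub>\<delta>(0)\<close> hits 0 within a time of order \<open>\<delta>\<^bsup>\<gamma>\<^esup>\<close> after 1
  with probability at least 1/2, which reduces the claim to the behaviour of paths before their last zero.
\<close>

section \<open>The path space\<close>

text \<open>The obstacle is uniformity in the final time. Scheffe's lemma controls excursions from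
  \<open>c\<close> on \<open>(u, s)\<close>, given an endpoint near \<open>c\<close>, only with a
  radius that depends on \<open>s\<close> and may shrink as \<open>s\<close> tends to 1, whereas
  tightness needs one radius for all \<open>s < 1\<close>. For \<open>c \<noteq> 0\<close> the bound
  is therefore proved for arbitrary Borel endpoint sets close to a point: such bounds add up over
  disjoint sets, so the local radius may depend on \<open>s\<close>, and compactness patches them
  together on a fixed interval around \<open>c\<close>. Scaling moves \<open>c\<close> to the other
  points of that interval. It cannot move 0; there the bound is obtained on events about the last
  zero, in which no endpoint radius occurs, and a doubling estimate for the law of
  \<open>X_1\<close> near 0 translates it back. A second obstacle is measurability: the last hitting
  time is measurable only for the completion, but the Markov property and scaling speak about the
  coordinate sigma-field. Events of the future are therefore completed under the law of the shifted
  path and then replaced by measurable ones.\<close>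

lemma space_coord_algebra [simp]: "space (coord_algebra S I J) = cadlag_paths S I"
  unfolding coord_algebra_def by (simp add: space_measure_of_conv)

lemma sets_coord_algebra:
  "sets (coord_algebra S I J) = sigma_sets (cadlag_paths S I)
     {{f \<in> cadlag_paths S I. f r \<in> B} | r B. r \<in> J \<and> B \<in> sets borel}"
  unfolding coord_algebra_def by (rule sets_measure_of) auto

lemma measurable_coordinate:
  "r \<in> J \<Longrightarrow> (\<lambda>f. f r) \<in> borel_measurable (coord_algebra S I J)"
proof (rule measurableI)
  fix A :: "real set" assume "A \<in> sets borel" "r \<in> J"
  then have "{f \<in> cadlag_paths S I. f r \<in> A} \<in> sets (coord_algebra S I J)"
    unfolding sets_coord_algebra by (intro sigma_sets.Basic) blast
  then show "(\<lambda>f. f r) -` A \<inter> space (coord_algebra S I J) \<in> sets (coord_algebra S I J)"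
    by (simp add: vimage_def Int_def conj_commute)
qed simp

lemma measurable_coord_algebraI:
  assumes "\<And>x. x \<in> space M \<Longrightarrow> T x \<in> cadlag_paths S I"
    and "\<And>r. r \<in> J \<Longrightarrow> (\<lambda>x. T x r) \<in> borel_measurable M"
  shows "T \<in> measurable M (coord_algebra S I J)"
  unfolding coord_algebra_def
proof (rule measurable_measure_of)
  fix A assume "A \<in> {{f \<in> cadlag_paths S I. f r \<in> B} |r B. r \<in> J \<and> B \<in> sets borel}"
  then obtain r B where r: "r \<in> J" "B \<in> sets borel" "A = {f \<in> cadlag_paths S I. f r \<in> B}" by blast
  have "T -` A \<inter> space M = (\<lambda>x. T x r) -` B \<inter> space M" using assms(1) r by auto
  then show "T -` A \<inter> space M \<in> sets M" using measurable_sets[OF assms(2)[OF r(1)] r(2)] by simp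
qed (use assms in auto)

lemma measurable_coord_algebra_mono:
  assumes "f \<in> measurable (coord_algebra S I J) N" "J \<subseteq> J'"
  shows "f \<in> measurable (coord_algebra S I J') N"
proof -
  have "sets (coord_algebra S I J) \<subseteq> sets (coord_algebra S I J')"
    unfolding sets_coord_algebra using assms(2) by (intro sigma_sets_mono') blast
  with assms(1) show ?thesis by (auto simp: measurable_def)
qed

lemma cadlag_paths_right:
  assumes "f \<in> cadlag_paths S I" "s \<in> I" "\<forall>\<^sub>F r in at_right s. r \<in> I"
  shows "(f \<longlongrightarrow> f s) (at_right s)"
proof -
  have "(f \<longlongrightarrow> f s) (at s within I \<inter> {s..})"
    using assms by (auto simp: cadlag_paths_def continuous_within)
  moreover have "at_right s \<le> at s within I \<inter> {s..}"
    using assms(3) unfolding at_within_def le_inf_iff le_principal eventually_inf_principal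
    by (auto elim!: eventually_mono)
  ultimately show ?thesis by (rule tendsto_mono[rotated])
qed

lemma cadlag_paths_left:
  "f \<in> cadlag_paths S I \<Longrightarrow> s \<in> I \<Longrightarrow> 0 < s \<Longrightarrow> \<exists>l. (f \<longlongrightarrow> l) (at_left s)"
  by (auto simp: cadlag_paths_def)

text \<open>Paths are \<open>undefined\<close> outside \<open>I\<close>, so at a right end of
  \<open>I\<close> nothing can be asked of \<open>at_right s\<close>; hence the restriction to
  points that have elements of \<open>I\<close> to their right.\<close>

lemma cadlag_pathsI:
  assumes "f \<in> I \<rightarrow>\<^sub>E S"
    and "\<And>s. s \<in> I \<Longrightarrow> I \<inter> {s<..} \<noteq> {} \<Longrightarrow> (f \<longlongrightarrow> f s) (at_right s)"
    and "\<And>s. s \<in> I \<Longrightarrow> 0 < s \<Longrightarrow> \<exists>l. (f \<longlongrightarrow> l) (at_left s)"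
  shows "f \<in> cadlag_paths S I"
  unfolding cadlag_paths_def
proof (clarify, intro conjI ballI impI)
  fix s assume s: "s \<in> I"
  show "continuous (at s within I \<inter> {s..}) f"
  proof (cases "I \<inter> {s<..} = {}")
    case True
    then have "I \<inter> {s..} = {s}" using s by force
    then show ?thesis by (simp add: continuous_within at_within_def)
  next
    case False
    have "at s within I \<inter> {s..} \<le> at_right s"
      unfolding at_within_def by (intro inf_mono) auto
    then show ?thesis using assms(2)[OF s False] unfolding continuous_within by (rule tendsto_mono)
  qed
qed (use assms in auto)

lemma eventually_at_right_ge: "a \<le> s \<Longrightarrow> \<forall>\<^sub>F r in at_right s. a \<le> (r::real)"
  unfolding eventually_at_right_field by (intro exI[of _ "s + 1"]) auto

lemma cadlag_right: "f \<in> cadlag_paths S {0..} \<Longrightarrow> 0 \<le> s \<Longrightarrow> (f \<longlongrightarrow> f s) (at_right s)"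
  by (rule cadlag_paths_right) (auto simp: eventually_at_right_ge)

lemma cadlag_left: "f \<in> cadlag_paths S {0..} \<Longrightarrow> 0 < s \<Longrightarrow> \<exists>l. (f \<longlongrightarrow> l) (at_left s)"
  by (rule cadlag_paths_left) auto

lemma cadlag_Lim_left:
  "f \<in> cadlag_paths S {0..} \<Longrightarrow> 0 < s \<Longrightarrow> (f \<longlongrightarrow> Lim (at_left s) f) (at_left s)"
  using cadlag_left[of f S s] by (auto simp: tendsto_Lim)

lemma tendsto_at_right_affine:
  fixes f :: "real \<Rightarrow> 'a::topological_space"
  assumes "(f \<longlongrightarrow> l) (at_right (b + a * s))" "0 < a"
  shows "((\<lambda>r. f (b + a * r)) \<longlongrightarrow> l) (at_right s)"
proof (rule filterlim_compose[OF assms(1)])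
  show "filterlim (\<lambda>r. b + a * r) (at_right (b + a * s)) (at_right s)"
    unfolding filterlim_at using assms(2)
    by (auto intro!: tendsto_eq_intros simp: eventually_at_right_field intro: exI[of _ "s + 1"])
qed

lemma tendsto_at_left_affine:
  fixes f :: "real \<Rightarrow> 'a::topological_space"
  assumes "(f \<longlongrightarrow> l) (at_left (b + a * s))" "0 < a"
  shows "((\<lambda>r. f (b + a * r)) \<longlongrightarrow> l) (at_left s)"
proof (rule filterlim_compose[OF assms(1)])
  show "filterlim (\<lambda>r. b + a * r) (at_left (b + a * s)) (at_left s)"
    unfolding filterlim_at using assms(2)
    by (auto intro!: tendsto_eq_intros simp: eventually_at_left_field intro: exI[of _ "s - 1"])
qed

definition cone :: "real set \<Rightarrow> bool" where
  "cone S \<longleftrightarrow> (\<forall>a\<ge>0. \<forall>x\<in>S. a * x \<in> S)"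

lemma cadlag_affine:
  assumes f: "f \<in> cadlag_paths S {0..}" and a: "0 < a" and b: "0 \<le> b" and k: "0 \<le> k" and S: "cone S"
  shows "(\<lambda>t\<in>{0..}. k * f (b + a * t)) \<in> cadlag_paths S {0..}"
proof (rule cadlag_pathsI)
  have fS: "f r \<in> S" if "0 \<le> r" for r using f that by (auto simp: cadlag_paths_def)
  show "(\<lambda>t\<in>{0..}. k * f (b + a * t)) \<in> {0..} \<rightarrow>\<^sub>E S"
    using fS a b k S by (auto simp: cone_def)
  show "((\<lambda>t\<in>{0..}. k * f (b + a * t)) \<longlongrightarrow> (\<lambda>t\<in>{0..}. k * f (b + a * t)) s) (at_right s)"
    if s: "s \<in> {0..}" for s
  proof -
    have "((\<lambda>t. k * f (b + a * t)) \<longlongrightarrow> k * f (b + a * s)) (at_right s)"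
      using s a b by (intro tendsto_mult tendsto_const tendsto_at_right_affine[OF cadlag_right[OF f]]) auto
    moreover have "\<forall>\<^sub>F t in at_right s. k * f (b + a * t) = (\<lambda>t\<in>{0..}. k * f (b + a * t)) t"
      using eventually_at_right_ge[of 0 s] s by (auto elim!: eventually_mono)
    ultimately show ?thesis using s by (simp add: Lim_transform_eventually)
  qed
  show "\<exists>l. ((\<lambda>t\<in>{0..}. k * f (b + a * t)) \<longlongrightarrow> l) (at_left s)" if s: "s \<in> {0..}" "0 < s" for s
  proof -
    have "0 < b + a * s" using a b s by (simp add: add_nonneg_pos)
    then obtain l where "(f \<longlongrightarrow> l) (at_left (b + a * s))" using cadlag_left[OF f] by blast
    then have "((\<lambda>t. k * f (b + a * t)) \<longlongrightarrow> k * l) (at_left s)"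
      using a by (intro tendsto_mult tendsto_const tendsto_at_left_affine)
    then have "((\<lambda>t\<in>{0..}. k * f (b + a * t)) \<longlongrightarrow> k * l) (at_left s)"
      by (rule Lim_transform_eventually) (use s in \<open>auto simp: eventually_at_left_field intro: exI[of _ 0]\<close>)
    then show ?thesis by blast
  qed
qed

lemma path_scaling_cadlag:
  assumes f: "f \<in> cadlag_paths S {0..}" and "0 < v" "cone S"
  shows "path_scaling \<gamma> v f \<in> cadlag_paths S {0..}"
  using cadlag_affine[OF f, of "1 / v" 0 "v powr (1 / \<gamma>)"] assms
  by (simp add: path_scaling_def)

lemma path_shift_cadlag:
  assumes f: "f \<in> cadlag_paths S {0..}" and "0 \<le> s"
  shows "path_shift s f \<in> cadlag_paths S {0..}"
proof (rule cadlag_pathsI)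
  show "path_shift s f \<in> {0..} \<rightarrow>\<^sub>E S"
    using assms by (auto simp: path_shift_def cadlag_paths_def)
  show "(path_shift s f \<longlongrightarrow> path_shift s f t) (at_right t)" if t: "t \<in> {0..}" for t
  proof -
    have "((\<lambda>r. f (s + 1 * r)) \<longlongrightarrow> f (s + 1 * t)) (at_right t)"
      using t assms by (intro tendsto_at_right_affine cadlag_right[OF f]) auto
    moreover have "\<forall>\<^sub>F r in at_right t. f (s + 1 * r) = path_shift s f r"
      using eventually_at_right_ge[of 0 t] t by (auto simp: path_shift_def elim!: eventually_mono)
    ultimately show ?thesis using t by (simp add: Lim_transform_eventually path_shift_def)
  qed
  show "\<exists>l. (path_shift s f \<longlongrightarrow> l) (at_left t)" if t: "t \<in> {0..}" "0 < t" for t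
  proof -
    obtain l where "(f \<longlongrightarrow> l) (at_left (s + 1 * t))" using cadlag_left[OF f, of "s + t"] t assms by auto
    then have "((\<lambda>r. f (s + 1 * r)) \<longlongrightarrow> l) (at_left t)" by (rule tendsto_at_left_affine) simp
    then have "(path_shift s f \<longlongrightarrow> l) (at_left t)" unfolding path_shift_def
      by (rule Lim_transform_eventually) (use t in \<open>auto simp: eventually_at_left_field intro: exI[of _ 0]\<close>)
    then show ?thesis by blast
  qed
qed

lemma Lim_left_path_shift:
  assumes f: "f \<in> cadlag_paths S {0..}" and "0 \<le> s" "0 < t"
  shows "Lim (at_left t) (path_shift s f) = Lim (at_left (s + t)) f"
proof -
  have "(f \<longlongrightarrow> Lim (at_left (s + t)) f) (at_left (s + 1 * t))"
    using cadlag_Lim_left[OF f, of "s + t"] assms by simp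
  then have "((\<lambda>r. f (s + 1 * r)) \<longlongrightarrow> Lim (at_left (s + t)) f) (at_left t)" by (rule tendsto_at_left_affine) simp
  then have "(path_shift s f \<longlongrightarrow> Lim (at_left (s + t)) f) (at_left t)" unfolding path_shift_def
    by (rule Lim_transform_eventually) (use assms in \<open>auto simp: eventually_at_left_field intro: exI[of _ 0]\<close>)
  then show ?thesis by (intro tendsto_Lim) auto
qed

lemma Lim_left_path_scaling:
  assumes f: "f \<in> cadlag_paths S {0..}" and "0 < v" "0 < t"
  shows "Lim (at_left t) (path_scaling \<gamma> v f) = v powr (1 / \<gamma>) * Lim (at_left (t / v)) f"
proof -
  let ?l = "Lim (at_left (t / v)) f"
  have "(f \<longlongrightarrow> ?l) (at_left (0 + (1 / v) * t))"
    using cadlag_Lim_left[OF f, of "t / v"] assms by simp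
  then have "((\<lambda>r. f (0 + (1 / v) * r)) \<longlongrightarrow> ?l) (at_left t)"
    by (rule tendsto_at_left_affine) (use assms in simp)
  then have "((\<lambda>r. v powr (1 / \<gamma>) * f (0 + (1 / v) * r)) \<longlongrightarrow> v powr (1 / \<gamma>) * ?l) (at_left t)"
    by (intro tendsto_intros)
  then have "(path_scaling \<gamma> v f \<longlongrightarrow> v powr (1 / \<gamma>) * ?l) (at_left t)" unfolding path_scaling_def
    by (rule Lim_transform_eventually) (use assms in \<open>auto simp: eventually_at_left_field intro: exI[of _ 0]\<close>)
  then show ?thesis by (intro tendsto_Lim) auto
qed

lemma measurable_path_shift:
  assumes "0 \<le> s"
  shows "path_shift s \<in> measurable (path_space S {0..}) (path_space S {0..})"
  by (rule measurable_coord_algebraI)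
    (use assms path_shift_cadlag in \<open>auto simp: path_shift_def intro!: measurable_coordinate\<close>)

lemma measurable_path_scaling_coord:
  assumes "0 < v" "cone S"
  shows "path_scaling \<gamma> v \<in> measurable (coord_algebra S {0..} {0..s}) (coord_algebra S {0..} {0..s * v})"
proof (rule measurable_coord_algebraI)
  fix r assume "r \<in> {0..s * v}"
  then have "r \<ge> 0" "r / v \<in> {0..s}" using assms by (auto simp: field_simps)
  then show "(\<lambda>x. path_scaling \<gamma> v x r) \<in> borel_measurable (coord_algebra S {0..} {0..s})"
    using borel_measurable_times[OF borel_measurable_const measurable_coordinate]
    by (simp add: path_scaling_def)
qed (use assms in \<open>auto simp: path_scaling_cadlag\<close>)

lemma measurable_path_scaling:
  assumes "0 < v" "cone S"
  shows "path_scaling \<gamma> v \<in> measurable (path_space S {0..}) (path_space S {0..})"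
proof (rule measurable_coord_algebraI)
  fix r :: real assume "r \<in> {0..}"
  then have "r \<ge> 0" "r / v \<in> {0..}" using assms by (auto simp: field_simps)
  then show "(\<lambda>x. path_scaling \<gamma> v x r) \<in> borel_measurable (path_space S {0..})"
    using borel_measurable_times[OF borel_measurable_const measurable_coordinate]
    by (simp add: path_scaling_def)
qed (use assms in \<open>auto simp: path_scaling_cadlag\<close>)

text \<open>The random time is approximated strictly from the right by times with countably many
  values, and right-continuity gives the limit. Strictness makes \<open>at_right\<close> applicable
  even if \<open>\<tau> x\<close> is itself a grid time.\<close>

lemma measurable_eval_random_time:
  assumes T: "T \<in> measurable M (path_space S {0..})" and \<tau>: "\<tau> \<in> borel_measurable M"
    and nn: "\<And>x. x \<in> space M \<Longrightarrow> 0 \<le> \<tau> x"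
  shows "(\<lambda>x. T x (\<tau> x)) \<in> borel_measurable M"
proof -
  let ?t = "\<lambda>n x. (of_int \<lfloor>real (Suc n) * \<tau> x\<rfloor> + 1) / real (Suc n)"
  have coord: "(\<lambda>x. T x r) \<in> borel_measurable M" if "r \<ge> 0" for r
    using measurable_compose[OF T measurable_coordinate[of r "{0..}"]] that by simp
  \<comment> \<open>The countable decomposition runs over all integers, also negative ones;
    \<open>max 0\<close> keeps the evaluation time in the index set.\<close>
  have "(\<lambda>x. T x (max 0 (?t n x))) \<in> borel_measurable M" for n
  proof -
    have "(\<lambda>x. T x (max 0 ((of_int i + 1) / real (Suc n)))) \<in> borel_measurable M" for i :: int
      by (rule coord) simp
    moreover have "(\<lambda>x. \<lfloor>real (Suc n) * \<tau> x\<rfloor>) \<in> measurable M (count_space UNIV)"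
      using \<tau> by measurable
    ultimately show ?thesis by (rule measurable_compose_countable)
  qed
  moreover have "(\<lambda>n. T x (max 0 (?t n x))) \<longlonglongrightarrow> T x (\<tau> x)" if x: "x \<in> space M" for x
  proof -
    have Tx: "T x \<in> cadlag_paths S {0..}" using measurable_space[OF T x] by simp
    have b: "\<tau> x < ?t n x" "?t n x \<le> \<tau> x + 1 / real (Suc n)" for n
    proof -
      have "real (Suc n) * \<tau> x < of_int \<lfloor>real (Suc n) * \<tau> x\<rfloor> + 1"
        "of_int \<lfloor>real (Suc n) * \<tau> x\<rfloor> \<le> real (Suc n) * \<tau> x" by linarith+
      moreover have "\<tau> x + 1 / real (Suc n) = (real (Suc n) * \<tau> x + 1) / real (Suc n)"
        by (simp add: add_divide_distrib)
      ultimately show "\<tau> x < ?t n x" "?t n x \<le> \<tau> x + 1 / real (Suc n)"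
        by (simp_all add: divide_right_mono pos_less_divide_eq mult.commute del: of_nat_Suc)
    qed
    have "(\<lambda>n. \<tau> x + 1 / real (Suc n)) \<longlonglongrightarrow> \<tau> x + 0"
      by (intro tendsto_intros LIMSEQ_Suc[OF lim_1_over_n])
    then have up: "(\<lambda>n. \<tau> x + 1 / real (Suc n)) \<longlonglongrightarrow> \<tau> x" by simp
    have "(\<lambda>n. ?t n x) \<longlonglongrightarrow> \<tau> x"
    proof (rule tendsto_sandwich[OF _ _ tendsto_const up])
      show "\<forall>\<^sub>F n in sequentially. \<tau> x \<le> ?t n x"
        using b(1) by (intro always_eventually allI less_imp_le)
      show "\<forall>\<^sub>F n in sequentially. ?t n x \<le> \<tau> x + 1 / real (Suc n)"
        using b(2) by (intro always_eventually allI)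
    qed
    moreover have "\<forall>\<^sub>F n in sequentially. ?t n x \<in> {\<tau> x<..} \<and> ?t n x \<noteq> \<tau> x"
    proof (intro always_eventually allI)
      fix n show "?t n x \<in> {\<tau> x<..} \<and> ?t n x \<noteq> \<tau> x" using b(1)[of n] by (simp del: of_nat_Suc)
    qed
    ultimately have "filterlim (\<lambda>n. ?t n x) (at_right (\<tau> x)) sequentially"
      unfolding filterlim_at by blast
    from filterlim_compose[OF cadlag_right[OF Tx nn[OF x]] this]
    have "(\<lambda>n. T x (?t n x)) \<longlonglongrightarrow> T x (\<tau> x)" .
    moreover have "max 0 (?t n x) = ?t n x" for n using b(1)[of n] nn[OF x] by simp
    ultimately show ?thesis by simp
  qed
  ultimately show ?thesis by (rule borel_measurable_LIMSEQ_real[rotated])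
qed

lemma rational_in_interval:
  assumes f: "f \<in> cadlag_paths S {0..}" and r: "0 \<le> u" "u < r" "r < s" and U: "open U" "f r \<in> U"
  shows "\<exists>q\<in>\<rat>. u < q \<and> q < s \<and> f q \<in> U"
proof -
  have "\<forall>\<^sub>F q in at_right r. f q \<in> U"
    using cadlag_right[OF f, of r] r U by (auto simp: tendsto_def)
  then obtain b where b: "r < b" "\<And>q. r < q \<Longrightarrow> q < b \<Longrightarrow> f q \<in> U"
    unfolding eventually_at_right_field by blast
  obtain q where "q \<in> \<rat>" "r < q" "q < min b s" using Rats_dense_in_real[of r "min b s"] b r by auto
  then show ?thesis using b r by (intro bexI[of _ q]) auto
qed

text \<open>Both the time interval and the condition on the value are open. So rational times decide
  the event, and it depends only on coordinates before time \<open>s\<close>.\<close>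

definition far :: "real \<Rightarrow> real \<Rightarrow> real \<Rightarrow> real \<Rightarrow> (real \<Rightarrow> real) \<Rightarrow> bool" where
  "far c u s \<eta> f \<longleftrightarrow> (\<exists>r. u < r \<and> r < s \<and> \<bar>f r - c\<bar> > \<eta>)"

lemma far_mono: "far c u s \<eta> f \<Longrightarrow> u' \<le> u \<Longrightarrow> s \<le> s' \<Longrightarrow> \<eta>' \<le> \<eta> \<Longrightarrow> far c u' s' \<eta>' f"
  unfolding far_def by (meson le_less_trans less_le_trans)

lemma far_iff_rat:
  assumes "f \<in> cadlag_paths S {0..}" "0 \<le> u"
  shows "far c u s \<eta> f \<longleftrightarrow> (\<exists>q::rat. u < of_rat q \<and> of_rat q < s \<and> \<bar>f (of_rat q) - c\<bar> > \<eta>)"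
proof
  assume "far c u s \<eta> f"
  then obtain r where "u < r" "r < s" "\<bar>f r - c\<bar> > \<eta>" by (auto simp: far_def)
  moreover have "open {x. \<eta> < \<bar>x - c\<bar>}" by (intro open_Collect_less continuous_intros)
  ultimately obtain q where "q \<in> \<rat>" "u < q" "q < s" "\<bar>f q - c\<bar> > \<eta>"
    using rational_in_interval[OF assms(1), of u r s "{x. \<bar>x - c\<bar> > \<eta>}"] assms by auto
  then show "\<exists>q::rat. u < of_rat q \<and> of_rat q < s \<and> \<bar>f (of_rat q) - c\<bar> > \<eta>"
    by (auto simp: Rats_def)
qed (auto simp: far_def)

lemma far_measurable:
  assumes "0 \<le> u" "s \<le> s'"
  shows "Measurable.pred (coord_algebra S {0..} {0..s'}) (far c u s \<eta>)"
proof -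
  let ?M = "coord_algebra S {0..} {0..s'}"
  have "Measurable.pred ?M (\<lambda>f. u < of_rat q \<and> of_rat q < s \<and> \<bar>f (of_rat q) - c\<bar> > \<eta>)" for q :: rat
  proof (cases "u < of_rat q \<and> of_rat q < s")
    case True
    then have [measurable]: "(\<lambda>f. f (of_rat q)) \<in> borel_measurable ?M"
      using assms by (intro measurable_coordinate) (simp del: zero_le_of_rat_iff)
    show ?thesis by measurable
  next
    case False
    then have "(\<lambda>f. u < of_rat q \<and> of_rat q < s \<and> \<bar>f (of_rat q) - c\<bar> > \<eta>) = (\<lambda>_::real \<Rightarrow> real. False)" by auto
    then show ?thesis by simp
  qed
  then have "Measurable.pred ?M (\<lambda>f. \<exists>q::rat. u < of_rat q \<and> of_rat q < s \<and> \<bar>f (of_rat q) - c\<bar> > \<eta>)"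
    by (rule pred_intros_countable)
  then show ?thesis
    by (rule measurable_cong[THEN iffD2, rotated]) (auto simp: far_iff_rat[OF _ assms(1)])
qed

section \<open>Last hitting times by left limits\<close>

lemma measurable_completion_AE:
  assumes "f \<in> measurable M N" and "AE x in M. f x = g x" and "\<And>x. x \<in> space M \<Longrightarrow> g x \<in> space N"
  shows "g \<in> measurable (completion M) N"
proof (rule measurableI)
  fix A assume A: "A \<in> sets N"
  show "g -` A \<inter> space (completion M) \<in> sets (completion M)"
  proof (rule completion.in_sets_AE)
    show "AE x in completion M. x \<in> f -` A \<inter> space M \<longleftrightarrow> x \<in> g -` A \<inter> space (completion M)"
      using AE_completion[OF assms(2)] by eventually_elim auto
    show "f -` A \<inter> space M \<in> sets (completion M)" using measurable_sets[OF assms(1) A] by auto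
  qed auto
qed (use assms in auto)

text \<open>Curve and lower end are parameters because a time shift turns \<open>curve\<close> into
  \<open>\<lambda>r. curve (t + r)\<close>, and the event that the last hit lies in a given cell is
  cut out by two different lower ends.\<close>

definition left_hits :: "(real \<Rightarrow> real) \<Rightarrow> real \<Rightarrow> real \<Rightarrow> (real \<Rightarrow> real) \<Rightarrow> real set" where
  "left_hits \<kappa> a b f = {t \<in> {a<..b}. Lim (at_left t) f = \<kappa> t}"

text \<open>The last hitting time is the essential infimum \<open>R\<close> of its measurable upper bounds: if the left
  limit at \<open>R\<close> misses the curve, then so do all left limits on some \<open>(q, R]\<close> with \<open>q\<close> rational, and
  \<open>R\<close> could be lowered to \<open>q\<close>. This replaces the measurable projection theorem.\<close>

lemma last_left_hit_measurable:
  fixes \<kappa> :: "real \<Rightarrow> real"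
  assumes M: "prob_space M" and sM: "sets M = sets (path_space S {0..})"
    and \<kappa>: "\<And>t. 0 < t \<Longrightarrow> (\<kappa> \<longlongrightarrow> \<kappa> t) (at_left t)" and ab: "0 \<le> a" "a \<le> b"
  shows "\<exists>R\<in>borel_measurable M. (\<forall>f\<in>space M. a \<le> R f \<and> R f \<le> b) \<and>
    (\<forall>f\<in>space M. \<forall>t\<in>left_hits \<kappa> a b f. t \<le> R f) \<and>
    (AE f in M. a < R f \<longrightarrow> R f \<in> left_hits \<kappa> a b f)"
proof -
  interpret prob_space M by fact
  have spM: "space M = cadlag_paths S {0..}" using sets_eq_imp_space_eq[OF sM] by simp
  \<comment> \<open>A sequence in this class with expectations tending to their infimum yields the
    essential infimum; the constant \<open>b\<close> shows that the class is nonempty.\<close>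
  define RR where "RR = {R \<in> borel_measurable M. (\<forall>f\<in>space M. a \<le> R f \<and> R f \<le> b) \<and>
    (\<forall>f\<in>space M. \<forall>t\<in>left_hits \<kappa> a b f. t \<le> R f)}"
  have RRI: "integrable M R" if "R \<in> RR" for R
    by (rule integrable_const_bound[of _ "\<bar>a\<bar> + \<bar>b\<bar>"]) (use that in \<open>fastforce simp: RR_def\<close>)+
  define I where "I = Inf ((\<lambda>R. integral\<^sup>L M R) ` RR)"
  have "(\<lambda>_. b) \<in> RR" using ab by (auto simp: RR_def left_hits_def)
  then have ne: "(\<lambda>R. integral\<^sup>L M R) ` RR \<noteq> {}" by blast
  have "a \<le> integral\<^sup>L M R" if "R \<in> RR" for R
    by (rule integral_ge_const[OF RRI[OF that]]) (use that in \<open>auto simp: RR_def\<close>)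
  then have bdd: "bdd_below ((\<lambda>R. integral\<^sup>L M R) ` RR)" by (intro bdd_belowI[of _ a]) auto
  have "\<exists>R\<in>RR. integral\<^sup>L M R < I + 1 / Suc n" for n
  proof -
    have "Inf ((\<lambda>R. integral\<^sup>L M R) ` RR) < I + 1 / Suc n" unfolding I_def[symmetric] by simp
    from cInf_lessD[OF ne this] show ?thesis by blast
  qed
  then obtain Rn where Rn: "\<And>n. Rn n \<in> RR" "\<And>n. integral\<^sup>L M (Rn n) < I + 1 / Suc n" by metis
  define R where "R f = (INF n. Rn n f)" for f
  have bddR: "bdd_below (range (\<lambda>n. Rn n f))" if "f \<in> space M" for f
    using Rn(1) that by (intro bdd_belowI[of _ a]) (auto simp: RR_def)
  have Rle: "R f \<le> Rn n f" if "f \<in> space M" for f n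
    unfolding R_def by (rule cINF_lower[OF bddR[OF that]]) simp
  have R: "R \<in> RR"
  proof -
    have "R \<in> borel_measurable M" unfolding R_def
      by (rule borel_measurable_cINF) (use Rn(1) bddR in \<open>auto simp: RR_def\<close>)
    moreover have "a \<le> R f \<and> R f \<le> b" if f: "f \<in> space M" for f
    proof
      show "a \<le> R f" unfolding R_def using Rn(1) f by (intro cINF_greatest) (auto simp: RR_def)
      have "Rn 0 f \<le> b" using Rn(1) f by (auto simp: RR_def)
      then show "R f \<le> b" using Rle[OF f, of 0] by linarith
    qed
    moreover have "t \<le> R f" if "f \<in> space M" "t \<in> left_hits \<kappa> a b f" for f t
      unfolding R_def using Rn(1) that by (intro cINF_greatest) (auto simp: RR_def)
    ultimately show ?thesis by (auto simp: RR_def)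
  qed
  have IR: "integral\<^sup>L M R \<le> I"
  proof (rule field_le_epsilon)
    fix e :: real assume "0 < e"
    then obtain n where n: "1 / Suc n < e" using nat_approx_posE by blast
    have "integral\<^sup>L M R \<le> integral\<^sup>L M (Rn n)"
      using Rle by (intro integral_mono RRI R Rn) auto
    then show "integral\<^sup>L M R \<le> I + e" using Rn(2)[of n] n by linarith
  qed
  have [measurable]: "R \<in> borel_measurable M" using R by (simp add: RR_def)
  have coord [measurable]: "(\<lambda>f. f (max 0 q)) \<in> borel_measurable M" for q
    using measurable_coordinate[of "max 0 q" "{0..}" S "{0..}"] measurable_cong_sets[OF sM refl] by auto
  \<comment> \<open>On \<open>cnd q\<close> the path keeps a positive distance from the curve at the
    rational times in \<open>(q, R f)\<close>, hence every left limit in \<open>(q, R f]\<close>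
    misses the curve. Membership in the sigma-field is clear because only rational times occur;
    \<open>max 0\<close> merely keeps the index in \<open>{0..}\<close>.\<close>
  define cnd where "cnd q f \<longleftrightarrow> a \<le> real_of_rat q \<and> real_of_rat q < R f \<and>
    (\<exists>n. \<forall>r::rat. real_of_rat q < real_of_rat r \<and> real_of_rat r < R f \<longrightarrow>
       1 / real (Suc n) \<le> \<bar>f (max 0 (real_of_rat r)) - \<kappa> (real_of_rat r)\<bar>)" for q :: rat and f
  have [measurable]: "Measurable.pred M (cnd q)" for q unfolding cnd_def by measurable
  have nc: "AE f in M. \<not> cnd q f" for q
  proof -
    define Rq where "Rq f = (if cnd q f then real_of_rat q else R f)" for f
    have "t \<le> Rq f" if f: "f \<in> space M" and t: "t \<in> left_hits \<kappa> a b f" for f t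
    proof (rule ccontr)
      assume "\<not> t \<le> Rq f"
      moreover have tR: "t \<le> R f" using R f t by (auto simp: RR_def)
      ultimately have c: "cnd q f" and q: "real_of_rat q < t" "a \<le> real_of_rat q"
        by (auto simp: Rq_def cnd_def split: if_splits)
      obtain n where n: "\<And>r. real_of_rat q < real_of_rat r \<Longrightarrow> real_of_rat r < R f \<Longrightarrow>
         1 / real (Suc n) \<le> \<bar>f (max 0 (real_of_rat r)) - \<kappa> (real_of_rat r)\<bar>"
        using c unfolding cnd_def by blast
      have t0: "0 < t" "Lim (at_left t) f = \<kappa> t" using t ab by (auto simp: left_hits_def)
      have "((\<lambda>r. f r - \<kappa> r) \<longlongrightarrow> \<kappa> t - \<kappa> t) (at_left t)"
        using cadlag_Lim_left[of f S t] f t0 \<kappa>[of t] unfolding spM by (intro tendsto_diff) auto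
      then have "\<forall>\<^sub>F r in at_left t. dist (f r - \<kappa> r) (\<kappa> t - \<kappa> t) < 1 / real (Suc n)"
        by (rule tendstoD) simp
      then obtain d where d: "d < t" "\<And>r. d < r \<Longrightarrow> r < t \<Longrightarrow> \<bar>f r - \<kappa> r\<bar> < 1 / real (Suc n)"
        unfolding eventually_at_left_field by (auto simp: dist_real_def)
      obtain r where r: "max d (real_of_rat q) < real_of_rat r" "real_of_rat r < t"
        using of_rat_dense[of "max d (real_of_rat q)" t] d q by auto
      have "0 \<le> real_of_rat r" using r q ab by linarith
      then have "max 0 (real_of_rat r) = real_of_rat r" by linarith
      then show False using n[of r] d(2)[of "real_of_rat r"] r tR by auto
    qed
    moreover have "a \<le> Rq f \<and> Rq f \<le> b" if "f \<in> space M" for f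
    proof -
      have "a \<le> R f \<and> R f \<le> b" using R that by (auto simp: RR_def)
      then show ?thesis by (auto simp: Rq_def cnd_def)
    qed
    moreover have "Rq \<in> borel_measurable M" unfolding Rq_def by measurable
    ultimately have Rq: "Rq \<in> RR" by (auto simp: RR_def)
    \<comment> \<open>\<open>Rq\<close> competes in the minimisation and lies below
      \<open>R\<close>, strictly so on \<open>cnd q\<close>; minimality of the expectation of
      \<open>R\<close> makes \<open>cnd q\<close> a null event.\<close>
    have "I \<le> integral\<^sup>L M Rq" unfolding I_def using Rq by (intro cINF_lower[OF bdd]) auto
    then have "(\<integral>f. R f - Rq f \<partial>M) \<le> 0" using IR RRI[OF R] RRI[OF Rq] by simp
    moreover have nn: "0 \<le> R f - Rq f" for f by (auto simp: Rq_def cnd_def)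
    ultimately have "(\<integral>f. R f - Rq f \<partial>M) = 0" by (intro antisym integral_nonneg_AE) auto
    then have "AE f in M. R f - Rq f = 0"
      using RRI[OF R] RRI[OF Rq] nn by (subst (asm) integral_nonneg_eq_0_iff_AE) auto
    moreover have "R f - Rq f \<noteq> 0" if "cnd q f" for f
      using that by (simp add: Rq_def) (simp add: cnd_def)
    ultimately show ?thesis by (auto elim!: eventually_mono)
  qed
  have "AE f in M. a < R f \<longrightarrow> R f \<in> left_hits \<kappa> a b f"
  proof -
    have "AE f in M. \<forall>q. \<not> cnd q f" using nc by (simp add: AE_all_countable)
    then show ?thesis
    proof (rule AE_mp, intro AE_I2 impI)
      fix f assume f: "f \<in> space M" and nc: "\<forall>q. \<not> cnd q f" and aR: "a < R f"
      have Rb: "R f \<le> b" using R f by (auto simp: RR_def)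
      show "R f \<in> left_hits \<kappa> a b f"
      proof (rule ccontr)
        assume "R f \<notin> left_hits \<kappa> a b f"
        then have ne: "Lim (at_left (R f)) f - \<kappa> (R f) \<noteq> 0" using aR Rb by (auto simp: left_hits_def)
        define e where "e = \<bar>Lim (at_left (R f)) f - \<kappa> (R f)\<bar> / 2"
        have e: "0 < e" using ne by (simp add: e_def)
        have "((\<lambda>r. f r - \<kappa> r) \<longlongrightarrow> Lim (at_left (R f)) f - \<kappa> (R f)) (at_left (R f))"
          using cadlag_Lim_left[of f S "R f"] f aR ab \<kappa>[of "R f"] unfolding spM by (intro tendsto_diff) auto
        from tendstoD[OF this e] obtain d where d: "d < R f"
          "\<And>r. d < r \<Longrightarrow> r < R f \<Longrightarrow> \<bar>(f r - \<kappa> r) - (Lim (at_left (R f)) f - \<kappa> (R f))\<bar> < e"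
          unfolding eventually_at_left_field by (auto simp: dist_real_def)
        obtain n where n: "1 / Suc n < e" using e nat_approx_posE by blast
        obtain q where q: "max a d < real_of_rat q" "real_of_rat q < R f"
          using of_rat_dense[of "max a d" "R f"] aR d(1) by auto
        have "1 / real (Suc n) \<le> \<bar>f (max 0 (real_of_rat r)) - \<kappa> (real_of_rat r)\<bar>"
          if r: "real_of_rat q < real_of_rat r" "real_of_rat r < R f" for r
        proof -
          have "0 \<le> real_of_rat r" using r q ab by linarith
          then have m: "max 0 (real_of_rat r) = real_of_rat r" by linarith
          have "\<bar>(f (real_of_rat r) - \<kappa> (real_of_rat r)) - (Lim (at_left (R f)) f - \<kappa> (R f))\<bar> < e"
            using r q by (intro d(2)) linarith+
          moreover have "\<bar>y\<bar> / 2 \<le> \<bar>x\<bar>" if "\<bar>x - y\<bar> < \<bar>y\<bar> / 2" for x y :: real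
            using that by (auto simp: abs_if split: if_splits)
          ultimately have "e \<le> \<bar>f (real_of_rat r) - \<kappa> (real_of_rat r)\<bar>" unfolding e_def by blast
          then show ?thesis using n m by simp
        qed
        then have "cnd q f" unfolding cnd_def using q by auto
        then show False using nc by blast
      qed
    qed
  qed
  then show ?thesis using R by (auto simp: RR_def)
qed

text \<open>With \<open>R\<close> from the previous lemma, the event agrees up to a null set with
  \<open>a < R f\<close>: \<open>R\<close> majorises all hits, and almost surely it is a hit as soon
  as it exceeds \<open>a\<close>.\<close>

lemma left_hits_completion:
  fixes \<kappa> :: "real \<Rightarrow> real"
  assumes M: "prob_space M" and sM: "sets M = sets (path_space S {0..})"
    and \<kappa>: "\<And>t. 0 < t \<Longrightarrow> (\<kappa> \<longlongrightarrow> \<kappa> t) (at_left t)" and a: "0 \<le> a"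
  shows "Measurable.pred (completion M) (\<lambda>f. left_hits \<kappa> a b f \<noteq> {})"
proof (cases "a \<le> b")
  case True
  obtain R where R: "R \<in> borel_measurable M" "\<And>f. f \<in> space M \<Longrightarrow> a \<le> R f \<and> R f \<le> b"
    "\<And>f t. f \<in> space M \<Longrightarrow> t \<in> left_hits \<kappa> a b f \<Longrightarrow> t \<le> R f"
    "AE f in M. a < R f \<longrightarrow> R f \<in> left_hits \<kappa> a b f"
    using last_left_hit_measurable[OF M sM \<kappa> a True] by blast
  have "AE f in M. (a < R f) = (left_hits \<kappa> a b f \<noteq> {})"
    using R(4)
  proof (rule AE_mp, intro AE_I2 impI)
    fix f assume "f \<in> space M" "a < R f \<longrightarrow> R f \<in> left_hits \<kappa> a b f"
    moreover have "a < t" if "t \<in> left_hits \<kappa> a b f" for t using that by (auto simp: left_hits_def)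
    ultimately show "(a < R f) = (left_hits \<kappa> a b f \<noteq> {})" using R(3) by (metis ex_in_conv less_le_trans)
  qed
  moreover have "Measurable.pred M (\<lambda>f. a < R f)"
    using R(1) by measurable
  ultimately show ?thesis by (intro measurable_completion_AE) auto
next
  case False
  then show ?thesis by (simp add: left_hits_def)
qed

section \<open>Skorohod-continuous functionals\<close>

lemma tendsto_head_bound:
  fixes f :: "real \<Rightarrow> real"
  assumes "(f \<longlongrightarrow> l) (at_left x)" "0 < e"
  shows "\<exists>d>0. \<forall>r s. x - d < r \<and> r < x \<and> x - d < s \<and> s < x \<longrightarrow> \<bar>f r - f s\<bar> < e"
proof -
  have "\<forall>\<^sub>F r in at_left x. dist (f r) l < e / 2" by (rule tendstoD[OF assms(1)]) (use assms in simp)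
  then obtain b where b: "b < x" "\<And>r. b < r \<Longrightarrow> r < x \<Longrightarrow> \<bar>f r - l\<bar> < e / 2"
    unfolding eventually_at_left_field by (auto simp: dist_real_def)
  show ?thesis
  proof (intro exI[of _ "x - b"] conjI allI impI)
    fix r s assume "x - (x - b) < r \<and> r < x \<and> x - (x - b) < s \<and> s < x"
    then have "\<bar>f r - l\<bar> < e / 2" "\<bar>f s - l\<bar> < e / 2" using b(2) by simp_all
    then show "\<bar>f r - f s\<bar> < e" by linarith
  qed (use b in simp)
qed

lemma frac_ceiling_bounds:
  assumes "0 < n"
  shows "a \<le> of_int \<lceil>real n * a\<rceil> / real n" "of_int \<lceil>real n * a\<rceil> / real n < a + 1 / real n"
proof -
  have "real n * a \<le> of_int \<lceil>real n * a\<rceil>" "of_int \<lceil>real n * a\<rceil> < real n * a + 1" by linarith+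
  then show "a \<le> of_int \<lceil>real n * a\<rceil> / real n" "of_int \<lceil>real n * a\<rceil> / real n < a + 1 / real n"
    using assms by (auto simp: field_simps)
qed

lemma frac_floor_bounds:
  assumes "0 < n"
  shows "of_int \<lfloor>real n * a\<rfloor> / real n \<le> a" "a - 1 / real n < of_int \<lfloor>real n * a\<rfloor> / real n"
proof -
  have "of_int \<lfloor>real n * a\<rfloor> \<le> real n * a" "real n * a - 1 < of_int \<lfloor>real n * a\<rfloor>" by linarith+
  moreover have "a - 1 / real n = (real n * a - 1) / real n" using assms by (simp add: diff_divide_distrib)
  ultimately show "of_int \<lfloor>real n * a\<rfloor> / real n \<le> a" "a - 1 / real n < of_int \<lfloor>real n * a\<rfloor> / real n"
    using assms by (simp_all add: divide_strict_right_mono pos_divide_le_eq mult.commute)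
qed

text \<open>A grid-to-path time change on \<open>[\<lceil>na\<rceil>/n, \<lceil>nb\<rceil>/n]\<close> along which sampling \<open>f\<close> at the grid points is
  uniformly within \<open>e\<close> of \<open>f\<close>. Such time changes can be concatenated.\<close>

definition sampling_change :: "(real \<Rightarrow> real) \<Rightarrow> real \<Rightarrow> nat \<Rightarrow> real \<Rightarrow> real \<Rightarrow> (real \<Rightarrow> real) \<Rightarrow> bool" where
  "sampling_change f e n a b l \<longleftrightarrow>
     (let a' = of_int \<lceil>real n * a\<rceil> / real n; b' = of_int \<lceil>real n * b\<rceil> / real n in
      strict_mono_on {a'..b'} l \<and> l ` {a'..b'} = {a..b} \<and>
      (\<forall>r\<in>{a'..b'}. \<bar>l r - r\<bar> \<le> 1 / real n) \<and>
      (\<forall>r\<in>{a'..<b'}. \<bar>f (of_int \<lfloor>real n * r\<rfloor> / real n) - f (l r)\<bar> \<le> e))"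

lemma strict_mono_onto_endpoints:
  fixes l :: "real \<Rightarrow> real"
  assumes "strict_mono_on {a'..b'} l" "l ` {a'..b'} = {a..b}" "a' \<le> b'"
  shows "l a' = a" "l b' = b"
proof -
  have m: "mono_on {a'..b'} l" using assms(1) by (rule strict_mono_on_imp_mono_on)
  have "a \<le> b" using assms(2,3) by (metis atLeastatMost_empty_iff image_is_empty)
  then obtain r s where "r \<in> {a'..b'}" "l r = a" "s \<in> {a'..b'}" "l s = b"
    using assms(2) by (metis atLeastAtMost_iff imageE order_refl)
  moreover have "l a' \<in> {a..b}" "l b' \<in> {a..b}" using assms(2,3) by auto
  ultimately show "l a' = a" "l b' = b"
    using m assms(3) unfolding mono_on_def by (metis atLeastAtMost_iff order_antisym order_refl)+
qed

text \<open>The affine map between the intervals works. Both ends are rounded up, so every grid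
  point in \<open>[a', b')\<close> lies in \<open>[a, b)\<close>, where the oscillation of
  \<open>f\<close> is at most \<open>e\<close>.\<close>

lemma sampling_change_linear:
  assumes n: "0 < n" and ab: "a < b" "1 / real n < b - a"
    and osc: "\<And>r s. a \<le> r \<Longrightarrow> r < b \<Longrightarrow> a \<le> s \<Longrightarrow> s < b \<Longrightarrow> \<bar>f r - f s\<bar> \<le> e"
  shows "\<exists>l. sampling_change f e n a b l"
proof -
  define a' where "a' = of_int \<lceil>real n * a\<rceil> / real n"
  define b' where "b' = of_int \<lceil>real n * b\<rceil> / real n"
  have a': "a \<le> a'" "a' < a + 1 / real n" and b': "b \<le> b'" "b' < b + 1 / real n"
    using frac_ceiling_bounds[OF n] by (auto simp: a'_def b'_def)
  have ab': "a' < b'" using a' b' ab by linarith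
  define k where "k = (b - a) / (b' - a')"
  have k: "0 < k" "k * (b' - a') = b - a" using ab ab' by (auto simp: k_def)
  define l where "l r = a + k * (r - a')" for r
  have "strict_mono_on {a'..b'} l" using k by (auto simp: strict_mono_on_def l_def)
  moreover have onto: "l ` {a'..b'} = {a..b}"
  proof -
    have "l ` {a'..b'} = (\<lambda>r. k * r + (a - k * a')) ` {a'..b'}" by (auto simp: l_def algebra_simps)
    also have "\<dots> = {k * a' + (a - k * a')..k * b' + (a - k * a')}"
      using k ab' by (subst image_affinity_atLeastAtMost) auto
    finally show ?thesis using k by (simp add: algebra_simps)
  qed
  moreover have "\<bar>l r - r\<bar> \<le> 1 / real n" if r: "r \<in> {a'..b'}" for r
  proof -
    \<comment> \<open>In the barycentric coordinate \<open>th\<close>, the displacement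
      \<open>r - l r\<close> is a convex combination of the end displacements \<open>a' - a\<close>
      and \<open>b' - b\<close>, which lie in \<open>[0, 1/n)\<close>.\<close>
    define th where "th = (r - a') / (b' - a')"
    have th: "0 \<le> th" "th \<le> 1" "th * (b' - a') = r - a'" using r ab' by (auto simp: th_def)
    have "l r = a + th * (b - a)" using ab' by (simp add: l_def k_def th_def)
    then have "r - l r = a' + th * (b' - a') - (a + th * (b - a))" using th(3) by linarith
    then have "r - l r = (1 - th) * (a' - a) + th * (b' - b)" by (simp add: algebra_simps)
    moreover have "0 \<le> (1 - th) * (a' - a) + th * (b' - b)" using th a' b' by simp
    moreover have "(1 - th) * (a' - a) + th * (b' - b) \<le> (1 - th) * (1 / real n) + th * (1 / real n)"
      using th a' b' by (intro add_mono mult_left_mono) auto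
    moreover have "(1 - th) * (1 / real n) + th * (1 / real n) = 1 / real n"
      by (simp flip: add_divide_distrib)
    ultimately show ?thesis by linarith
  qed
  moreover have "\<bar>f (of_int \<lfloor>real n * r\<rfloor> / real n) - f (l r)\<bar> \<le> e" if r: "r \<in> {a'..<b'}" for r
  proof (rule osc)
    have "\<lceil>real n * a\<rceil> \<le> \<lfloor>real n * r\<rfloor>"
      using r n by (simp add: le_floor_iff a'_def field_simps)
    then have "a' \<le> of_int \<lfloor>real n * r\<rfloor> / real n" using n by (simp add: a'_def divide_right_mono)
    then show "a \<le> of_int \<lfloor>real n * r\<rfloor> / real n" using a' by linarith
    have "\<lfloor>real n * r\<rfloor> < \<lceil>real n * b\<rceil>" using r n by (simp add: floor_less_iff b'_def field_simps)
    then have "of_int \<lfloor>real n * r\<rfloor> < real n * b" by (simp add: less_ceiling_iff)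
    then show "of_int \<lfloor>real n * r\<rfloor> / real n < b" using n by (simp add: field_simps)
    have "l r \<in> {a..b}" using onto r by auto
    moreover have "k * (r - a') < k * (b' - a')" using k r by (intro mult_strict_left_mono) auto
    then have "l r < b" using k(2) by (simp add: l_def)
    ultimately show "a \<le> l r" "l r < b" by auto
  qed
  ultimately show ?thesis unfolding sampling_change_def Let_def a'_def[symmetric] b'_def[symmetric] by blast
qed

text \<open>Both pieces take the value \<open>b\<close> at the common rounded point
  \<open>b'\<close>. The sampling condition is half-open, so at \<open>b'\<close> only the right
  piece has to satisfy it.\<close>

lemma sampling_change_concat:
  assumes n: "0 < n" and ab: "a \<le> b" "b \<le> c"
    and l1: "sampling_change f e n a b l1" and l2: "sampling_change f e n b c l2"
  shows "\<exists>l. sampling_change f e n a c l"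
proof -
  define a' where "a' = of_int \<lceil>real n * a\<rceil> / real n"
  define b' where "b' = of_int \<lceil>real n * b\<rceil> / real n"
  define c' where "c' = of_int \<lceil>real n * c\<rceil> / real n"
  have o: "a' \<le> b'" "b' \<le> c'" using ab
    unfolding a'_def b'_def c'_def by (intro divide_right_mono; simp add: ceiling_mono mult_left_mono)+
  have L1: "strict_mono_on {a'..b'} l1" "l1 ` {a'..b'} = {a..b}"
    "\<And>r. r \<in> {a'..b'} \<Longrightarrow> \<bar>l1 r - r\<bar> \<le> 1 / real n"
    "\<And>r. r \<in> {a'..<b'} \<Longrightarrow> \<bar>f (of_int \<lfloor>real n * r\<rfloor> / real n) - f (l1 r)\<bar> \<le> e"
    using l1 unfolding sampling_change_def Let_def a'_def b'_def by blast+
  have L2: "strict_mono_on {b'..c'} l2" "l2 ` {b'..c'} = {b..c}"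
    "\<And>r. r \<in> {b'..c'} \<Longrightarrow> \<bar>l2 r - r\<bar> \<le> 1 / real n"
    "\<And>r. r \<in> {b'..<c'} \<Longrightarrow> \<bar>f (of_int \<lfloor>real n * r\<rfloor> / real n) - f (l2 r)\<bar> \<le> e"
    using l2 unfolding sampling_change_def Let_def c'_def b'_def by blast+
  have ends: "l1 b' = b" "l2 b' = b"
    using strict_mono_onto_endpoints[OF L1(1,2) o(1)] strict_mono_onto_endpoints[OF L2(1,2) o(2)] by auto
  define l where "l r = (if r \<le> b' then l1 r else l2 r)" for r
  have l2': "l r = l2 r" if "b' \<le> r" for r using that ends by (auto simp: l_def)
  have "strict_mono_on {a'..c'} l"
  proof (rule strict_mono_onI)
    fix r s assume rs: "r \<in> {a'..c'}" "s \<in> {a'..c'}" "r < s"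
    consider "s \<le> b'" | "b' \<le> r" | "r < b'" "b' < s" by linarith
    then show "l r < l s"
    proof cases
      case 1 then show ?thesis using rs L1(1) by (auto simp: l_def strict_mono_on_def)
    next
      case 2 then show ?thesis using rs L2(1) by (auto simp: l2' strict_mono_on_def)
    next
      case 3
      then have "l1 r < l1 b'" "l2 b' < l2 s" using rs L1(1) L2(1) o by (auto simp: strict_mono_on_def)
      then show ?thesis using 3 ends by (simp add: l_def)
    qed
  qed
  moreover have "l ` {a'..c'} = {a..c}"
  proof -
    have "l ` {a'..c'} = l ` {a'..b'} \<union> l ` {b'..c'}" using o by (simp add: ivl_disj_un_two_touch image_Un[symmetric])
    also have "l ` {a'..b'} = l1 ` {a'..b'}" by (auto simp: l_def)
    also have "l ` {b'..c'} = l2 ` {b'..c'}" using l2' by auto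
    finally show ?thesis using L1(2) L2(2) ab by (auto simp: ivl_disj_un_two_touch)
  qed
  moreover have "\<bar>l r - r\<bar> \<le> 1 / real n" if "r \<in> {a'..c'}" for r
    using L1(3)[of r] L2(3)[of r] that by (auto simp: l_def)
  moreover have "\<bar>f (of_int \<lfloor>real n * r\<rfloor> / real n) - f (l r)\<bar> \<le> e" if "r \<in> {a'..<c'}" for r
    using L1(4)[of r] L2(4)[of r] that l2'[of r] by (cases "r < b'") (auto simp: l_def)
  ultimately show ?thesis unfolding sampling_change_def Let_def a'_def[symmetric] c'_def[symmetric] by blast
qed

lemma sampling_change_trivial: "0 < n \<Longrightarrow> \<exists>l. sampling_change f e n a a l"
proof -
  assume n: "0 < n"
  let ?a = "of_int \<lceil>real n * a\<rceil> / real n"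
  have "a \<le> ?a" "?a < a + 1 / real n" using frac_ceiling_bounds[OF n] by auto
  then have "sampling_change f e n a a (\<lambda>_. a)"
    by (auto simp: sampling_change_def Let_def strict_mono_on_def)
  then show ?thesis by blast
qed

text \<open>Bolzano's bisection principle replaces the usual partition into pieces of small
  oscillation: a short interval around \<open>x\<close> is cut at \<open>x\<close>, where
  right-continuity controls the piece \<open>[x, b)\<close> and the left limit controls the piece
  \<open>[a, x)\<close>.\<close>

lemma sampling_change_ex:
  assumes f: "f \<in> cadlag_paths S {0..1}" and e: "0 < e"
  shows "\<forall>\<^sub>F n in sequentially. \<exists>l. sampling_change f e n 0 1 l"
proof -
  \<comment> \<open>The principle quantifies over all short intervals around a point, including
    those that leave \<open>[0, 1]\<close>; for these \<open>Q\<close> holds vacuously.\<close>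
  define Q where "Q a b \<longleftrightarrow> (0 \<le> a \<longrightarrow> a \<le> b \<longrightarrow> b \<le> 1 \<longrightarrow>
     (\<forall>\<^sub>F n in sequentially. \<exists>l. sampling_change f e n a b l))" for a b :: real
  have lin: "Q a b" if osc: "\<And>r s. a \<le> r \<Longrightarrow> r < b \<Longrightarrow> a \<le> s \<Longrightarrow> s < b \<Longrightarrow> \<bar>f r - f s\<bar> \<le> e" for a b
  proof (cases "a < b")
    case True
    then have "\<forall>\<^sub>F n in sequentially. 1 / real n < b - a"
      using order_tendstoD(2)[OF lim_1_over_n, of "b - a"] by simp
    then have "\<forall>\<^sub>F n in sequentially. 0 < n \<and> 1 / real n < b - a"
      by (intro eventually_conj eventually_gt_at_top)
    then show ?thesis unfolding Q_def
      using sampling_change_linear[OF _ True _ osc] by (auto elim!: eventually_mono)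
  next
    case False
    then show ?thesis unfolding Q_def using sampling_change_trivial[of _ f e a]
      by (auto intro!: eventually_mono[OF eventually_gt_at_top[of 0]])
  qed
  have trans: "Q a c" if "Q a b" "Q b c" "a \<le> b" "b \<le> c" for a b c
    unfolding Q_def
  proof (intro impI)
    assume "0 \<le> a" "a \<le> c" "c \<le> 1"
    then have "\<forall>\<^sub>F n in sequentially. \<exists>l. sampling_change f e n a b l"
      "\<forall>\<^sub>F n in sequentially. \<exists>l. sampling_change f e n b c l" using that by (auto simp: Q_def)
    then show "\<forall>\<^sub>F n in sequentially. \<exists>l. sampling_change f e n a c l"
      using eventually_gt_at_top[of 0]
      by eventually_elim (use sampling_change_concat that(3,4) in blast)
  qed
  have "Q 0 1"
  proof (rule Bolzano)
    fix x :: real assume x: "0 \<le> x" "x \<le> 1"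
    have R: "\<exists>d>0. \<forall>r s. x \<le> r \<and> r < x + d \<and> x \<le> s \<and> s < x + d \<and> r \<le> 1 \<and> s \<le> 1 \<longrightarrow> \<bar>f r - f s\<bar> \<le> e"
    proof (cases "x < 1")
      case True
      have "(f \<longlongrightarrow> f x) (at_right x)"
        using f x True by (intro cadlag_paths_right[OF f]) (auto simp: eventually_at_right_field intro: exI[of _ 1])
      then have "\<forall>\<^sub>F r in at_right x. dist (f r) (f x) < e / 2" using e by (intro tendstoD) auto
      then obtain b where b: "x < b" "\<And>r. x < r \<Longrightarrow> r < b \<Longrightarrow> \<bar>f r - f x\<bar> < e / 2"
        unfolding eventually_at_right_field by (auto simp: dist_real_def)
      have b': "\<bar>f r - f x\<bar> \<le> e / 2" if "x \<le> r" "r < b" for r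
        using b(2)[of r] that e by (cases "r = x") auto
      show ?thesis
      proof (intro exI[of _ "b - x"] conjI allI impI)
        fix r s assume "x \<le> r \<and> r < x + (b - x) \<and> x \<le> s \<and> s < x + (b - x) \<and> r \<le> 1 \<and> s \<le> 1"
        then have "\<bar>f r - f x\<bar> \<le> e / 2" "\<bar>f s - f x\<bar> \<le> e / 2" using b' by simp_all
        then show "\<bar>f r - f s\<bar> \<le> e" by linarith
      qed (use b in simp)
    next
      case False
      then show ?thesis using x e by (intro exI[of _ 1]) auto
    qed
    have L: "\<exists>d>0. \<forall>r s. x - d < r \<and> r < x \<and> x - d < s \<and> s < x \<and> 0 \<le> r \<and> 0 \<le> s \<longrightarrow> \<bar>f r - f s\<bar> \<le> e"
    proof (cases "0 < x")
      case True
      obtain l where "(f \<longlongrightarrow> l) (at_left x)" using cadlag_paths_left[OF f _ True] x by auto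
      from tendsto_head_bound[OF this e] obtain d where "d > 0"
        "\<And>r s. x - d < r \<and> r < x \<and> x - d < s \<and> s < x \<Longrightarrow> \<bar>f r - f s\<bar> < e" by blast
      then show ?thesis by (intro exI[of _ d]) (auto intro: less_imp_le)
    next
      case False
      then show ?thesis by (intro exI[of _ 1]) auto
    qed
    obtain d1 where d1: "d1 > 0" "\<And>r s. x \<le> r \<Longrightarrow> r < x + d1 \<Longrightarrow> x \<le> s \<Longrightarrow> s < x + d1 \<Longrightarrow> r \<le> 1 \<Longrightarrow> s \<le> 1 \<Longrightarrow> \<bar>f r - f s\<bar> \<le> e"
      using R by blast
    obtain d2 where d2: "d2 > 0" "\<And>r s. x - d2 < r \<Longrightarrow> r < x \<Longrightarrow> x - d2 < s \<Longrightarrow> s < x \<Longrightarrow> 0 \<le> r \<Longrightarrow> 0 \<le> s \<Longrightarrow> \<bar>f r - f s\<bar> \<le> e"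
      using L by blast
    have "Q a b" if ab: "a \<le> x" "x \<le> b" "b - a < min d1 d2" for a b
    proof (cases "0 \<le> a \<and> b \<le> 1")
      case True
      have "Q a x" by (rule lin, rule d2(2)) (use ab True in auto)
      moreover have "Q x b" by (rule lin, rule d1(2)) (use ab True in auto)
      ultimately show ?thesis using trans ab by blast
    next
      case False
      then show ?thesis by (auto simp: Q_def)
    qed
    then show "\<exists>d>0. \<forall>a b. a \<le> x \<and> x \<le> b \<and> b - a < d \<longrightarrow> Q a b"
      using d1(1) d2(1) by (intro exI[of _ "min d1 d2"]) auto
  qed (use trans in auto)
  then show ?thesis by (simp add: Q_def)
qed

section \<open>Approximation by countably many step paths\<close>

text \<open>The values are multiples of \<open>1/n\<close> coded by integers, so that only countably
  many paths occur and any functional of them is measurable.\<close>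

definition step_path :: "nat \<Rightarrow> int list \<Rightarrow> real \<Rightarrow> real" where
  "step_path n xs = (\<lambda>r\<in>{0..1}. of_int (xs ! nat \<lfloor>real n * r\<rfloor>) / real n)"

text \<open>The list has \<open>n + 1\<close> entries, the last being the sample at time 1. Rounding
  down keeps nonnegative values nonnegative, so the step path stays in
  \<open>S = {0..}\<close>.\<close>

definition samples :: "nat \<Rightarrow> (real \<Rightarrow> real) \<Rightarrow> int list" where
  "samples n f = map (\<lambda>i. \<lfloor>real n * f (real i / real n)\<rfloor>) [0..<Suc n]"

lemma eventually_floor_right:
  assumes "0 < n" shows "\<forall>\<^sub>F r in at_right s. \<lfloor>real n * r\<rfloor> = \<lfloor>real n * s\<rfloor>"
proof -
  let ?b = "(of_int \<lfloor>real n * s\<rfloor> + 1) / real n"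
  have "real n * s < of_int \<lfloor>real n * s\<rfloor> + 1" by linarith
  then have "s < ?b" using assms by (simp add: pos_less_divide_eq mult.commute)
  moreover have "\<lfloor>real n * r\<rfloor> = \<lfloor>real n * s\<rfloor>" if "s < r" "r < ?b" for r
  proof -
    have "real n * s \<le> real n * r" using that by (simp add: mult_left_mono)
    moreover have "real n * r < of_int \<lfloor>real n * s\<rfloor> + 1" using that assms
      by (simp add: pos_less_divide_eq mult.commute)
    ultimately show ?thesis by linarith
  qed
  ultimately show ?thesis unfolding eventually_at_right_field by blast
qed

lemma eventually_floor_left:
  assumes "0 < n" shows "\<forall>\<^sub>F r in at_left s. \<lfloor>real n * r\<rfloor> = \<lceil>real n * s\<rceil> - 1"
proof -
  let ?b = "(of_int \<lceil>real n * s\<rceil> - 1) / real n"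
  have "of_int \<lceil>real n * s\<rceil> - 1 < real n * s" by linarith
  then have "?b < s" using assms by (simp add: pos_divide_less_eq mult.commute)
  moreover have "\<lfloor>real n * r\<rfloor> = \<lceil>real n * s\<rceil> - 1" if "?b < r" "r < s" for r
  proof -
    have "real n * r < real n * s" using that assms by simp
    moreover have "of_int \<lceil>real n * s\<rceil> - 1 < real n * r" using that assms
      by (simp add: pos_divide_less_eq mult.commute)
    ultimately show ?thesis by linarith
  qed
  ultimately show ?thesis unfolding eventually_at_left_field by blast
qed

lemma step_path_samples_eq:
  assumes "0 < n" "r \<in> {0..1}"
  shows "step_path n (samples n f) r = of_int \<lfloor>real n * f (of_int \<lfloor>real n * r\<rfloor> / real n)\<rfloor> / real n"
proof -
  have fl: "0 \<le> \<lfloor>real n * r\<rfloor>" "\<lfloor>real n * r\<rfloor> \<le> int n"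
  proof -
    show "0 \<le> \<lfloor>real n * r\<rfloor>" using assms by simp
    have "real n * r \<le> real n * 1" using assms by (intro mult_left_mono) auto
    then show "\<lfloor>real n * r\<rfloor> \<le> int n" by linarith
  qed
  then have "nat \<lfloor>real n * r\<rfloor> < Suc n" by linarith
  moreover have "real (nat \<lfloor>real n * r\<rfloor>) = of_int \<lfloor>real n * r\<rfloor>" using fl by simp
  ultimately show ?thesis using assms(2) by (simp add: step_path_def samples_def del: upt_Suc)
qed

lemma step_path_cadlag:
  assumes n: "0 < n" and S: "S = {0..} \<or> S = UNIV" and f: "f \<in> cadlag_paths S {0..1}"
  shows "step_path n (samples n f) \<in> cadlag_paths S {0..1}"
proof (rule cadlag_pathsI)
  let ?g = "step_path n (samples n f)"
  have g: "?g r = of_int (samples n f ! nat \<lfloor>real n * r\<rfloor>) / real n" if "0 \<le> r" "r \<le> 1" for r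
    using that by (simp add: step_path_def)
  have "?g r \<in> S" if r: "r \<in> {0..1}" for r
  proof (cases "S = UNIV")
    case False
    then have S: "S = {0..}" using S by blast
    have "of_int \<lfloor>real n * r\<rfloor> / real n \<le> r" "0 \<le> of_int \<lfloor>real n * r\<rfloor> / real n"
      using frac_floor_bounds(1)[OF n] r by auto
    then have "0 \<le> f (of_int \<lfloor>real n * r\<rfloor> / real n)" using f r by (auto simp: cadlag_paths_def S)
    then show ?thesis using r n by (simp add: step_path_samples_eq S)
  qed simp
  then show "?g \<in> {0..1} \<rightarrow>\<^sub>E S" by (auto simp: step_path_def)
  show "(?g \<longlongrightarrow> ?g s) (at_right s)" if s: "s \<in> {0..1}" "{0..1} \<inter> {s<..} \<noteq> {}" for s
  proof (rule tendsto_eventually)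
    have "s < 1" using s by auto
    then have "\<forall>\<^sub>F r in at_right s. s < r \<and> r < 1" unfolding eventually_at_right_field by blast
    then show "\<forall>\<^sub>F r in at_right s. ?g r = ?g s" using eventually_floor_right[OF n, of s]
      by eventually_elim (use s g in auto)
  qed
  show "\<exists>l. (?g \<longlongrightarrow> l) (at_left s)" if s: "s \<in> {0..1}" "0 < s" for s
  proof (intro exI tendsto_eventually)
    have "\<forall>\<^sub>F r in at_left s. 0 < r \<and> r < s" using s unfolding eventually_at_left_field by blast
    then show "\<forall>\<^sub>F r in at_left s. ?g r = of_int (samples n f ! nat (\<lceil>real n * s\<rceil> - 1)) / real n"
      using eventually_floor_left[OF n, of s] by eventually_elim (use s g in auto)
  qed
qed

lemma step_path_close:
  assumes f: "f \<in> cadlag_paths S {0..1}" and e: "0 < e"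
  shows "\<forall>\<^sub>F n in sequentially. skorohod_close 1 (step_path n (samples n f)) f e"
proof -
  have "0 < e / 2" using e by simp
  note sampling_change_ex[OF f this]
  moreover have "\<forall>\<^sub>F n in sequentially. 1 / real n < e / 2"
    using order_tendstoD(2)[OF lim_1_over_n, of "e / 2"] e by simp
  ultimately show ?thesis using eventually_gt_at_top[of 0]
  proof eventually_elim
    case (elim n)
    then obtain l where l: "sampling_change f (e / 2) n 0 1 l" by blast
    have L: "strict_mono_on {0..1} l" "l ` {0..1} = {0..1}"
      "\<And>r. r \<in> {0..1} \<Longrightarrow> \<bar>l r - r\<bar> \<le> 1 / real n"
      "\<And>r. r \<in> {0..<1} \<Longrightarrow> \<bar>f (of_int \<lfloor>real n * r\<rfloor> / real n) - f (l r)\<bar> \<le> e / 2"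
      using l elim(3) unfolding sampling_change_def by auto
    have tc: "l \<in> time_changes 1" using L by (auto simp: time_changes_def)
    have "\<bar>l r - r\<bar> \<le> e \<and> \<bar>step_path n (samples n f) r - f (l r)\<bar> \<le> e" if r: "r \<in> {0..1}" for r
    proof
      show "\<bar>l r - r\<bar> \<le> e" using L(3)[OF r] elim(2) e by linarith
      have "\<bar>step_path n (samples n f) r - f (of_int \<lfloor>real n * r\<rfloor> / real n)\<bar> \<le> e / 2"
        using frac_floor_bounds[OF elim(3), of "f (of_int \<lfloor>real n * r\<rfloor> / real n)"] elim(2)
        unfolding step_path_samples_eq[OF elim(3) r] by linarith
      moreover have "\<bar>f (of_int \<lfloor>real n * r\<rfloor> / real n) - f (l r)\<bar> \<le> e / 2"
      proof (cases "r = 1")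
        case True
        then show ?thesis using time_changes_end[OF tc] elim(3) e by simp
      qed (use L(4)[of r] r in simp)
      ultimately show "\<bar>step_path n (samples n f) r - f (l r)\<bar> \<le> e" by linarith
    qed
    then show ?case unfolding skorohod_close_def using tc by blast
  qed
qed

lemma measurable_map_count_space:
  assumes "\<And>i. i \<in> set is \<Longrightarrow> (\<lambda>x. h i x) \<in> measurable M (count_space UNIV)"
  shows "(\<lambda>x. map (\<lambda>i. h i x) is :: int list) \<in> measurable M (count_space UNIV)"
proof -
  have "Measurable.pred M (\<lambda>x. map (\<lambda>i. h i x) is = xs)" for xs
    using assms
  proof (induction "is" arbitrary: xs)
    case (Cons i "is")
    have [measurable]: "(\<lambda>x. h i x) \<in> measurable M (count_space UNIV)" using Cons by simp
    show ?case
    proof (cases xs)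
      case (Cons y ys)
      have [measurable]: "Measurable.pred M (\<lambda>x. map (\<lambda>i. h i x) is = ys)"
        by (rule Cons.IH) (use Cons.prems in auto)
      show ?thesis unfolding Cons by simp
    qed simp
  qed simp
  then show ?thesis
    by (subst measurable_count_space_eq2_countable)
      (auto simp: vimage_def Int_def conj_commute dest: predE)
qed

definition skorohod_continuous :: "real set \<Rightarrow> ((real \<Rightarrow> real) \<Rightarrow> real) \<Rightarrow> bool" where
  "skorohod_continuous S F \<longleftrightarrow>
     (\<forall>f\<in>cadlag_paths S {0..1}. \<forall>g. (\<forall>n. g n \<in> cadlag_paths S {0..1}) \<longrightarrow>
        (\<forall>e>0. \<forall>\<^sub>F n in sequentially. skorohod_close 1 (g n) f e) \<longrightarrow> (\<lambda>n. F (g n)) \<longlonglongrightarrow> F f)"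

text \<open>\<open>F\<close> is the pointwise limit of its values on step paths. Each approximation
  factors through a countable discrete space, which makes it measurable without any regularity of
  \<open>F\<close>.\<close>

lemma skorohod_continuous_measurable:
  assumes S: "S = {0..} \<or> S = UNIV" and F: "skorohod_continuous S F"
  shows "F \<in> borel_measurable (path_space S {0..1})"
proof (rule borel_measurable_LIMSEQ_real)
  fix n
  have "samples (Suc n) \<in> measurable (path_space S {0..1}) (count_space UNIV)"
    unfolding samples_def
  proof (rule measurable_map_count_space)
    fix i assume "i \<in> set [0..<Suc (Suc n)]"
    then have "real i / real (Suc n) \<in> {0..1}" by (auto simp: divide_le_eq)
    then have [measurable]: "(\<lambda>f. f (real i / real (Suc n))) \<in> borel_measurable (path_space S {0..1})"
      by (rule measurable_coordinate)
    show "(\<lambda>f. \<lfloor>real (Suc n) * f (real i / real (Suc n))\<rfloor>) \<in> measurable (path_space S {0..1}) (count_space UNIV)"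
      by measurable
  qed
  then show "(\<lambda>f. F (step_path (Suc n) (samples (Suc n) f))) \<in> borel_measurable (path_space S {0..1})"
    by (rule measurable_compose) simp
next
  fix f assume f: "f \<in> space (path_space S {0..1})"
  have "\<forall>\<^sub>F n in sequentially. skorohod_close 1 (step_path (Suc n) (samples (Suc n) f)) f e" if "0 < e" for e
    using step_path_close[of f S e] f that
    by (subst eventually_sequentially_Suc[of "\<lambda>n. skorohod_close 1 (step_path n (samples n f)) f e"]) simp
  then show "(\<lambda>n. F (step_path (Suc n) (samples (Suc n) f))) \<longlonglongrightarrow> F f"
    using F f step_path_cadlag[OF _ S, of "Suc _" f] unfolding skorohod_continuous_def by simp
qed

lemma skorohod_dist_le:
  assumes "f \<in> cadlag_paths S {0..t}" "g \<in> cadlag_paths S {0..t}" "0 < e" "skorohod_close t f g e"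
  shows "skorohod_dist S t f g \<le> e"
proof -
  have "Inf {e. 0 < e \<and> skorohod_close t f g e} \<le> e"
    using assms by (intro cInf_lower bdd_belowI[of _ 0]) auto
  then show ?thesis using assms by (simp add: skorohod_dist_def)
qed

lemma skorohod_continuousI:
  assumes "continuous_map (skorohod_topology S 1) euclideanreal F"
  shows "skorohod_continuous S F"
  unfolding skorohod_continuous_def
proof (intro ballI allI impI)
  fix f g assume f: "f \<in> cadlag_paths S {0..1}" and g: "\<forall>n. g n \<in> cadlag_paths S {0..1}"
    and close: "\<forall>e>0. \<forall>\<^sub>F n in sequentially. skorohod_close 1 (g n) f e"
  interpret D: Metric_space "cadlag_paths S {0..1}" "skorohod_dist S 1" by (rule Metric_space_skorohod)
  have "limitin (skorohod_topology S 1) g f sequentially"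
    unfolding D.limitin_metric
  proof (intro conjI allI impI f)
    fix e :: real assume e: "0 < e"
    then have "\<forall>\<^sub>F n in sequentially. skorohod_close 1 (g n) f (e / 2)" using close by simp
    then show "\<forall>\<^sub>F n in sequentially. g n \<in> cadlag_paths S {0..1} \<and> skorohod_dist S 1 (g n) f < e"
    proof eventually_elim
      case (elim n)
      then show ?case using skorohod_dist_le[of "g n" S 1 f "e / 2"] f g e by auto
    qed
  qed
  then show "(\<lambda>n. F (g n)) \<longlonglongrightarrow> F f"
    using continuous_map_limit[OF assms] by (fastforce simp: o_def)
qed

section \<open>Weak convergence tested on Lipschitz functionals\<close>

text \<open>\<open>E k\<close> is the Lipschitz envelope of \<open>F\<close>, that is, its
  inf-convolution with \<open>k\<close> times the distance. It lies below \<open>F\<close>, is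
  Lipschitz with constant \<open>k\<close>, and converges pointwise to \<open>F\<close>; so the
  hypothesis applied to one large \<open>k\<close> bounds the integrals of \<open>F\<close> from
  below.\<close>

lemma skorohod_lower_semicontinuity:
  fixes \<mu> :: "real \<Rightarrow> (real \<Rightarrow> real) measure"
  assumes S: "S = {0..} \<or> S = UNIV"
    and Q: "prob_space Q" "sets Q = sets (path_space S {0..1})"
    and \<mu>: "\<forall>\<^sub>F \<delta> in at_right 0. prob_space (\<mu> \<delta>) \<and> sets (\<mu> \<delta>) = sets (path_space S {0..1})"
    and lip: "\<And>F C K. \<lbrakk>F \<in> borel_measurable (path_space S {0..1}); 0 \<le> K;
       \<And>f. f \<in> cadlag_paths S {0..1} \<Longrightarrow> \<bar>F f\<bar> \<le> C;
       \<And>f g e. \<lbrakk>f \<in> cadlag_paths S {0..1}; g \<in> cadlag_paths S {0..1}; 0 < e; skorohod_close 1 f g e\<rbrakk> \<Longrightarrow>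
          \<bar>F f - F g\<bar> \<le> K * e\<rbrakk> \<Longrightarrow>
       ((\<lambda>\<delta>. \<integral>f. F f \<partial>\<mu> \<delta>) \<longlongrightarrow> (\<integral>f. F f \<partial>Q)) (at_right 0)"
    and F: "continuous_map (skorohod_topology S 1) euclideanreal F"
    and C: "\<And>f. f \<in> cadlag_paths S {0..1} \<Longrightarrow> \<bar>F f\<bar> \<le> C" and \<eta>: "0 < \<eta>"
  shows "\<forall>\<^sub>F \<delta> in at_right 0. (\<integral>f. F f \<partial>Q) - \<eta> < (\<integral>f. F f \<partial>\<mu> \<delta>)"
proof -
  let ?D = "cadlag_paths S {0..1}" and ?d = "skorohod_dist S 1"
  interpret D: Metric_space ?D ?d by (rule Metric_space_skorohod)
  interpret Q: prob_space Q by fact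
  have spQ: "space Q = ?D" using sets_eq_imp_space_eq[OF Q(2)] by simp
  have ne: "?D \<noteq> {}" using Q.not_empty spQ by simp
  define E where "E k f = (INF g\<in>?D. F g + real k * ?d f g)" for k :: nat and f
  have bdd: "bdd_below ((\<lambda>g. F g + real k * ?d f g) ` ?D)" for k f
  proof (rule bdd_belowI2)
    fix g assume "g \<in> ?D"
    then show "- C \<le> F g + real k * ?d f g" using C[of g] D.nonneg[of f g] by (auto intro: add_increasing2)
  qed
  have EF: "E k f \<le> F f" if "f \<in> ?D" for k f
    unfolding E_def using cINF_lower[OF bdd that, of k f] that by simp
  have EC: "- C \<le> E k f" for k f unfolding E_def
  proof (rule cINF_greatest[OF ne])
    fix g assume "g \<in> ?D"
    then show "- C \<le> F g + real k * ?d f g" using C[of g] D.nonneg[of f g] by (auto intro: add_increasing2)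
  qed
  have EL: "E k f \<le> E k g + real k * ?d f g" if f: "f \<in> ?D" and g: "g \<in> ?D" for k f g
  proof -
    have "E k f - real k * ?d f g \<le> E k g"
      unfolding E_def[of k g]
    proof (rule cINF_greatest[OF ne])
      fix h assume h: "h \<in> ?D"
      have "E k f \<le> F h + real k * ?d f h" unfolding E_def by (rule cINF_lower[OF bdd h])
      also have "\<dots> \<le> F h + real k * (?d f g + ?d g h)"
        using D.triangle[OF f g h] by (intro add_left_mono mult_left_mono) auto
      finally show "E k f - real k * ?d f g \<le> F h + real k * ?d g h" by (simp add: algebra_simps)
    qed
    then show ?thesis by simp
  qed
  have Elip: "\<bar>E k f - E k g\<bar> \<le> real k * e"
    if "f \<in> ?D" "g \<in> ?D" "0 < e" "skorohod_close 1 f g e" for k f g e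
  proof -
    have "real k * ?d f g \<le> real k * e" using skorohod_dist_le[OF that] by (intro mult_left_mono) auto
    then show ?thesis using EL[of f g k] EL[of g f k] that D.commute[of f g] by auto
  qed
  have Emeas [measurable]: "E k \<in> borel_measurable (path_space S {0..1})" for k
  proof (rule skorohod_continuous_measurable[OF S])
    show "skorohod_continuous S (E k)"
      unfolding skorohod_continuous_def
    proof (intro ballI allI impI LIMSEQ_I)
      fix f g and r :: real assume f: "f \<in> ?D" and g: "\<forall>n. g n \<in> ?D" and r: "0 < r"
        and close: "\<forall>e>0. \<forall>\<^sub>F n in sequentially. skorohod_close 1 (g n) f e"
      define e where "e = r / (real k + 1)"
      have e: "0 < e" "real k * e < r" using r by (auto simp: e_def field_simps)
      have "\<forall>\<^sub>F n in sequentially. norm (E k (g n) - E k f) < r"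
        using close[rule_format, OF e(1)]
      proof eventually_elim
        case (elim n)
        then show ?case using Elip[of "g n" f e k] f g e by auto
      qed
      then show "\<exists>no. \<forall>n\<ge>no. norm (E k (g n) - E k f) < r" by (simp add: eventually_sequentially)
    qed
  qed
  have Fmeas [measurable]: "F \<in> borel_measurable (path_space S {0..1})"
    by (rule skorohod_continuous_measurable[OF S skorohod_continuousI[OF F]])
  have Eabs: "\<bar>E k f\<bar> \<le> C" if "f \<in> ?D" for k f using EF[OF that, of k] EC[of k f] C[OF that] by linarith
  have Econv: "(\<lambda>k. E k f) \<longlonglongrightarrow> F f" if f: "f \<in> ?D" for f
  proof (rule LIMSEQ_I)
    fix r :: real assume r: "0 < r"
    have "openin (skorohod_topology S 1) {g \<in> topspace (skorohod_topology S 1). F g \<in> {F f - r / 2<..}}"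
      by (rule openin_continuous_map_preimage[OF F]) simp
    then obtain s where s: "0 < s" "D.mball f s \<subseteq> {g \<in> ?D. F f - r / 2 < F g}"
      using f r unfolding D.openin_mtopology by auto
    have "\<forall>\<^sub>F k in sequentially. 2 * C / s \<le> real k"
      using filterlim_real_sequentially by (simp add: filterlim_at_top)
    then have "\<forall>\<^sub>F k in sequentially. norm (E k f - F f) < r"
    proof eventually_elim
      case (elim k)
      have "F f - r / 2 \<le> E k f" unfolding E_def
      proof (rule cINF_greatest[OF ne])
        fix g assume g: "g \<in> ?D"
        show "F f - r / 2 \<le> F g + real k * ?d f g"
        proof (cases "?d f g < s")
          case True
          then have "F f - r / 2 < F g" using s(2) f g by auto
          then show ?thesis using D.nonneg[of f g] by (auto intro: add_increasing2)
        next
          \<comment> \<open>Outside the ball of radius \<open>s\<close> the penalty is at least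
            \<open>2 * C\<close>, which is the most that \<open>F\<close> can vary.\<close>
          case False
          then have "2 * C \<le> real k * s" using elim s(1) by (simp add: pos_divide_le_eq)
          also have "\<dots> \<le> real k * ?d f g" using False by (intro mult_left_mono) auto
          finally show ?thesis using C[OF f] C[OF g] r by linarith
        qed
      qed
      then show ?case using EF[OF f, of k] r by (simp add: abs_if)
    qed
    then show "\<exists>no. \<forall>n\<ge>no. norm (E n f - F f) < r" by (simp add: eventually_sequentially)
  qed
  have mQ: "borel_measurable Q = borel_measurable (path_space S {0..1})"
    by (rule measurable_cong_sets[OF Q(2) refl])
  have "(\<lambda>k. \<integral>f. E k f \<partial>Q) \<longlonglongrightarrow> (\<integral>f. F f \<partial>Q)"
  proof (rule integral_dominated_convergence[where w="\<lambda>_. C"])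
    show "F \<in> borel_measurable Q" "\<And>k. E k \<in> borel_measurable Q" using Fmeas Emeas by (simp_all add: mQ)
    show "AE f in Q. (\<lambda>k. E k f) \<longlonglongrightarrow> F f" using Econv spQ by (intro AE_I2) auto
    show "\<And>k. AE f in Q. norm (E k f) \<le> C" using Eabs spQ by (intro AE_I2) auto
  qed auto
  then have "\<forall>\<^sub>F k in sequentially. (\<integral>f. F f \<partial>Q) - \<eta> / 2 < (\<integral>f. E k f \<partial>Q)"
    using \<eta> by (intro order_tendstoD) auto
  then obtain k where k: "(\<integral>f. F f \<partial>Q) - \<eta> / 2 < (\<integral>f. E k f \<partial>Q)"
    using eventually_happens by force
  have "((\<lambda>\<delta>. \<integral>f. E k f \<partial>\<mu> \<delta>) \<longlongrightarrow> (\<integral>f. E k f \<partial>Q)) (at_right 0)"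
    using Elip Eabs by (intro lip[of "E k" "real k" C]) auto
  then have "\<forall>\<^sub>F \<delta> in at_right 0. (\<integral>f. E k f \<partial>Q) - \<eta> / 2 < (\<integral>f. E k f \<partial>\<mu> \<delta>)"
    using \<eta> by (intro order_tendstoD) auto
  then show ?thesis using \<mu>
  proof eventually_elim
    case (elim \<delta>)
    interpret m: prob_space "\<mu> \<delta>" using elim by simp
    have m: "borel_measurable (\<mu> \<delta>) = borel_measurable (path_space S {0..1})"
      using elim by (intro measurable_cong_sets) auto
    have sp: "space (\<mu> \<delta>) = ?D" using sets_eq_imp_space_eq[of "\<mu> \<delta>" "path_space S {0..1}"] elim by simp
    have "(\<integral>f. E k f \<partial>\<mu> \<delta>) \<le> (\<integral>f. F f \<partial>\<mu> \<delta>)"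
    proof (rule integral_mono)
      show "integrable (\<mu> \<delta>) (E k)"
        by (rule m.integrable_const_bound[of _ C]) (use Eabs Emeas sp m in \<open>auto intro!: AE_I2\<close>)
      show "integrable (\<mu> \<delta>) F"
        by (rule m.integrable_const_bound[of _ C]) (use C Fmeas sp m in \<open>auto intro!: AE_I2\<close>)
    qed (use EF sp in auto)
    then show ?case using elim k by linarith
  qed
qed

text \<open>The lower bound is applied to \<open>F\<close> and to \<open>- F\<close>.\<close>

lemma skorohod_weak_limit:
  fixes \<mu> :: "real \<Rightarrow> (real \<Rightarrow> real) measure"
  assumes S: "S = {0..} \<or> S = UNIV"
    and Q: "prob_space Q" "sets Q = sets (path_space S {0..1})"
    and \<mu>: "\<forall>\<^sub>F \<delta> in at_right 0. prob_space (\<mu> \<delta>) \<and> sets (\<mu> \<delta>) = sets (path_space S {0..1})"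
    and lip: "\<And>F C K. \<lbrakk>F \<in> borel_measurable (path_space S {0..1}); 0 \<le> K;
       \<And>f. f \<in> cadlag_paths S {0..1} \<Longrightarrow> \<bar>F f\<bar> \<le> C;
       \<And>f g e. \<lbrakk>f \<in> cadlag_paths S {0..1}; g \<in> cadlag_paths S {0..1}; 0 < e; skorohod_close 1 f g e\<rbrakk> \<Longrightarrow>
          \<bar>F f - F g\<bar> \<le> K * e\<rbrakk> \<Longrightarrow>
       ((\<lambda>\<delta>. \<integral>f. F f \<partial>\<mu> \<delta>) \<longlongrightarrow> (\<integral>f. F f \<partial>Q)) (at_right 0)"
    and F: "continuous_map (skorohod_topology S 1) euclideanreal F"
    and bF: "bounded (F ` cadlag_paths S {0..1})"
  shows "((\<lambda>\<delta>. \<integral>f. F f \<partial>\<mu> \<delta>) \<longlongrightarrow> (\<integral>f. F f \<partial>Q)) (at_right 0)"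
proof -
  obtain C where C: "\<And>f. f \<in> cadlag_paths S {0..1} \<Longrightarrow> \<bar>F f\<bar> \<le> C"
    using bF by (auto simp: bounded_iff)
  have F': "continuous_map (skorohod_topology S 1) euclideanreal (\<lambda>f. - F f)"
    using F by (simp add: continuous_map_minus)
  have lower: "\<forall>\<^sub>F \<delta> in at_right 0. (\<integral>f. G f \<partial>Q) - \<eta> < (\<integral>f. G f \<partial>\<mu> \<delta>)"
    if "continuous_map (skorohod_topology S 1) euclideanreal G"
      "\<And>f. f \<in> cadlag_paths S {0..1} \<Longrightarrow> \<bar>G f\<bar> \<le> C" "0 < \<eta>" for G \<eta>
    by (rule skorohod_lower_semicontinuity[OF S Q \<mu> _ that]) (use lip in blast)+
  show ?thesis
  proof (rule order_tendstoI)
    fix a assume "a < (\<integral>f. F f \<partial>Q)"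
    then show "\<forall>\<^sub>F \<delta> in at_right 0. a < (\<integral>f. F f \<partial>\<mu> \<delta>)"
      using lower[OF F C, of "(\<integral>f. F f \<partial>Q) - a"] by simp
  next
    fix a assume "(\<integral>f. F f \<partial>Q) < a"
    then show "\<forall>\<^sub>F \<delta> in at_right 0. (\<integral>f. F f \<partial>\<mu> \<delta>) < a"
      using lower[OF F', of "a - (\<integral>f. F f \<partial>Q)"] C by simp
  qed
qed

section \<open>Self-similar Feller families with densities\<close>

lemma bounded_measurableI:
  "F \<in> borel_measurable M \<Longrightarrow> (\<And>x. x \<in> space M \<Longrightarrow> \<bar>F x\<bar> \<le> C) \<Longrightarrow> bounded_measurable M F"
  unfolding bounded_measurable_def bounded_iff by auto

locale self_similar_bridge =
  fixes S :: "real set" and P :: "real \<Rightarrow> (real \<Rightarrow> real) measure"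
    and \<mu> :: "real measure" and p :: "real \<Rightarrow> real \<Rightarrow> real \<Rightarrow> real" and \<gamma> c :: real
  assumes S: "S = {0..} \<or> S = UNIV"
    and \<gamma>: "\<gamma> > 0"
    and feller: "feller_family S P"
    and self_similar: "self_similar S \<gamma> P"
    and sigma_finite: "sigma_finite_measure \<mu>"
    and sets_\<mu>: "sets \<mu> = sets (restrict_space borel S)"
    and densities: "transition_densities S P \<mu> p"
    and p_continuous: "\<And>x. x \<in> S \<Longrightarrow> continuous_on ({0<..} \<times> S) (\<lambda>(s, y). p s x y)"
    and chapman_kolmogorov: "\<And>x y s t. \<lbrakk>x \<in> S; y \<in> S; 0 < s; s < t; p t x y > 0\<rbrakk>
           \<Longrightarrow> p t x y = (\<integral>z. p (t - s) x z * p s z y \<partial>\<mu>)"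
    and c: "c \<in> S"
    and p_pos: "p 1 0 c > 0"
    and last_hit_pos: "AE f in P 0. last_hit \<gamma> c f > 0"
begin

abbreviation "\<Omega> \<equiv> path_space S {0..}"
abbreviation "D \<equiv> cadlag_paths S {0..}"
abbreviation "Ft s \<equiv> coord_algebra S {0..} {0..s}"
abbreviation "bS \<equiv> restrict_space borel S :: real measure"

lemma cone_S: "cone S" using S by (auto simp: cone_def)

lemma zero_S [simp]: "0 \<in> S" using S by auto

lemma S_borel [measurable]: "S \<in> sets borel" using S by auto

lemma markovian: "markovian_family S P" using feller by (simp add: feller_family_def)

lemma prob_P: "x \<in> S \<Longrightarrow> prob_space (P x)"
  using markovian by (simp add: markovian_family_def)

lemma sets_P: "x \<in> S \<Longrightarrow> sets (P x) = sets \<Omega>"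
  using markovian by (simp add: markovian_family_def)

lemma space_P: "x \<in> S \<Longrightarrow> space (P x) = D"
  using sets_eq_imp_space_eq[OF sets_P] by simp

lemma measurable_P: "x \<in> S \<Longrightarrow> measurable (P x) N = measurable \<Omega> N"
  by (intro measurable_cong_sets sets_P refl)

lemma path_in_S: "f \<in> D \<Longrightarrow> 0 \<le> t \<Longrightarrow> f t \<in> S"
  by (auto simp: cadlag_paths_def)

lemma AE_start: "x \<in> S \<Longrightarrow> AE f in P x. f 0 = x"
proof -
  assume x: "x \<in> S"
  interpret prob_space "P x" using prob_P[OF x] .
  have "prob {f \<in> D. f 0 = x} = 1" using markovian x by (simp add: markovian_family_def)
  then have "AE f in P x. f \<in> {f \<in> D. f 0 = x}" by (rule AE_prob_1)
  then show ?thesis by eventually_elim simp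
qed

lemma coord_bS: "0 \<le> t \<Longrightarrow> t \<in> J \<Longrightarrow> (\<lambda>f. f t) \<in> measurable (coord_algebra S {0..} J) bS"
  by (intro measurable_restrict_space2 measurable_coordinate) (auto simp: cadlag_paths_def)

lemma coord_P: "x \<in> S \<Longrightarrow> 0 \<le> t \<Longrightarrow> (\<lambda>f. f t) \<in> measurable (P x) bS"
  by (simp add: measurable_P coord_bS)

lemma coord_compose: "h \<in> borel_measurable bS \<Longrightarrow> 0 \<le> t \<Longrightarrow> (\<lambda>f. h (f t)) \<in> borel_measurable \<Omega>"
  by (rule measurable_compose[OF coord_bS]) auto

lemma coord_compose_P:
  "h \<in> borel_measurable bS \<Longrightarrow> x \<in> S \<Longrightarrow> 0 \<le> t \<Longrightarrow> (\<lambda>f. h (f t)) \<in> borel_measurable (P x)"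
  by (simp add: measurable_P coord_compose)

lemma bounded_measurable_coord:
  assumes "bounded_measurable bS h" "0 \<le> t"
  shows "bounded_measurable \<Omega> (\<lambda>f. h (f t))"
proof -
  obtain B where B: "\<And>y. y \<in> S \<Longrightarrow> \<bar>h y\<bar> \<le> B"
    using assms(1) by (auto simp: bounded_measurable_def bounded_iff)
  show ?thesis
  proof (rule bounded_measurableI)
    show "(\<lambda>f. h (f t)) \<in> borel_measurable \<Omega>"
      using assms by (intro coord_compose) (simp_all add: bounded_measurable_def)
    show "\<bar>h (f t)\<bar> \<le> B" if "f \<in> space \<Omega>" for f
      using that assms(2) by (intro B path_in_S) simp_all
  qed
qed

lemma space_\<mu>: "space \<mu> = S"
  using sets_eq_imp_space_eq[OF sets_\<mu>] by simp

lemma measurable_\<mu>: "measurable \<mu> N = measurable bS N"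
  by (intro measurable_cong_sets sets_\<mu> refl)

lemma integral_measurable:
  "bounded_measurable \<Omega> F \<Longrightarrow> (\<lambda>x. \<integral>f. F f \<partial>P x) \<in> borel_measurable bS"
  using markovian by (simp add: markovian_family_def)

lemma markov:
  "x \<in> S \<Longrightarrow> 0 \<le> s \<Longrightarrow> bounded_measurable (Ft s) F \<Longrightarrow> bounded_measurable \<Omega> G \<Longrightarrow>
    (\<integral>f. F f * G (path_shift s f) \<partial>P x) = (\<integral>f. F f * (\<integral>g. G g \<partial>P (f s)) \<partial>P x)"
  using markovian by (simp add: markovian_family_def)

lemma scaling: "x \<in> S \<Longrightarrow> 0 < v \<Longrightarrow> distr (P x) \<Omega> (path_scaling \<gamma> v) = P (v powr (1 / \<gamma>) * x)"
  using self_similar by (simp add: self_similar_def)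

lemma integral_scaling:
  fixes F :: "(real \<Rightarrow> real) \<Rightarrow> real"
  assumes "0 < v" "F \<in> borel_measurable \<Omega>"
  shows "(\<integral>f. F (path_scaling \<gamma> v f) \<partial>P 0) = (\<integral>f. F f \<partial>P 0)"
proof -
  have "path_scaling \<gamma> v \<in> measurable (P 0) \<Omega>"
    using measurable_path_scaling[OF assms(1) cone_S] by (simp add: measurable_P)
  from integral_distr[OF this assms(2)]
  have "(\<integral>f. F f \<partial>distr (P 0) \<Omega> (path_scaling \<gamma> v)) = (\<integral>f. F (path_scaling \<gamma> v f) \<partial>P 0)" .
  then show ?thesis using scaling[OF zero_S assms(1)] by simp
qed

lemma p_nonneg: "x \<in> S \<Longrightarrow> y \<in> S \<Longrightarrow> 0 < s \<Longrightarrow> 0 \<le> p s x y"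
  using densities by (simp add: transition_densities_def)

lemma integral_density_p:
  "x \<in> S \<Longrightarrow> 0 < s \<Longrightarrow> bounded_measurable bS h \<Longrightarrow> (\<integral>f. h (f s) \<partial>P x) = (\<integral>y. h y * p s x y \<partial>\<mu>)"
  using densities by (simp add: transition_densities_def transition_semigroup_def)

lemma p_continuous_y: "x \<in> S \<Longrightarrow> 0 < s \<Longrightarrow> continuous_on S (p s x)"
proof -
  assume x: "x \<in> S" and s: "0 < s"
  have "continuous_on S (\<lambda>y. (\<lambda>(s, y). p s x y) (s, y))"
    by (rule continuous_on_compose2[OF p_continuous[OF x]]) (use s in \<open>auto intro!: continuous_intros\<close>)
  then show ?thesis by simp
qed

lemma p_measurable: "x \<in> S \<Longrightarrow> 0 < s \<Longrightarrow> p s x \<in> borel_measurable bS"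
  by (rule borel_measurable_continuous_on_restrict[OF p_continuous_y])

lemma p_integral_1: "x \<in> S \<Longrightarrow> 0 < s \<Longrightarrow> (\<integral>y. p s x y \<partial>\<mu>) = 1"
proof -
  assume x: "x \<in> S" and s: "0 < s"
  interpret prob_space "P x" using prob_P[OF x] .
  have "bounded_measurable bS (\<lambda>_. 1 :: real)" by (rule bounded_measurableI[of _ _ 1]) auto
  from integral_density_p[OF x s this] show ?thesis by (simp add: prob_space)
qed

lemma p_integrable: "x \<in> S \<Longrightarrow> 0 < s \<Longrightarrow> integrable \<mu> (p s x)"
  using p_integral_1 not_integrable_integral_eq by fastforce

lemma law_density:
  assumes x: "x \<in> S" and s: "0 < s"
  shows "distr (P x) bS (\<lambda>f. f s) = density \<mu> (\<lambda>y. ennreal (p s x y))"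
proof (rule measure_eqI)
  interpret prob_space "P x" using prob_P[OF x] .
  show "sets (distr (P x) bS (\<lambda>f. f s)) = sets (density \<mu> (\<lambda>y. ennreal (p s x y)))"
    by (simp add: sets_\<mu>)
  fix A assume "A \<in> sets (distr (P x) bS (\<lambda>f. f s))"
  then have A: "A \<in> sets bS" by simp
  then have AS: "A \<subseteq> S" using sets.sets_into_space[of A bS] by simp
  have coord: "(\<lambda>f. f s) \<in> measurable (P x) bS" using s by (intro coord_P[OF x]) simp
  have bm: "bounded_measurable bS (indicator A :: real \<Rightarrow> real)"
    using A by (intro bounded_measurableI[of _ _ 1]) (auto simp: indicator_def)
  have int: "integrable \<mu> (\<lambda>y. indicator A y * p s x y)"
    using integrable_mult_indicator[OF _ p_integrable[OF x s], of A] A sets_\<mu> by simp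
  have "emeasure (distr (P x) bS (\<lambda>f. f s)) A = emeasure (P x) ((\<lambda>f. f s) -` A \<inter> space (P x))"
    by (rule emeasure_distr[OF coord A])
  also have "\<dots> = ennreal (\<integral>f. indicator ((\<lambda>f. f s) -` A \<inter> space (P x)) f \<partial>P x)"
    using measurable_sets[OF coord A] by (simp add: emeasure_eq_measure)
  also have "(\<integral>f. indicator ((\<lambda>f. f s) -` A \<inter> space (P x)) f \<partial>P x) = (\<integral>f. indicator A (f s) \<partial>P x)"
    by (intro Bochner_Integration.integral_cong) (auto simp: indicator_def)
  also have "\<dots> = (\<integral>y. indicator A y * p s x y \<partial>\<mu>)" by (rule integral_density_p[OF x s bm])
  also have "ennreal \<dots> = (\<integral>\<^sup>+y. ennreal (indicator A y * p s x y) \<partial>\<mu>)"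
    using int p_nonneg[OF x _ s] space_\<mu> by (intro nn_integral_eq_integral[symmetric]) auto
  also have "\<dots> = (\<integral>\<^sup>+y. ennreal (p s x y) * indicator A y \<partial>\<mu>)"
    by (intro nn_integral_cong) (auto simp: indicator_def)
  also have "\<dots> = emeasure (density \<mu> (\<lambda>y. ennreal (p s x y))) A"
    using p_measurable[OF x s] A by (intro emeasure_density[symmetric]) (auto simp: measurable_\<mu> sets_\<mu>)
  finally show "emeasure (distr (P x) bS (\<lambda>f. f s)) A = emeasure (density \<mu> (\<lambda>y. ennreal (p s x y))) A" .
qed

text \<open>The defining property of the densities covers only bounded functions. The conditioning
  weight \<open>p (1 - s) z c\<close>, as a function of \<open>z\<close>, may be unbounded, and its
  integrability is part of what is needed.\<close>

lemma integral_coord_unbounded: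
  assumes x: "x \<in> S" and s: "0 < s" and \<phi>: "\<phi> \<in> borel_measurable bS"
  shows "(\<integral>f. \<phi> (f s) \<partial>P x) = (\<integral>y. p s x y * \<phi> y \<partial>\<mu>)"
    and "integrable (P x) (\<lambda>f. \<phi> (f s)) \<longleftrightarrow> integrable \<mu> (\<lambda>y. p s x y * \<phi> y)"
proof -
  have coord: "(\<lambda>f. f s) \<in> measurable (P x) bS" using s by (intro coord_P[OF x]) simp
  have nn: "AE y in \<mu>. 0 \<le> p s x y" using p_nonneg[OF x _ s] space_\<mu> by (intro AE_I2) auto
  have pm: "p s x \<in> borel_measurable \<mu>" "\<phi> \<in> borel_measurable \<mu>"
    using p_measurable[OF x s] \<phi> by (simp_all add: measurable_\<mu>)
  have "(\<integral>f. \<phi> (f s) \<partial>P x) = (\<integral>y. \<phi> y \<partial>density \<mu> (\<lambda>y. ennreal (p s x y)))"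
    unfolding law_density[OF x s, symmetric] by (rule integral_distr[OF coord \<phi>, symmetric])
  then show "(\<integral>f. \<phi> (f s) \<partial>P x) = (\<integral>y. p s x y * \<phi> y \<partial>\<mu>)"
    using integral_real_density[OF pm(1) nn pm(2)] by simp
  have "integrable (P x) (\<lambda>f. \<phi> (f s)) \<longleftrightarrow> integrable (density \<mu> (\<lambda>y. ennreal (p s x y))) \<phi>"
    unfolding law_density[OF x s, symmetric] by (rule integrable_distr_eq[OF coord \<phi>, symmetric])
  then show "integrable (P x) (\<lambda>f. \<phi> (f s)) \<longleftrightarrow> integrable \<mu> (\<lambda>y. p s x y * \<phi> y)"
    using integrable_real_density[OF pm(1) nn pm(2)] by simp
qed

section \<open>Conditioning on an endpoint near \<open>c\<close>\<close>

text \<open>General weights instead of indicators of balls are needed because the Markov property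
  multiplies the indicator by the conditional probability of a future event; the product is again a
  localizer.\<close>

definition localizer :: "real \<Rightarrow> (real \<Rightarrow> real) \<Rightarrow> bool" where
  "localizer \<delta> h \<longleftrightarrow> h \<in> borel_measurable bS \<and> (\<forall>y\<in>S. 0 \<le> h y \<and> h y \<le> 1 \<and> (\<delta> \<le> \<bar>y - c\<bar> \<longrightarrow> h y = 0))"

lemma localizer_bounded: "localizer \<delta> h \<Longrightarrow> bounded_measurable bS h"
  by (rule bounded_measurableI[of _ _ 1]) (auto simp: localizer_def)

lemma localizer_indicator:
  "B \<in> sets borel \<Longrightarrow> B \<inter> S \<subseteq> ball c \<delta> \<Longrightarrow> localizer \<delta> (indicator B)"
  by (force simp: localizer_def indicator_def dist_real_def abs_minus_commute
      intro!: borel_measurable_indicator' measurable_restrict_space1)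

text \<open>\<open>L\<close> is the value at \<open>c\<close> of the continuous version of \<open>y \<mapsto> E(G | X\<^sub>1 = y)\<close>.\<close>

definition pinned_limit :: "((real \<Rightarrow> real) \<Rightarrow> real) \<Rightarrow> real \<Rightarrow> bool" where
  "pinned_limit G L \<longleftrightarrow> (\<forall>\<epsilon>>0. \<exists>\<delta>>0. \<forall>h. localizer \<delta> h \<longrightarrow>
     \<bar>(\<integral>f. G f * h (f 1) \<partial>P 0) - L * (\<integral>f. h (f 1) \<partial>P 0)\<bar> \<le> \<epsilon> * (\<integral>f. h (f 1) \<partial>P 0))"

lemma p_near_c: "0 < e \<Longrightarrow> x \<in> S \<Longrightarrow> 0 < s \<Longrightarrow> \<exists>d>0. \<forall>y\<in>S. \<bar>y - c\<bar> < d \<longrightarrow> \<bar>p s x y - p s x c\<bar> < e"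
  using p_continuous_y[of x s] c unfolding continuous_on_iff by (auto simp: dist_real_def)

text \<open>Near \<open>c\<close> the density \<open>p 1 0\<close> is at least half of its positive
  value at \<open>c\<close>, while its total integral is 1.\<close>

lemma \<mu>_locally_finite: "\<exists>r>0. emeasure \<mu> (ball c r \<inter> S) < \<infinity>"
proof -
  obtain d where d: "0 < d" "\<And>y. y \<in> S \<Longrightarrow> \<bar>y - c\<bar> < d \<Longrightarrow> \<bar>p 1 0 y - p 1 0 c\<bar> < p 1 0 c / 2"
    using p_near_c[of "p 1 0 c / 2" 0 1] p_pos by auto
  have B: "ball c d \<inter> S \<in> sets \<mu>" unfolding sets_\<mu> by (auto simp: sets_restrict_space)
  have "ennreal (p 1 0 c / 2) * emeasure \<mu> (ball c d \<inter> S) = (\<integral>\<^sup>+y. ennreal (p 1 0 c / 2) * indicator (ball c d \<inter> S) y \<partial>\<mu>)"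
    using B by (rule nn_integral_cmult_indicator[symmetric])
  also have "\<dots> \<le> (\<integral>\<^sup>+y. ennreal (p 1 0 y) \<partial>\<mu>)"
  proof (rule nn_integral_mono)
    fix y assume "y \<in> space \<mu>"
    then have y: "y \<in> S" by (simp add: space_\<mu>)
    show "ennreal (p 1 0 c / 2) * indicator (ball c d \<inter> S) y \<le> ennreal (p 1 0 y)"
    proof (cases "y \<in> ball c d")
      case True
      then have "\<bar>p 1 0 y - p 1 0 c\<bar> < p 1 0 c / 2" using d(2)[OF y] by (simp add: dist_real_def abs_minus_commute)
      then have "p 1 0 c / 2 \<le> p 1 0 y" by (auto simp: abs_if split: if_splits)
      then show ?thesis using True y by (simp add: ennreal_leI)
    qed simp
  qed
  also have "\<dots> = ennreal (\<integral>y. p 1 0 y \<partial>\<mu>)"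
    using p_nonneg[of 0 _ 1] space_\<mu> by (intro nn_integral_eq_integral p_integrable) auto
  also have "\<dots> < \<infinity>" by simp
  finally have "emeasure \<mu> (ball c d \<inter> S) < \<infinity>"
    using p_pos by (auto simp: ennreal_mult_less_top top_unique less_top)
  then show ?thesis using d by blast
qed

text \<open>Local finiteness of \<open>\<mu>\<close> makes \<open>h\<close> itself integrable, so
  that the continuous density can be replaced by its value at \<open>c\<close> with an error
  relative to the mass of \<open>h\<close>.\<close>

lemma localizer_average:
  assumes h: "localizer d h" and r: "emeasure \<mu> (ball c d \<inter> S) < \<infinity>" and x: "x \<in> S" "0 < s"
    and e: "\<And>y. y \<in> S \<Longrightarrow> \<bar>y - c\<bar> < d \<Longrightarrow> \<bar>p s x y - p s x c\<bar> \<le> e"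
  shows "\<bar>(\<integral>y. h y * p s x y \<partial>\<mu>) - p s x c * (\<integral>y. h y \<partial>\<mu>)\<bar> \<le> e * (\<integral>y. h y \<partial>\<mu>)"
proof -
  have hm: "h \<in> borel_measurable \<mu>" using h by (simp add: localizer_def measurable_\<mu>)
  have B: "ball c d \<inter> S \<in> sets \<mu>" unfolding sets_\<mu> by (auto simp: sets_restrict_space)
  have ih: "integrable \<mu> h"
  proof (rule Bochner_Integration.integrable_bound)
    show "integrable \<mu> (indicator (ball c d \<inter> S) :: real \<Rightarrow> real)" using B r by simp
    show "AE y in \<mu>. norm (h y) \<le> norm (indicator (ball c d \<inter> S) y :: real)"
    proof (rule AE_I2)
      fix y assume "y \<in> space \<mu>"
      then have "y \<in> S" by (simp add: space_\<mu>)
      then show "norm (h y) \<le> norm (indicator (ball c d \<inter> S) y :: real)"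
        using h by (cases "d \<le> \<bar>y - c\<bar>") (auto simp: localizer_def indicator_def dist_real_def abs_minus_commute)
    qed
  qed (rule hm)
  have ihp: "integrable \<mu> (\<lambda>y. h y * p s x y)"
  proof (rule Bochner_Integration.integrable_bound[OF p_integrable[OF x]])
    show "AE y in \<mu>. norm (h y * p s x y) \<le> norm (p s x y)"
    proof (rule AE_I2)
      fix y assume "y \<in> space \<mu>"
      then have "\<bar>h y\<bar> \<le> 1" using h by (auto simp: localizer_def space_\<mu>)
      then show "norm (h y * p s x y) \<le> norm (p s x y)"
        using mult_right_mono[of "\<bar>h y\<bar>" 1 "\<bar>p s x y\<bar>"] by (simp add: abs_mult)
    qed
  qed (use hm p_measurable[OF x] in \<open>simp add: measurable_\<mu>\<close>)
  have "(\<integral>y. h y * p s x y \<partial>\<mu>) - p s x c * (\<integral>y. h y \<partial>\<mu>) = (\<integral>y. h y * p s x y - p s x c * h y \<partial>\<mu>)"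
    using ih ihp by simp
  also have "\<bar>\<dots>\<bar> \<le> (\<integral>y. \<bar>h y * p s x y - p s x c * h y\<bar> \<partial>\<mu>)" by (rule integral_abs_bound)
  also have "\<dots> \<le> (\<integral>y. e * h y \<partial>\<mu>)"
  proof (rule integral_mono)
    fix y assume "y \<in> space \<mu>"
    then have y: "y \<in> S" by (simp add: space_\<mu>)
    show "\<bar>h y * p s x y - p s x c * h y\<bar> \<le> e * h y"
    proof (cases "d \<le> \<bar>y - c\<bar>")
      case False
      have "\<bar>h y * p s x y - p s x c * h y\<bar> = \<bar>p s x y - p s x c\<bar> * h y"
      proof -
        have "h y * p s x y - p s x c * h y = (p s x y - p s x c) * h y" by (simp add: algebra_simps)
        then show ?thesis using h y by (simp add: localizer_def abs_mult)
      qed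
      then show ?thesis using e[OF y] False h y by (simp add: localizer_def mult_right_mono)
    qed (use h y in \<open>auto simp: localizer_def\<close>)
  qed (use ih ihp in auto)
  finally show ?thesis by simp
qed

lemma markov_endpoint:
  assumes G: "G \<in> borel_measurable (Ft s)" "\<And>f. f \<in> D \<Longrightarrow> \<bar>G f\<bar> \<le> C" and s: "0 < s" "s < 1"
    and h: "bounded_measurable bS h"
  shows "(\<integral>f. G f * h (f 1) \<partial>P 0) = (\<integral>f. G f * (\<integral>y. h y * p (1 - s) (f s) y \<partial>\<mu>) \<partial>P 0)"
proof -
  have hb: "bounded_measurable \<Omega> (\<lambda>f. h (f (1 - s)))"
    using h s by (intro bounded_measurable_coord) auto
  have Gb: "bounded_measurable (Ft s) G" by (rule bounded_measurableI) (use G in auto)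
  have "(\<integral>f. G f * h (f 1) \<partial>P 0) = (\<integral>f. G f * h (path_shift s f (1 - s)) \<partial>P 0)"
    using s by (simp add: path_shift_def)
  also have "\<dots> = (\<integral>f. G f * (\<integral>g. h (g (1 - s)) \<partial>P (f s)) \<partial>P 0)"
    by (rule markov[OF zero_S _ Gb hb]) (use s in simp)
  also have "\<dots> = (\<integral>f. G f * (\<integral>y. h y * p (1 - s) (f s) y \<partial>\<mu>) \<partial>P 0)"
    using s by (intro Bochner_Integration.integral_cong refl) (simp add: space_P path_in_S integral_density_p[OF _ _ h])
  finally show ?thesis .
qed

text \<open>Divided by their masses, localizers act as an approximate identity at \<open>c\<close>.
  The kernels \<open>k n\<close> then converge pointwise to \<open>q\<close>, and Chapman-Kolmogorov
  identifies the limit of their expectations at time \<open>s\<close> as the expectation of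
  \<open>q\<close>; Scheffe's lemma upgrades this to convergence in mean, which survives
  multiplication by the bounded \<open>G\<close>.\<close>

lemma pinned_limit_exists:
  assumes G: "G \<in> borel_measurable (Ft s)" "\<And>f. f \<in> D \<Longrightarrow> \<bar>G f\<bar> \<le> C" and s: "0 < s" "s < 1"
  shows "\<exists>L. pinned_limit G L"
proof -
  interpret P0: prob_space "P 0" by (rule prob_P) simp
  define q where "q z = p (1 - s) z c" for z
  \<comment> \<open>This is the Doob transform: before time \<open>s\<close> the bridge to
    \<open>c\<close> has density \<open>q (f s) / p 1 0 c\<close> with respect to
    \<open>P 0\<close>.\<close>
  define L where "L = (\<integral>f. G f * q (f s) \<partial>P 0) / p 1 0 c"
  have GP: "G \<in> borel_measurable (P 0)"
    using measurable_coord_algebra_mono[OF G(1), of "{0..}"] by (simp add: measurable_P)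
  have "pinned_limit G L"
  \<comment> \<open>Scheffe's lemma concerns sequences. A failure of the claim supplies one:
    localizers shrinking to \<open>c\<close> that all violate the bound with the same
    \<open>\<epsilon>\<close>.\<close>
  proof (rule ccontr)
    assume "\<not> pinned_limit G L"
    then obtain \<epsilon> where \<epsilon>: "\<epsilon> > 0" and bad: "\<And>\<delta>. \<delta> > 0 \<Longrightarrow> \<exists>h. localizer \<delta> h \<and>
        \<bar>(\<integral>f. G f * h (f 1) \<partial>P 0) - L * (\<integral>f. h (f 1) \<partial>P 0)\<bar> > \<epsilon> * (\<integral>f. h (f 1) \<partial>P 0)"
      unfolding pinned_limit_def by (meson not_le)
    obtain r where r: "r > 0" "emeasure \<mu> (ball c r \<inter> S) < \<infinity>" using \<mu>_locally_finite by blast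
    define d where "d n = min r (1 / real (Suc n))" for n
    have d: "0 < d n" "d n \<le> r" for n using r by (auto simp: d_def)
    have d0: "d \<longlonglongrightarrow> 0"
    proof (rule tendsto_sandwich[OF _ _ tendsto_const LIMSEQ_Suc[OF lim_1_over_n]])
      show "\<forall>\<^sub>F n in sequentially. 0 \<le> d n" using d by (intro always_eventually allI less_imp_le)
      show "\<forall>\<^sub>F n in sequentially. d n \<le> 1 / real (Suc n)" by (intro always_eventually allI) (simp add: d_def)
    qed
    have dfin: "emeasure \<mu> (ball c (d n) \<inter> S) < \<infinity>" for n
    proof -
      have "ball c r \<inter> S \<in> sets \<mu>" unfolding sets_\<mu> by (auto simp: sets_restrict_space)
      then have "emeasure \<mu> (ball c (d n) \<inter> S) \<le> emeasure \<mu> (ball c r \<inter> S)"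
        using d(2)[of n] by (intro emeasure_mono) auto
      then show ?thesis using r(2) by (rule le_less_trans)
    qed
    have "\<forall>n. \<exists>h. localizer (d n) h \<and>
        \<bar>(\<integral>f. G f * h (f 1) \<partial>P 0) - L * (\<integral>f. h (f 1) \<partial>P 0)\<bar> > \<epsilon> * (\<integral>f. h (f 1) \<partial>P 0)"
      using bad[OF d(1)] by blast
    from choice[OF this] obtain h where hh: "\<forall>n. localizer (d n) (h n) \<and>
        \<bar>(\<integral>f. G f * h n (f 1) \<partial>P 0) - L * (\<integral>f. h n (f 1) \<partial>P 0)\<bar> > \<epsilon> * (\<integral>f. h n (f 1) \<partial>P 0)" ..
    have h: "localizer (d n) (h n)" for n using hh by blast
    have viol: "\<bar>(\<integral>f. G f * h n (f 1) \<partial>P 0) - L * (\<integral>f. h n (f 1) \<partial>P 0)\<bar> > \<epsilon> * (\<integral>f. h n (f 1) \<partial>P 0)" for n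
      using hh by blast
    have hb: "bounded_measurable bS (h n)" for n by (rule localizer_bounded[OF h])
    have hnn: "0 \<le> h n y" "h n y \<le> 1" if "y \<in> S" for n y using h[of n] that by (auto simp: localizer_def)
    define a where "a n = (\<integral>y. h n y \<partial>\<mu>)" for n
    define e where "e n = (\<integral>f. h n (f 1) \<partial>P 0)" for n
    have e_eq: "e n = (\<integral>y. h n y * p 1 0 y \<partial>\<mu>)" for n
      unfolding e_def by (rule integral_density_p[OF _ _ hb]) auto
    have avg: "\<exists>d'>0. \<forall>n. d n \<le> d' \<longrightarrow> \<bar>(\<integral>y. h n y * p t x y \<partial>\<mu>) - p t x c * a n\<bar> \<le> \<eta> * a n"
      if x: "x \<in> S" "0 < t" and \<eta>: "0 < \<eta>" for x t \<eta>
    proof -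
      obtain d' where d': "d' > 0" "\<And>y. y \<in> S \<Longrightarrow> \<bar>y - c\<bar> < d' \<Longrightarrow> \<bar>p t x y - p t x c\<bar> < \<eta>"
        using p_near_c[OF \<eta> x] by blast
      show ?thesis unfolding a_def
        using d' by (intro exI[of _ d'] conjI allI impI localizer_average[OF h dfin x]) (auto intro: less_imp_le)
    qed
    have hm: "(\<lambda>f. h n (f 1)) \<in> borel_measurable (P 0)" for n
      using hb[of n] by (intro coord_compose_P) (auto simp: bounded_measurable_def)
    have hint: "integrable (P 0) (\<lambda>f. h n (f 1))" for n
      by (rule P0.integrable_const_bound[of _ 1])
        (use hm hnn in \<open>auto intro!: AE_I2 simp: space_P path_in_S\<close>)
    \<comment> \<open>If the mass \<open>a n\<close> vanished, then so would \<open>e n\<close>, and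
      with it both sides of the strict inequality that \<open>h n\<close> is supposed to
      satisfy.\<close>
    have a_pos: "0 < a n" if n: "d n \<le> d1" and d1: "\<And>n. d n \<le> d1 \<Longrightarrow>
        \<bar>(\<integral>y. h n y * p 1 0 y \<partial>\<mu>) - p 1 0 c * a n\<bar> \<le> 1 * a n" for n d1
    proof (rule ccontr)
      assume "\<not> 0 < a n"
      moreover have "0 \<le> a n" unfolding a_def using hnn space_\<mu> by (intro Bochner_Integration.integral_nonneg) auto
      ultimately have "a n = 0" by simp
      then have e0: "e n = 0" using d1[OF n] by (simp add: e_eq)
      have "\<bar>\<integral>f. G f * h n (f 1) \<partial>P 0\<bar> \<le> (\<integral>f. \<bar>G f * h n (f 1)\<bar> \<partial>P 0)" by (rule integral_abs_bound)
      also have "\<dots> \<le> (\<integral>f. C * h n (f 1) \<partial>P 0)"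
      proof (rule integral_mono_AE)
        show "integrable (P 0) (\<lambda>f. \<bar>G f * h n (f 1)\<bar>)"
        proof (rule P0.integrable_const_bound[of _ C])
          show "AE f in P 0. norm \<bar>G f * h n (f 1)\<bar> \<le> C"
          proof (rule AE_I2)
            fix f assume "f \<in> space (P 0)"
            then have "f \<in> D" "\<bar>G f\<bar> \<le> C" "f 1 \<in> S" using G(2) by (auto simp: space_P path_in_S)
            then show "norm \<bar>G f * h n (f 1)\<bar> \<le> C"
              using mult_mono[of "\<bar>G f\<bar>" C "\<bar>h n (f 1)\<bar>" 1] hnn by (simp add: abs_mult)
          qed
        qed (use GP hm in auto)
        show "AE f in P 0. \<bar>G f * h n (f 1)\<bar> \<le> C * h n (f 1)"
        proof (rule AE_I2)
          fix f assume "f \<in> space (P 0)"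
          then have "\<bar>G f\<bar> \<le> C" "f 1 \<in> S" using G(2) by (auto simp: space_P path_in_S)
          then show "\<bar>G f * h n (f 1)\<bar> \<le> C * h n (f 1)" using hnn by (simp add: abs_mult mult_right_mono)
        qed
      qed (use hint in auto)
      also have "\<dots> = 0" using e0 by (simp add: e_def)
      finally show False using viol[of n] e0 by (simp add: e_def)
    qed
    obtain d1 where d1: "d1 > 0" "\<And>n. d n \<le> d1 \<Longrightarrow> \<bar>(\<integral>y. h n y * p 1 0 y \<partial>\<mu>) - p 1 0 c * a n\<bar> \<le> 1 * a n"
      using avg[of 0 1 1] by auto
    have evd: "\<forall>\<^sub>F n in sequentially. d n \<le> d'" if "0 < d'" for d'
      using order_tendstoD(2)[OF d0 that] by (auto elim: eventually_mono)
    have eva: "\<forall>\<^sub>F n in sequentially. 0 < a n"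
      using evd[OF d1(1)] by eventually_elim (use a_pos d1(2) in blast)
    have lim: "(\<lambda>n. (\<integral>y. h n y * p t x y \<partial>\<mu>) / a n) \<longlonglongrightarrow> p t x c" if x: "x \<in> S" "0 < t" for x t
    proof (rule LIMSEQ_I)
      fix \<eta> :: real assume \<eta>: "0 < \<eta>"
      then obtain d' where d': "d' > 0" "\<And>n. d n \<le> d' \<Longrightarrow> \<bar>(\<integral>y. h n y * p t x y \<partial>\<mu>) - p t x c * a n\<bar> \<le> \<eta> / 2 * a n"
        using avg[OF x, of "\<eta> / 2"] by auto
      have "\<forall>\<^sub>F n in sequentially. norm ((\<integral>y. h n y * p t x y \<partial>\<mu>) / a n - p t x c) < \<eta>"
        using evd[OF d'(1)] eva
      proof eventually_elim
        case (elim n)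
        have "(\<integral>y. h n y * p t x y \<partial>\<mu>) / a n - p t x c = ((\<integral>y. h n y * p t x y \<partial>\<mu>) - p t x c * a n) / a n"
          using elim(2) by (simp add: diff_divide_distrib)
        then have "norm ((\<integral>y. h n y * p t x y \<partial>\<mu>) / a n - p t x c) = \<bar>(\<integral>y. h n y * p t x y \<partial>\<mu>) - p t x c * a n\<bar> / a n"
          using elim(2) by simp
        also have "\<dots> \<le> \<eta> / 2" using d'(2)[OF elim(1)] elim(2) by (simp add: pos_divide_le_eq)
        finally show ?case using \<eta> by linarith
      qed
      then show "\<exists>no. \<forall>n\<ge>no. norm ((\<integral>y. h n y * p t x y \<partial>\<mu>) / a n - p t x c) < \<eta>"
        by (simp add: eventually_sequentially)
    qed
    define k where "k n z = (\<integral>y. h n y * p (1 - s) z y \<partial>\<mu>) / a n" for n z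
    have klim: "(\<lambda>n. k n z) \<longlonglongrightarrow> q z" if "z \<in> S" for z
      using lim[OF that, of "1 - s"] s by (simp add: k_def q_def)
    have km: "k n \<in> borel_measurable bS" for n
    proof -
      have "(\<lambda>z. \<integral>f. h n (f (1 - s)) \<partial>P z) \<in> borel_measurable bS"
        using hb[of n] s by (intro integral_measurable bounded_measurable_coord) auto
      then have "(\<lambda>z. \<integral>y. h n y * p (1 - s) z y \<partial>\<mu>) \<in> borel_measurable bS"
        using s by (subst measurable_cong[of _ _ "\<lambda>z. \<integral>f. h n (f (1 - s)) \<partial>P z"])
          (auto simp: integral_density_p[OF _ _ hb])
      then show ?thesis unfolding k_def by (rule borel_measurable_divide) simp
    qed
    have knn: "0 \<le> k n z" if "z \<in> S" for n z unfolding k_def a_def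
      using hnn p_nonneg[OF that] s space_\<mu> by (intro divide_nonneg_nonneg Bochner_Integration.integral_nonneg) auto
    have qm: "q \<in> borel_measurable bS"
      by (rule borel_measurable_LIMSEQ_real[OF _ km]) (use klim in simp)
    have qnn: "0 \<le> q z" if "z \<in> S" for z using p_nonneg[OF that c] s by (simp add: q_def)
    \<comment> \<open>Only this instance at the single endpoint \<open>c\<close> ensures that no
      mass is lost in the limit, which pointwise convergence of the kernels would not
      exclude.\<close>
    have CK: "p 1 0 c = (\<integral>z. p s 0 z * q z \<partial>\<mu>)"
      using chapman_kolmogorov[of 0 c "1 - s" 1] c p_pos s by (simp add: q_def)
    then have qs: "(\<integral>f. q (f s) \<partial>P 0) = p 1 0 c"
      using integral_coord_unbounded(1)[OF zero_S s(1) qm] by simp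
    have qint: "integrable (P 0) (\<lambda>f. q (f s))"
      using qs p_pos not_integrable_integral_eq by fastforce
    have ks: "(\<integral>f. k n (f s) \<partial>P 0) = e n / a n" for n
    proof -
      have "(\<integral>f. 1 * h n (f 1) \<partial>P 0) = (\<integral>f. 1 * (\<integral>y. h n y * p (1 - s) (f s) y \<partial>\<mu>) \<partial>P 0)"
        by (rule markov_endpoint[where C=1, OF _ _ s hb]) auto
      then show ?thesis by (simp add: k_def e_def)
    qed
    have kcoord: "(\<lambda>f. k n (f s)) \<in> borel_measurable (P 0)" for n
      using s by (intro coord_compose_P km) auto
    have kint: "integrable (P 0) (\<lambda>f. k n (f s))" for n
    proof -
      have "integrable (P 0) (\<lambda>f. \<integral>y. h n y * p (1 - s) (f s) y \<partial>\<mu>)"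
      proof (rule P0.integrable_const_bound[of _ 1])
        show "(\<lambda>f. \<integral>y. h n y * p (1 - s) (f s) y \<partial>\<mu>) \<in> borel_measurable (P 0)"
        proof (rule measurable_cong[THEN iffD1])
          show "(\<lambda>f. \<integral>g. h n (g (1 - s)) \<partial>P (f s)) \<in> borel_measurable (P 0)"
          proof (rule measurable_compose[OF coord_P[of 0 s]])
            show "(\<lambda>z. \<integral>f. h n (f (1 - s)) \<partial>P z) \<in> borel_measurable bS"
              using hb[of n] s by (intro integral_measurable bounded_measurable_coord) auto
          qed (use s in auto)
        qed (use s in \<open>simp add: integral_density_p[OF _ _ hb] space_P path_in_S\<close>)
        show "AE f in P 0. norm (\<integral>y. h n y * p (1 - s) (f s) y \<partial>\<mu>) \<le> 1"
        proof (rule AE_I2)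
          fix f assume "f \<in> space (P 0)"
          then have z: "f s \<in> S" using s by (auto simp: space_P path_in_S)
          have "norm (\<integral>y. h n y * p (1 - s) (f s) y \<partial>\<mu>) \<le> (\<integral>y. p (1 - s) (f s) y \<partial>\<mu>)"
          proof (rule Bochner_Integration.integral_norm_bound_integral)
            show "integrable \<mu> (p (1 - s) (f s))" using p_integrable[OF z] s by simp
            show "norm (h n y * p (1 - s) (f s) y) \<le> p (1 - s) (f s) y" if "y \<in> space \<mu>" for y
              using that hnn[of y n] p_nonneg[OF z, of y "1 - s"] s mult_right_mono[of "h n y" 1 "p (1 - s) (f s) y"]
              by (simp add: space_\<mu> abs_mult)
            show "integrable \<mu> (\<lambda>y. h n y * p (1 - s) (f s) y)"
            proof (rule Bochner_Integration.integrable_bound[OF p_integrable[OF z, of "1 - s"]])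
              show "(\<lambda>y. h n y * p (1 - s) (f s) y) \<in> borel_measurable \<mu>"
                using hb[of n] p_measurable[OF z, of "1 - s"] s
                by (auto simp: measurable_\<mu> bounded_measurable_def intro: borel_measurable_times)
              show "AE y in \<mu>. norm (h n y * p (1 - s) (f s) y) \<le> norm (p (1 - s) (f s) y)"
              proof (rule AE_I2)
                fix y assume "y \<in> space \<mu>"
                then show "norm (h n y * p (1 - s) (f s) y) \<le> norm (p (1 - s) (f s) y)"
                  using hnn[of y n] p_nonneg[OF z, of y "1 - s"] s mult_right_mono[of "h n y" 1 "p (1 - s) (f s) y"]
                  by (simp add: space_\<mu> abs_mult)
              qed
            qed (use s in simp)
          qed
          also have "\<dots> = 1" using p_integral_1[OF z] s by simp
          finally show "norm (\<integral>y. h n y * p (1 - s) (f s) y \<partial>\<mu>) \<le> 1" .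
        qed
      qed
      then show ?thesis unfolding k_def by simp
    qed
    have ea: "(\<lambda>n. e n / a n) \<longlonglongrightarrow> p 1 0 c" unfolding e_eq using lim[of 0 1] by simp
    have L1: "(\<lambda>n. \<integral>\<^sup>+f. norm (k n (f s) - q (f s)) \<partial>P 0) \<longlonglongrightarrow> 0"
    proof (rule Scheffe_lemma1[OF kint qint])
      show "AE f in P 0. (\<lambda>n. k n (f s)) \<longlonglongrightarrow> q (f s)"
        using klim s by (intro AE_I2) (auto simp: space_P path_in_S)
      have "(\<integral>\<^sup>+f. ennreal (norm (k n (f s))) \<partial>P 0) = ennreal (e n / a n)" for n
      proof -
        have "(\<integral>\<^sup>+f. ennreal (norm (k n (f s))) \<partial>P 0) = (\<integral>\<^sup>+f. ennreal (k n (f s)) \<partial>P 0)"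
          using knn s by (intro nn_integral_cong) (auto simp: space_P path_in_S)
        also have "\<dots> = ennreal (e n / a n)" unfolding ks[symmetric]
          using knn s by (intro nn_integral_eq_integral kint AE_I2) (auto simp: space_P path_in_S)
        finally show ?thesis .
      qed
      moreover have "(\<integral>\<^sup>+f. ennreal (norm (q (f s))) \<partial>P 0) = ennreal (p 1 0 c)"
      proof -
        have "(\<integral>\<^sup>+f. ennreal (norm (q (f s))) \<partial>P 0) = (\<integral>\<^sup>+f. ennreal (q (f s)) \<partial>P 0)"
          using qnn s by (intro nn_integral_cong) (auto simp: space_P path_in_S)
        also have "\<dots> = ennreal (p 1 0 c)" unfolding qs[symmetric]
          using qnn s by (intro nn_integral_eq_integral qint AE_I2) (auto simp: space_P path_in_S)
        finally show ?thesis .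
      qed
      moreover have "(\<lambda>n. ennreal (e n / a n)) \<longlonglongrightarrow> ennreal (p 1 0 c)" using ea by (rule tendsto_ennrealI)
      ultimately show "limsup (\<lambda>n. \<integral>\<^sup>+f. ennreal (norm (k n (f s))) \<partial>P 0) \<le> (\<integral>\<^sup>+f. ennreal (norm (q (f s))) \<partial>P 0)"
        by (simp add: lim_imp_Limsup)
    qed
    have Gk_int: "integrable (P 0) (\<lambda>f. G f * u (f s))" if "integrable (P 0) (\<lambda>f. u (f s))" for u
    proof (rule Bochner_Integration.integrable_bound)
      show "integrable (P 0) (\<lambda>f. C * u (f s))" using that by simp
      show "(\<lambda>f. G f * u (f s)) \<in> borel_measurable (P 0)" using GP that by auto
      show "AE f in P 0. norm (G f * u (f s)) \<le> norm (C * u (f s))"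
      proof (rule AE_I2)
        fix f assume "f \<in> space (P 0)"
        then have "\<bar>G f\<bar> \<le> \<bar>C\<bar>" using G(2) by (fastforce simp: space_P)
        then show "norm (G f * u (f s)) \<le> norm (C * u (f s))" by (simp add: abs_mult mult_right_mono)
      qed
    qed
    have C0: "0 \<le> C" using G(2) P0.not_empty by (fastforce simp: space_P)
    have L1': "(\<lambda>n. \<integral>f. norm (k n (f s) - q (f s)) \<partial>P 0) \<longlonglongrightarrow> 0"
    proof -
      have "(\<integral>\<^sup>+f. norm (k n (f s) - q (f s)) \<partial>P 0) = ennreal (\<integral>f. norm (k n (f s) - q (f s)) \<partial>P 0)" for n
        using kint qint by (intro nn_integral_eq_integral) auto
      then have "(\<lambda>n. ennreal (\<integral>f. norm (k n (f s) - q (f s)) \<partial>P 0)) \<longlonglongrightarrow> ennreal 0" using L1 by simp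
      then show ?thesis by (rule tendsto_ennrealD) (auto intro!: always_eventually)
    qed
    have Gk: "(\<lambda>n. \<integral>f. G f * k n (f s) \<partial>P 0) \<longlonglongrightarrow> (\<integral>f. G f * q (f s) \<partial>P 0)"
    proof (rule LIM_zero_cancel, rule Lim_null_comparison)
      show "(\<lambda>n. C * (\<integral>f. norm (k n (f s) - q (f s)) \<partial>P 0)) \<longlonglongrightarrow> 0"
        using tendsto_mult_right_zero[OF L1'] by simp
      show "\<forall>\<^sub>F n in sequentially. norm ((\<integral>f. G f * k n (f s) \<partial>P 0) - (\<integral>f. G f * q (f s) \<partial>P 0))
          \<le> C * (\<integral>f. norm (k n (f s) - q (f s)) \<partial>P 0)"
      proof (intro always_eventually allI)
        fix n
        have "(\<integral>f. G f * k n (f s) \<partial>P 0) - (\<integral>f. G f * q (f s) \<partial>P 0) = (\<integral>f. G f * k n (f s) - G f * q (f s) \<partial>P 0)"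
          using Gk_int[OF kint, of n] Gk_int[OF qint] by simp
        also have "norm \<dots> \<le> (\<integral>f. norm (G f * k n (f s) - G f * q (f s)) \<partial>P 0)"
          by (rule integral_norm_bound)
        also have "\<dots> \<le> (\<integral>f. C * norm (k n (f s) - q (f s)) \<partial>P 0)"
        proof (rule integral_mono)
          fix f assume "f \<in> space (P 0)"
          then have "\<bar>G f\<bar> \<le> C" using G(2) by (simp add: space_P)
          moreover have "G f * k n (f s) - G f * q (f s) = G f * (k n (f s) - q (f s))" by (simp add: algebra_simps)
          ultimately show "norm (G f * k n (f s) - G f * q (f s)) \<le> C * norm (k n (f s) - q (f s))"
            by (simp add: abs_mult mult_right_mono)
        qed (use Gk_int[OF kint, of n] Gk_int[OF qint] kint qint in auto)
        finally show "norm ((\<integral>f. G f * k n (f s) \<partial>P 0) - (\<integral>f. G f * q (f s) \<partial>P 0))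
          \<le> C * (\<integral>f. norm (k n (f s) - q (f s)) \<partial>P 0)" by simp
      qed
    qed
    have GE: "(\<integral>f. G f * h n (f 1) \<partial>P 0) = a n * (\<integral>f. G f * k n (f s) \<partial>P 0)" if "0 < a n" for n
    proof -
      have "(\<integral>f. G f * h n (f 1) \<partial>P 0) = (\<integral>f. G f * (\<integral>y. h n y * p (1 - s) (f s) y \<partial>\<mu>) \<partial>P 0)"
        by (rule markov_endpoint[OF G s hb])
      also have "\<dots> = (\<integral>f. a n * (G f * k n (f s)) \<partial>P 0)"
        using that by (intro Bochner_Integration.integral_cong refl) (simp add: k_def)
      finally show ?thesis by simp
    qed
    have "(\<lambda>n. \<bar>(\<integral>f. G f * k n (f s) \<partial>P 0) - L * (e n / a n)\<bar>) \<longlonglongrightarrow> \<bar>(\<integral>f. G f * q (f s) \<partial>P 0) - L * p 1 0 c\<bar>"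
      by (intro tendsto_intros Gk ea)
    moreover have "(\<integral>f. G f * q (f s) \<partial>P 0) - L * p 1 0 c = 0" using p_pos by (simp add: L_def)
    ultimately have l0: "(\<lambda>n. \<bar>(\<integral>f. G f * k n (f s) \<partial>P 0) - L * (e n / a n)\<bar>) \<longlonglongrightarrow> 0" by simp
    have l1: "(\<lambda>n. \<epsilon> * (e n / a n)) \<longlonglongrightarrow> \<epsilon> * p 1 0 c" by (intro tendsto_intros ea)
    have "\<forall>\<^sub>F n in sequentially. \<epsilon> * (e n / a n) \<le> \<bar>(\<integral>f. G f * k n (f s) \<partial>P 0) - L * (e n / a n)\<bar>"
      using eva
    proof eventually_elim
      case (elim n)
      have "\<epsilon> * e n < \<bar>a n * (\<integral>f. G f * k n (f s) \<partial>P 0) - L * e n\<bar>"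
        using viol[of n] GE[OF elim] by (simp add: e_def)
      also have "\<dots> = a n * \<bar>(\<integral>f. G f * k n (f s) \<partial>P 0) - L * (e n / a n)\<bar>"
      proof -
        have "a n * (\<integral>f. G f * k n (f s) \<partial>P 0) - L * e n = a n * ((\<integral>f. G f * k n (f s) \<partial>P 0) - L * (e n / a n))"
          using elim by (simp add: right_diff_distrib)
        then show ?thesis using elim by (simp add: abs_mult)
      qed
      finally show ?case using elim by (simp add: pos_divide_le_eq mult.commute)
    qed
    then have "\<epsilon> * p 1 0 c \<le> 0" by (rule tendsto_le[OF _ l0 l1, rotated]) simp
    then show False using \<epsilon> p_pos by (simp add: mult_le_0_iff)
  qed
  then show ?thesis by blast
qed

section \<open>The backward Markov property at the last hitting time\<close>

abbreviation "P0c \<equiv> completion (P 0)"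
abbreviation "g \<equiv> last_hit \<gamma> c"
definition "curve t = c * t powr (1 / \<gamma>)"
abbreviation "sc t \<equiv> path_scaling \<gamma> (1 / t)"

lemma curve_left: "0 < t \<Longrightarrow> (curve \<longlongrightarrow> curve t) (at_left t)"
  unfolding curve_def by (intro tendsto_intros) auto

lemma hit_times_eq: "hit_times \<gamma> c f = left_hits curve 0 1 f"
  by (simp add: hit_times_def left_hits_def curve_def)

lemma prob_P0: "prob_space (P 0)" by (rule prob_P) simp

lemma space_P0c: "space P0c = D" by (simp add: space_P)

lemma prob_P0c: "prob_space P0c"
proof
  interpret prob_space "P 0" by (rule prob_P0)
  show "emeasure P0c (space P0c) = 1" using emeasure_space_1 by simp
qed

lemma integrable_P0cI:
  fixes Z :: "(real \<Rightarrow> real) \<Rightarrow> real"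
  assumes "Z \<in> borel_measurable P0c" "\<And>f. f \<in> D \<Longrightarrow> \<bar>Z f\<bar> \<le> K"
  shows "integrable P0c Z"
proof -
  interpret prob_space P0c by (rule prob_P0c)
  show ?thesis
    by (rule integrable_const_bound[of _ K]) (use assms in \<open>auto simp: space_P\<close>)
qed

lemma measurable_P0cI: "f \<in> measurable \<Omega> N \<Longrightarrow> f \<in> measurable P0c N"
  by (intro measurable_completion) (simp add: measurable_P)

lemma last_hit_bounds: "0 \<le> g f" "g f \<le> 1"
proof -
  have "t \<in> hit_times \<gamma> c f \<Longrightarrow> 0 < t \<and> t \<le> 1" for t by (auto simp: hit_times_def)
  then have "bdd_above (hit_times \<gamma> c f)" "\<And>t. t \<in> hit_times \<gamma> c f \<Longrightarrow> 0 < t \<and> t \<le> 1" by force+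
  then show "0 \<le> g f" "g f \<le> 1"
    unfolding last_hit_def by (auto intro!: cSup_least intro: less_imp_le cSup_upper2)
qed

lemma less_last_hit_iff:
  assumes "0 \<le> t"
  shows "t < g f \<longleftrightarrow> (\<exists>s\<in>hit_times \<gamma> c f. t < s)"
proof (cases "hit_times \<gamma> c f = {}")
  case False
  have "bdd_above (hit_times \<gamma> c f)" by (rule bdd_aboveI[of _ 1]) (auto simp: hit_times_def)
  then show ?thesis using False by (simp add: last_hit_def less_cSup_iff)
qed (use assms in \<open>simp add: last_hit_def\<close>)

text \<open>The version \<open>R\<close> is measurable for the coordinate sigma-field, so the
  scaling relation, which concerns \<open>P 0\<close> itself, can be applied to events about
  \<open>g\<close>.\<close>

lemma last_hit_AE:
  "\<exists>R\<in>borel_measurable (P 0). AE f in P 0. g f = R f \<and> 0 < g f \<and> Lim (at_left (g f)) f = curve (g f)"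
proof -
  obtain R where R: "R \<in> borel_measurable (P 0)" "\<And>f. f \<in> D \<Longrightarrow> 0 \<le> R f \<and> R f \<le> 1"
    "\<And>f t. f \<in> D \<Longrightarrow> t \<in> hit_times \<gamma> c f \<Longrightarrow> t \<le> R f"
    "AE f in P 0. 0 < R f \<longrightarrow> R f \<in> hit_times \<gamma> c f"
    using last_left_hit_measurable[OF prob_P0 sets_P[OF zero_S], of curve 0 1] curve_left
    unfolding hit_times_eq space_P[OF zero_S] by auto
  have "AE f in P 0. g f = R f \<and> 0 < g f \<and> Lim (at_left (g f)) f = curve (g f)"
    using R(4) last_hit_pos AE_space
  proof eventually_elim
    case (elim f)
    then have f: "f \<in> D" by (simp add: space_P)
    have ne: "hit_times \<gamma> c f \<noteq> {}" using elim(2) by (auto simp: last_hit_def)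
    then obtain t where "t \<in> hit_times \<gamma> c f" by blast
    then have "0 < R f" using R(3)[OF f] by (force simp: hit_times_def)
    then have hit: "R f \<in> hit_times \<gamma> c f" using elim by simp
    have "g f = R f" unfolding last_hit_def using ne hit R(3)[OF f] by (auto intro!: cSup_eq_maximum)
    then show ?case using hit elim by (auto simp: hit_times_def curve_def)
  qed
  with R(1) show ?thesis by blast
qed

lemma last_hit_measurable [measurable]: "g \<in> borel_measurable P0c"
proof -
  obtain R where R: "R \<in> borel_measurable (P 0)"
    "AE f in P 0. g f = R f \<and> 0 < g f \<and> Lim (at_left (g f)) f = curve (g f)"
    using last_hit_AE by blast
  show ?thesis by (rule measurable_completion_AE[OF R(1)]) (use R(2) in \<open>auto elim: eventually_mono\<close>)
qed

lemma last_hit_good: "AE f in P0c. 0 < g f \<and> Lim (at_left (g f)) f = curve (g f)"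
  by (rule AE_completion) (use last_hit_AE in \<open>auto elim!: eventually_mono\<close>)

text \<open>The shifted path must hit the shifted curve after time 0 but no longer after time
  \<open>h\<close>. So the event that the last hit falls in the cell is decided by the future of
  \<open>t\<close>.\<close>

lemma last_hit_cell_shift:
  assumes f: "f \<in> D" and t: "0 \<le> t" "0 \<le> h"
  shows "t < g f \<and> g f \<le> t + h \<longleftrightarrow>
    left_hits (\<lambda>r. curve (t + r)) 0 (1 - t) (path_shift t f) \<noteq> {} \<and>
    left_hits (\<lambda>r. curve (t + r)) h (1 - t) (path_shift t f) = {}"
proof -
  have hits: "left_hits (\<lambda>r. curve (t + r)) a (1 - t) (path_shift t f) \<noteq> {} \<longleftrightarrow> t + a < g f" if a: "0 \<le> a" for a
  proof
    assume "left_hits (\<lambda>r. curve (t + r)) a (1 - t) (path_shift t f) \<noteq> {}"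
    then obtain r where r: "a < r" "r \<le> 1 - t" "Lim (at_left r) (path_shift t f) = curve (t + r)"
      by (auto simp: left_hits_def)
    then have "t + r \<in> hit_times \<gamma> c f" using Lim_left_path_shift[OF f t(1), of r] a t
      by (simp add: hit_times_def curve_def)
    then show "t + a < g f" using r a t by (auto simp: less_last_hit_iff intro!: bexI[of _ "t + r"])
  next
    assume "t + a < g f"
    then obtain s where s: "s \<in> hit_times \<gamma> c f" "t + a < s" using a t less_last_hit_iff[of "t + a" f] by auto
    then have "s - t \<in> left_hits (\<lambda>r. curve (t + r)) a (1 - t) (path_shift t f)"
      using Lim_left_path_shift[OF f t(1), of "s - t"] a t
      by (simp add: left_hits_def hit_times_def curve_def)
    then show "left_hits (\<lambda>r. curve (t + r)) a (1 - t) (path_shift t f) \<noteq> {}" by blast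
  qed
  show ?thesis using hits[of 0] hits[of h] t by (auto simp: not_less)
qed

text \<open>The Markov property demands a future event in the coordinate sigma-field. The exact
  event is measurable only for the completion of the law of the shifted path, and \<open>H\<close>
  is a measurable subset of it with a null difference; pulling back along the shift preserves null
  sets.\<close>

lemma last_hit_cell_future:
  assumes t: "0 \<le> t" "0 \<le> h"
  shows "\<exists>H\<in>sets \<Omega>. AE f in P 0. path_shift t f \<in> H \<longleftrightarrow> t < g f \<and> g f \<le> t + h"
proof -
  interpret P0: prob_space "P 0" by (rule prob_P0)
  let ?\<kappa> = "\<lambda>r. curve (t + r)"
  have sm: "path_shift t \<in> measurable (P 0) \<Omega>" using measurable_path_shift[OF t(1)] by (simp add: measurable_P)
  let ?M = "distr (P 0) \<Omega> (path_shift t)"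
  have M: "prob_space ?M" by (rule P0.prob_space_distr[OF sm])
  have \<kappa>: "(?\<kappa> \<longlongrightarrow> ?\<kappa> r) (at_left r)" if "0 < r" for r
    unfolding curve_def using that t by (intro tendsto_intros) auto
  have sM: "sets ?M = sets (path_space S {0..})" by simp
  have [measurable]: "Measurable.pred (completion ?M) (\<lambda>f. left_hits ?\<kappa> a (1 - t) f \<noteq> {})" if "0 \<le> a" for a
    by (rule left_hits_completion[OF M sM \<kappa> that])
  define A where "A = {f \<in> space (completion ?M). left_hits ?\<kappa> 0 (1 - t) f \<noteq> {} \<and> \<not> left_hits ?\<kappa> h (1 - t) f \<noteq> {}}"
  have A: "A \<in> sets (completion ?M)" unfolding A_def using t by measurable
  define H where "H = main_part ?M A"
  have "H \<in> sets \<Omega>" using main_part_sets[OF A] by (simp add: H_def)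
  moreover have "AE f in ?M. f \<in> H \<longleftrightarrow> f \<in> A" unfolding H_def by (rule AE_in_main_part[OF A])
  then have "AE f in P 0. path_shift t f \<in> H \<longleftrightarrow> path_shift t f \<in> A" by (rule AE_distrD[OF sm])
  then have "AE f in P 0. path_shift t f \<in> H \<longleftrightarrow> t < g f \<and> g f \<le> t + h"
    using AE_space
  proof eventually_elim
    case (elim f)
    then have f: "f \<in> D" by (simp add: space_P)
    have "path_shift t f \<in> A \<longleftrightarrow> t < g f \<and> g f \<le> t + h"
      unfolding last_hit_cell_shift[OF f t] A_def using path_shift_cadlag[OF f t(1)] by simp
    then show ?case using elim by simp
  qed
  ultimately show ?thesis by blast
qed

lemma sc_at_1: "0 < t \<Longrightarrow> f t = t powr (1 / \<gamma>) * sc t f 1"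
  by (simp add: path_scaling_def powr_divide)

lemma sc_in_D: "f \<in> D \<Longrightarrow> 0 < t \<Longrightarrow> sc t f \<in> D"
  by (intro path_scaling_cadlag cone_S) auto

lemma sc_measurable_Ft:
  assumes "0 < t" "s \<le> 1" "G \<in> borel_measurable (Ft s)"
  shows "(\<lambda>f. G (sc t f)) \<in> borel_measurable (Ft t)"
proof -
  have "G \<in> borel_measurable (Ft 1)" by (rule measurable_coord_algebra_mono[OF assms(3)]) (use assms in auto)
  moreover have "sc t \<in> measurable (Ft t) (Ft 1)"
    using measurable_path_scaling_coord[OF _ cone_S, of "1 / t" \<gamma> t] assms by simp
  ultimately show ?thesis by (rule measurable_compose[rotated])
qed

lemma sc_measurable_P0c:
  assumes "0 < t" "G \<in> borel_measurable \<Omega>"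
  shows "(\<lambda>f. G (sc t f)) \<in> borel_measurable P0c"
  by (rule measurable_P0cI, rule measurable_compose[OF measurable_path_scaling[OF _ cone_S] assms(2)])
    (use assms in simp)

text \<open>The Markov property at \<open>t\<close> replaces the cell indicator by a function of
  \<open>f t\<close>, and \<open>f t\<close> is a multiple of the endpoint of \<open>sc t f\<close>.
  Since \<open>sc t f\<close> has law \<open>P 0\<close>, everything becomes an expectation of
  \<open>G\<close> against a weight at time 1, to which \<open>loc\<close> applies.\<close>

lemma backward_markov_cell:
  assumes G: "G \<in> borel_measurable (Ft s)" "\<And>f. f \<in> D \<Longrightarrow> \<bar>G f\<bar> \<le> C" and s: "s \<le> 1"
    and B: "localizer \<delta> b" and t: "0 < t" "0 \<le> h"
    and loc: "\<And>h. localizer \<delta> h \<Longrightarrow>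
     \<bar>(\<integral>f. G f * h (f 1) \<partial>P 0) - L * (\<integral>f. h (f 1) \<partial>P 0)\<bar> \<le> \<epsilon> * (\<integral>f. h (f 1) \<partial>P 0)"
  defines "I \<equiv> \<lambda>f. indicator {f. t < g f \<and> g f \<le> t + h} f :: real"
  shows "\<bar>(\<integral>f. G (sc t f) * b (sc t f 1) * I f \<partial>P0c) - L * (\<integral>f. b (sc t f 1) * I f \<partial>P0c)\<bar>
    \<le> \<epsilon> * (\<integral>f. b (sc t f 1) * I f \<partial>P0c)"
proof -
  obtain H where H: "H \<in> sets \<Omega>" "AE f in P 0. path_shift t f \<in> H \<longleftrightarrow> t < g f \<and> g f \<le> t + h"
    using last_hit_cell_future[of t h] t by auto
  have bb: "bounded_measurable bS b" by (rule localizer_bounded[OF B])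
  have bm: "b \<in> borel_measurable bS" using bb by (simp add: bounded_measurable_def)
  have b01: "0 \<le> b y" "b y \<le> 1" if "y \<in> S" for y using B that by (auto simp: localizer_def)
  define e :: "real \<Rightarrow> real" where "e x = (\<integral>f. indicator H f \<partial>P x)" for x
  \<comment> \<open>The factor \<open>e\<close> is the probability that the future lies in
    \<open>H\<close>, seen from the unscaled point; it lies in \<open>[0, 1]\<close>, so
    \<open>k\<close> inherits the support of \<open>b\<close>.\<close>
  define k where "k y = b y * e (t powr (1 / \<gamma>) * y)" for y
  have Hb: "bounded_measurable \<Omega> (indicator H :: _ \<Rightarrow> real)"
    by (rule bounded_measurableI[of _ _ 1]) (use H in \<open>auto simp: indicator_def\<close>)
  have scale_S: "t powr (1 / \<gamma>) * y \<in> S" if "y \<in> S" for y using that cone_S by (simp add: cone_def)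
  have k: "localizer \<delta> k"
    unfolding localizer_def
  proof (intro conjI ballI)
    have "e \<in> borel_measurable bS" unfolding e_def by (rule integral_measurable[OF Hb])
    moreover have "(\<lambda>y. t powr (1 / \<gamma>) * y) \<in> measurable bS bS"
      using scale_S by (intro measurable_restrict_space2 measurable_restrict_space1) auto
    ultimately have "(\<lambda>y. e (t powr (1 / \<gamma>) * y)) \<in> borel_measurable bS" by (rule measurable_compose[rotated])
    then show "k \<in> borel_measurable bS" unfolding k_def using bm by (intro borel_measurable_times)
    fix y assume y: "y \<in> S"
    interpret Py: prob_space "P (t powr (1 / \<gamma>) * y)" by (rule prob_P[OF scale_S[OF y]])
    have "0 \<le> e (t powr (1 / \<gamma>) * y)" "e (t powr (1 / \<gamma>) * y) \<le> 1"
      unfolding e_def using H by (auto simp: sets_P scale_S y)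
    then show "0 \<le> k y" "k y \<le> 1" "\<delta> \<le> \<bar>y - c\<bar> \<longrightarrow> k y = 0"
      using b01[OF y] B y unfolding k_def by (auto simp: localizer_def mult_le_one)
  qed
  \<comment> \<open>Stated for a general functional because it is used twice: for \<open>G\<close>,
    and for the constant 1, which gives the normalising mass.\<close>
  have key: "(\<integral>f. G' (sc t f) * b (sc t f 1) * I f \<partial>P0c) = (\<integral>f. G' f * k (f 1) \<partial>P 0)"
    if G': "G' \<in> borel_measurable (Ft s')" "\<And>f. f \<in> D \<Longrightarrow> \<bar>G' f\<bar> \<le> C'" "s' \<le> 1" for G' s' C'
  proof -
    have G\<Omega>: "G' \<in> borel_measurable \<Omega>" by (rule measurable_coord_algebra_mono[OF G'(1)]) auto
    have m1: "(\<lambda>f. b (f 1)) \<in> borel_measurable (Ft 1)"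
      by (rule measurable_compose[OF coord_bS bm]) auto
    define F where "F f = G' (sc t f) * b (sc t f 1)" for f
    have Fm: "F \<in> borel_measurable (Ft t)"
      unfolding F_def using sc_measurable_Ft[OF t(1) G'(3,1)] sc_measurable_Ft[OF t(1) order_refl m1]
      by (intro borel_measurable_times)
    have Fb: "bounded_measurable (Ft t) F"
    proof (rule bounded_measurableI[OF Fm])
      fix f assume "f \<in> space (Ft t)"
      then have "\<bar>G' (sc t f)\<bar> \<le> C'" "sc t f 1 \<in> S" using G'(2) sc_in_D[OF _ t(1)] path_in_S by auto
      then show "\<bar>F f\<bar> \<le> C'" using mult_mono[of "\<bar>G' (sc t f)\<bar>" C' "\<bar>b (sc t f 1)\<bar>" 1] b01
        by (simp add: F_def abs_mult)
    qed
    have FP: "F \<in> borel_measurable (P 0)"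
      using measurable_coord_algebra_mono[OF Fm, of "{0..}"] by (simp add: measurable_P)
    have sh: "path_shift t \<in> measurable (P 0) \<Omega>"
      using measurable_path_shift[of t S] t by (simp add: measurable_P)
    have ind: "(indicator H :: _ \<Rightarrow> real) \<in> borel_measurable \<Omega>" using H by simp
    have Hs: "(\<lambda>f. indicator H (path_shift t f) :: real) \<in> borel_measurable (P 0)"
      using measurable_compose[OF sh ind] .
    have Im: "I \<in> borel_measurable P0c" unfolding I_def by measurable
    have "(\<integral>f. F f * I f \<partial>P0c) = (\<integral>f. F f * indicator H (path_shift t f) \<partial>P0c)"
    proof (rule integral_cong_AE)
      show "AE f in P0c. F f * I f = F f * indicator H (path_shift t f)"
        using AE_completion[OF H(2)] by eventually_elim (auto simp: I_def indicator_def)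
    qed (use measurable_completion[OF FP] measurable_completion[OF Hs] Im in \<open>auto intro: borel_measurable_times\<close>)
    also have "\<dots> = (\<integral>f. F f * indicator H (path_shift t f) \<partial>P 0)"
      by (rule integral_completion) (use FP Hs in \<open>auto intro: borel_measurable_times\<close>)
    also have "\<dots> = (\<integral>f. F f * e (f t) \<partial>P 0)"
      unfolding e_def by (rule markov[OF zero_S _ Fb Hb]) (use t in simp)
    also have "\<dots> = (\<integral>f. G' (sc t f) * k (sc t f 1) \<partial>P 0)"
      unfolding F_def k_def sc_at_1[OF t(1), symmetric] by (simp add: mult.assoc)
    also have "\<dots> = (\<integral>f. G' f * k (f 1) \<partial>P 0)"
    proof -
      have "(\<lambda>f. G' f * k (f 1)) \<in> borel_measurable \<Omega>"
        by (intro borel_measurable_times G\<Omega> coord_compose) (use k in \<open>auto simp: localizer_def\<close>)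
      from integral_scaling[OF _ this, of "1 / t"] show ?thesis using t by simp
    qed
    finally show ?thesis unfolding F_def .
  qed
  have "(\<integral>f. b (sc t f 1) * I f \<partial>P0c) = (\<integral>f. k (f 1) \<partial>P 0)"
    using key[of "\<lambda>_. 1" 1 1] by simp
  then show ?thesis using key[OF G s] loc[OF k] by simp
qed

section \<open>Grid approximation of the last hitting time\<close>

text \<open>The largest multiple of \<open>1/N\<close> strictly below \<open>g f\<close>. The
  subtraction of 1 after rounding up gives strictness also when \<open>g f\<close> is a grid point;
  if \<open>g f = 0\<close>, the result is negative.\<close>

definition grid :: "nat \<Rightarrow> (real \<Rightarrow> real) \<Rightarrow> real" where
  "grid N f = (of_int \<lceil>real N * g f\<rceil> - 1) / real N"

lemma grid_bounds: "0 < N \<Longrightarrow> grid N f < g f" "0 < N \<Longrightarrow> g f \<le> grid N f + 1 / real N"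
proof -
  assume N: "0 < N"
  have b: "real N * g f \<le> of_int \<lceil>real N * g f\<rceil>" "of_int \<lceil>real N * g f\<rceil> < real N * g f + 1" by linarith+
  then show "grid N f < g f" using N by (simp add: grid_def pos_divide_less_eq mult.commute)
  have "grid N f + 1 / real N = of_int \<lceil>real N * g f\<rceil> / real N" by (simp add: grid_def diff_divide_distrib)
  then show "g f \<le> grid N f + 1 / real N" using b N by (simp add: pos_le_divide_eq mult.commute)
qed

lemma grid_tendsto: "filterlim (\<lambda>N. grid N f) (at_left (g f)) sequentially"
  unfolding filterlim_at
proof
  show "\<forall>\<^sub>F N in sequentially. grid N f \<in> {..<g f} \<and> grid N f \<noteq> g f"
    using eventually_gt_at_top[of 0]
  proof eventually_elim
    case (elim N) then show ?case using grid_bounds(1)[of N f] by simp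
  qed
  show "(\<lambda>N. grid N f) \<longlonglongrightarrow> g f"
  proof (rule tendsto_sandwich)
    show "(\<lambda>N. g f - 1 / real N) \<longlonglongrightarrow> g f" using tendsto_diff[OF tendsto_const lim_1_over_n] by simp
    show "\<forall>\<^sub>F N in sequentially. g f - 1 / real N \<le> grid N f"
      using eventually_gt_at_top[of 0]
    proof eventually_elim
      case (elim N) then show ?case using grid_bounds(2)[of N f] by linarith
    qed
    show "\<forall>\<^sub>F N in sequentially. grid N f \<le> g f"
      using eventually_gt_at_top[of 0]
    proof eventually_elim
      case (elim N) then show ?case using grid_bounds(1)[of N f] by simp
    qed
  qed simp
qed

lemma eventually_grid_pos: "0 < g f \<Longrightarrow> \<forall>\<^sub>F N in sequentially. 0 < grid N f"
  using grid_tendsto[of f] by (auto simp: filterlim_at intro: order_tendstoD(1))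

text \<open>The set \<open>J\<close> restricts the time of the last grid point before
  \<open>g\<close>. It is \<open>UNIV\<close> when the law of the rescaled path is identified, and a
  half-line when late hits are singled out.\<close>

definition on_grid :: "real set \<Rightarrow> (real \<Rightarrow> (real \<Rightarrow> real) \<Rightarrow> real) \<Rightarrow> nat \<Rightarrow> (real \<Rightarrow> real) \<Rightarrow> real" where
  "on_grid J \<Phi> N f = (if 0 < grid N f \<and> grid N f \<in> J then \<Phi> (grid N f) f else 0)"

text \<open>The random grid time is split into deterministic times with cell indicators, where the
  simple Markov property suffices. The index 0 is absent because scaling by time 0 is meaningless,
  in accordance with \<open>0 < grid N f\<close>.\<close>

lemma on_grid_sum:
  assumes N: "0 < N"
  shows "on_grid J \<Phi> N f = (\<Sum>k | k \<in> {1..<N} \<and> real k / real N \<in> J. \<Phi> (real k / real N) f *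
    indicator {f. real k / real N < g f \<and> g f \<le> real k / real N + 1 / real N} f)"
proof -
  let ?K = "{k. k \<in> {1..<N} \<and> real k / real N \<in> J}"
  define i where "i = \<lceil>real N * g f\<rceil>"
  have i: "i \<le> int N" using last_hit_bounds(2)[of f] N by (simp add: i_def ceiling_le_iff mult_left_le)
  have cell: "(real k / real N < g f \<and> g f \<le> real k / real N + 1 / real N) \<longleftrightarrow> i = int k + 1" for k
  proof -
    have "real k / real N + 1 / real N = (real k + 1) / real N" by (simp add: add_divide_distrib)
    then have "(real k / real N < g f \<and> g f \<le> real k / real N + 1 / real N) \<longleftrightarrow>
      real k < real N * g f \<and> real N * g f \<le> real k + 1"
      using N by (simp add: pos_divide_less_eq pos_le_divide_eq mult.commute)
    also have "\<dots> \<longleftrightarrow> i = int k + 1" unfolding i_def by linarith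
    finally show ?thesis .
  qed
  show ?thesis
  proof (cases "2 \<le> i")
    case True
    define k0 where "k0 = nat (i - 1)"
    have k0: "i = int k0 + 1" "k0 \<in> {1..<N}" using True i by (auto simp: k0_def)
    have gr: "grid N f = real k0 / real N" by (simp add: grid_def i_def[symmetric] k0)
    have "(\<Sum>k\<in>?K. \<Phi> (real k / real N) f * indicator {f. real k / real N < g f \<and> g f \<le> real k / real N + 1 / real N} f)
      = (\<Sum>k\<in>?K. if k = k0 then \<Phi> (real k / real N) f else 0)"
      by (intro sum.cong refl) (simp add: cell indicator_def k0)
    also have "\<dots> = (if k0 \<in> ?K then \<Phi> (real k0 / real N) f else 0)" by (subst sum.delta) auto
    also have "\<dots> = on_grid J \<Phi> N f" using k0 N by (simp add: on_grid_def gr)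
    finally show ?thesis by simp
  next
    case False
    then have "grid N f \<le> 0" unfolding grid_def i_def[symmetric] by (simp add: divide_le_0_iff)
    moreover have "indicator {f. real k / real N < g f \<and> g f \<le> real k / real N + 1 / real N} f = (0::real)"
      if "k \<in> ?K" for k using that False by (simp add: indicator_def cell)
    ultimately show ?thesis by (simp add: on_grid_def)
  qed
qed

lemma cell_measurable: "(indicator {f. a < g f \<and> g f \<le> b} :: _ \<Rightarrow> real) \<in> borel_measurable P0c"
proof -
  have "Measurable.pred P0c (\<lambda>f. a < g f \<and> g f \<le> b)" by measurable
  then have "(\<lambda>f. if a < g f \<and> g f \<le> b then 1 else 0 :: real) \<in> borel_measurable P0c" by measurable
  then show ?thesis by (simp add: indicator_def)
qed

lemma on_grid_measurable:
  assumes "\<And>t. 0 < t \<Longrightarrow> \<Phi> t \<in> borel_measurable P0c" "0 < N"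
  shows "on_grid J \<Phi> N \<in> borel_measurable P0c"
proof -
  have "\<Phi> (real k / real N) \<in> borel_measurable P0c" if "k \<in> {1..<N}" for k using assms that by simp
  then show ?thesis unfolding on_grid_sum[OF assms(2)]
    by (intro borel_measurable_sum borel_measurable_times cell_measurable) auto
qed

text \<open>Grid points approach \<open>g f\<close> strictly from the left, so they see the left
  limit, which lies on the curve, and not the value of the path after a possible jump.\<close>

lemma endpoint_tendsto:
  assumes "f \<in> D" "0 < g f" "Lim (at_left (g f)) f = curve (g f)"
  shows "(\<lambda>N. sc (grid N f) f 1) \<longlonglongrightarrow> c"
proof -
  have "(f \<longlongrightarrow> curve (g f)) (at_left (g f))" using cadlag_Lim_left[OF assms(1,2)] assms(3) by simp
  then have "((\<lambda>t. (1 / t) powr (1 / \<gamma>) * f t) \<longlongrightarrow> (1 / g f) powr (1 / \<gamma>) * curve (g f)) (at_left (g f))"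
    using assms(2) by (intro tendsto_intros) auto
  also have "(1 / g f) powr (1 / \<gamma>) * curve (g f) = c"
    using assms(2) by (simp add: curve_def powr_divide)
  finally have "(\<lambda>N. (1 / grid N f) powr (1 / \<gamma>) * f (grid N f)) \<longlonglongrightarrow> c"
    by (rule filterlim_compose[OF _ grid_tendsto])
  then show ?thesis by (simp add: path_scaling_def)
qed

text \<open>The Markov property at the grid points together with \<open>pinned_limit\<close>: given the future of the last grid
  point before \<open>g\<close>, the rescaled past has asymptotically the law of the bridge.\<close>

lemma backward_limit:
  assumes G: "G \<in> borel_measurable (Ft s)" "\<And>f. f \<in> D \<Longrightarrow> \<bar>G f\<bar> \<le> C" and s: "s \<le> 1"
    and L: "pinned_limit G L"
  shows "(\<lambda>N. (\<integral>f. on_grid J (\<lambda>t f. G (sc t f)) N f \<partial>P0c) - L * (\<integral>f. on_grid J (\<lambda>t f. 1) N f \<partial>P0c)) \<longlonglongrightarrow> 0"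
proof (rule LIMSEQ_I)
  interpret M: prob_space P0c by (rule prob_P0c)
  fix r :: real assume r: "0 < r"
  then have "0 < r / 3" by simp
  then obtain \<delta> where \<delta>: "0 < \<delta>" "\<And>h. localizer \<delta> h \<Longrightarrow>
     \<bar>(\<integral>f. G f * h (f 1) \<partial>P 0) - L * (\<integral>f. h (f 1) \<partial>P 0)\<bar> \<le> r / 3 * (\<integral>f. h (f 1) \<partial>P 0)"
    using L unfolding pinned_limit_def by blast
  \<comment> \<open>The cell estimate applies only to rescaled paths that end near \<open>c\<close>.
    The versions \<open>U\<close> and \<open>V\<close> contain this restriction, and
    \<open>X\<close> and \<open>Y\<close> do not.\<close>
  define b :: "real \<Rightarrow> real" where "b = indicator (ball c \<delta>)"
  have b: "localizer \<delta> b" unfolding b_def by (rule localizer_indicator) auto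
  have C: "0 \<le> C" using G(2) M.not_empty space_P0c by (fastforce dest: order_trans[OF abs_ge_zero])
  have G\<Omega>: "G \<in> borel_measurable \<Omega>" by (rule measurable_coord_algebra_mono[OF G(1)]) auto
  have b\<Omega>: "(\<lambda>f. b (f 1)) \<in> borel_measurable \<Omega>"
    by (rule coord_compose) (use b in \<open>auto simp: localizer_def\<close>)
  have m1: "(\<lambda>f. G (sc t f)) \<in> borel_measurable P0c" if "0 < t" for t
    by (rule sc_measurable_P0c[OF that G\<Omega>])
  have m2: "(\<lambda>f. b (sc t f 1)) \<in> borel_measurable P0c" if "0 < t" for t
    by (rule sc_measurable_P0c[OF that b\<Omega>])
  define U where "U = on_grid J (\<lambda>t f. G (sc t f) * b (sc t f 1))"
  define V where "V = on_grid J (\<lambda>t f. b (sc t f 1))"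
  define X where "X = on_grid J (\<lambda>t f. G (sc t f))"
  define Y where "Y = on_grid J (\<lambda>t f. 1)"
  have meas: "U N \<in> borel_measurable P0c" "V N \<in> borel_measurable P0c" "X N \<in> borel_measurable P0c"
    "Y N \<in> borel_measurable P0c" if "0 < N" for N
    unfolding U_def V_def X_def Y_def using m1 m2 that by (auto intro!: on_grid_measurable borel_measurable_times)
  have Gb: "\<bar>G (sc t f)\<bar> \<le> C" if "f \<in> D" "0 < t" for t f using G(2) sc_in_D[OF that] by blast
  have bds: "\<bar>X N f\<bar> \<le> C" "0 \<le> V N f" "V N f \<le> Y N f" "0 \<le> Y N f" "Y N f \<le> 1" "\<bar>U N f\<bar> \<le> C"
    "\<bar>X N f - U N f\<bar> \<le> C * (Y N f - V N f)" "V N f \<le> 1" if "f \<in> D" for N f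
    using Gb[OF that] C by (auto simp: X_def V_def Y_def U_def on_grid_def b_def indicator_def)
  have int: "integrable P0c (U N)" "integrable P0c (V N)" "integrable P0c (X N)" "integrable P0c (Y N)" if N: "0 < N" for N
  proof -
    note b = bds
    show "integrable P0c (U N)" by (rule integrable_P0cI[OF meas(1)[OF N] b(6)])
    show "integrable P0c (X N)" by (rule integrable_P0cI[OF meas(3)[OF N] b(1)])
    show "integrable P0c (Y N)" by (rule integrable_P0cI[OF meas(4)[OF N], of 1]) (use b(4,5) in simp)
    show "integrable P0c (V N)"
    proof (rule integrable_P0cI[OF meas(2)[OF N], of 1])
      show "\<bar>V N f\<bar> \<le> 1" if "f \<in> D" for f using b(2,3,5)[OF that, of N] by simp
    qed
  qed
  have cells: "\<bar>(\<integral>f. U N f \<partial>P0c) - L * (\<integral>f. V N f \<partial>P0c)\<bar> \<le> r / 3" if N: "0 < N" for N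
  proof -
    let ?K = "{k. k \<in> {1..<N} \<and> real k / real N \<in> J}"
    let ?I = "\<lambda>k. indicator {f. real k / real N < g f \<and> g f \<le> real k / real N + 1 / real N} :: (real \<Rightarrow> real) \<Rightarrow> real"
    let ?u = "\<lambda>k f. G (sc (real k / real N) f) * b (sc (real k / real N) f 1) * ?I k f"
    let ?v = "\<lambda>k f. b (sc (real k / real N) f 1) * ?I k f"
    have pos: "0 < real k / real N" if "k \<in> ?K" for k using that N by auto
    have Im: "?I k \<in> borel_measurable P0c" for k by (rule cell_measurable)
    have iu: "integrable P0c (?u k)" if k: "k \<in> ?K" for k
    proof (rule integrable_P0cI)
      show "?u k \<in> borel_measurable P0c" using m1[OF pos[OF k]] m2[OF pos[OF k]] Im by (intro borel_measurable_times)
      show "\<bar>?u k f\<bar> \<le> C" if "f \<in> D" for f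
        using Gb[OF that pos[OF k]] C by (auto simp: b_def indicator_def)
    qed
    have iv: "integrable P0c (?v k)" if k: "k \<in> ?K" for k
    proof (rule integrable_P0cI)
      show "?v k \<in> borel_measurable P0c" using m2[OF pos[OF k]] Im by (intro borel_measurable_times)
      show "\<bar>?v k f\<bar> \<le> 1" for f by (auto simp: b_def indicator_def)
    qed
    have "(\<integral>f. U N f \<partial>P0c) = (\<Sum>k\<in>?K. \<integral>f. ?u k f \<partial>P0c)"
      unfolding U_def on_grid_sum[OF N] using iu by (intro Bochner_Integration.integral_sum) auto
    moreover have V: "(\<integral>f. V N f \<partial>P0c) = (\<Sum>k\<in>?K. \<integral>f. ?v k f \<partial>P0c)"
      unfolding V_def on_grid_sum[OF N] using iv by (intro Bochner_Integration.integral_sum) auto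
    ultimately have "\<bar>(\<integral>f. U N f \<partial>P0c) - L * (\<integral>f. V N f \<partial>P0c)\<bar>
      = \<bar>\<Sum>k\<in>?K. (\<integral>f. ?u k f \<partial>P0c) - L * (\<integral>f. ?v k f \<partial>P0c)\<bar>"
      by (simp add: sum_subtractf sum_distrib_left)
    also have "\<dots> \<le> (\<Sum>k\<in>?K. \<bar>(\<integral>f. ?u k f \<partial>P0c) - L * (\<integral>f. ?v k f \<partial>P0c)\<bar>)" by (rule sum_abs)
    \<comment> \<open>The error in each cell is relative to the mass of that cell. Therefore the sum
      of the errors stays bounded although the number of cells grows with \<open>N\<close>.\<close>
    also have "\<dots> \<le> (\<Sum>k\<in>?K. r / 3 * (\<integral>f. ?v k f \<partial>P0c))"
      using pos \<delta>(2) by (intro sum_mono backward_markov_cell[OF G s b]) auto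
    also have "\<dots> = r / 3 * (\<integral>f. V N f \<partial>P0c)" by (simp add: V sum_distrib_left)
    also have "\<dots> \<le> r / 3 * 1"
    proof (intro mult_left_mono)
      show "(\<integral>f. V N f \<partial>P0c) \<le> 1"
      proof (rule M.integral_le_const[OF int(2)[OF N]])
        show "AE f in P0c. V N f \<le> 1" using bds(8) by (intro AE_I2) (auto simp: space_P)
      qed
    qed (use r in simp)
    finally show ?thesis by simp
  qed
  \<comment> \<open>For almost every path the endpoint at the last grid point is eventually within
    \<open>\<delta>\<close> of \<open>c\<close>, so the restriction costs nothing in the
    limit.\<close>
  have "(\<lambda>N. \<integral>f. Y (Suc N) f - V (Suc N) f \<partial>P0c) \<longlonglongrightarrow> (\<integral>f. 0 \<partial>P0c)"
  proof (rule integral_dominated_convergence[where w="\<lambda>_. 1"])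
    show "AE f in P0c. (\<lambda>N. Y (Suc N) f - V (Suc N) f) \<longlonglongrightarrow> 0"
      using last_hit_good AE_space
    proof eventually_elim
      case (elim f)
      then have "(\<lambda>N. sc (grid N f) f 1) \<longlonglongrightarrow> c" by (intro endpoint_tendsto) (auto simp: space_P)
      from tendstoD[OF this \<delta>(1)] have "\<forall>\<^sub>F N in sequentially. Y N f - V N f = 0"
        by eventually_elim (auto simp: Y_def V_def on_grid_def b_def dist_commute)
      then have "(\<lambda>N. Y N f - V N f) \<longlonglongrightarrow> 0" by (rule tendsto_eventually)
      then show ?case by (rule LIMSEQ_Suc)
    qed
    show "\<And>N. AE f in P0c. norm (Y (Suc N) f - V (Suc N) f) \<le> 1"
    proof (rule AE_I2)
      fix N f assume "f \<in> space P0c"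
      then have "f \<in> D" by (simp add: space_P)
      from bds[OF this, of "Suc N"] show "norm (Y (Suc N) f - V (Suc N) f) \<le> 1" by (auto simp: abs_if)
    qed
  qed (use meas in auto)
  then have YV0: "(\<lambda>N. \<integral>f. Y N f - V N f \<partial>P0c) \<longlonglongrightarrow> 0" using filterlim_sequentially_Suc[of "\<lambda>N. \<integral>f. Y N f - V N f \<partial>P0c"] by simp
  have "(\<lambda>N. (C + \<bar>L\<bar>) * (\<integral>f. Y N f - V N f \<partial>P0c)) \<longlonglongrightarrow> 0" using tendsto_mult_right_zero[OF YV0] by simp
  then have "\<forall>\<^sub>F N in sequentially. (C + \<bar>L\<bar>) * (\<integral>f. Y N f - V N f \<partial>P0c) < r / 3"
    using r by (intro order_tendstoD) auto
  then have "\<forall>\<^sub>F N in sequentially. norm ((\<integral>f. X N f \<partial>P0c) - L * (\<integral>f. Y N f \<partial>P0c) - 0) < r"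
    using eventually_gt_at_top[of 0]
  proof eventually_elim
    case (elim N)
    note i = int[OF elim(2)]
    have 1: "\<bar>(\<integral>f. X N f \<partial>P0c) - (\<integral>f. U N f \<partial>P0c)\<bar> \<le> C * (\<integral>f. Y N f - V N f \<partial>P0c)"
    proof -
      have "\<bar>(\<integral>f. X N f \<partial>P0c) - (\<integral>f. U N f \<partial>P0c)\<bar> = \<bar>\<integral>f. X N f - U N f \<partial>P0c\<bar>" using i by simp
      also have "\<dots> \<le> (\<integral>f. \<bar>X N f - U N f\<bar> \<partial>P0c)" by (rule integral_abs_bound)
      also have "\<dots> \<le> (\<integral>f. C * (Y N f - V N f) \<partial>P0c)"
        using i bds by (intro integral_mono) (auto simp: space_P)
      finally show ?thesis by simp
    qed
    have YV: "(\<integral>f. Y N f - V N f \<partial>P0c) = (\<integral>f. Y N f \<partial>P0c) - (\<integral>f. V N f \<partial>P0c)" using i by simp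
    have nn: "0 \<le> (\<integral>f. Y N f - V N f \<partial>P0c)" using bds by (intro integral_nonneg_AE AE_I2) (simp add: space_P)
    have "L * (\<integral>f. V N f \<partial>P0c) - L * (\<integral>f. Y N f \<partial>P0c) = - (L * (\<integral>f. Y N f - V N f \<partial>P0c))"
      unfolding YV by (simp add: algebra_simps)
    moreover have "\<bar>L * (\<integral>f. Y N f - V N f \<partial>P0c)\<bar> = \<bar>L\<bar> * (\<integral>f. Y N f - V N f \<partial>P0c)" using nn by (simp add: abs_mult)
    moreover have "(C + \<bar>L\<bar>) * (\<integral>f. Y N f - V N f \<partial>P0c) =
      C * (\<integral>f. Y N f - V N f \<partial>P0c) + \<bar>L\<bar> * (\<integral>f. Y N f - V N f \<partial>P0c)" by (simp add: distrib_right)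
    ultimately show ?case using 1 cells[OF elim(2)] elim(1) r unfolding real_norm_def by linarith
  qed
  then show "\<exists>no. \<forall>N\<ge>no. norm ((\<integral>f. on_grid J (\<lambda>t f. G (sc t f)) N f \<partial>P0c) - L * (\<integral>f. on_grid J (\<lambda>t f. 1) N f \<partial>P0c) - 0) < r"
    unfolding X_def Y_def eventually_sequentially .
qed

end

text \<open>The exceptional set \<open>A\<close> costs at most \<open>2 * C\<close> times its
  probability. Off \<open>A\<close> the approximation may hold from a path-dependent index on,
  because the sets where it still fails have vanishing probability by dominated convergence.\<close>

lemma (in prob_space) limit_compare:
  fixes X :: "nat \<Rightarrow> 'a \<Rightarrow> real"
  assumes X: "\<forall>\<^sub>F n in sequentially. X n \<in> borel_measurable M \<and> (\<forall>x\<in>space M. \<bar>X n x\<bar> \<le> C)"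
    and v: "v \<in> borel_measurable M" "\<And>x. x \<in> space M \<Longrightarrow> \<bar>v x\<bar> \<le> C"
    and A: "A \<in> sets M" and e: "0 \<le> e"
    and close: "AE x in M. x \<notin> A \<longrightarrow> (\<forall>\<^sub>F n in sequentially. \<bar>X n x - v x\<bar> \<le> e)"
    and L: "(\<lambda>n. expectation (X n)) \<longlonglongrightarrow> L"
  shows "\<bar>L - expectation v\<bar> \<le> e + 2 * C * prob A"
proof -
  have C: "0 \<le> C" using v(2) not_empty by (fastforce dest: order_trans[OF abs_ge_zero])
  obtain n0 where n0: "\<And>n. n0 \<le> n \<Longrightarrow> X n \<in> borel_measurable M" "\<And>n x. n0 \<le> n \<Longrightarrow> x \<in> space M \<Longrightarrow> \<bar>X n x\<bar> \<le> C"
    using X unfolding eventually_sequentially by blast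
  define Z where "Z n = X (n + n0)" for n
  have Z [measurable]: "Z n \<in> borel_measurable M" and Zb: "\<And>x. x \<in> space M \<Longrightarrow> \<bar>Z n x\<bar> \<le> C" for n
    using n0 by (auto simp: Z_def)
  have [measurable]: "v \<in> borel_measurable M" by fact
  define B where "B n = {x \<in> space M. e < \<bar>Z n x - v x\<bar>} - A" for n
  have B [measurable]: "B n \<in> sets M" for n unfolding B_def using A by measurable
  have iZ: "integrable M (Z n)" for n
    by (rule integrable_const_bound[of _ C]) (use Zb in auto)
  have iv: "integrable M v" by (rule integrable_const_bound[of _ C]) (use v in auto)
  have iB: "integrable M (indicator (B n) :: 'a \<Rightarrow> real)" for n
    by (rule integrable_const_bound[of _ 1]) (auto simp: indicator_def)
  have iA: "integrable M (indicator A :: 'a \<Rightarrow> real)"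
    by (rule integrable_const_bound[of _ 1]) (use A in \<open>auto simp: indicator_def\<close>)
  have "(\<lambda>n. expectation (indicator (B n))) \<longlonglongrightarrow> expectation (\<lambda>_. 0 :: real)"
  proof (rule integral_dominated_convergence[where w="\<lambda>_. 1"])
    show "AE x in M. (\<lambda>n. indicator (B n) x :: real) \<longlonglongrightarrow> 0"
      using close
    proof eventually_elim
      case (elim x)
      show ?case
      proof (cases "x \<in> A")
        case False
        then have "\<forall>\<^sub>F n in sequentially. \<bar>X n x - v x\<bar> \<le> e" using elim by simp
        then have "\<forall>\<^sub>F n in sequentially. \<bar>Z n x - v x\<bar> \<le> e"
          unfolding Z_def by (rule eventually_all_ge_at_top[THEN eventually_mono, THEN sequentially_offset]) auto
        then show ?thesis by (intro tendsto_eventually) (auto elim!: eventually_mono simp: B_def)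
      qed (simp add: B_def)
    qed
  qed (auto simp: indicator_def)
  then have "(\<lambda>n. prob (B n)) \<longlonglongrightarrow> 0" by simp
  then have up: "(\<lambda>n. e + 2 * C * prob A + 2 * C * prob (B n)) \<longlonglongrightarrow> e + 2 * C * prob A + 2 * C * 0"
    by (intro tendsto_intros)
  have lo: "(\<lambda>n. \<bar>expectation (Z n) - expectation v\<bar>) \<longlonglongrightarrow> \<bar>L - expectation v\<bar>"
    unfolding Z_def by (intro tendsto_intros LIMSEQ_ignore_initial_segment[OF L])
  have "\<bar>expectation (Z n) - expectation v\<bar> \<le> e + 2 * C * prob A + 2 * C * prob (B n)" for n
  proof -
    have "\<bar>expectation (Z n) - expectation v\<bar> = \<bar>expectation (\<lambda>x. Z n x - v x)\<bar>" using iZ iv by simp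
    also have "\<dots> \<le> expectation (\<lambda>x. \<bar>Z n x - v x\<bar>)" by (rule integral_abs_bound)
    also have "\<dots> \<le> expectation (\<lambda>x. e + 2 * C * indicator A x + 2 * C * indicator (B n) x)"
    proof (rule integral_mono)
      fix x assume x: "x \<in> space M"
      have "\<bar>Z n x - v x\<bar> \<le> 2 * C" using Zb[OF x, of n] v(2)[OF x] by linarith
      then show "\<bar>Z n x - v x\<bar> \<le> e + 2 * C * indicator A x + 2 * C * indicator (B n) x"
        using x e C by (auto simp: B_def indicator_def not_less)
    qed (use iZ iv iB iA in auto)
    also have "\<dots> = e + 2 * C * prob A + 2 * C * prob (B n)"
      using iB iA A by (simp add: prob_space)
    finally show ?thesis .
  qed
  then show ?thesis using tendsto_le[OF _ up lo] by (simp add: always_eventually)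
qed

context self_similar_bridge
begin

section \<open>The rescaled path and its limit law before time 1\<close>

lemma measurable_random_scaling:
  assumes T: "T \<in> measurable M \<Omega>" and \<tau>: "\<tau> \<in> borel_measurable M"
    and nn: "\<And>x. x \<in> space M \<Longrightarrow> 0 \<le> \<tau> x"
  shows "(\<lambda>x. sc (\<tau> x) (T x)) \<in> measurable M \<Omega>"
proof (rule measurable_coord_algebraI)
  fix x assume x: "x \<in> space M"
  have Tx: "T x \<in> D" using measurable_space[OF T x] by simp
  show "sc (\<tau> x) (T x) \<in> D"
  proof (cases "\<tau> x = 0")
    \<comment> \<open>Division by zero gives 0, so scaling with time 0 yields the zero path rather
      than an illegal value.\<close>
    case True
    have "(\<lambda>t\<in>{0..}. 0 * T x (0 + 1 * t)) \<in> D" by (rule cadlag_affine[OF Tx]) (auto simp: cone_S)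
    then show ?thesis using True by (simp add: path_scaling_def)
  qed (use sc_in_D[OF Tx] nn[OF x] in simp)
next
  fix r :: real assume r: "r \<in> {0..}"
  have "(\<lambda>x. T x (r * \<tau> x)) \<in> borel_measurable M"
    by (rule measurable_eval_random_time[OF T]) (use \<tau> nn r in auto)
  then have "(\<lambda>x. (1 / \<tau> x) powr (1 / \<gamma>) * T x (r * \<tau> x)) \<in> borel_measurable M" using \<tau> by measurable
  then show "(\<lambda>x. sc (\<tau> x) (T x) r) \<in> borel_measurable M" using r by (simp add: path_scaling_def)
qed

text \<open>Freezing the path at the target \<open>c\<close> gives a functional of the past of
  \<open>s\<close> with values in the paths on \<open>{0..1}\<close>. The cut at 1, applied after
  scaling by \<open>g\<close>, is the rescaled path, and the cut at 2 is plain restriction.\<close>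

definition trunc :: "real \<Rightarrow> (real \<Rightarrow> real) \<Rightarrow> (real \<Rightarrow> real)" where
  "trunc s f = (\<lambda>r\<in>{0..1}. if r < s then f r else c)"

lemma rescaled_path_eq: "rescaled_path \<gamma> c f = trunc 1 (sc (g f) f)"
proof -
  have "(1 / g f) powr (1 / \<gamma>) = g f powr (- 1 / \<gamma>)"
    using last_hit_bounds(1)[of f] by (simp add: powr_divide powr_minus_divide)
  then show ?thesis by (auto simp: rescaled_path_def trunc_def path_scaling_def fun_eq_iff)
qed

lemma trunc_cadlag:
  assumes h: "h \<in> D" and s: "0 < s"
  shows "trunc s h \<in> cadlag_paths S {0..1}"
proof (rule cadlag_pathsI)
  show "trunc s h \<in> {0..1} \<rightarrow>\<^sub>E S" using path_in_S[OF h] c by (auto simp: trunc_def)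
  show "(trunc s h \<longlongrightarrow> trunc s h r) (at_right r)" if r: "r \<in> {0..1}" "{0..1} \<inter> {r<..} \<noteq> {}" for r
  proof (cases "r < s")
    case True
    have "r < 1" using r by auto
    then have "\<forall>\<^sub>F t in at_right r. r < t \<and> t < min s 1"
      using True unfolding eventually_at_right_field by (intro exI[of _ "min s 1"]) auto
    then have "\<forall>\<^sub>F t in at_right r. h t = trunc s h t" by eventually_elim (use r in \<open>auto simp: trunc_def\<close>)
    moreover have "trunc s h r = h r" using True r by (simp add: trunc_def)
    ultimately show ?thesis using cadlag_right[OF h, of r] r by (auto intro: Lim_transform_eventually)
  next
    case False
    have "r < 1" using r by auto
    then have "\<forall>\<^sub>F t in at_right r. r < t \<and> t < 1" unfolding eventually_at_right_field by blast
    then have "\<forall>\<^sub>F t in at_right r. trunc s h t = trunc s h r"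
      by eventually_elim (use r False in \<open>auto simp: trunc_def\<close>)
    then show ?thesis by (rule tendsto_eventually)
  qed
  show "\<exists>l. (trunc s h \<longlongrightarrow> l) (at_left r)" if r: "r \<in> {0..1}" "0 < r" for r
  proof (cases "r \<le> s")
    case True
    obtain l where l: "(h \<longlongrightarrow> l) (at_left r)" using cadlag_left[OF h r(2)] by blast
    have "\<forall>\<^sub>F t in at_left r. 0 < t \<and> t < r" using r unfolding eventually_at_left_field by blast
    then have "\<forall>\<^sub>F t in at_left r. h t = trunc s h t" by eventually_elim (use r True in \<open>auto simp: trunc_def\<close>)
    then show ?thesis using l by (blast intro: Lim_transform_eventually)
  next
    case False
    then have "\<forall>\<^sub>F t in at_left r. s < t \<and> t < r" unfolding eventually_at_left_field by force
    then have "\<forall>\<^sub>F t in at_left r. trunc s h t = c" by eventually_elim (use r s in \<open>auto simp: trunc_def\<close>)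
    then show ?thesis by (blast intro: tendsto_eventually)
  qed
qed

lemma trunc_measurable:
  assumes "0 < s"
  shows "trunc s \<in> measurable (Ft s) (path_space S {0..1})"
proof (rule measurable_coord_algebraI)
  fix r :: real assume r: "r \<in> {0..1}"
  show "(\<lambda>f. trunc s f r) \<in> borel_measurable (Ft s)"
  proof (cases "r < s")
    case True
    then have "(\<lambda>f. f r) \<in> borel_measurable (Ft s)" using r by (intro measurable_coordinate) auto
    then show ?thesis using True r by (simp add: trunc_def)
  qed (use r in \<open>simp add: trunc_def\<close>)
qed (use trunc_cadlag assms in auto)

lemma scaled_last_hit_measurable: "(\<lambda>f. sc (g f) f) \<in> measurable P0c \<Omega>"
  by (rule measurable_random_scaling) (use last_hit_bounds in \<open>auto intro: measurable_P0cI last_hit_measurable\<close>)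

lemma scaled_last_hit_D: "f \<in> D \<Longrightarrow> sc (g f) f \<in> D"
  using measurable_space[OF scaled_last_hit_measurable, of f] by (simp add: space_P)

lemma rescaled_path_measurable: "rescaled_path \<gamma> c \<in> measurable P0c (path_space S {0..1})"
proof -
  have "trunc 1 \<in> measurable \<Omega> (path_space S {0..1})"
    using measurable_coord_algebra_mono[OF trunc_measurable[of 1], of "{0..}"] by auto
  from measurable_compose[OF scaled_last_hit_measurable this] show ?thesis
    unfolding rescaled_path_eq[abs_def] .
qed

lemma far_scaled_measurable:
  assumes "0 \<le> u" shows "{f \<in> D. far c u s \<eta> (sc (g f) f)} \<in> sets P0c"
proof -
  have "Measurable.pred (coord_algebra S {0..} {0..s}) (far c u s \<eta>)" by (rule far_measurable[OF assms]) simp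
  then have "Measurable.pred \<Omega> (far c u s \<eta>)" by (rule measurable_coord_algebra_mono) auto
  from measurable_compose[OF scaled_last_hit_measurable this]
  show ?thesis by (auto dest: predE simp: space_P)
qed

lemma scaled_left_limit:
  assumes f: "f \<in> D" "0 < g f" "Lim (at_left (g f)) f = curve (g f)"
  shows "(sc (g f) f \<longlongrightarrow> c) (at_left 1)"
proof -
  have "Lim (at_left 1) (sc (g f) f) = (1 / g f) powr (1 / \<gamma>) * Lim (at_left (g f)) f"
    using Lim_left_path_scaling[OF f(1), of "1 / g f" 1] f(2) by simp
  also have "\<dots> = c" using f by (simp add: curve_def powr_divide)
  finally show ?thesis using cadlag_Lim_left[OF scaled_last_hit_D[OF f(1)], of 1] by simp
qed

text \<open>The rescaled path has left limit \<open>c\<close> at time 1 almost surely, so the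
  indicators of the excursion events tend to 0 as \<open>u\<close> increases to 1.\<close>

lemma far_scaled_small:
  assumes "0 < \<epsilon>" "0 < \<eta>"
  shows "\<exists>u>0. u < 1 \<and> measure P0c {f \<in> D. far c u 1 \<eta> (sc (g f) f)} \<le> \<epsilon>"
proof -
  interpret M: prob_space P0c by (rule prob_P0c)
  define u where "u n = 1 - 1 / real (n + 2)" for n
  have u: "0 < u n" "u n < 1" for n by (auto simp: u_def field_simps)
  have u1: "u \<longlonglongrightarrow> 1"
  proof -
    have "(\<lambda>n. 1 - 1 / real (n + 2)) \<longlonglongrightarrow> 1 - 0"
      by (intro tendsto_intros LIMSEQ_ignore_initial_segment[OF lim_1_over_n])
    then show ?thesis by (simp add: u_def[abs_def])
  qed
  define A where "A n = {f \<in> D. far c (u n) 1 \<eta> (sc (g f) f)}" for n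
  have A: "A n \<in> sets P0c" for n unfolding A_def using u by (intro far_scaled_measurable) (simp add: less_imp_le)
  have "(\<lambda>n. \<integral>f. indicator (A n) f \<partial>P0c) \<longlonglongrightarrow> (\<integral>f. (0::real) \<partial>P0c)"
  proof (rule integral_dominated_convergence[where w="\<lambda>_. 1"])
    show "AE f in P0c. (\<lambda>n. indicator (A n) f :: real) \<longlonglongrightarrow> 0"
      using last_hit_good AE_space
    proof eventually_elim
      case (elim f)
      then have "(sc (g f) f \<longlongrightarrow> c) (at_left 1)" by (intro scaled_left_limit) (auto simp: space_P)
      from tendstoD[OF this assms(2)] obtain b where b: "b < 1" "\<And>r. b < r \<Longrightarrow> r < 1 \<Longrightarrow> \<bar>sc (g f) f r - c\<bar> < \<eta>"
        unfolding eventually_at_left_field by (auto simp: dist_real_def)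
      have "\<forall>\<^sub>F n in sequentially. b < u n" using u1 b(1) by (rule order_tendstoD)
      then have "\<forall>\<^sub>F n in sequentially. indicator (A n) f = (0::real)"
      proof eventually_elim
        case (elim n)
        then have "\<not> far c (u n) 1 \<eta> (sc (g f) f)" unfolding far_def using b(2) by (metis less_trans less_asym)
        then show ?case by (simp add: A_def)
      qed
      then show ?case by (rule tendsto_eventually)
    qed
  qed (use A in \<open>auto simp: indicator_def\<close>)
  moreover have "A n \<inter> space (P 0) = A n" for n by (auto simp: A_def space_P)
  ultimately have "(\<lambda>n. measure P0c (A n)) \<longlonglongrightarrow> 0" by simp
  then have "\<forall>\<^sub>F n in sequentially. measure P0c (A n) < \<epsilon>" using assms(1) by (rule order_tendstoD)
  then obtain n where "measure P0c (A n) < \<epsilon>" using eventually_happens by force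
  then show ?thesis using u[of n] unfolding A_def by (intro exI[of _ "u n"]) auto
qed

lemma sc_sc:
  assumes "0 < \<tau>" "0 < t" "0 \<le> r"
  shows "sc \<tau> f r = (t / \<tau>) powr (1 / \<gamma>) * sc t f (\<tau> / t * r)"
proof -
  have "(t / \<tau>) powr (1 / \<gamma>) * (1 / t) powr (1 / \<gamma>) = (1 / \<tau>) powr (1 / \<gamma>)"
    using assms by (simp flip: powr_mult)
  then show ?thesis using assms by (simp add: path_scaling_def mult.assoc[symmetric] mult.commute[of r])
qed

lemma on_grid_expectation_1: "(\<lambda>N. \<integral>f. on_grid UNIV (\<lambda>t f. 1) N f \<partial>P0c) \<longlonglongrightarrow> 1"
proof -
  interpret M: prob_space P0c by (rule prob_P0c)
  have "(\<lambda>N. \<integral>f. on_grid UNIV (\<lambda>t f. 1) (Suc N) f \<partial>P0c) \<longlonglongrightarrow> (\<integral>f. (1::real) \<partial>P0c)"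
  proof (rule integral_dominated_convergence[where w="\<lambda>_. 1"])
    show "AE f in P0c. (\<lambda>N. on_grid UNIV (\<lambda>t f. 1) (Suc N) f) \<longlonglongrightarrow> 1"
      using last_hit_good
    proof eventually_elim
      case (elim f)
      have "\<forall>\<^sub>F N in sequentially. on_grid UNIV (\<lambda>t f. 1) N f = 1"
        using eventually_grid_pos[of f] elim by (auto simp: on_grid_def elim: eventually_mono)
      then show ?case by (intro LIMSEQ_Suc tendsto_eventually)
    qed
    show "on_grid UNIV (\<lambda>t f. 1) (Suc N) \<in> borel_measurable P0c" for N by (rule on_grid_measurable) auto
  qed (auto simp: on_grid_def)
  then show ?thesis
    using filterlim_sequentially_Suc[of "\<lambda>N. \<integral>f. on_grid UNIV (\<lambda>t f. 1) N f \<partial>P0c"]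
    by (simp add: prob_space.prob_space[OF prob_P0])
qed

text \<open>With \<open>J = UNIV\<close> the mass in \<open>backward_limit\<close> tends to 1, so
  \<open>L\<close> is the limit of the expectations of \<open>G\<close> on the paths rescaled at the
  grid points.\<close>

lemma pinned_limit_compare:
  assumes G: "G \<in> borel_measurable (Ft s)" "\<And>f. f \<in> D \<Longrightarrow> \<bar>G f\<bar> \<le> C" and s: "s \<le> 1"
    and L: "pinned_limit G L"
    and v: "v \<in> borel_measurable P0c" "\<And>f. f \<in> D \<Longrightarrow> \<bar>v f\<bar> \<le> C"
    and A: "A \<in> sets P0c" and e: "0 \<le> e"
    and close: "\<And>f. \<lbrakk>f \<in> D; f \<notin> A; 0 < g f\<rbrakk> \<Longrightarrow> \<forall>\<^sub>F N in sequentially. \<bar>G (sc (grid N f) f) - v f\<bar> \<le> e"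
  shows "\<bar>L - (\<integral>f. v f \<partial>P0c)\<bar> \<le> e + 2 * C * measure P0c A"
proof -
  interpret M: prob_space P0c by (rule prob_P0c)
  have C: "0 \<le> C" using v(2) M.not_empty space_P0c by (fastforce dest: order_trans[OF abs_ge_zero])
  have G\<Omega>: "G \<in> borel_measurable \<Omega>" by (rule measurable_coord_algebra_mono[OF G(1)]) auto
  let ?X = "on_grid UNIV (\<lambda>t f. G (sc t f))"
  have "(\<lambda>N. (\<integral>f. ?X N f \<partial>P0c) - L * (\<integral>f. on_grid UNIV (\<lambda>t f. 1) N f \<partial>P0c)
      + L * (\<integral>f. on_grid UNIV (\<lambda>t f. 1) N f \<partial>P0c)) \<longlonglongrightarrow> 0 + L * 1"
    by (intro tendsto_add backward_limit[OF G s L] tendsto_mult tendsto_const on_grid_expectation_1)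
  then have lim: "(\<lambda>N. \<integral>f. ?X N f \<partial>P0c) \<longlonglongrightarrow> L" by simp
  show ?thesis
  proof (rule M.limit_compare[OF _ v(1) _ A e _ lim])
    have "?X N \<in> borel_measurable P0c" if "0 < N" for N
      using that sc_measurable_P0c[OF _ G\<Omega>] by (intro on_grid_measurable) auto
    moreover have "\<bar>?X N f\<bar> \<le> C" if "f \<in> D" for N f
      using G(2) sc_in_D[OF that] C by (auto simp: on_grid_def)
    ultimately show "\<forall>\<^sub>F N in sequentially. ?X N \<in> borel_measurable P0c \<and> (\<forall>f\<in>space P0c. \<bar>?X N f\<bar> \<le> C)"
      by (intro eventually_mono[OF eventually_gt_at_top[of "0::nat"]]) (auto simp: space_P)
    show "AE f in P0c. f \<notin> A \<longrightarrow> (\<forall>\<^sub>F N in sequentially. \<bar>?X N f - v f\<bar> \<le> e)"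
      using last_hit_good AE_space
    proof eventually_elim
      case (elim f)
      show ?case
      proof
        assume "f \<notin> A"
        then have "\<forall>\<^sub>F N in sequentially. \<bar>G (sc (grid N f) f) - v f\<bar> \<le> e"
          using elim by (intro close) (auto simp: space_P)
        moreover have "\<forall>\<^sub>F N in sequentially. 0 < grid N f" using elim by (intro eventually_grid_pos) simp
        ultimately show "\<forall>\<^sub>F N in sequentially. \<bar>?X N f - v f\<bar> \<le> e"
          by eventually_elim (simp add: on_grid_def)
      qed
    qed
  qed (use v in \<open>auto simp: space_P\<close>)
qed

lemma grid_ratio_tendsto:
  assumes "0 < g f" shows "(\<lambda>N. grid N f / g f) \<longlonglongrightarrow> 1"
proof -
  have "(\<lambda>N. grid N f) \<longlonglongrightarrow> g f" using grid_tendsto[of f] by (simp add: filterlim_at)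
  then have "(\<lambda>N. grid N f / g f) \<longlonglongrightarrow> g f / g f" using assms by (intro tendsto_intros) auto
  then show ?thesis using assms by simp
qed

lemma grid_scale_tendsto:
  assumes "0 < g f" shows "(\<lambda>N. (g f / grid N f) powr (1 / \<gamma>)) \<longlonglongrightarrow> 1"
proof -
  have "(\<lambda>N. inverse (grid N f / g f) powr (1 / \<gamma>)) \<longlonglongrightarrow> inverse 1 powr (1 / \<gamma>)"
    by (intro tendsto_intros grid_ratio_tendsto assms) auto
  then show ?thesis by simp
qed

lemma far_pred_indicator:
  assumes "0 \<le> u" "s \<le> s'"
  shows "(indicator {f. far c u s \<eta> f} :: _ \<Rightarrow> real) \<in> borel_measurable (Ft s')"
proof -
  have [measurable]: "Measurable.pred (Ft s') (far c u s \<eta>)" by (rule far_measurable[OF assms])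
  have "(\<lambda>f. if far c u s \<eta> f then 1 else 0 :: real) \<in> borel_measurable (Ft s')" by measurable
  then show ?thesis by (simp add: indicator_def)
qed

text \<open>The same \<open>u\<close> serves all \<open>s < 1\<close>, because \<open>s\<close>
  enters only through the inclusion of excursions before \<open>s\<close> in excursions before 1.
  Uniformity of \<open>u\<close> in \<open>s\<close> is what allows \<open>s\<close> to approach 1
  later.\<close>

lemma far_pinned_small:
  assumes "0 < \<epsilon>" "0 < \<eta>"
  shows "\<exists>u>0. u < 1 \<and> (\<forall>s L. u < s \<longrightarrow> s < 1 \<longrightarrow> pinned_limit (indicator {f. far c u s \<eta> f}) L \<longrightarrow> L \<le> \<epsilon>)"
proof -
  have "0 < \<epsilon> / 2" "0 < \<eta> / 2" using assms by auto
  from far_scaled_small[OF this] obtain u' where u': "0 < u'" "u' < 1"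
    "measure P0c {f \<in> D. far c u' 1 (\<eta> / 2) (sc (g f) f)} \<le> \<epsilon> / 2" by blast
  \<comment> \<open>The margin between \<open>u'\<close> and \<open>u\<close> absorbs the change of
    clock: the ratio \<open>grid N f / g f\<close> tends to 1, so it eventually maps times beyond
    \<open>u\<close> to times beyond \<open>u'\<close>.\<close>
  define u where "u = (1 + u') / 2"
  have u: "u' < u" "0 < u" "u < 1" using u' by (auto simp: u_def)
  define A where "A = {f \<in> D. far c u' 1 (\<eta> / 2) (sc (g f) f)}"
  have "L \<le> \<epsilon>" if s: "u < s" "s < 1" and L: "pinned_limit (indicator {f. far c u s \<eta> f}) L" for s L
  proof -
    have "\<bar>L - (\<integral>f. 0 \<partial>P0c)\<bar> \<le> 0 + 2 * 1 * measure P0c A"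
    proof (rule pinned_limit_compare[OF _ _ _ L])
      show "(indicator {f. far c u s \<eta> f} :: _ \<Rightarrow> real) \<in> borel_measurable (Ft s)" using u by (intro far_pred_indicator) auto
      show "A \<in> sets P0c" unfolding A_def using u' by (intro far_scaled_measurable) simp
      fix f assume f: "f \<in> D" "f \<notin> A" "0 < g f"
      \<comment> \<open>Off \<open>A\<close> the path is bounded by
        \<open>\<bar>c\<bar> + \<eta> / 2\<close> on the relevant stretch, so the change of scale
        moves it by at most this quantity, which uses up the second half of
        \<open>\<eta>\<close>.\<close>
      have "(\<lambda>N. ((g f / grid N f) powr (1 / \<gamma>) - 1) * (\<bar>c\<bar> + \<eta> / 2)) \<longlonglongrightarrow> (1 - 1) * (\<bar>c\<bar> + \<eta> / 2)"
        by (intro tendsto_intros grid_scale_tendsto f)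
      from order_tendstoD(2)[OF this, of "\<eta> / 2"]
      have "\<forall>\<^sub>F N in sequentially. ((g f / grid N f) powr (1 / \<gamma>) - 1) * (\<bar>c\<bar> + \<eta> / 2) < \<eta> / 2"
        using assms by simp
      moreover have "\<forall>\<^sub>F N in sequentially. u' / u < grid N f / g f"
        using u by (intro order_tendstoD(1)[OF grid_ratio_tendsto] f) simp
      ultimately have "\<forall>\<^sub>F N in sequentially. \<not> far c u s \<eta> (sc (grid N f) f)"
        using eventually_grid_pos[OF f(3)] eventually_gt_at_top[of 0]
      proof eventually_elim
        case (elim N)
        define a where "a = grid N f / g f"
        define k where "k = (g f / grid N f) powr (1 / \<gamma>)"
        have a: "0 < a" "a < 1" "u' < a * u" using elim f grid_bounds(1)[of N f] u
          by (auto simp: a_def pos_divide_less_eq)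
        have "1 \<le> k" unfolding k_def using elim grid_bounds(1)[of N f] \<gamma> by (intro ge_one_powr_ge_zero) auto
        have "\<bar>sc (grid N f) f r - c\<bar> \<le> \<eta>" if r: "u < r" "r < s" for r
        proof -
          have "u' < a * r" using a r mult_strict_left_mono[of u r a] by linarith
          moreover have "a * r < 1" using a r s u mult_strict_mono[of a 1 r 1] by simp
          moreover have "\<not> far c u' 1 (\<eta> / 2) (sc (g f) f)" using f(1,2) by (simp add: A_def)
          ultimately have b: "\<bar>sc (g f) f (a * r) - c\<bar> \<le> \<eta> / 2" unfolding far_def by (meson not_less)
          then have "\<bar>sc (g f) f (a * r)\<bar> \<le> \<bar>c\<bar> + \<eta> / 2" by linarith
          then have "(k - 1) * \<bar>sc (g f) f (a * r)\<bar> \<le> (k - 1) * (\<bar>c\<bar> + \<eta> / 2)"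
            using \<open>1 \<le> k\<close> by (intro mult_left_mono) auto
          moreover have "\<bar>(k - 1) * sc (g f) f (a * r)\<bar> = (k - 1) * \<bar>sc (g f) f (a * r)\<bar>"
            using \<open>1 \<le> k\<close> by (simp add: abs_mult)
          moreover have "sc (grid N f) f r - c = (k - 1) * sc (g f) f (a * r) + (sc (g f) f (a * r) - c)"
            using sc_sc[of "grid N f" "g f" r f] elim f r u by (simp add: a_def k_def algebra_simps)
          ultimately show ?thesis using b elim(1) unfolding k_def[symmetric] by linarith
        qed
        then show ?case unfolding far_def by (meson not_less)
      qed
      then show "\<forall>\<^sub>F N in sequentially. \<bar>indicator {f. far c u s \<eta> f} (sc (grid N f) f) - 0\<bar> \<le> (0::real)"
        by eventually_elim simp
    qed (use s in \<open>auto simp: indicator_def\<close>)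
    then show ?thesis using u'(3) by (simp add: A_def)
  qed
  then show ?thesis using u by blast
qed

section \<open>Reduction to tightness at the endpoint\<close>

text \<open>A positive density at \<open>c\<close> does not by itself exclude that
  \<open>\<mu>\<close> vanishes near \<open>c\<close>. If the ball were null, scaling would make the
  analogous event null at every positive rational time, contradicting that the path rescaled at the
  grid points, which are rational, ends near \<open>c\<close>.\<close>

lemma law_at_1_pos: "0 < \<delta> \<Longrightarrow> 0 < measure (P 0) {f \<in> D. f 1 \<in> ball c \<delta>}"
proof (rule ccontr)
  interpret P0: prob_space "P 0" by (rule prob_P0)
  assume \<delta>: "0 < \<delta>" and "\<not> 0 < measure (P 0) {f \<in> D. f 1 \<in> ball c \<delta>}"
  then have z: "measure (P 0) {f \<in> D. f 1 \<in> ball c \<delta>} = 0" using measure_nonneg by (simp add: not_less order_antisym)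
  have meas1: "{f \<in> D. f 1 \<in> ball c \<delta>} \<in> sets (P 0)"
    using measurable_sets[OF measurable_coordinate[of 1 "{0..}" S "{0..}"], of "ball c \<delta>"]
    by (simp add: vimage_def Int_def conj_commute sets_P)
  have "AE f in P 0. f \<notin> {f \<in> D. f 1 \<in> ball c \<delta>}" using z P0.prob_eq_0[OF meas1] by simp
  then have "AE f in P 0. f 1 \<notin> ball c \<delta>" using AE_space by eventually_elim (auto simp: space_P)
  then have "AE f in P 0. sc q f 1 \<notin> ball c \<delta>" if q: "0 < q" for q
  proof -
    have m: "sc q \<in> measurable (P 0) \<Omega>" using measurable_path_scaling[OF _ cone_S, of "1 / q"] q by (simp add: measurable_P)
    have "distr (P 0) \<Omega> (sc q) = P 0" using scaling[OF zero_S, of "1 / q"] q by simp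
    then have "AE f in distr (P 0) \<Omega> (sc q). f 1 \<notin> ball c \<delta>" using \<open>AE f in P 0. f 1 \<notin> ball c \<delta>\<close> by (simp only:)
    then show ?thesis by (rule AE_distrD[OF m])
  qed
  then have "AE f in P 0. \<forall>q::rat. 0 < q \<longrightarrow> sc (of_rat q) f 1 \<notin> ball c \<delta>"
    by (subst AE_all_countable) auto
  moreover have "AE f in P 0. 0 < g f \<and> Lim (at_left (g f)) f = curve (g f)"
    using last_hit_good by (simp add: AE_completion_iff)
  ultimately have "AE f in P 0. False"
    using AE_space
  proof eventually_elim
    case (elim f)
    then have "(\<lambda>N. sc (grid N f) f 1) \<longlonglongrightarrow> c" by (intro endpoint_tendsto) (auto simp: space_P)
    from tendstoD[OF this \<delta>] have "\<forall>\<^sub>F N in sequentially. dist (sc (grid N f) f 1) c < \<delta>" .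
    moreover have "\<forall>\<^sub>F N in sequentially. 0 < grid N f" using elim by (intro eventually_grid_pos) simp
    ultimately have "\<forall>\<^sub>F N in sequentially. False"
    proof eventually_elim
      case (elim N)
      have "grid N f = of_rat (of_int (\<lceil>real N * g f\<rceil> - 1) / of_nat N)" by (simp add: grid_def of_rat_divide of_rat_diff)
      then obtain q :: rat where "grid N f = of_rat q" by blast
      then show ?case
        using elim \<open>\<forall>q::rat. 0 < q \<longrightarrow> sc (of_rat q) f 1 \<notin> ball c \<delta>\<close> by (auto simp: dist_commute)
    qed
    then show ?case by simp
  qed
  then show False by simp
qed

lemma pinned_law_integral:
  fixes F :: "(real \<Rightarrow> real) \<Rightarrow> real"
  assumes \<delta>: "0 < \<delta>" and F: "F \<in> borel_measurable (path_space S {0..1})"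
  shows "(\<integral>f. F f \<partial>pinned_law S P 1 0 c \<delta>) =
      (\<integral>f. F (trunc 2 f) * indicator (ball c \<delta>) (f 1) \<partial>P 0) / measure (P 0) {f \<in> D. f 1 \<in> ball c \<delta>}"
    and "prob_space (pinned_law S P 1 0 c \<delta>)"
    and "sets (pinned_law S P 1 0 c \<delta>) = sets (path_space S {0..1})"
proof -
  interpret P0: prob_space "P 0" by (rule prob_P0)
  define A where "A = {f \<in> D. f 1 \<in> ball c \<delta>}"
  have A: "A \<in> sets (P 0)"
    using measurable_sets[OF measurable_coordinate[of 1 "{0..}" S "{0..}"], of "ball c \<delta>"]
    by (simp add: A_def vimage_def Int_def conj_commute sets_P)
  have pos: "0 < measure (P 0) A" unfolding A_def by (rule law_at_1_pos[OF \<delta>])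
  have restr: "(\<lambda>f. restrict f {0..1}) = trunc 2" by (auto simp: trunc_def fun_eq_iff)
  have tm: "trunc 2 \<in> measurable (P 0) (path_space S {0..1})"
    using measurable_coord_algebra_mono[OF trunc_measurable[of 2], of "{0..}"] by (simp add: measurable_P)
  have um: "uniform_measure (P 0) A = density (P 0) (\<lambda>f. ennreal (indicator A f / measure (P 0) A))"
    unfolding uniform_measure_def
    using pos by (simp add: P0.emeasure_eq_measure divide_ennreal[symmetric] ennreal_indicator)
  have pl: "pinned_law S P 1 0 c \<delta> = distr (uniform_measure (P 0) A) (path_space S {0..1}) (trunc 2)"
    unfolding pinned_law_def A_def restr ..
  have tm': "trunc 2 \<in> measurable (uniform_measure (P 0) A) (path_space S {0..1})"
    using tm by (simp add: uniform_measure_def)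
  show "sets (pinned_law S P 1 0 c \<delta>) = sets (path_space S {0..1})" by (simp add: pinned_law_def)
  have "prob_space (uniform_measure (P 0) A)"
    using pos by (intro prob_space_uniform_measure) (auto simp: P0.emeasure_eq_measure)
  then show "prob_space (pinned_law S P 1 0 c \<delta>)" unfolding pl by (rule prob_space.prob_space_distr[OF _ tm'])
  have FT: "(\<lambda>f. F (trunc 2 f)) \<in> borel_measurable (P 0)" by (rule measurable_compose[OF tm F])
  have "(\<integral>f. F f \<partial>pinned_law S P 1 0 c \<delta>) = (\<integral>f. F (trunc 2 f) \<partial>uniform_measure (P 0) A)"
    unfolding pl by (rule integral_distr[OF tm' F])
  also have "\<dots> = (\<integral>f. (indicator A f / measure (P 0) A) * F (trunc 2 f) \<partial>P 0)"
    unfolding um using A FT pos by (intro integral_real_density) (auto simp: less_imp_le)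
  also have "\<dots> = (\<integral>f. (F (trunc 2 f) * indicator (ball c \<delta>) (f 1)) / measure (P 0) A \<partial>P 0)"
    by (intro Bochner_Integration.integral_cong refl) (auto simp: A_def indicator_def space_P)
  finally show "(\<integral>f. F f \<partial>pinned_law S P 1 0 c \<delta>) =
      (\<integral>f. F (trunc 2 f) * indicator (ball c \<delta>) (f 1) \<partial>P 0) / measure (P 0) {f \<in> D. f 1 \<in> ball c \<delta>}"
    by (simp add: A_def)
qed

text \<open>Before \<open>s\<close> the two paths differ by a slower clock with rate
  \<open>a\<close> and a factor \<open>k\<close>. After \<open>s\<close> one path is frozen at
  \<open>c\<close> and the other stays within \<open>e\<close> of \<open>c\<close>, so the clock may
  there catch up freely.\<close>

lemma skorohod_close_trunc:
  assumes a: "0 < a" "a < 1" and s: "0 < s" "s < 1" and k: "1 \<le> k"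
    and h': "\<And>r. 0 \<le> r \<Longrightarrow> h' r = k * h (a * r)"
    and B: "\<And>r. 0 \<le> r \<Longrightarrow> r < 1 \<Longrightarrow> \<bar>h r\<bar> \<le> B" and e: "(k - 1) * B \<le> e" "1 - a \<le> e"
    and end1: "\<And>r. a * s \<le> r \<Longrightarrow> r < 1 \<Longrightarrow> \<bar>h r - c\<bar> \<le> e"
  shows "skorohod_close 1 (trunc s h') (trunc 1 h) e"
proof -
  define \<kappa> where "\<kappa> = (1 - a * s) / (1 - s)"
  have as: "a * s < s" "0 < a * s" using a s by auto
  have \<kappa>: "1 \<le> \<kappa>" "(1 - s) * \<kappa> = 1 - a * s" using s as a by (auto simp: \<kappa>_def pos_le_divide_eq)
  \<comment> \<open>The slope is \<open>a\<close> up to \<open>s\<close> and \<open>\<kappa>\<close>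
    afterwards; the two lines meet at \<open>s\<close>. Writing it as a maximum gives continuity and
    strict monotonicity at once.\<close>
  define l where "l r = max (a * r) (1 - (1 - r) * \<kappa>)" for r
  have sm: "l r < l t" if "r < t" for r t
  proof -
    have "a * r < a * t" "(1 - t) * \<kappa> < (1 - r) * \<kappa>" using that a \<kappa> by auto
    then show ?thesis unfolding l_def by linarith
  qed
  have l01: "l 0 = 0" "l 1 = 1" using \<kappa> a by (auto simp: l_def)
  have cont: "continuous_on {0..1} l" unfolding l_def by (intro continuous_intros)
  have tc: "l \<in> time_changes 1"
    unfolding time_changes_def
  proof (intro CollectI conjI)
    show "strict_mono_on {0..1} l" using sm by (auto simp: strict_mono_on_def)
    show "l ` {0..1} = {0..1}"
    proof (intro equalityI subsetI)
      fix y assume "y \<in> l ` {0..1}"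
      then obtain r where r: "0 \<le> r" "r \<le> 1" "y = l r" by auto
      then show "y \<in> {0..1}" using sm[of 0 r] sm[of r 1] l01 by (cases "r = 0"; cases "r = 1") auto
    next
      fix y :: real assume "y \<in> {0..1}"
      then obtain r where "0 \<le> r" "r \<le> 1" "l r = y" using IVT'[of l 0 y 1] l01 cont by auto
      then show "y \<in> l ` {0..1}" by auto
    qed
  qed
  have e0: "0 \<le> e" using e a by linarith
  have "\<bar>l r - r\<bar> \<le> e \<and> \<bar>trunc s h' r - trunc 1 h (l r)\<bar> \<le> e" if r: "r \<in> {0..1}" for r
  proof
    have "1 * (1 - r) \<le> \<kappa> * (1 - r)" using \<kappa> r by (intro mult_right_mono) auto
    then have "1 - (1 - r) * \<kappa> \<le> r" by (simp add: mult.commute)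
    moreover have "a * r \<le> r" using a r by (simp add: mult_left_le_one_le)
    moreover have "r - a * r \<le> 1 - a"
    proof -
      have "(1 - a) * r \<le> (1 - a) * 1" using a r by (intro mult_left_mono) auto
      then show ?thesis by (simp add: algebra_simps)
    qed
    ultimately show "\<bar>l r - r\<bar> \<le> e" using e unfolding l_def by linarith
    show "\<bar>trunc s h' r - trunc 1 h (l r)\<bar> \<le> e"
    proof (cases "r < s")
      case True
      have "1 - (1 - r) * \<kappa> \<le> a * r"
      proof -
        have "1 * (s - r) \<le> \<kappa> * (s - r)" using \<kappa> True by (intro mult_right_mono) auto
        moreover have "a * (s - r) \<le> 1 * (s - r)" using a True by (intro mult_right_mono) auto
        moreover have "1 - (1 - r) * \<kappa> = a * s - \<kappa> * (s - r)" using \<kappa>(2) by (simp add: algebra_simps)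
        ultimately show ?thesis by (simp add: algebra_simps)
      qed
      then have lr: "l r = a * r" by (simp add: l_def)
      have ar: "0 \<le> a * r" "a * r < 1" using a r True s mult_strict_mono[of a 1 r 1] by (auto simp: mult_left_le_one_le le_less_trans[of "a * r" r 1])
      have "trunc s h' r - trunc 1 h (l r) = (k - 1) * h (a * r)"
        using ar r True h'[of r] by (simp add: lr trunc_def algebra_simps)
      then have "\<bar>trunc s h' r - trunc 1 h (l r)\<bar> = (k - 1) * \<bar>h (a * r)\<bar>" using k by (simp add: abs_mult)
      also have "\<dots> \<le> (k - 1) * B" using k B[OF ar] by (intro mult_left_mono) auto
      finally show ?thesis using e by linarith
    next
      case False
      have lr: "a * s \<le> l r"
      proof -
        have "a * s \<le> a * r" using a False by simp
        then show ?thesis unfolding l_def by linarith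
      qed
      have "l r \<le> 1" using sm[of r 1] l01 r by (cases "r = 1") auto
      then show ?thesis using end1[OF lr] False r e0 lr as
        by (cases "l r = 1") (auto simp: trunc_def abs_minus_commute)
    qed
  qed
  then show ?thesis unfolding skorohod_close_def using tc by blast
qed

text \<open>A bound on the conditional probability, written without division. One \<open>d\<close>
  has to serve the whole interval \<open>(u, 1)\<close>.\<close>

definition end_tight :: bool where
  "end_tight \<longleftrightarrow> (\<forall>\<epsilon>>0. \<forall>\<eta>>0. \<exists>u d. 0 < u \<and> u < 1 \<and> 0 < d \<and> (\<forall>\<delta>. 0 < \<delta> \<longrightarrow> \<delta> < d \<longrightarrow>
     measure (P 0) {f \<in> D. far c u 1 \<eta> f \<and> f 1 \<in> ball c \<delta>} \<le> \<epsilon> * measure (P 0) {f \<in> D. f 1 \<in> ball c \<delta>}))"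

text \<open>Both sides are compared with the value \<open>L\<close> of the bridge for the functional
  cut at a time \<open>s\<close> close to 1. On the side of the pinned law the cut is paid for by
  \<open>end_tight\<close>, on the side of the rescaled path by its left limit \<open>c\<close> at
  1.\<close>

lemma pinned_law_lipschitz_limit:
  assumes tight: end_tight
    and F: "F \<in> borel_measurable (path_space S {0..1})" and K: "0 \<le> K"
    and C: "\<And>f. f \<in> cadlag_paths S {0..1} \<Longrightarrow> \<bar>F f\<bar> \<le> C"
    and lip: "\<And>f h e. \<lbrakk>f \<in> cadlag_paths S {0..1}; h \<in> cadlag_paths S {0..1}; 0 < e; skorohod_close 1 f h e\<rbrakk> \<Longrightarrow>
          \<bar>F f - F h\<bar> \<le> K * e"
  shows "((\<lambda>\<delta>. \<integral>f. F f \<partial>pinned_law S P 1 0 c \<delta>) \<longlongrightarrow> (\<integral>f. F (rescaled_path \<gamma> c f) \<partial>P0c)) (at_right 0)"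
proof (rule tendstoI)
  interpret P0: prob_space "P 0" by (rule prob_P0)
  fix r :: real assume r: "0 < r"
  obtain f0 where "f0 \<in> D" using P0.not_empty by (auto simp: space_P)
  then have "trunc 1 f0 \<in> cadlag_paths S {0..1}" by (rule trunc_cadlag) simp
  then have C0: "0 \<le> C" using C by (meson abs_ge_zero order_trans)
  define \<eta> where "\<eta> = r / (12 * (K + 1))"
  define \<epsilon> where "\<epsilon> = r / (12 * (C + 1))"
  have \<eta>: "0 < \<eta>" "K * \<eta> \<le> r / 12" using r K by (auto simp: \<eta>_def field_simps)
  have \<epsilon>: "0 < \<epsilon>" "C * \<epsilon> \<le> r / 12" "\<epsilon> \<le> r / 12" using r C0 by (auto simp: \<epsilon>_def field_simps)
  obtain u1 where u1: "0 < u1" "u1 < 1" "measure P0c {f \<in> D. far c u1 1 \<eta> (sc (g f) f)} \<le> \<epsilon>"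
    using far_scaled_small[OF \<epsilon>(1) \<eta>(1)] by blast
  obtain u2 d where u2: "0 < u2" "u2 < 1" "0 < d" "\<And>\<delta>. 0 < \<delta> \<Longrightarrow> \<delta> < d \<Longrightarrow>
     measure (P 0) {f \<in> D. far c u2 1 \<eta> f \<and> f 1 \<in> ball c \<delta>} \<le> \<epsilon> * measure (P 0) {f \<in> D. f 1 \<in> ball c \<delta>}"
    using tight[unfolded end_tight_def, rule_format, OF \<epsilon>(1) \<eta>(1)] by blast
  define u where "u = max u1 u2"
  \<comment> \<open>The cut is placed strictly after \<open>u\<close>, so that after a slight change
    of clock it is still beyond \<open>u\<close>.\<close>
  define s where "s = (1 + u) / 2"
  have u: "0 < u" "u < 1" and s: "u < s" "0 < s" "s < 1" using u1 u2 by (auto simp: u_def s_def)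
  define G where "G f = F (trunc s f)" for f
  have Gm: "G \<in> borel_measurable (Ft s)" unfolding G_def by (rule measurable_compose[OF trunc_measurable[OF s(2)] F])
  have Gb: "\<bar>G f\<bar> \<le> C" if "f \<in> D" for f unfolding G_def using that s by (intro C trunc_cadlag)
  obtain L where L: "pinned_limit G L" using pinned_limit_exists[OF Gm Gb s(2,3)] by blast
  have Y_D: "rescaled_path \<gamma> c f \<in> cadlag_paths S {0..1}" if "f \<in> D" for f
    unfolding rescaled_path_eq by (intro trunc_cadlag scaled_last_hit_D that) simp
  define A where "A = {f \<in> D. far c u1 1 \<eta> (sc (g f) f)}"
  have 1: "\<bar>L - (\<integral>f. F (rescaled_path \<gamma> c f) \<partial>P0c)\<bar> \<le> K * (2 * \<eta>) + 2 * C * measure P0c A"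
  proof (rule pinned_limit_compare[OF Gm Gb _ L])
    show "(\<lambda>f. F (rescaled_path \<gamma> c f)) \<in> borel_measurable P0c"
      by (rule measurable_compose[OF rescaled_path_measurable F])
    show "\<bar>F (rescaled_path \<gamma> c f)\<bar> \<le> C" if "f \<in> D" for f using that by (intro C Y_D)
    show "A \<in> sets P0c" unfolding A_def using u1 by (intro far_scaled_measurable) simp
    fix f assume f: "f \<in> D" "f \<notin> A" "0 < g f"
    \<comment> \<open>The bound depends on the path, which is harmless: closeness is needed only
      eventually in \<open>N\<close> for each path separately.\<close>
    obtain B where B: "\<And>r. r \<in> {0..1} \<Longrightarrow> \<bar>trunc 1 (sc (g f) f) r\<bar> \<le> B"
      using cadlag_bounded[OF trunc_cadlag[OF scaled_last_hit_D[OF f(1)], of 1]] by fastforce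
    have "(\<lambda>N. ((g f / grid N f) powr (1 / \<gamma>) - 1) * B) \<longlonglongrightarrow> (1 - 1) * B"
      by (intro tendsto_intros grid_scale_tendsto f)
    from order_tendstoD(2)[OF this, of \<eta>]
    have "\<forall>\<^sub>F N in sequentially. ((g f / grid N f) powr (1 / \<gamma>) - 1) * B < \<eta>" using \<eta> by simp
    moreover have "\<forall>\<^sub>F N in sequentially. max (1 - \<eta>) (u / s) < grid N f / g f"
      using s \<eta> by (intro order_tendstoD(1)[OF grid_ratio_tendsto] f) simp
    ultimately show "\<forall>\<^sub>F N in sequentially. \<bar>G (sc (grid N f) f) - F (rescaled_path \<gamma> c f)\<bar> \<le> K * (2 * \<eta>)"
      using eventually_grid_pos[OF f(3)] eventually_gt_at_top[of 0]
    proof eventually_elim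
      case (elim N)
      define a where "a = grid N f / g f"
      define k where "k = (g f / grid N f) powr (1 / \<gamma>)"
      have a: "0 < a" "a < 1" using elim f grid_bounds(1)[of N f] by (auto simp: a_def pos_divide_less_eq)
      have "u / s < a" using elim by (simp add: a_def)
      then have aus: "u < a * s" using s by (simp add: pos_divide_less_eq)
      have k1: "1 \<le> k" unfolding k_def using elim grid_bounds(1)[of N f] \<gamma> by (intro ge_one_powr_ge_zero) auto
      have "skorohod_close 1 (trunc s (sc (grid N f) f)) (trunc 1 (sc (g f) f)) (2 * \<eta>)"
      proof (rule skorohod_close_trunc[OF a s(2,3) k1])
        show "sc (grid N f) f r = k * sc (g f) f (a * r)" if "0 \<le> r" for r
          using sc_sc[of "grid N f" "g f" r f] elim f that by (simp add: a_def k_def)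
        show "\<bar>sc (g f) f r\<bar> \<le> B" if "0 \<le> r" "r < 1" for r using B[of r] that by (simp add: trunc_def)
        show "(k - 1) * B \<le> 2 * \<eta>" using elim \<eta> unfolding k_def by linarith
        show "1 - a \<le> 2 * \<eta>" using elim \<eta> unfolding a_def by linarith
        show "\<bar>sc (g f) f r - c\<bar> \<le> 2 * \<eta>" if "a * s \<le> r" "r < 1" for r
        proof -
          have "\<not> far c u1 1 \<eta> (sc (g f) f)" using f(1,2) by (simp add: A_def)
          moreover have "u1 < r" using that aus by (simp add: u_def)
          ultimately have "\<bar>sc (g f) f r - c\<bar> \<le> \<eta>" using that unfolding far_def by (meson not_less)
          then show ?thesis using \<eta> by linarith
        qed
      qed
      then show ?case unfolding G_def rescaled_path_eq
        using s f elim \<eta> by (intro lip trunc_cadlag sc_in_D scaled_last_hit_D) auto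
    qed
  qed (use s K \<eta> in auto)
  then have "\<bar>L - (\<integral>f. F (rescaled_path \<gamma> c f) \<partial>P0c)\<bar> \<le> 2 * (r / 12) + 2 * (r / 12)"
    using \<eta>(2) \<epsilon>(2) mult_left_mono[OF u1(3) C0] by (simp add: A_def)
  then have YL: "\<bar>L - (\<integral>f. F (rescaled_path \<gamma> c f) \<partial>P0c)\<bar> \<le> r / 3" by simp
  obtain \<delta>0 where \<delta>0: "0 < \<delta>0" "\<And>h. localizer \<delta>0 h \<Longrightarrow>
     \<bar>(\<integral>f. G f * h (f 1) \<partial>P 0) - L * (\<integral>f. h (f 1) \<partial>P 0)\<bar> \<le> r / 12 * (\<integral>f. h (f 1) \<partial>P 0)"
    using L[unfolded pinned_limit_def, rule_format, of "r / 12"] r by auto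
  have GP: "G \<in> borel_measurable (P 0)"
    using measurable_coord_algebra_mono[OF Gm, of "{0..}"] by (simp add: measurable_P)
  have PL: "\<bar>(\<integral>f. F f \<partial>pinned_law S P 1 0 c \<delta>) - L\<bar> \<le> r / 2" if \<delta>: "0 < \<delta>" "\<delta> < min d (min \<delta>0 \<eta>)" for \<delta>
  proof -
    define m where "m = measure (P 0) {f \<in> D. f 1 \<in> ball c \<delta>}"
    define b where "b f = (indicator (ball c \<delta>) (f 1) :: real)" for f :: "real \<Rightarrow> real"
    define H where "H = {f \<in> D. far c u2 1 \<eta> f \<and> f 1 \<in> ball c \<delta>}"
    have m: "0 < m" unfolding m_def by (rule law_at_1_pos[OF \<delta>(1)])
    have c1: "(\<lambda>f. f 1) \<in> borel_measurable (P 0)" using measurable_coordinate[of 1 "{0..}" S "{0..}"] by (simp add: measurable_P)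
    have bm: "b \<in> borel_measurable (P 0)" unfolding b_def
      by (rule measurable_compose[OF c1]) (rule borel_measurable_indicator, simp)
    have mball: "{f \<in> D. f 1 \<in> ball c \<delta>} \<in> sets (P 0)"
      using measurable_sets[OF c1, of "ball c \<delta>"] by (simp add: vimage_def Int_def conj_commute space_P)
    have Em: "(\<integral>f. b f \<partial>P 0) = m"
    proof -
      have "(\<integral>f. b f \<partial>P 0) = (\<integral>f. indicator {f \<in> D. f 1 \<in> ball c \<delta>} f \<partial>P 0)"
        by (intro Bochner_Integration.integral_cong refl) (auto simp: b_def indicator_def space_P)
      also have "\<dots> = m"
      proof -
        have "{f \<in> D. f 1 \<in> ball c \<delta>} \<inter> space (P 0) = {f \<in> D. f 1 \<in> ball c \<delta>}" by (auto simp: space_P)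
        then show ?thesis by (simp add: m_def)
      qed
      finally show ?thesis .
    qed
    have Hm: "H \<in> sets (P 0)"
    proof -
      have "Measurable.pred \<Omega> (far c u2 1 \<eta>)"
        by (rule measurable_coord_algebra_mono[OF far_measurable[of u2 1 1]]) (use u2 in auto)
      then have "{f \<in> D. far c u2 1 \<eta> f} \<in> sets (P 0)" by (auto dest: predE simp: sets_P)
      moreover have "H = {f \<in> D. far c u2 1 \<eta> f} \<inter> {f \<in> D. f 1 \<in> ball c \<delta>}" by (auto simp: H_def)
      ultimately show ?thesis using mball by simp
    qed
    \<comment> \<open>Without an excursion after \<open>u2\<close>, and with endpoint in the ball,
      freezing at \<open>s\<close> moves the path by at most \<open>\<eta>\<close>, even with the
      identity as time change.\<close>
    have ptw: "\<bar>F (trunc 2 f) * b f - G f * b f\<bar> \<le> K * \<eta> * b f + 2 * C * indicator H f" if f: "f \<in> D" for f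
    proof (cases "f 1 \<in> ball c \<delta>")
      case True
      then have b1: "b f = 1" by (simp add: b_def)
      show ?thesis
      proof (cases "f \<in> H")
        case True
        have "\<bar>F (trunc 2 f)\<bar> \<le> C" "\<bar>G f\<bar> \<le> C" using C[OF trunc_cadlag[OF f]] Gb[OF f] by auto
        then show ?thesis using True b1 \<eta> K by (simp add: add_increasing)
      next
        case False
        then have nf: "\<not> far c u2 1 \<eta> f" using True f by (simp add: H_def)
        have "skorohod_close 1 (trunc 2 f) (trunc s f) \<eta>"
          unfolding skorohod_close_def
        proof (intro bexI[OF _ time_changes_id] ballI conjI)
          fix t :: real assume t: "t \<in> {0..1}"
          show "\<bar>trunc 2 f t - trunc s f t\<bar> \<le> \<eta>"
          proof (cases "t < s")
            case False
            have "\<bar>f t - c\<bar> \<le> \<eta>"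
            proof (cases "t = 1")
              case True
              then show ?thesis using \<open>f 1 \<in> ball c \<delta>\<close> \<delta> by (simp add: dist_real_def abs_minus_commute)
            next
              case nt: False
              have "u2 < t" "t < 1" using False s t nt by (auto simp: u_def)
              then show ?thesis using nf unfolding far_def by (meson not_less)
            qed
            then show ?thesis using t False by (simp add: trunc_def)
          qed (use t \<eta> in \<open>simp add: trunc_def\<close>)
        qed (use \<eta> in simp)
        then have "\<bar>F (trunc 2 f) - G f\<bar> \<le> K * \<eta>" unfolding G_def
          using \<eta> s f by (intro lip trunc_cadlag) auto
        then show ?thesis using b1 False by simp
      qed
    qed (use C0 in \<open>simp add: b_def\<close>)
    have tm: "(\<lambda>f. F (trunc 2 f)) \<in> borel_measurable (P 0)"
      using measurable_compose[OF measurable_coord_algebra_mono[OF trunc_measurable[of 2], of "{0..}"] F]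
      by (simp add: measurable_P)
    have i1: "integrable (P 0) (\<lambda>f. F (trunc 2 f) * b f)"
    proof (rule P0.integrable_const_bound[of _ C])
      show "AE f in P 0. norm (F (trunc 2 f) * b f) \<le> C"
      proof (rule AE_I2)
        fix f assume "f \<in> space (P 0)"
        then have "\<bar>F (trunc 2 f)\<bar> \<le> C" by (intro C trunc_cadlag) (auto simp: space_P)
        then show "norm (F (trunc 2 f) * b f) \<le> C" using C0 by (simp add: b_def indicator_def)
      qed
    qed (use tm bm in auto)
    have i2: "integrable (P 0) (\<lambda>f. G f * b f)"
    proof (rule P0.integrable_const_bound[of _ C])
      show "AE f in P 0. norm (G f * b f) \<le> C"
        using Gb C0 by (intro AE_I2) (auto simp: b_def indicator_def space_P)
    qed (use GP bm in auto)
    have i3: "integrable (P 0) b" by (rule P0.integrable_const_bound[of _ 1]) (use bm in \<open>auto simp: b_def indicator_def\<close>)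
    have i4: "integrable (P 0) (indicator H :: _ \<Rightarrow> real)"
      by (rule P0.integrable_const_bound[of _ 1]) (use Hm in \<open>auto simp: indicator_def\<close>)
    have "\<bar>(\<integral>f. F (trunc 2 f) * b f \<partial>P 0) - (\<integral>f. G f * b f \<partial>P 0)\<bar> = \<bar>\<integral>f. F (trunc 2 f) * b f - G f * b f \<partial>P 0\<bar>"
      using i1 i2 by simp
    also have "\<dots> \<le> (\<integral>f. \<bar>F (trunc 2 f) * b f - G f * b f\<bar> \<partial>P 0)" by (rule integral_abs_bound)
    also have "\<dots> \<le> (\<integral>f. K * \<eta> * b f + 2 * C * indicator H f \<partial>P 0)"
      using i1 i2 i3 i4 ptw by (intro integral_mono) (auto simp: space_P)
    also have "\<dots> = K * \<eta> * m + 2 * C * measure (P 0) H"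
    proof -
      have "H \<inter> space (P 0) = H" by (auto simp: H_def space_P)
      then show ?thesis using i3 i4 Em by simp
    qed
    also have "\<dots> \<le> r / 12 * m + 2 * (r / 12) * m"
    proof -
      have "measure (P 0) H \<le> \<epsilon> * m" unfolding H_def m_def using \<delta> by (intro u2(4)) auto
      then have "C * measure (P 0) H \<le> C * (\<epsilon> * m)" using C0 by (intro mult_left_mono)
      also have "\<dots> \<le> r / 12 * m" using \<epsilon>(2) m mult_right_mono[of "C * \<epsilon>" "r / 12" m] by (simp add: mult.assoc)
      finally have "C * measure (P 0) H \<le> r / 12 * m" .
      moreover have "K * \<eta> * m \<le> r / 12 * m" using \<eta>(2) m by (intro mult_right_mono) auto
      ultimately have "K * \<eta> * m + 2 * (C * measure (P 0) H) \<le> r / 12 * m + 2 * (r / 12 * m)" by linarith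
      then show ?thesis by (simp only: mult.assoc)
    qed
    finally have e1: "\<bar>(\<integral>f. F (trunc 2 f) * b f \<partial>P 0) - (\<integral>f. G f * b f \<partial>P 0)\<bar> \<le> r / 12 * m + 2 * (r / 12) * m" .
    have "localizer \<delta>0 (indicator (ball c \<delta>))" using \<delta> by (intro localizer_indicator) auto
    from \<delta>0(2)[OF this] have e2: "\<bar>(\<integral>f. G f * b f \<partial>P 0) - L * m\<bar> \<le> r / 12 * m" unfolding b_def[symmetric] Em .
    have "\<bar>(\<integral>f. F (trunc 2 f) * b f \<partial>P 0) - L * m\<bar> \<le> r / 2 * m"
    proof -
      have "r / 2 * m = r / 12 * m + 2 * (r / 12) * m + r / 12 * m + r / 6 * m" by (simp add: field_simps)
      moreover have "0 \<le> r / 6 * m" using r m by simp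
      ultimately show ?thesis using e1 e2 by linarith
    qed
    moreover have "(\<integral>f. F f \<partial>pinned_law S P 1 0 c \<delta>) - L = ((\<integral>f. F (trunc 2 f) * b f \<partial>P 0) - L * m) / m"
      using pinned_law_integral(1)[OF \<delta>(1) F] m by (simp add: b_def m_def diff_divide_distrib)
    ultimately show ?thesis using m by (simp add: pos_divide_le_eq)
  qed
  have "dist (\<integral>f. F f \<partial>pinned_law S P 1 0 c \<delta>) (\<integral>f. F (rescaled_path \<gamma> c f) \<partial>P0c) < r"
    if "0 < \<delta>" "\<delta> < min d (min \<delta>0 \<eta>)" for \<delta>
    using PL[OF that] YL r unfolding dist_real_def by linarith
  moreover have "0 < min d (min \<delta>0 \<eta>)" using u2 \<delta>0 \<eta> by simp
  ultimately show "\<forall>\<^sub>F \<delta> in at_right 0. dist (\<integral>f. F f \<partial>pinned_law S P 1 0 c \<delta>) (\<integral>f. F (rescaled_path \<gamma> c f) \<partial>P0c) < r"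
    unfolding eventually_at_right_field by blast
qed

lemma bridge_law_if_end_tight:
  assumes end_tight
  shows "is_bridge_law S P 1 0 c (distr P0c (path_space S {0..1}) (rescaled_path \<gamma> c))"
  unfolding is_bridge_law_def
proof (intro conjI allI impI)
  let ?Q = "distr P0c (path_space S {0..1}) (rescaled_path \<gamma> c)"
  show Q: "prob_space ?Q" by (rule prob_space.prob_space_distr[OF prob_P0c rescaled_path_measurable])
  show "sets ?Q = sets (path_space S {0..1})" by simp
  fix F assume F: "continuous_map (skorohod_topology S 1) euclideanreal F" "bounded (F ` cadlag_paths S {0..1})"
  show "((\<lambda>\<delta>. \<integral>f. F f \<partial>pinned_law S P 1 0 c \<delta>) \<longlongrightarrow> (\<integral>f. F f \<partial>?Q)) (at_right 0)"
  proof (rule skorohod_weak_limit[OF S Q _ _ _ F])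
    have "\<forall>\<^sub>F \<delta> in at_right (0::real). 0 < \<delta>" unfolding eventually_at_right_field by (intro exI[of _ 1]) auto
    then show "\<forall>\<^sub>F \<delta> in at_right 0. prob_space (pinned_law S P 1 0 c \<delta>) \<and>
        sets (pinned_law S P 1 0 c \<delta>) = sets (path_space S {0..1})"
    proof eventually_elim
      case (elim \<delta>)
      have "(\<lambda>_. 0 :: real) \<in> borel_measurable (path_space S {0..1})" by simp
      from pinned_law_integral(2,3)[OF elim this] show ?case by blast
    qed
    fix F :: "(real \<Rightarrow> real) \<Rightarrow> real" and C K
    assume *: "F \<in> borel_measurable (path_space S {0..1})" "0 \<le> K"
      "\<And>f. f \<in> cadlag_paths S {0..1} \<Longrightarrow> \<bar>F f\<bar> \<le> C"
      "\<And>f g e. \<lbrakk>f \<in> cadlag_paths S {0..1}; g \<in> cadlag_paths S {0..1}; 0 < e; skorohod_close 1 f g e\<rbrakk> \<Longrightarrow>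
          \<bar>F f - F g\<bar> \<le> K * e"
    have "(\<integral>f. F f \<partial>?Q) = (\<integral>f. F (rescaled_path \<gamma> c f) \<partial>P0c)"
      by (rule integral_distr[OF rescaled_path_measurable *(1)])
    then show "((\<lambda>\<delta>. \<integral>f. F f \<partial>pinned_law S P 1 0 c \<delta>) \<longlongrightarrow> (\<integral>f. F f \<partial>?Q)) (at_right 0)"
      using pinned_law_lipschitz_limit[OF assms *] by simp
  qed simp
qed

section \<open>Tightness at a nonzero endpoint\<close>

lemma far_set: "0 \<le> u \<Longrightarrow> {f \<in> D. far a u s \<eta> f} \<in> sets \<Omega>"
proof -
  assume "0 \<le> u"
  then have "Measurable.pred \<Omega> (far a u s \<eta>)"
    by (rule measurable_coord_algebra_mono[OF far_measurable[of u s s]]) auto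
  then show ?thesis by (auto dest: predE)
qed

lemma coord_set: "0 \<le> t \<Longrightarrow> B \<in> sets borel \<Longrightarrow> {f \<in> D. f t \<in> B} \<in> sets \<Omega>"
  using measurable_sets[OF measurable_coordinate[of t "{0..}" S "{0..}"], of B]
  by (simp add: vimage_def Int_def conj_commute)

lemma measure_shift:
  assumes \<tau>: "0 < \<tau>" and W: "W \<in> sets \<Omega>"
  shows "measure (P 0) {f \<in> D. path_shift \<tau> f \<in> W} = (\<integral>z. p \<tau> 0 z * measure (P z) W \<partial>\<mu>)"
    and "integrable \<mu> (\<lambda>z. p \<tau> 0 z * measure (P z) W)"
proof -
  interpret P0: prob_space "P 0" by (rule prob_P0)
  have Wb: "bounded_measurable \<Omega> (indicator W :: _ \<Rightarrow> real)"
    by (rule bounded_measurableI[of _ _ 1]) (use W in \<open>auto simp: indicator_def\<close>)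
  have mW: "(\<integral>f. indicator W f \<partial>P z) = measure (P z) W" if "z \<in> S" for z
    using W sets.sets_into_space[OF W] by (simp add: space_P that Int_absorb2)
  have pm: "(\<lambda>z. measure (P z) W) \<in> borel_measurable bS"
    using integral_measurable[OF Wb] by (rule measurable_cong[THEN iffD1, rotated]) (rule mW, simp)
  have m1: "measure (P z) W \<le> 1" if "z \<in> S" for z
    using prob_space.prob_le_1[OF prob_P[OF that]] .
  have int: "integrable (P 0) (\<lambda>f. measure (P (f \<tau>)) W)"
  proof (rule P0.integrable_const_bound[of _ 1])
    show "(\<lambda>f. measure (P (f \<tau>)) W) \<in> borel_measurable (P 0)"
      using \<tau> by (intro coord_compose_P[OF pm]) auto
    show "AE f in P 0. norm (measure (P (f \<tau>)) W) \<le> 1"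
      using m1 \<tau> by (intro AE_I2) (auto simp: space_P path_in_S)
  qed
  then show "integrable \<mu> (\<lambda>z. p \<tau> 0 z * measure (P z) W)"
    using integral_coord_unbounded(2)[OF zero_S \<tau> pm] by simp
  have one: "bounded_measurable (Ft \<tau>) (\<lambda>_. 1 :: real)" by (rule bounded_measurableI[of _ _ 1]) auto
  have "measure (P 0) {f \<in> D. path_shift \<tau> f \<in> W} = (\<integral>f. indicator {f \<in> D. path_shift \<tau> f \<in> W} f \<partial>P 0)"
  proof -
    have "{f \<in> D. path_shift \<tau> f \<in> W} \<inter> space (P 0) = {f \<in> D. path_shift \<tau> f \<in> W}" by (auto simp: space_P)
    then show ?thesis by simp
  qed
  also have "\<dots> = (\<integral>f. 1 * indicator W (path_shift \<tau> f) \<partial>P 0)"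
    by (intro Bochner_Integration.integral_cong refl) (auto simp: indicator_def space_P)
  also have "\<dots> = (\<integral>f. 1 * (\<integral>h. indicator W h \<partial>P (f \<tau>)) \<partial>P 0)"
    by (rule markov[OF zero_S _ one Wb]) (use \<tau> in simp)
  also have "\<dots> = (\<integral>f. measure (P (f \<tau>)) W \<partial>P 0)"
    using \<tau> by (intro Bochner_Integration.integral_cong refl) (subst mW, auto simp: space_P path_in_S)
  also have "\<dots> = (\<integral>z. p \<tau> 0 z * measure (P z) W \<partial>\<mu>)"
    by (rule integral_coord_unbounded(1)[OF zero_S \<tau> pm])
  finally show "measure (P 0) {f \<in> D. path_shift \<tau> f \<in> W} = (\<integral>z. p \<tau> 0 z * measure (P z) W \<partial>\<mu>)" .
qed

lemma measure_coord:
  assumes t: "0 < t" and B: "B \<in> sets borel"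
  shows "measure (P 0) {f \<in> D. f t \<in> B} = (\<integral>y. indicator B y * p t 0 y \<partial>\<mu>)"
    and "integrable \<mu> (\<lambda>y. indicator B y * p t 0 y)"
proof -
  have Bb: "bounded_measurable bS (indicator B :: real \<Rightarrow> real)"
    by (rule bounded_measurableI[of _ _ 1])
      (use B in \<open>auto simp: indicator_def intro!: measurable_restrict_space1\<close>)
  have "measure (P 0) {f \<in> D. f t \<in> B} = (\<integral>f. indicator {f \<in> D. f t \<in> B} f \<partial>P 0)"
  proof -
    have "{f \<in> D. f t \<in> B} \<inter> space (P 0) = {f \<in> D. f t \<in> B}" by (auto simp: space_P)
    then show ?thesis by simp
  qed
  also have "\<dots> = (\<integral>f. indicator B (f t) \<partial>P 0)"
    by (intro Bochner_Integration.integral_cong refl) (auto simp: indicator_def space_P)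
  also have "\<dots> = (\<integral>y. indicator B y * p t 0 y \<partial>\<mu>)" by (rule integral_density_p[OF zero_S t Bb])
  finally show "measure (P 0) {f \<in> D. f t \<in> B} = (\<integral>y. indicator B y * p t 0 y \<partial>\<mu>)" .
  show "integrable \<mu> (\<lambda>y. indicator B y * p t 0 y)"
  proof (rule Bochner_Integration.integrable_bound[OF p_integrable[OF zero_S t]])
    show "(\<lambda>y. indicator B y * p t 0 y) \<in> borel_measurable \<mu>"
      using Bb p_measurable[OF zero_S t] by (auto simp: measurable_\<mu> bounded_measurable_def intro: borel_measurable_times)
  qed (auto simp: indicator_def)
qed

text \<open>\<open>far\<close> looks only at times after \<open>u\<close>; right-continuity extends
  the bound to \<open>u\<close> itself. This locates the starting point of a shifted path that stays
  near the target.\<close>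

lemma not_far_start:
  assumes "f \<in> D" "0 \<le> u" "u < s" "\<not> far a u s \<eta> f"
  shows "\<bar>f u - a\<bar> \<le> \<eta>"
proof (rule ccontr)
  assume n: "\<not> \<bar>f u - a\<bar> \<le> \<eta>"
  have "((\<lambda>r. \<bar>f r - a\<bar>) \<longlongrightarrow> \<bar>f u - a\<bar>) (at_right u)"
    by (intro tendsto_intros cadlag_right[OF assms(1,2)])
  then have "\<forall>\<^sub>F r in at_right u. \<eta> < \<bar>f r - a\<bar>" using n by (intro order_tendstoD(1)) auto
  moreover have "\<forall>\<^sub>F r in at_right u. u < r \<and> r < s" using assms(3) unfolding eventually_at_right_field by blast
  ultimately have "\<forall>\<^sub>F r in at_right u. u < r \<and> r < s \<and> \<eta> < \<bar>f r - a\<bar>" by eventually_elim auto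
  then obtain r where "u < r \<and> r < s \<and> \<eta> < \<bar>f r - a\<bar>" using eventually_happens'[OF trivial_limit_at_right_real] by blast
  then show False using assms(4) by (auto simp: far_def)
qed

lemma far_shift: "0 \<le> \<tau> \<Longrightarrow> far a 0 s \<eta> (path_shift \<tau> f) \<longleftrightarrow> far a \<tau> (\<tau> + s) \<eta> f"
proof
  assume "0 \<le> \<tau>" "far a 0 s \<eta> (path_shift \<tau> f)"
  then obtain r where "0 < r" "r < s" "\<bar>f (\<tau> + r) - a\<bar> > \<eta>" by (auto simp: far_def path_shift_def)
  then show "far a \<tau> (\<tau> + s) \<eta> f" unfolding far_def by (intro exI[of _ "\<tau> + r"]) auto
next
  assume "0 \<le> \<tau>" "far a \<tau> (\<tau> + s) \<eta> f"
  then obtain r where "\<tau> < r" "r < \<tau> + s" "\<bar>f r - a\<bar> > \<eta>" by (auto simp: far_def)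
  then show "far a 0 s \<eta> (path_shift \<tau> f)" unfolding far_def path_shift_def by (intro exI[of _ "r - \<tau>"]) auto
qed

lemma measure_scaled:
  assumes t: "0 < t" and A: "A \<in> sets \<Omega>"
  shows "measure (P 0) {f \<in> D. sc t f \<in> A} = measure (P 0) A"
proof -
  have m: "sc t \<in> measurable (P 0) \<Omega>" using measurable_path_scaling[OF _ cone_S, of "1 / t"] t by (simp add: measurable_P)
  have "measure (distr (P 0) \<Omega> (sc t)) A = measure (P 0) (sc t -` A \<inter> space (P 0))"
    by (rule measure_distr[OF m A])
  moreover have "sc t -` A \<inter> space (P 0) = {f \<in> D. sc t f \<in> A}" by (auto simp: space_P)
  moreover have "distr (P 0) \<Omega> (sc t) = P 0" using scaling[OF zero_S, of "1 / t"] t by simp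
  ultimately show ?thesis by simp
qed

text \<open>Here \<open>\<delta>\<close> is chosen after \<open>s\<close>, which is too weak for
  \<open>end_tight\<close>. In return the bound holds for every Borel set of endpoints in the ball,
  which makes patching possible.\<close>

lemma far_endpoint_small:
  assumes "0 < \<epsilon>" "0 < \<eta>"
  shows "\<exists>u>0. u < 1 \<and> (\<forall>s. u < s \<longrightarrow> s < 1 \<longrightarrow> (\<exists>\<delta>>0. \<forall>B\<in>sets borel. B \<inter> S \<subseteq> ball c \<delta> \<longrightarrow>
    measure (P 0) {f \<in> D. far c u s \<eta> f \<and> f 1 \<in> B} \<le> \<epsilon> * measure (P 0) {f \<in> D. f 1 \<in> B}))"
proof -
  have e2: "0 < \<epsilon> / 2" using assms by simp
  obtain u where u: "0 < u" "u < 1"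
    "\<And>s L. u < s \<Longrightarrow> s < 1 \<Longrightarrow> pinned_limit (indicator {f. far c u s \<eta> f}) L \<Longrightarrow> L \<le> \<epsilon> / 2"
    using far_pinned_small[OF e2 assms(2)] by blast
  have "\<exists>\<delta>>0. \<forall>B\<in>sets borel. B \<inter> S \<subseteq> ball c \<delta> \<longrightarrow>
    measure (P 0) {f \<in> D. far c u s \<eta> f \<and> f 1 \<in> B} \<le> \<epsilon> * measure (P 0) {f \<in> D. f 1 \<in> B}" if s: "u < s" "s < 1" for s
  proof -
    define G where "G = (indicator {f. far c u s \<eta> f} :: (real \<Rightarrow> real) \<Rightarrow> real)"
    have "\<exists>L. pinned_limit G L"
    proof (rule pinned_limit_exists[of _ s 1])
      show "G \<in> borel_measurable (Ft s)" unfolding G_def using u by (intro far_pred_indicator) auto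
    qed (use u s in \<open>auto simp: G_def indicator_def\<close>)
    then obtain L where L: "pinned_limit G L" by blast
    have Le: "L \<le> \<epsilon> / 2" using u(3)[OF s] L by (simp add: G_def)
    obtain \<delta> where \<delta>: "0 < \<delta>" "\<And>h. localizer \<delta> h \<Longrightarrow>
     \<bar>(\<integral>f. G f * h (f 1) \<partial>P 0) - L * (\<integral>f. h (f 1) \<partial>P 0)\<bar> \<le> \<epsilon> / 2 * (\<integral>f. h (f 1) \<partial>P 0)"
      using L[unfolded pinned_limit_def, rule_format, OF e2] by blast
    have "measure (P 0) {f \<in> D. far c u s \<eta> f \<and> f 1 \<in> B} \<le> \<epsilon> * measure (P 0) {f \<in> D. f 1 \<in> B}"
      if B: "B \<in> sets borel" "B \<inter> S \<subseteq> ball c \<delta>" for B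
    proof -
      define m where "m = measure (P 0) {f \<in> D. f 1 \<in> B}"
      have "(\<integral>f. indicator B (f 1) \<partial>P 0) = (\<integral>f. indicator {f \<in> D. f 1 \<in> B} f \<partial>P 0)"
        by (intro Bochner_Integration.integral_cong refl) (auto simp: indicator_def space_P)
      also have "\<dots> = m"
      proof -
        have "{f \<in> D. f 1 \<in> B} \<inter> space (P 0) = {f \<in> D. f 1 \<in> B}" by (auto simp: space_P)
        then show ?thesis by (simp add: m_def)
      qed
      finally have 1: "(\<integral>f. indicator B (f 1) \<partial>P 0) = m" .
      have "(\<integral>f. G f * indicator B (f 1) \<partial>P 0) = (\<integral>f. indicator {f \<in> D. far c u s \<eta> f \<and> f 1 \<in> B} f \<partial>P 0)"
        by (intro Bochner_Integration.integral_cong refl) (auto simp: indicator_def space_P G_def)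
      also have "\<dots> = measure (P 0) {f \<in> D. far c u s \<eta> f \<and> f 1 \<in> B}"
      proof -
        have "{f \<in> D. far c u s \<eta> f \<and> f 1 \<in> B} \<inter> space (P 0) = {f \<in> D. far c u s \<eta> f \<and> f 1 \<in> B}" by (auto simp: space_P)
        then show ?thesis by simp
      qed
      finally have 2: "(\<integral>f. G f * indicator B (f 1) \<partial>P 0) = measure (P 0) {f \<in> D. far c u s \<eta> f \<and> f 1 \<in> B}" .
      have "localizer \<delta> (indicator B)" by (rule localizer_indicator) (use B in auto)
      from \<delta>(2)[OF this] have "measure (P 0) {f \<in> D. far c u s \<eta> f \<and> f 1 \<in> B} \<le> L * m + \<epsilon> / 2 * m"
        unfolding 1 2 by linarith
      also have "\<dots> \<le> \<epsilon> / 2 * m + \<epsilon> / 2 * m" using Le by (intro add_mono mult_right_mono) (auto simp: m_def)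
      finally show ?thesis by (simp add: m_def)
    qed
    then show ?thesis using \<delta>(1) by blast
  qed
  then show ?thesis using u(1,2) by blast
qed

lemma p_jointly_near:
  assumes "0 < e"
  shows "\<exists>\<rho>>0. \<forall>t z. z \<in> S \<longrightarrow> \<bar>t - 1\<bar> < \<rho> \<longrightarrow> \<bar>z - c\<bar> < \<rho> \<longrightarrow> 0 < t \<and> \<bar>p t 0 z - p 1 0 c\<bar> < e"
proof -
  have cont: "continuous_on ({0<..} \<times> S) (\<lambda>(s, y). p s 0 y)" by (rule p_continuous) simp
  have mem: "(1 :: real, c) \<in> {0<..} \<times> S" using c by simp
  obtain d where d: "0 < d" "\<And>x. x \<in> {0<..} \<times> S \<Longrightarrow> dist x (1, c) < d \<Longrightarrow>
      dist ((\<lambda>(s, y). p s 0 y) x) ((\<lambda>(s, y). p s 0 y) (1, c)) < e"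
    using cont[unfolded continuous_on_iff, rule_format, OF mem assms] by blast
  show ?thesis
  proof (intro exI[of _ "min 1 (d / 2)"] conjI allI impI)
    fix t z assume z: "z \<in> S" "\<bar>t - 1\<bar> < min 1 (d / 2)" "\<bar>z - c\<bar> < min 1 (d / 2)"
    then show t: "0 < t" by linarith
    have "dist (t, z) (1, c) \<le> dist t 1 + dist z c"
      using sqrt_sum_squares_le_sum[of "dist t 1" "dist z c"] by (simp add: dist_Pair_Pair)
    also have "\<dots> < d" using z by (simp add: dist_real_def)
    finally show "\<bar>p t 0 z - p 1 0 c\<bar> < e" using d(2)[of "(t, z)"] t z by (simp add: dist_real_def)
  qed (use d in auto)
qed

text \<open>By the Markov property at time \<open>t - v\<close>, the last stretches of the paths conditioned to end in \<open>B\<close> at time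
  \<open>t\<close> and at time 1 differ only through the densities \<open>p (t - v) 0\<close> and \<open>p (1 - v) 0\<close> of the starting
  point, which are comparable near \<open>c\<close>. Paths staying near \<open>c\<close> are compared, so the paths away
  from \<open>c\<close> are controlled by complementation.\<close>

lemma far_endpoint_time_change:
  assumes \<epsilon>: "0 < \<epsilon>" and \<eta>0: "0 < \<eta>0"
  shows "\<exists>\<eta> v \<rho>. 0 < \<eta> \<and> \<eta> \<le> \<eta>0 \<and> 0 < v \<and> v < 1 / 2 \<and> 0 < \<rho> \<and> \<rho> < 1 / 2 \<and>
    (\<forall>s. 1 - v < s \<longrightarrow> s < 1 \<longrightarrow> (\<exists>\<delta>>0. \<forall>t B. \<bar>t - 1\<bar> < \<rho> \<longrightarrow> B \<in> sets borel \<longrightarrow> B \<inter> S \<subseteq> ball c \<delta> \<longrightarrow>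
      measure (P 0) {f \<in> D. far c (t - v) (t - 1 + s) \<eta> f \<and> f t \<in> B} \<le> \<epsilon> * measure (P 0) {f \<in> D. f t \<in> B}))"
proof -
  interpret P0: prob_space "P 0" by (rule prob_P0)
  \<comment> \<open>Three comparisons each lose a factor \<open>1 - x\<close>, and the cube of
    \<open>1 - x\<close> is at least \<open>1 - 3 * x\<close>.\<close>
  define x where "x = min (1 / 2) (\<epsilon> / 3)"
  have x: "0 < x" "x \<le> 1 / 2" "3 * x \<le> \<epsilon>" using \<epsilon> by (auto simp: x_def)
  define K where "K = p 1 0 c"
  have K: "0 < K" using p_pos by (simp add: K_def)
  have "0 < x / 2 * K" using x K by simp
  from p_jointly_near[OF this] obtain \<rho>' where \<rho>': "0 < \<rho>'"
    "\<And>t z. z \<in> S \<Longrightarrow> \<bar>t - 1\<bar> < \<rho>' \<Longrightarrow> \<bar>z - c\<bar> < \<rho>' \<Longrightarrow> 0 < t \<and> \<bar>p t 0 z - K\<bar> < x / 2 * K"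
    unfolding K_def by blast
  \<comment> \<open>The starting time \<open>t - v\<close> may differ from 1 by
    \<open>\<bar>t - 1\<bar> + v\<close>, hence by less than \<open>2 * \<rho>\<close>; this must
    stay in the range where the densities are comparable.\<close>
  define \<rho> where "\<rho> = min (1 / 4) (\<rho>' / 2)"
  have \<rho>: "0 < \<rho>" "\<rho> < 1 / 2" "2 * \<rho> \<le> \<rho>'" using \<rho>' by (auto simp: \<rho>_def)
  have ratio: "(1 - x) * p t' 0 z' \<le> p t 0 z"
    if "z \<in> S" "\<bar>t - 1\<bar> < \<rho>'" "\<bar>z - c\<bar> < \<rho>'" "z' \<in> S" "\<bar>t' - 1\<bar> < \<rho>'" "\<bar>z' - c\<bar> < \<rho>'" for t z t' z'
  proof -
    have "p t' 0 z' \<le> (1 + x / 2) * K" "(1 - x / 2) * K \<le> p t 0 z"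
      using \<rho>'(2)[OF that(1-3)] \<rho>'(2)[OF that(4-6)] by (auto simp: algebra_simps abs_if split: if_splits)
    then have "(1 - x) * p t' 0 z' \<le> (1 - x) * ((1 + x / 2) * K)" using x by (intro mult_left_mono) auto
    also have "\<dots> \<le> (1 - x / 2) * K"
    proof -
      have "(1 - x) * (1 + x / 2) \<le> 1 - x / 2" using x by (simp add: algebra_simps)
      then show ?thesis using K by (simp add: mult.assoc[symmetric])
    qed
    finally show ?thesis using \<open>(1 - x / 2) * K \<le> p t 0 z\<close> by linarith
  qed
  define \<eta> where "\<eta> = min \<eta>0 \<rho>"
  have \<eta>: "0 < \<eta>" "\<eta> \<le> \<eta>0" "\<eta> < \<rho>'" using \<eta>0 \<rho> by (auto simp: \<eta>_def)
  obtain u0 where u0: "0 < u0" "u0 < 1" and u0s: "\<And>s. u0 < s \<Longrightarrow> s < 1 \<Longrightarrow> \<exists>\<delta>>0. \<forall>B\<in>sets borel. B \<inter> S \<subseteq> ball c \<delta> \<longrightarrow>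
    measure (P 0) {f \<in> D. far c u0 s \<eta> f \<and> f 1 \<in> B} \<le> x * measure (P 0) {f \<in> D. f 1 \<in> B}"
    using far_endpoint_small[OF x(1) \<eta>(1)] by blast
  define v where "v = min (1 - u0) \<rho>"
  have v: "0 < v" "v \<le> \<rho>" "u0 \<le> 1 - v" using u0 \<rho> by (auto simp: v_def)
  have v2: "v < 1 / 2" using v(2) \<rho>(2) by linarith
  note v = v v2
  have "\<exists>\<delta>>0. \<forall>t B. \<bar>t - 1\<bar> < \<rho> \<longrightarrow> B \<in> sets borel \<longrightarrow> B \<inter> S \<subseteq> ball c \<delta> \<longrightarrow>
      measure (P 0) {f \<in> D. far c (t - v) (t - 1 + s) \<eta> f \<and> f t \<in> B} \<le> \<epsilon> * measure (P 0) {f \<in> D. f t \<in> B}"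
    if s: "1 - v < s" "s < 1" for s
  proof -
    obtain \<delta>' where \<delta>': "0 < \<delta>'" "\<And>B. B \<in> sets borel \<Longrightarrow> B \<inter> S \<subseteq> ball c \<delta>' \<Longrightarrow>
      measure (P 0) {f \<in> D. far c u0 s \<eta> f \<and> f 1 \<in> B} \<le> x * measure (P 0) {f \<in> D. f 1 \<in> B}"
      using u0s[of s] s v by auto
    define \<delta> where "\<delta> = min \<delta>' \<rho>'"
    have \<delta>: "0 < \<delta>" "\<delta> \<le> \<delta>'" "\<delta> \<le> \<rho>'" using \<delta>' \<rho>' by (auto simp: \<delta>_def)
    define a where "a = s - (1 - v)"
    have a: "0 < a" using s by (simp add: a_def)
    have "measure (P 0) {f \<in> D. far c (t - v) (t - 1 + s) \<eta> f \<and> f t \<in> B} \<le> \<epsilon> * measure (P 0) {f \<in> D. f t \<in> B}"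
      if t: "\<bar>t - 1\<bar> < \<rho>" and B: "B \<in> sets borel" "B \<inter> S \<subseteq> ball c \<delta>" for t B
    proof -
      have tpos: "0 < t - v" "0 < t" using t v \<rho> by auto
      \<comment> \<open>Staying near \<open>c\<close> is used instead of leaving it: only then is
        the starting point of the last stretch confined to the region where the densities are
        comparable.\<close>
      define W where "W = {f \<in> D. \<not> far c 0 a \<eta> f \<and> f v \<in> B}"
      have W: "W \<in> sets \<Omega>"
      proof -
        have "W = {f \<in> D. f v \<in> B} - {f \<in> D. far c 0 a \<eta> f}" by (auto simp: W_def)
        then show ?thesis using coord_set[of v B] far_set[of 0 c a \<eta>] v B by auto
      qed
      \<comment> \<open>A path in \<open>W\<close> starts within \<open>\<eta>\<close> of
        \<open>c\<close>, so other starting points contribute nothing to the integrals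
        below.\<close>
      have near: "measure (P z) W = 0" if z: "z \<in> S" "\<not> \<bar>z - c\<bar> \<le> \<eta>" for z
      proof -
        interpret Pz: prob_space "P z" by (rule prob_P[OF z(1)])
        have "AE f in P z. f \<notin> W"
          using AE_start[OF z(1)]
        proof (rule AE_mp, intro AE_I2 impI)
          fix f assume "f \<in> space (P z)" "f 0 = z"
          then show "f \<notin> W" using not_far_start[of f 0 a c \<eta>] z a by (auto simp: W_def space_P)
        qed
        then show ?thesis using W sets_P[OF z(1)] by (subst Pz.prob_eq_0) auto
      qed
      have shiftW: "{f \<in> D. path_shift \<tau> f \<in> W} = {f \<in> D. \<not> far c \<tau> (\<tau> + a) \<eta> f \<and> f (\<tau> + v) \<in> B}" if "0 < \<tau>" for \<tau>
        using that v far_shift[of \<tau> c a \<eta>] path_shift_cadlag[of _ S \<tau>]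
        by (auto simp: W_def path_shift_def)
      have "(1 - x) * measure (P 0) {f \<in> D. path_shift (1 - v) f \<in> W} \<le> measure (P 0) {f \<in> D. path_shift (t - v) f \<in> W}"
      proof -
        have "(1 - x) * (\<integral>z. p (1 - v) 0 z * measure (P z) W \<partial>\<mu>) = (\<integral>z. (1 - x) * (p (1 - v) 0 z * measure (P z) W) \<partial>\<mu>)"
          by simp
        also have "\<dots> \<le> (\<integral>z. p (t - v) 0 z * measure (P z) W \<partial>\<mu>)"
        proof (rule integral_mono)
          fix z assume "z \<in> space \<mu>"
          then have z: "z \<in> S" by (simp add: space_\<mu>)
          show "(1 - x) * (p (1 - v) 0 z * measure (P z) W) \<le> p (t - v) 0 z * measure (P z) W"
          proof (cases "\<bar>z - c\<bar> \<le> \<eta>")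
            case True
            have "(1 - x) * p (1 - v) 0 z \<le> p (t - v) 0 z"
              using True t v \<rho> \<eta> z by (intro ratio) auto
            then show ?thesis by (simp add: mult.assoc[symmetric] mult_right_mono)
          qed (simp add: near[OF z])
        qed (use measure_shift(2)[OF _ W, of "1 - v"] measure_shift(2)[OF tpos(1) W] v in auto)
        finally show ?thesis using measure_shift(1)[OF _ W, of "1 - v"] measure_shift(1)[OF tpos(1) W] v by simp
      qed
      then have 1: "(1 - x) * measure (P 0) {f \<in> D. \<not> far c (1 - v) s \<eta> f \<and> f 1 \<in> B}
        \<le> measure (P 0) {f \<in> D. \<not> far c (t - v) (t - 1 + s) \<eta> f \<and> f t \<in> B}"
        using shiftW[of "1 - v"] shiftW[OF tpos(1)] v by (simp add: a_def algebra_simps)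
      have 2: "(1 - x) * measure (P 0) {f \<in> D. f t \<in> B} \<le> measure (P 0) {f \<in> D. f 1 \<in> B}"
      proof -
        have "(1 - x) * (\<integral>y. indicator B y * p t 0 y \<partial>\<mu>) = (\<integral>y. (1 - x) * (indicator B y * p t 0 y) \<partial>\<mu>)" by simp
        also have "\<dots> \<le> (\<integral>y. indicator B y * p 1 0 y \<partial>\<mu>)"
        proof (rule integral_mono)
          fix y assume "y \<in> space \<mu>"
          then have y: "y \<in> S" by (simp add: space_\<mu>)
          show "(1 - x) * (indicator B y * p t 0 y) \<le> indicator B y * p 1 0 y"
          proof (cases "y \<in> B")
            case True
            then have "\<bar>y - c\<bar> < \<rho>'" using B(2) y \<delta>(3) by (auto simp: dist_real_def abs_minus_commute)
            then show ?thesis using True ratio[of y 1 y t] y t \<rho> by simp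
          qed simp
        qed (use measure_coord(2)[OF _ B(1)] tpos in auto)
        finally show ?thesis using measure_coord(1)[OF _ B(1)] tpos by simp
      qed
      have split: "measure (P 0) {f \<in> D. f r \<in> B} = measure (P 0) {f \<in> D. far c w s' \<eta> f \<and> f r \<in> B}
          + measure (P 0) {f \<in> D. \<not> far c w s' \<eta> f \<and> f r \<in> B}" if "0 \<le> r" "0 \<le> w" for r w s'
      proof -
        have A: "{f \<in> D. far c w s' \<eta> f} \<inter> {f \<in> D. f r \<in> B} \<in> sets (P 0)"
          "{f \<in> D. f r \<in> B} - {f \<in> D. far c w s' \<eta> f} \<in> sets (P 0)"
          using far_set[OF that(2)] coord_set[OF that(1) B(1)] by (auto simp: sets_P)
        have "measure (P 0) (({f \<in> D. far c w s' \<eta> f} \<inter> {f \<in> D. f r \<in> B}) \<union> ({f \<in> D. f r \<in> B} - {f \<in> D. far c w s' \<eta> f}))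
          = measure (P 0) ({f \<in> D. far c w s' \<eta> f} \<inter> {f \<in> D. f r \<in> B})
          + measure (P 0) ({f \<in> D. f r \<in> B} - {f \<in> D. far c w s' \<eta> f})"
          by (rule P0.finite_measure_Union[OF A]) auto
        moreover have "({f \<in> D. far c w s' \<eta> f} \<inter> {f \<in> D. f r \<in> B}) \<union> ({f \<in> D. f r \<in> B} - {f \<in> D. far c w s' \<eta> f}) = {f \<in> D. f r \<in> B}" by auto
        moreover have "{f \<in> D. far c w s' \<eta> f} \<inter> {f \<in> D. f r \<in> B} = {f \<in> D. far c w s' \<eta> f \<and> f r \<in> B}" by auto
        moreover have "{f \<in> D. f r \<in> B} - {f \<in> D. far c w s' \<eta> f} = {f \<in> D. \<not> far c w s' \<eta> f \<and> f r \<in> B}" by auto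
        ultimately show ?thesis by simp
      qed
      have 3: "measure (P 0) {f \<in> D. far c (1 - v) s \<eta> f \<and> f 1 \<in> B} \<le> x * measure (P 0) {f \<in> D. f 1 \<in> B}"
      proof -
        have "{f \<in> D. far c u0 s \<eta> f \<and> f 1 \<in> B} = {f \<in> D. far c u0 s \<eta> f} \<inter> {f \<in> D. f 1 \<in> B}" by auto
        then have "{f \<in> D. far c u0 s \<eta> f \<and> f 1 \<in> B} \<in> sets (P 0)"
          using far_set[of u0 c s \<eta>] coord_set[of 1 B] u0 B(1) by (simp add: sets_P)
        then have "measure (P 0) {f \<in> D. far c (1 - v) s \<eta> f \<and> f 1 \<in> B} \<le> measure (P 0) {f \<in> D. far c u0 s \<eta> f \<and> f 1 \<in> B}"
          by (intro P0.finite_measure_mono) (use v far_mono in blast)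
        also have "\<dots> \<le> x * measure (P 0) {f \<in> D. f 1 \<in> B}" using B \<delta> by (intro \<delta>'(2)) auto
        finally show ?thesis .
      qed
      define m1 where "m1 = measure (P 0) {f \<in> D. f 1 \<in> B}"
      define mt where "mt = measure (P 0) {f \<in> D. f t \<in> B}"
      have "(1 - x) * m1 \<le> measure (P 0) {f \<in> D. \<not> far c (1 - v) s \<eta> f \<and> f 1 \<in> B}"
        using split[of 1 "1 - v" s] 3 v by (simp add: m1_def algebra_simps)
      then have "(1 - x) * ((1 - x) * m1) \<le> (1 - x) * measure (P 0) {f \<in> D. \<not> far c (1 - v) s \<eta> f \<and> f 1 \<in> B}"
        using x by (intro mult_left_mono) auto
      with 1 have 4: "(1 - x) * ((1 - x) * m1) \<le> measure (P 0) {f \<in> D. \<not> far c (t - v) (t - 1 + s) \<eta> f \<and> f t \<in> B}" by linarith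
      \<comment> \<open>The three factors come from the density at the endpoint, from the excursion
        bound for endpoint time 1, and from the density at the start of the last stretch.\<close>
      have "(1 - x) * ((1 - x) * ((1 - x) * mt)) \<le> (1 - x) * ((1 - x) * m1)"
        using x 2 by (intro mult_left_mono) (auto simp: m1_def mt_def)
      moreover have "(1 - 3 * x) * mt \<le> (1 - x) * ((1 - x) * ((1 - x) * mt))"
      proof -
        have "1 - 3 * x \<le> (1 - x) * ((1 - x) * (1 - x))"
        proof -
          have "(1 - x) * ((1 - x) * (1 - x)) = 1 - 3 * x + x * x * (3 - x)" by (simp add: algebra_simps)
          moreover have "0 \<le> x * x * (3 - x)" using x by simp
          ultimately show ?thesis by linarith
        qed
        then have "(1 - 3 * x) * mt \<le> ((1 - x) * ((1 - x) * (1 - x))) * mt" by (intro mult_right_mono) (auto simp: mt_def)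
        then show ?thesis by (simp add: mult.assoc)
      qed
      ultimately have "measure (P 0) {f \<in> D. far c (t - v) (t - 1 + s) \<eta> f \<and> f t \<in> B} \<le> mt - (1 - 3 * x) * mt"
        using 4 split[of t "t - v" "t - 1 + s"] tpos by (simp add: mt_def)
      also have "\<dots> = 3 * x * mt" by (simp add: algebra_simps)
      also have "\<dots> \<le> \<epsilon> * mt" using x(3) by (intro mult_right_mono) (auto simp: mt_def)
      finally show ?thesis by (simp add: mt_def)
    qed
    then show ?thesis using \<delta>(1) by blast
  qed
  then show ?thesis using \<eta> v \<rho> by blast
qed

section \<open>From local bounds before time 1 to tightness\<close>

text \<open>Since \<open>d\<close> is independent of \<open>s\<close>, continuity of the measure
  along increasing events lets \<open>s\<close> tend to 1.\<close>

lemma end_tightI: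
  assumes "\<And>\<epsilon> \<eta>. 0 < \<epsilon> \<Longrightarrow> 0 < \<eta> \<Longrightarrow> \<exists>u d. 0 < u \<and> u < 1 \<and> 0 < d \<and> (\<forall>\<delta> s. 0 < \<delta> \<longrightarrow> \<delta> < d \<longrightarrow> 0 < s \<longrightarrow> s < 1 \<longrightarrow>
     measure (P 0) {f \<in> D. far c u s \<eta> f \<and> f 1 \<in> ball c \<delta>} \<le> \<epsilon> * measure (P 0) {f \<in> D. f 1 \<in> ball c \<delta>})"
  shows end_tight
  unfolding end_tight_def
proof (intro allI impI)
  interpret P0: prob_space "P 0" by (rule prob_P0)
  fix \<epsilon> \<eta> :: real assume "0 < \<epsilon>" "0 < \<eta>"
  from assms[OF this] obtain u d where ud: "0 < u" "u < 1" "0 < d" "\<And>\<delta> s. 0 < \<delta> \<Longrightarrow> \<delta> < d \<Longrightarrow> 0 < s \<Longrightarrow> s < 1 \<Longrightarrow>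
     measure (P 0) {f \<in> D. far c u s \<eta> f \<and> f 1 \<in> ball c \<delta>} \<le> \<epsilon> * measure (P 0) {f \<in> D. f 1 \<in> ball c \<delta>}"
    by blast
  have "measure (P 0) {f \<in> D. far c u 1 \<eta> f \<and> f 1 \<in> ball c \<delta>} \<le> \<epsilon> * measure (P 0) {f \<in> D. f 1 \<in> ball c \<delta>}"
    if \<delta>: "0 < \<delta>" "\<delta> < d" for \<delta>
  proof -
    define s where "s n = 1 - 1 / real (n + 2)" for n
    have s: "0 < s n" "s n < 1" for n by (auto simp: s_def field_simps)
    have s_mono: "s m \<le> s n" if "m \<le> n" for m n using that by (auto simp: s_def field_simps)
    have s_lim: "s \<longlonglongrightarrow> 1"
    proof -
      have "(\<lambda>n. 1 - 1 / real (n + 2)) \<longlonglongrightarrow> 1 - 0"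
        by (intro tendsto_intros LIMSEQ_ignore_initial_segment[OF lim_1_over_n])
      then show ?thesis by (simp add: s_def[abs_def])
    qed
    define A where "A n = {f \<in> D. far c u (s n) \<eta> f \<and> f 1 \<in> ball c \<delta>}" for n
    have "A n = {f \<in> D. far c u (s n) \<eta> f} \<inter> {f \<in> D. f 1 \<in> ball c \<delta>}" for n by (auto simp: A_def)
    then have A: "A n \<in> sets (P 0)" for n using far_set[of u c "s n" \<eta>] coord_set[of 1 "ball c \<delta>"] ud by (simp add: sets_P)
    have inc: "incseq A" unfolding A_def by (intro monoI Collect_mono) (use s_mono far_mono in blast)
    have U: "(\<Union>n. A n) = {f \<in> D. far c u 1 \<eta> f \<and> f 1 \<in> ball c \<delta>}"
    proof (intro equalityI subsetI)
      fix f assume "f \<in> {f \<in> D. far c u 1 \<eta> f \<and> f 1 \<in> ball c \<delta>}"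
      then obtain r where r: "f \<in> D" "f 1 \<in> ball c \<delta>" "u < r" "r < 1" "\<bar>f r - c\<bar> > \<eta>" by (auto simp: far_def)
      have "\<forall>\<^sub>F n in sequentially. r < s n" using s_lim r(4) by (rule order_tendstoD)
      then obtain n where "r < s n" using eventually_happens by force
      then show "f \<in> (\<Union>n. A n)" using r unfolding A_def far_def by blast
    next
      fix f assume "f \<in> (\<Union>n. A n)"
      then obtain n where "f \<in> A n" by blast
      then show "f \<in> {f \<in> D. far c u 1 \<eta> f \<and> f 1 \<in> ball c \<delta>}"
        using far_mono[of c u "s n" \<eta> f u 1 \<eta>] s[of n] by (auto simp: A_def)
    qed
    have "(\<lambda>n. measure (P 0) (A n)) \<longlonglongrightarrow> measure (P 0) (\<Union>n. A n)"
      by (rule P0.finite_Lim_measure_incseq) (use A inc in auto)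
    then show ?thesis unfolding U
      by (rule LIMSEQ_le_const2) (use ud(4)[OF \<delta>] s in \<open>auto simp: A_def\<close>)
  qed
  then show "\<exists>u d. 0 < u \<and> u < 1 \<and> 0 < d \<and> (\<forall>\<delta>. 0 < \<delta> \<longrightarrow> \<delta> < d \<longrightarrow>
     measure (P 0) {f \<in> D. far c u 1 \<eta> f \<and> f 1 \<in> ball c \<delta>} \<le> \<epsilon> * measure (P 0) {f \<in> D. f 1 \<in> ball c \<delta>})"
    using ud(1,2,3) by blast
qed

lemma measure_coord_split:
  assumes "A \<in> sets \<Omega>" "B \<in> sets borel" "B' \<in> sets borel" "B \<inter> B' = {}"
  shows "measure (P 0) {f \<in> A. f 1 \<in> B \<union> B'} = measure (P 0) {f \<in> A. f 1 \<in> B} + measure (P 0) {f \<in> A. f 1 \<in> B'}"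
proof -
  interpret P0: prob_space "P 0" by (rule prob_P0)
  have AD: "A \<subseteq> D" using sets.sets_into_space[OF assms(1)] by simp
  have s: "{f \<in> A. f 1 \<in> X} \<in> sets (P 0)" if "X \<in> sets borel" for X
  proof -
    have "{f \<in> A. f 1 \<in> X} = A \<inter> {f \<in> D. f 1 \<in> X}" using AD by auto
    then show ?thesis using assms(1) coord_set[of 1 X] that by (simp add: sets_P)
  qed
  have "{f \<in> A. f 1 \<in> B \<union> B'} = {f \<in> A. f 1 \<in> B} \<union> {f \<in> A. f 1 \<in> B'}" by auto
  then show ?thesis using P0.finite_measure_Union[OF s[OF assms(2)] s[OF assms(3)]] assms(4) by auto
qed

text \<open>Both sides are additive in the endpoint set, so the property passes from two adjacent
  intervals to their union, and Bolzano's principle applies. No uniformity of the local radii in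
  \<open>x\<close> is required.\<close>

lemma endpoint_bound_local_global:
  assumes A: "A \<in> sets \<Omega>" and ab: "a \<le> b"
    and local: "\<And>x. a \<le> x \<Longrightarrow> x \<le> b \<Longrightarrow> \<exists>\<delta>>0. \<forall>B\<in>sets borel. B \<subseteq> ball x \<delta> \<longrightarrow>
      measure (P 0) {f \<in> A. f 1 \<in> B} \<le> \<epsilon> * measure (P 0) {f \<in> D. f 1 \<in> B}"
    and B: "B \<in> sets borel" "B \<subseteq> {a..b}"
  shows "measure (P 0) {f \<in> A. f 1 \<in> B} \<le> \<epsilon> * measure (P 0) {f \<in> D. f 1 \<in> B}"
proof -
  define Q where "Q a' b' \<longleftrightarrow> (\<forall>B\<in>sets borel. B \<subseteq> {a'..b'} \<longrightarrow>
      measure (P 0) {f \<in> A. f 1 \<in> B} \<le> \<epsilon> * measure (P 0) {f \<in> D. f 1 \<in> B})" for a' b' :: real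
  have "Q a b"
  proof (rule Bolzano[OF ab])
    fix x y z assume Q: "Q x y" "Q y z" "x \<le> y" "y \<le> z"
    show "Q x z"
      unfolding Q_def
    proof (intro ballI impI)
      fix B :: "real set" assume B: "B \<in> sets borel" "B \<subseteq> {x..z}"
      \<comment> \<open>The common end \<open>y\<close> is given to the left part only, to keep the
        two parts disjoint.\<close>
      have e: "B = (B \<inter> {..y}) \<union> (B \<inter> {y<..})" by auto
      have m: "B \<inter> {..y} \<in> sets borel" "B \<inter> {y<..} \<in> sets borel" using B by auto
      have d: "(B \<inter> {..y}) \<inter> (B \<inter> {y<..}) = {}" by auto
      have D: "D \<in> sets \<Omega>" using sets.top[of \<Omega>] by simp
      have "measure (P 0) {f \<in> A. f 1 \<in> B \<inter> {..y}} \<le> \<epsilon> * measure (P 0) {f \<in> D. f 1 \<in> B \<inter> {..y}}"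
        by (rule Q(1)[unfolded Q_def, rule_format, OF m(1)]) (use B in auto)
      moreover have "measure (P 0) {f \<in> A. f 1 \<in> B \<inter> {y<..}} \<le> \<epsilon> * measure (P 0) {f \<in> D. f 1 \<in> B \<inter> {y<..}}"
        by (rule Q(2)[unfolded Q_def, rule_format, OF m(2)]) (use B in auto)
      moreover have "measure (P 0) {f \<in> A. f 1 \<in> B} = measure (P 0) {f \<in> A. f 1 \<in> B \<inter> {..y}} + measure (P 0) {f \<in> A. f 1 \<in> B \<inter> {y<..}}"
        using measure_coord_split[OF A m d] by (simp add: e[symmetric])
      moreover have "measure (P 0) {f \<in> D. f 1 \<in> B} = measure (P 0) {f \<in> D. f 1 \<in> B \<inter> {..y}} + measure (P 0) {f \<in> D. f 1 \<in> B \<inter> {y<..}}"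
        using measure_coord_split[OF D m d] by (simp add: e[symmetric])
      ultimately show "measure (P 0) {f \<in> A. f 1 \<in> B} \<le> \<epsilon> * measure (P 0) {f \<in> D. f 1 \<in> B}"
        by (simp add: distrib_left)
    qed
  next
    fix x assume "a \<le> x" "x \<le> b"
    from local[OF this] obtain \<delta> where \<delta>: "0 < \<delta>" "\<And>B. B \<in> sets borel \<Longrightarrow> B \<subseteq> ball x \<delta> \<Longrightarrow>
      measure (P 0) {f \<in> A. f 1 \<in> B} \<le> \<epsilon> * measure (P 0) {f \<in> D. f 1 \<in> B}" by blast
    have "Q a' b'" if "a' \<le> x \<and> x \<le> b' \<and> b' - a' < \<delta>" for a' b'
      unfolding Q_def
    proof (intro ballI impI \<delta>(2))
      fix B assume "B \<subseteq> {a'..b'}"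
      moreover have "{a'..b'} \<subseteq> ball x \<delta>" using that by (auto simp: dist_real_def)
      ultimately show "B \<subseteq> ball x \<delta>" by blast
    qed
    then show "\<exists>d>0. \<forall>a b. a \<le> x \<and> x \<le> b \<and> b - a < d \<longrightarrow> Q a b" using \<delta>(1) by blast
  qed
  then show ?thesis using B by (auto simp: Q_def)
qed

text \<open>A bridge of length 1 to \<open>x\<close> near \<open>c\<close> is a rescaled bridge of length \<open>(c / x)\<^bsup>\<gamma>\<^esup>\<close> to \<open>c\<close>.\<close>

lemma end_tight_nonzero:
  assumes c0: "c \<noteq> 0"
  shows end_tight
proof (rule end_tightI)
  interpret P0: prob_space "P 0" by (rule prob_P0)
  fix \<epsilon> \<eta>0 :: real assume \<epsilon>: "0 < \<epsilon>" and \<eta>0: "0 < \<eta>0"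
  \<comment> \<open>Rescaling turns a deviation of more than \<open>\<eta>0\<close> into one of more
    than \<open>\<eta>0 / 3\<close>: half of it pays for the distance of \<open>x\<close> from
    \<open>c\<close>, and the scale factor is at most 3/2. Hence \<open>\<eta>0 / 8\<close>
    suffices.\<close>
  then have "0 < \<eta>0 / 8" by simp
  from far_endpoint_time_change[OF \<epsilon> this] obtain \<eta> v \<rho> where
    \<eta>: "0 < \<eta>" "\<eta> \<le> \<eta>0 / 8" and v: "0 < v" "v < 1 / 2" and \<rho>: "0 < \<rho>" "\<rho> < 1 / 2"
    and tc: "\<And>s. 1 - v < s \<Longrightarrow> s < 1 \<Longrightarrow> \<exists>\<delta>>0. \<forall>t B. \<bar>t - 1\<bar> < \<rho> \<longrightarrow> B \<in> sets borel \<longrightarrow> B \<inter> S \<subseteq> ball c \<delta> \<longrightarrow>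
      measure (P 0) {f \<in> D. far c (t - v) (t - 1 + s) \<eta> f \<and> f t \<in> B} \<le> \<epsilon> * measure (P 0) {f \<in> D. f t \<in> B}"
    by blast
  have "((\<lambda>y. (c / y) powr \<gamma>) \<longlongrightarrow> (c / c) powr \<gamma>) (at c)"
    using c0 by (intro tendsto_intros) auto
  then have "((\<lambda>y. (c / y) powr \<gamma>) \<longlongrightarrow> 1) (at c)" using c0 by simp
  from tendstoD[OF this \<rho>(1)] obtain d1 where d1: "0 < d1"
    "\<And>y. y \<noteq> c \<Longrightarrow> \<bar>y - c\<bar> < d1 \<Longrightarrow> \<bar>(c / y) powr \<gamma> - 1\<bar> < \<rho>"
    unfolding eventually_at by (auto simp: dist_real_def)
  have d1': "\<bar>(c / y) powr \<gamma> - 1\<bar> < \<rho>" if "\<bar>y - c\<bar> < d1" for y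
    using d1(2)[of y] that c0 \<rho> by (cases "y = c") auto
  \<comment> \<open>The three bounds keep the length \<open>t\<close> close to 1, the scale factor
    between 1/2 and 3/2, and the shift of the target below half of \<open>\<eta>0\<close>. None of
    them involves \<open>s\<close>.\<close>
  define d where "d = min (d1 / 2) (min (\<bar>c\<bar> / 2) (\<eta>0 / 2))"
  have d: "0 < d" "d < d1" "d \<le> \<bar>c\<bar> / 2" "d \<le> \<eta>0 / 2" using d1 c0 \<eta>0 by (auto simp: d_def)
  define u where "u = 1 - v / 2"
  have u: "0 < u" "u < 1" using v by (auto simp: u_def)
  have "measure (P 0) {f \<in> D. far c u s \<eta>0 f \<and> f 1 \<in> ball c \<delta>} \<le> \<epsilon> * measure (P 0) {f \<in> D. f 1 \<in> ball c \<delta>}"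
    if \<delta>: "0 < \<delta>" "\<delta> < d" and s: "0 < s" "s < 1" for \<delta> s
  proof -
    define A where "A = {f \<in> D. far c u s \<eta>0 f}"
    have A: "A \<in> sets \<Omega>" unfolding A_def using u by (intro far_set) simp
    \<comment> \<open>As \<open>t \<ge> 1 / 2\<close>, an interval of length \<open>1 - s\<close>
      before time 1 becomes one of length at least \<open>(1 - s) / 2\<close> before time
      \<open>t\<close>; \<open>s'\<close> leaves no more than this. The other bound puts
      \<open>s'\<close> above \<open>1 - v\<close>.\<close>
    define s' where "s' = max (1 - (1 - s) / 2) (1 - v / 2)"
    have "1 - (1 - s) / 2 \<le> s'" "1 - v / 2 \<le> s'" "s' < 1" using s v by (auto simp: s'_def)
    then have s': "1 - v < s'" "s' < 1" "1 - s' \<le> (1 - s) / 2" using v by linarith+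
    obtain \<delta>' where \<delta>': "0 < \<delta>'" "\<And>t B. \<bar>t - 1\<bar> < \<rho> \<Longrightarrow> B \<in> sets borel \<Longrightarrow> B \<inter> S \<subseteq> ball c \<delta>' \<Longrightarrow>
      measure (P 0) {f \<in> D. far c (t - v) (t - 1 + s') \<eta> f \<and> f t \<in> B} \<le> \<epsilon> * measure (P 0) {f \<in> D. f t \<in> B}"
      using tc[OF s'(1,2)] by blast
    have "measure (P 0) {f \<in> A. f 1 \<in> ball c \<delta>} \<le> \<epsilon> * measure (P 0) {f \<in> D. f 1 \<in> ball c \<delta>}"
    proof (rule endpoint_bound_local_global[OF A, of "c - d" "c + d"])
      fix x assume x: "c - d \<le> x" "x \<le> c + d"
      then have xc: "\<bar>x - c\<bar> \<le> d" by linarith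
      define k where "k = x / c"
      have kc: "k * c = x" using c0 by (simp add: k_def)
      have "\<bar>k - 1\<bar> * \<bar>c\<bar> = \<bar>x - c\<bar>" using c0 kc by (simp flip: abs_mult add: left_diff_distrib)
      also have "\<dots> \<le> 1 / 2 * \<bar>c\<bar>" using xc d by linarith
      finally have "\<bar>k - 1\<bar> \<le> 1 / 2" using c0 by (simp add: mult_le_cancel_right)
      then have k: "1 / 2 \<le> k" "k \<le> 3 / 2" by (auto simp: abs_if split: if_splits)
      \<comment> \<open>With this length the spatial factor of \<open>sc t\<close> is exactly
        \<open>k\<close>, so \<open>sc t\<close> carries an endpoint \<open>c\<close> at time
        \<open>t\<close> to the endpoint \<open>x\<close> at time 1.\<close>
      define t where "t = (c / x) powr \<gamma>"
      have x0: "x \<noteq> 0" using k c0 by (auto simp: k_def)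
      have t: "\<bar>t - 1\<bar> < \<rho>" unfolding t_def using xc d by (intro d1') linarith
      have t0: "0 < t" "t \<le> 2" "1 / 2 \<le> t" using t \<rho> by (auto simp: abs_if split: if_splits)
      have "t = (1 / k) powr \<gamma>" by (simp add: t_def k_def)
      then have tk: "(1 / t) powr (1 / \<gamma>) = k" using k \<gamma> by (simp add: powr_divide powr_powr)
      have sc: "sc t f r = k * f (r * t)" if "0 \<le> r" for f r using that by (simp add: path_scaling_def tk)
      have far: "far c (t - v) (t - 1 + s') \<eta> f" if f: "far c u s \<eta>0 (sc t f)" for f
      proof -
        obtain r where r: "u < r" "r < s" "\<bar>sc t f r - c\<bar> > \<eta>0" using f by (auto simp: far_def)
        have "\<bar>k * f (r * t) - c\<bar> > \<eta>0" using r sc[of r f] u by simp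
        moreover have "k * f (r * t) - c = k * (f (r * t) - c) + (x - c)" using kc by (simp add: algebra_simps)
        ultimately have "\<bar>k * (f (r * t) - c)\<bar> > \<eta>0 / 2" using xc d by linarith
        then have "k * \<bar>f (r * t) - c\<bar> > \<eta>0 / 2" using k by (simp add: abs_mult)
        moreover have "k * \<bar>f (r * t) - c\<bar> \<le> 3 / 2 * \<bar>f (r * t) - c\<bar>" using k by (intro mult_right_mono) auto
        moreover have "\<eta> < y" if "\<eta>0 / 2 < k * y" "k * y \<le> 3 / 2 * y" for y using that \<eta> \<eta>0 by linarith
        ultimately have "\<eta> < \<bar>f (r * t) - c\<bar>" by blast
        moreover have "t - v < r * t"
        proof -
          have "u * t < r * t" using r t0 by simp
          moreover have "t - v \<le> u * t" using t0 v by (simp add: u_def algebra_simps)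
          ultimately show ?thesis by linarith
        qed
        moreover have "r * t < t - 1 + s'"
        proof -
          have "r * t < s * t" using r t0 by simp
          moreover have "1 / 2 * (1 - s) \<le> t * (1 - s)" using t0 s by (intro mult_right_mono) auto
          moreover have "t * (1 - s) = t - s * t" by (simp add: algebra_simps)
          ultimately show ?thesis using s'(3) by linarith
        qed
        ultimately show ?thesis unfolding far_def by blast
      qed
      have "measure (P 0) {f \<in> A. f 1 \<in> B} \<le> \<epsilon> * measure (P 0) {f \<in> D. f 1 \<in> B}"
        if B: "B \<in> sets borel" "B \<subseteq> ball x (\<delta>' / 2)" for B
      proof -
        \<comment> \<open>The preimage lies in the ball of radius \<open>\<delta>'\<close> around
          \<open>c\<close> because \<open>k \<ge> 1 / 2\<close>; this explains the radius
          \<open>\<delta>' / 2\<close> around \<open>x\<close>.\<close>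
        define B' where "B' = (\<lambda>z. k * z) -` B"
        have B': "B' \<in> sets borel" using measurable_sets[of "\<lambda>z. k * z" borel borel B] B by (simp add: B'_def)
        have B'c: "B' \<inter> S \<subseteq> ball c \<delta>'"
        proof
          fix z assume "z \<in> B' \<inter> S"
          then have "k * z \<in> ball x (\<delta>' / 2)" using B by (auto simp: B'_def)
          then have "\<bar>k * (c - z)\<bar> < \<delta>' / 2" using kc by (simp add: dist_real_def right_diff_distrib)
          then have "k * \<bar>c - z\<bar> < \<delta>' / 2" using k by (simp add: abs_mult)
          moreover have "1 / 2 * \<bar>c - z\<bar> \<le> k * \<bar>c - z\<bar>" using k by (intro mult_right_mono) auto
          ultimately show "z \<in> ball c \<delta>'" by (simp add: dist_real_def)
        qed
        have sc1: "sc t f 1 \<in> B \<longleftrightarrow> f t \<in> B'" for f using sc[of 1 f] by (simp add: B'_def)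
        have AB: "{f \<in> A. f 1 \<in> B} \<in> sets \<Omega>"
        proof -
          have "{f \<in> A. f 1 \<in> B} = A \<inter> {f \<in> D. f 1 \<in> B}" by (auto simp: A_def)
          then show ?thesis using A coord_set[of 1 B] B by simp
        qed
        have "measure (P 0) {f \<in> A. f 1 \<in> B} = measure (P 0) {f \<in> D. sc t f \<in> {f \<in> A. f 1 \<in> B}}"
          by (rule measure_scaled[OF t0(1) AB, symmetric])
        also have "\<dots> \<le> measure (P 0) {f \<in> D. far c (t - v) (t - 1 + s') \<eta> f \<and> f t \<in> B'}"
        proof (rule P0.finite_measure_mono)
          show "{f \<in> D. sc t f \<in> {f \<in> A. f 1 \<in> B}} \<subseteq> {f \<in> D. far c (t - v) (t - 1 + s') \<eta> f \<and> f t \<in> B'}"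
            using far sc1 by (auto simp: A_def)
          have "{f \<in> D. far c (t - v) (t - 1 + s') \<eta> f \<and> f t \<in> B'} = {f \<in> D. far c (t - v) (t - 1 + s') \<eta> f} \<inter> {f \<in> D. f t \<in> B'}" by auto
          then show "{f \<in> D. far c (t - v) (t - 1 + s') \<eta> f \<and> f t \<in> B'} \<in> sets (P 0)"
            using far_set[of "t - v" c "t - 1 + s'" \<eta>] coord_set[of t B'] B' t0 v by (simp add: sets_P)
        qed
        also have "\<dots> \<le> \<epsilon> * measure (P 0) {f \<in> D. f t \<in> B'}" by (rule \<delta>'(2)[OF t B' B'c])
        also have "measure (P 0) {f \<in> D. f t \<in> B'} = measure (P 0) {f \<in> D. f 1 \<in> B}"
        proof -
          have "{f \<in> D. f t \<in> B'} = {f \<in> D. sc t f \<in> {f \<in> D. f 1 \<in> B}}" using sc_in_D[OF _ t0(1)] sc1 by auto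
          then show ?thesis using measure_scaled[OF t0(1) coord_set[of 1 B]] B by simp
        qed
        finally show ?thesis .
      qed
      then show "\<exists>\<delta>>0. \<forall>B\<in>sets borel. B \<subseteq> ball x \<delta> \<longrightarrow>
          measure (P 0) {f \<in> A. f 1 \<in> B} \<le> \<epsilon> * measure (P 0) {f \<in> D. f 1 \<in> B}"
        using \<delta>'(1) by (intro exI[of _ "\<delta>' / 2"]) auto
    qed (use d \<delta> in \<open>auto simp: dist_real_def abs_if split: if_splits\<close>)
    then show ?thesis by (simp add: A_def conj_assoc)
  qed
  then show "\<exists>u d. 0 < u \<and> u < 1 \<and> 0 < d \<and> (\<forall>\<delta> s. 0 < \<delta> \<longrightarrow> \<delta> < d \<longrightarrow> 0 < s \<longrightarrow> s < 1 \<longrightarrow>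
     measure (P 0) {f \<in> D. far c u s \<eta>0 f \<and> f 1 \<in> ball c \<delta>} \<le> \<epsilon> * measure (P 0) {f \<in> D. f 1 \<in> ball c \<delta>})"
    using u d(1) by blast
qed

section \<open>Tightness at the origin\<close>

text \<open>A tent function below the indicator of \<open>(-R, R)\<close> has an expectation above
  1/2 from 0 once \<open>R\<close> is large, and the Feller property carries this to nearby starting
  points.\<close>

lemma Feller_bump:
  "\<exists>R>0. \<exists>z0>0. \<forall>z\<in>S. \<bar>z\<bar> < z0 \<longrightarrow> 1 / 2 \<le> measure (P z) {f \<in> D. \<bar>f 1\<bar> < R}"
proof -
  interpret P0: prob_space "P 0" by (rule prob_P0)
  define \<phi> where "\<phi> R x = max 0 (1 - \<bar>x\<bar> / R)" for R x :: real
  have \<phi>: "0 \<le> \<phi> R x" "\<phi> R x \<le> 1" if "0 < R" for R x using that by (auto simp: \<phi>_def)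
  have \<phi>m: "(\<lambda>f. \<phi> R (f 1)) \<in> borel_measurable (P z)" if "z \<in> S" for R z
  proof -
    have [measurable]: "(\<lambda>f. f 1) \<in> borel_measurable (P z)"
      using measurable_coordinate[of 1 "{0..}" S "{0..}"] that by (simp add: measurable_P)
    show ?thesis unfolding \<phi>_def by measurable
  qed
  have \<phi>C0: "\<phi> R \<in> C0 S" if R: "0 < R" for R
    unfolding C0_def
  proof (intro CollectI conjI allI impI)
    show "continuous_on S (\<phi> R)" unfolding \<phi>_def using R by (intro continuous_intros) auto
    fix e :: real assume e: "0 < e"
    have cl: "closed {x \<in> S. e \<le> \<bar>\<phi> R x\<bar>}"
    proof -
      have "closed S" using S by auto
      moreover have "continuous_on UNIV (\<lambda>x. \<bar>\<phi> R x\<bar>)" unfolding \<phi>_def using R by (intro continuous_intros) auto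
      then have "closed {x. e \<le> \<bar>\<phi> R x\<bar>}" by (intro closed_Collect_le continuous_on_const)
      ultimately show ?thesis by (simp add: closed_Int Collect_conj_eq)
    qed
    moreover have "{x \<in> S. e \<le> \<bar>\<phi> R x\<bar>} \<subseteq> cball 0 R"
    proof
      fix x assume x: "x \<in> {x \<in> S. e \<le> \<bar>\<phi> R x\<bar>}"
      show "x \<in> cball 0 R"
      proof (rule ccontr)
        assume "x \<notin> cball 0 R"
        then have "1 \<le> \<bar>x\<bar> / R" using R by (simp add: pos_le_divide_eq)
        then have "\<phi> R x = 0" by (simp add: \<phi>_def)
        then show False using x e by simp
      qed
    qed
    ultimately show "compact {x \<in> S. e \<le> \<bar>\<phi> R x\<bar>}"
      using bounded_subset[OF bounded_cball] compact_eq_bounded_closed by blast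
  qed
  have "(\<lambda>n. \<integral>f. \<phi> (real (Suc n)) (f 1) \<partial>P 0) \<longlonglongrightarrow> (\<integral>f. (1 :: real) \<partial>P 0)"
  proof (rule integral_dominated_convergence[where w="\<lambda>_. 1"])
    show "AE f in P 0. (\<lambda>n. \<phi> (real (Suc n)) (f 1)) \<longlonglongrightarrow> 1"
    proof (rule AE_I2)
      fix f :: "real \<Rightarrow> real"
      have "(\<lambda>n. \<bar>f 1\<bar> * (1 / real (Suc n))) \<longlonglongrightarrow> \<bar>f 1\<bar> * 0"
        by (intro tendsto_mult tendsto_const LIMSEQ_Suc[OF lim_1_over_n])
      then have "(\<lambda>n. max 0 (1 - \<bar>f 1\<bar> * (1 / real (Suc n)))) \<longlonglongrightarrow> max 0 (1 - \<bar>f 1\<bar> * 0)"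
        by (intro tendsto_max tendsto_diff tendsto_const)
      then show "(\<lambda>n. \<phi> (real (Suc n)) (f 1)) \<longlonglongrightarrow> 1" by (simp add: \<phi>_def)
    qed
    show "AE f in P 0. norm (\<phi> (real (Suc n)) (f 1)) \<le> 1" for n
      using \<phi>[of "real (Suc n)"] by (intro AE_I2) simp
  qed (use \<phi>m[OF zero_S] in auto)
  from order_tendstoD(1)[OF this, of "1 / 2"]
  have "\<forall>\<^sub>F n in sequentially. 1 / 2 < (\<integral>f. \<phi> (real (Suc n)) (f 1) \<partial>P 0)"
    by (simp add: P0.prob_space)
  then obtain n where n: "1 / 2 < (\<integral>f. \<phi> (real (Suc n)) (f 1) \<partial>P 0)" using eventually_happens by force
  define R where "R = real (Suc n)"
  have R: "0 < R" by (simp add: R_def)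
  have "transition_semigroup P 1 (\<phi> R) \<in> C0 S"
    using feller \<phi>C0[OF R] by (auto simp: feller_family_def)
  then have "continuous_on S (\<lambda>z. \<integral>f. \<phi> R (f 1) \<partial>P z)" by (simp add: C0_def transition_semigroup_def)
  then have "((\<lambda>z. \<integral>f. \<phi> R (f 1) \<partial>P z) \<longlongrightarrow> (\<integral>f. \<phi> R (f 1) \<partial>P 0)) (at 0 within S)"
    using zero_S unfolding continuous_on_def by blast
  from order_tendstoD(1)[OF this, of "1 / 2"] have "\<forall>\<^sub>F z in at 0 within S. 1 / 2 < (\<integral>f. \<phi> R (f 1) \<partial>P z)"
    using n by (simp add: R_def)
  then obtain z0 where z0: "0 < z0" "\<And>z. z \<in> S \<Longrightarrow> z \<noteq> 0 \<Longrightarrow> \<bar>z\<bar> < z0 \<Longrightarrow> 1 / 2 < (\<integral>f. \<phi> R (f 1) \<partial>P z)"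
    unfolding eventually_at by (auto simp: dist_real_def)
  have "1 / 2 \<le> measure (P z) {f \<in> D. \<bar>f 1\<bar> < R}" if z: "z \<in> S" "\<bar>z\<bar> < z0" for z
  proof -
    interpret Pz: prob_space "P z" by (rule prob_P[OF z(1)])
    have "{f \<in> D. f 1 \<in> {-R<..<R}} \<in> sets \<Omega>" by (rule coord_set) auto
    moreover have "{f \<in> D. f 1 \<in> {-R<..<R}} = {f \<in> D. \<bar>f 1\<bar> < R}" by auto
    ultimately have A: "{f \<in> D. \<bar>f 1\<bar> < R} \<in> sets (P z)" using z by (simp add: sets_P)
    have "1 / 2 < (\<integral>f. \<phi> R (f 1) \<partial>P z)" using z0(2)[OF z(1)] z n by (cases "z = 0") (auto simp: R_def)
    also have "\<dots> \<le> (\<integral>f. indicator {f \<in> D. \<bar>f 1\<bar> < R} f \<partial>P z)"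
    proof (rule integral_mono)
      show "integrable (P z) (\<lambda>f. \<phi> R (f 1))"
        by (rule Pz.integrable_const_bound[of _ 1]) (use \<phi>[OF R] \<phi>m[OF z(1)] in auto)
      show "integrable (P z) (indicator {f \<in> D. \<bar>f 1\<bar> < R} :: _ \<Rightarrow> real)"
        by (rule Pz.integrable_const_bound[of _ 1]) (use A in \<open>auto simp: indicator_def\<close>)
      fix f assume f: "f \<in> space (P z)"
      show "\<phi> R (f 1) \<le> indicator {f \<in> D. \<bar>f 1\<bar> < R} f"
      proof (cases "\<bar>f 1\<bar> < R")
        case True
        then show ?thesis using f z \<phi>[OF R] by (simp add: space_P)
      next
        case False
        then have "1 \<le> \<bar>f 1\<bar> / R" using R by (simp add: pos_le_divide_eq)
        then show ?thesis by (simp add: \<phi>_def)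
      qed
    qed
    also have "\<dots> = measure (P z) {f \<in> D. \<bar>f 1\<bar> < R}"
    proof -
      have "{f \<in> D. \<bar>f 1\<bar> < R} \<inter> space (P z) = {f \<in> D. \<bar>f 1\<bar> < R}" using z by (auto simp: space_P)
      then show ?thesis by simp
    qed
    finally show ?thesis by simp
  qed
  then show ?thesis using R z0(1) by blast
qed

lemma abs_coord_set: "0 \<le> t \<Longrightarrow> {f \<in> D. \<bar>f t\<bar> < r} \<in> sets \<Omega>"
proof -
  assume "0 \<le> t"
  then have "{f \<in> D. f t \<in> {-r<..<r}} \<in> sets \<Omega>" by (rule coord_set) auto
  moreover have "{f \<in> D. f t \<in> {-r<..<r}} = {f \<in> D. \<bar>f t\<bar> < r}" by auto
  ultimately show ?thesis by simp
qed

lemma measure_scaled_general: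
  assumes x: "x \<in> S" and v: "0 < v" and A: "A \<in> sets \<Omega>"
  shows "measure (P (v powr (1 / \<gamma>) * x)) A = measure (P x) {f \<in> D. path_scaling \<gamma> v f \<in> A}"
proof -
  have m: "path_scaling \<gamma> v \<in> measurable (P x) \<Omega>"
    using measurable_path_scaling[OF v cone_S] x by (simp add: measurable_P)
  have "measure (distr (P x) \<Omega> (path_scaling \<gamma> v)) A = measure (P x) (path_scaling \<gamma> v -` A \<inter> space (P x))"
    by (rule measure_distr[OF m A])
  moreover have "path_scaling \<gamma> v -` A \<inter> space (P x) = {f \<in> D. path_scaling \<gamma> v f \<in> A}" using x by (auto simp: space_P)
  ultimately show ?thesis using scaling[OF x v] by simp
qed

text \<open>The previous estimate at scale \<open>b\<close>. One bound for all \<open>b\<close>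
  between \<open>w\<close> and \<open>3 * w\<close> is wanted because the starting time will vary
  over a window of length \<open>2 * \<omega>\<close> while the observation time is fixed.\<close>

lemma stays_near_zero:
  "\<exists>R>0. \<exists>z0>0. \<forall>w>0. \<forall>b z. w \<le> b \<longrightarrow> b \<le> 3 * w \<longrightarrow> z \<in> S \<longrightarrow> \<bar>z\<bar> < z0 * w powr (1 / \<gamma>) \<longrightarrow>
     1 / 2 \<le> measure (P z) {f \<in> D. \<bar>f b\<bar> < R * (3 * w) powr (1 / \<gamma>)}"
proof -
  obtain R z0 where R: "0 < R" "0 < z0" "\<And>z. z \<in> S \<Longrightarrow> \<bar>z\<bar> < z0 \<Longrightarrow> 1 / 2 \<le> measure (P z) {f \<in> D. \<bar>f 1\<bar> < R}"
    using Feller_bump by blast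
  have "1 / 2 \<le> measure (P z) {f \<in> D. \<bar>f b\<bar> < R * (3 * w) powr (1 / \<gamma>)}"
    if w: "0 < w" "w \<le> b" "b \<le> 3 * w" and z: "z \<in> S" "\<bar>z\<bar> < z0 * w powr (1 / \<gamma>)" for w b z
  proof -
    define k where "k = b powr (1 / \<gamma>)"
    have b: "0 < b" using w by simp
    have k: "0 < k" "w powr (1 / \<gamma>) \<le> k" "k \<le> (3 * w) powr (1 / \<gamma>)"
      using w b \<gamma> by (auto simp: k_def intro!: powr_mono2)
    define x where "x = z / k"
    have "inverse k * z \<in> S" using cone_S z(1) k unfolding cone_def by simp
    then have x: "x \<in> S" by (simp add: x_def divide_inverse mult.commute)
    have "\<bar>z\<bar> < z0 * k" using z(2) k R(2) by (meson less_le_trans mult_left_mono less_imp_le)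
    then have "\<bar>x\<bar> < z0" using k by (simp add: x_def pos_divide_less_eq)
    then have "1 / 2 \<le> measure (P x) {f \<in> D. \<bar>f 1\<bar> < R}" using R(3) x by blast
    also have "\<dots> \<le> measure (P x) {f \<in> D. path_scaling \<gamma> b f \<in> {f \<in> D. \<bar>f b\<bar> < R * (3 * w) powr (1 / \<gamma>)}}"
    proof -
      interpret Px: prob_space "P x" by (rule prob_P[OF x])
      show ?thesis
      proof (rule Px.finite_measure_mono)
        show "{f \<in> D. \<bar>f 1\<bar> < R} \<subseteq> {f \<in> D. path_scaling \<gamma> b f \<in> {f \<in> D. \<bar>f b\<bar> < R * (3 * w) powr (1 / \<gamma>)}}"
        proof
          fix f assume f: "f \<in> {f \<in> D. \<bar>f 1\<bar> < R}"
          have "\<bar>path_scaling \<gamma> b f b\<bar> = k * \<bar>f 1\<bar>" using b k by (simp add: path_scaling_def k_def abs_mult)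
          also have "\<dots> < k * R" using f k by simp
          also have "\<dots> \<le> R * (3 * w) powr (1 / \<gamma>)" using k R by (simp add: mult.commute)
          finally show "f \<in> {f \<in> D. path_scaling \<gamma> b f \<in> {f \<in> D. \<bar>f b\<bar> < R * (3 * w) powr (1 / \<gamma>)}}"
            using f path_scaling_cadlag[OF _ b cone_S] by simp
        qed
        have "path_scaling \<gamma> b -` {f \<in> D. \<bar>f b\<bar> < R * (3 * w) powr (1 / \<gamma>)} \<inter> space \<Omega> \<in> sets \<Omega>"
          using b by (intro measurable_sets[OF measurable_path_scaling[OF b cone_S]] abs_coord_set) simp
        then show "{f \<in> D. path_scaling \<gamma> b f \<in> {f \<in> D. \<bar>f b\<bar> < R * (3 * w) powr (1 / \<gamma>)}} \<in> sets (P x)"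
          using x by (simp add: sets_P vimage_def Int_def conj_commute)
      qed
    qed
    also have "\<dots> = measure (P (k * x)) {f \<in> D. \<bar>f b\<bar> < R * (3 * w) powr (1 / \<gamma>)}"
      unfolding k_def using b by (intro measure_scaled_general[OF x b, symmetric] abs_coord_set) simp
    also have "k * x = z" using k by (simp add: x_def)
    finally show ?thesis .
  qed
  then show ?thesis using R(1,2) by blast
qed

section \<open>Zeros close to time 1\<close>

lemma markov_lower_bound:
  assumes r: "0 \<le> r" and N: "N \<in> sets (Ft r)" and V: "V \<in> sets \<Omega>" and a: "0 \<le> a"
    and low: "AE f in P 0. f \<in> N \<longrightarrow> a \<le> measure (P (f r)) V"
  shows "a * measure (P 0) N \<le> measure (P 0) {f \<in> N. path_shift r f \<in> V}"
proof -
  interpret P0: prob_space "P 0" by (rule prob_P0)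
  have ND: "N \<subseteq> D" using sets.sets_into_space[OF N] by simp
  have Nb: "bounded_measurable (Ft r) (indicator N :: _ \<Rightarrow> real)"
    by (rule bounded_measurableI[of _ _ 1]) (use N in \<open>auto simp: indicator_def\<close>)
  have N0: "(indicator N :: _ \<Rightarrow> real) \<in> borel_measurable (P 0)"
    using measurable_coord_algebra_mono[of "indicator N :: _ \<Rightarrow> real" S "{0..}" "{0..r}" borel "{0..}"] N
    by (simp add: measurable_P)
  then have NP: "N \<in> sets (P 0)" using ND by (simp add: borel_measurable_indicator_iff space_P Int_absorb2)
  have Vb: "bounded_measurable \<Omega> (indicator V :: _ \<Rightarrow> real)"
    by (rule bounded_measurableI[of _ _ 1]) (use V in \<open>auto simp: indicator_def\<close>)
  have mV: "(\<integral>f. indicator V f \<partial>P z) = measure (P z) V" if "z \<in> S" for z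
    using V sets.sets_into_space[OF V] by (simp add: space_P that Int_absorb2)
  have pm: "(\<lambda>z. measure (P z) V) \<in> borel_measurable bS"
    using integral_measurable[OF Vb] by (rule measurable_cong[THEN iffD1, rotated]) (rule mV, simp)
  have m1: "measure (P z) V \<le> 1" if "z \<in> S" for z using prob_space.prob_le_1[OF prob_P[OF that]] .
  have coordm: "(\<lambda>f. measure (P (f r)) V) \<in> borel_measurable (P 0)" using r by (intro coord_compose_P[OF pm]) auto
  have NV: "{f \<in> N. path_shift r f \<in> V} \<in> sets (P 0)"
  proof -
    have "path_shift r -` V \<inter> space \<Omega> \<in> sets \<Omega>" by (rule measurable_sets[OF measurable_path_shift[OF r] V])
    moreover have "{f \<in> N. path_shift r f \<in> V} = N \<inter> (path_shift r -` V \<inter> space \<Omega>)" using ND by auto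
    ultimately show ?thesis using NP by (simp add: sets_P)
  qed
  have "a * measure (P 0) N = (\<integral>f. a * indicator N f \<partial>P 0)" using NP ND by (simp add: space_P Int_absorb2)
  also have "\<dots> \<le> (\<integral>f. indicator N f * measure (P (f r)) V \<partial>P 0)"
  proof (rule integral_mono_AE)
    show "integrable (P 0) (\<lambda>f. a * indicator N f)" using NP by (auto intro!: integrable_real_indicator simp: P0.emeasure_eq_measure)
    show "integrable (P 0) (\<lambda>f. indicator N f * measure (P (f r)) V)"
    proof (rule P0.integrable_const_bound[of _ 1])
      show "AE f in P 0. norm (indicator N f * measure (P (f r)) V) \<le> 1"
        using m1 r by (intro AE_I2) (auto simp: indicator_def space_P path_in_S)
    qed (use N0 coordm in auto)
    show "AE f in P 0. a * indicator N f \<le> indicator N f * measure (P (f r)) V"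
      using low by eventually_elim (auto simp: indicator_def)
  qed
  also have "\<dots> = (\<integral>f. indicator N f * (\<integral>h. indicator V h \<partial>P (f r)) \<partial>P 0)"
    using r by (intro Bochner_Integration.integral_cong refl) (subst mV, auto simp: space_P path_in_S)
  also have "\<dots> = (\<integral>f. indicator N f * indicator V (path_shift r f) \<partial>P 0)"
    by (rule markov[OF zero_S r Nb Vb, symmetric])
  also have "\<dots> = (\<integral>f. indicator {f \<in> N. path_shift r f \<in> V} f \<partial>P 0)"
    by (intro Bochner_Integration.integral_cong refl) (auto simp: indicator_def)
  also have "\<dots> = measure (P 0) {f \<in> N. path_shift r f \<in> V}"
  proof -
    have "{f \<in> N. path_shift r f \<in> V} \<inter> space (P 0) = {f \<in> N. path_shift r f \<in> V}" using ND by (auto simp: space_P)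
    then show ?thesis using NV by simp
  qed
  finally show ?thesis .
qed

text \<open>A maximal inequality of Ottaviani type: from the first visit to the small interval the
  path ends in \<open>V\<close> with conditional probability at least 1/2. For finitely many times
  the decomposition by the first visit needs only the simple Markov property.\<close>

lemma grid_visit_bound:
  assumes T: "finite T" "\<And>r. r \<in> T \<Longrightarrow> 0 \<le> r \<and> r \<le> b" and V: "V = {f \<in> D. \<bar>f b\<bar> < y}"
    and low: "\<And>r z. r \<in> T \<Longrightarrow> z \<in> S \<Longrightarrow> \<bar>z\<bar> < \<kappa> \<Longrightarrow> 1 / 2 \<le> measure (P z) {f \<in> D. \<bar>f (b - r)\<bar> < y}"
  shows "measure (P 0) {f \<in> D. \<exists>r\<in>T. \<bar>f r\<bar> < \<kappa>} \<le> 2 * measure (P 0) V"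
proof -
  interpret P0: prob_space "P 0" by (rule prob_P0)
  define E where "E T = {f \<in> D. \<exists>r\<in>T. \<bar>f r\<bar> < \<kappa>}" for T
  have EF: "E T' \<in> sets (Ft s)" if "finite T'" "\<And>r. r \<in> T' \<Longrightarrow> 0 \<le> r \<and> r \<le> s" for T' s
  proof -
    have "{f \<in> D. \<bar>f r\<bar> < \<kappa>} \<in> sets (Ft s)" if "0 \<le> r" "r \<le> s" for r
    proof -
      have [measurable]: "(\<lambda>f. f r) \<in> borel_measurable (Ft s)" using that by (intro measurable_coordinate) simp
      have "Measurable.pred (Ft s) (\<lambda>f. \<bar>f r\<bar> < \<kappa>)" by measurable
      from predE[OF this] show ?thesis by simp
    qed
    then have "(\<Union>r\<in>T'. {f \<in> D. \<bar>f r\<bar> < \<kappa>}) \<in> sets (Ft s)" using that by (intro sets.finite_UN) auto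
    moreover have "(\<Union>r\<in>T'. {f \<in> D. \<bar>f r\<bar> < \<kappa>}) = E T'" by (auto simp: E_def)
    ultimately show ?thesis by simp
  qed
  have E\<Omega>: "E T' \<in> sets (P 0)" if "finite T'" "T' \<subseteq> {0..}" for T'
  proof -
    have "(\<Union>r\<in>T'. {f \<in> D. \<bar>f r\<bar> < \<kappa>}) \<in> sets \<Omega>" using that by (intro sets.finite_UN abs_coord_set) auto
    moreover have "(\<Union>r\<in>T'. {f \<in> D. \<bar>f r\<bar> < \<kappa>}) = E T'" by (auto simp: E_def)
    ultimately show ?thesis by (simp add: sets_P)
  qed
  have "0 \<le> b \<or> T = {}" using T(2) by force
  then show ?thesis
  proof
    assume b: "0 \<le> b"
    have VP: "V \<in> sets (P 0)" unfolding V using b by (simp add: sets_P abs_coord_set)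
    have "T' \<subseteq> T \<Longrightarrow> 1 / 2 * measure (P 0) (E T') \<le> measure (P 0) (E T' \<inter> V)" if "finite T'" for T'
      using that
    proof (induction T' rule: finite_linorder_max_induct)
      case empty
      then show ?case by (simp add: E_def)
    next
      case (insert r T')
      have T': "finite T'" "T' \<subseteq> {0..}" and r: "0 \<le> r" "r \<le> b" "r \<in> T" using insert T by force+
      \<comment> \<open>The induction inserts the times in increasing order, so \<open>N\<close> is
        the event that the first visit occurs at \<open>r\<close>, and it belongs to the past of
        \<open>r\<close>.\<close>
      define N where "N = E {r} - E T'"
      have N: "N \<in> sets (Ft r)" unfolding N_def using insert T by (intro sets.Diff EF) (auto intro: less_imp_le)
      have Er: "E {r} \<in> sets (P 0)" "E T' \<in> sets (P 0)" using E\<Omega>[of "{r}"] E\<Omega>[of T'] r T' by auto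
      have NP: "N \<in> sets (P 0)" unfolding N_def using Er by auto
      have split: "E (insert r T') = E T' \<union> N" "E T' \<inter> N = {}" by (auto simp: N_def E_def)
      have "1 / 2 * measure (P 0) N \<le> measure (P 0) {f \<in> N. path_shift r f \<in> {f \<in> D. \<bar>f (b - r)\<bar> < y}}"
      proof (rule markov_lower_bound[OF r(1) N])
        show "{f \<in> D. \<bar>f (b - r)\<bar> < y} \<in> sets \<Omega>" using r by (intro abs_coord_set) simp
        show "AE f in P 0. f \<in> N \<longrightarrow> 1 / 2 \<le> measure (P (f r)) {f \<in> D. \<bar>f (b - r)\<bar> < y}"
          using low[OF r(3)] r by (intro AE_I2) (auto simp: N_def E_def path_in_S)
      qed simp
      also have "{f \<in> N. path_shift r f \<in> {f \<in> D. \<bar>f (b - r)\<bar> < y}} = N \<inter> V"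
        using r path_shift_cadlag[of _ S r] by (auto simp: V N_def E_def path_shift_def)
      finally have 1: "1 / 2 * measure (P 0) N \<le> measure (P 0) (N \<inter> V)" .
      have 2: "1 / 2 * measure (P 0) (E T') \<le> measure (P 0) (E T' \<inter> V)" using insert by auto
      have 3: "measure (P 0) (E (insert r T')) = measure (P 0) (E T') + measure (P 0) N"
        unfolding split(1) by (rule P0.finite_measure_Union[OF Er(2) NP split(2)])
      have 4: "measure (P 0) (E (insert r T') \<inter> V) = measure (P 0) (E T' \<inter> V) + measure (P 0) (N \<inter> V)"
        unfolding split(1) Int_Un_distrib2 using Er NP VP split(2) by (intro P0.finite_measure_Union) auto
      show ?case unfolding 3 4 using 1 2 by (simp add: field_simps)
    qed
    from this[OF T(1) order_refl] have "1 / 2 * measure (P 0) (E T) \<le> measure (P 0) (E T \<inter> V)" .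
    also have "\<dots> \<le> measure (P 0) V" using VP by (intro P0.finite_measure_mono) auto
    finally show ?thesis by (simp add: E_def)
  qed simp
qed

lemma last_hit_event: "{f \<in> D. a \<le> g f} \<in> sets P0c" "{f \<in> D. a < g f} \<in> sets P0c"
proof -
  have "Measurable.pred P0c (\<lambda>f. a \<le> g f)" "Measurable.pred P0c (\<lambda>f. a < g f)" by measurable
  from this[THEN predE] show "{f \<in> D. a \<le> g f} \<in> sets P0c" "{f \<in> D. a < g f} \<in> sets P0c" by (simp_all add: space_P)
qed

lemma sets_P0c: "A \<in> sets \<Omega> \<Longrightarrow> A \<in> sets P0c"
  by (simp add: sets_P)

text \<open>Before a late last zero the path is small at grid times. From there it is still small at
  the later time \<open>1 + \<omega>\<close> with conditional probability at least 1/2, so the event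
  about \<open>g\<close> is bounded by one about a fixed time, whose law has a density.\<close>

lemma late_zero_bound:
  assumes c0: "c = 0"
  shows "\<exists>R>0. \<forall>\<omega>. 0 < \<omega> \<longrightarrow> \<omega> \<le> 1 / 4 \<longrightarrow>
    measure P0c {f \<in> D. 1 - \<omega> \<le> g f} \<le> 2 * measure (P 0) {f \<in> D. \<bar>f (1 + \<omega>)\<bar> < R * (3 * \<omega>) powr (1 / \<gamma>)}"
proof -
  interpret M: prob_space P0c by (rule prob_P0c)
  obtain R z0 where R: "0 < R" "0 < z0" and near: "\<And>w b z. 0 < w \<Longrightarrow> w \<le> b \<Longrightarrow> b \<le> 3 * w \<Longrightarrow> z \<in> S \<Longrightarrow>
     \<bar>z\<bar> < z0 * w powr (1 / \<gamma>) \<Longrightarrow> 1 / 2 \<le> measure (P z) {f \<in> D. \<bar>f b\<bar> < R * (3 * w) powr (1 / \<gamma>)}"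
    using stays_near_zero by blast
  have "measure P0c {f \<in> D. 1 - \<omega> \<le> g f} \<le> 2 * measure (P 0) {f \<in> D. \<bar>f (1 + \<omega>)\<bar> < R * (3 * \<omega>) powr (1 / \<gamma>)}"
    if \<omega>: "0 < \<omega>" "\<omega> \<le> 1 / 4" for \<omega>
  proof -
    define V where "V = {f \<in> D. \<bar>f (1 + \<omega>)\<bar> < R * (3 * \<omega>) powr (1 / \<gamma>)}"
    define \<kappa> where "\<kappa> = z0 * \<omega> powr (1 / \<gamma>)"
    have \<kappa>: "0 < \<kappa>" using R \<omega> by (simp add: \<kappa>_def)
    \<comment> \<open>The window starts at \<open>1 - 2 * \<omega>\<close> since grid points lie
      strictly before \<open>g\<close>. The waiting time until \<open>1 + \<omega>\<close> is then
      between \<open>\<omega>\<close> and \<open>3 * \<omega>\<close>.\<close>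
    define T where "T N = (\<lambda>k. real k / real N) ` {k. k \<le> N \<and> 1 - 2 * \<omega> \<le> real k / real N}" for N
    define E where "E N = {f \<in> D. \<exists>r\<in>T N. \<bar>f r\<bar> < \<kappa>}" for N
    define A where "A = {f \<in> D. 1 - \<omega> \<le> g f}"
    have A: "A \<in> sets P0c" unfolding A_def by (rule last_hit_event)
    have finT: "finite (T N)" for N unfolding T_def by (intro finite_imageI) (rule finite_subset[of _ "{..N}"], auto)
    have Tr: "1 - 2 * \<omega> \<le> r \<and> 0 \<le> r \<and> r \<le> 1" if "r \<in> T N" for r N
      using that \<omega> by (cases "N = 0") (auto simp: T_def divide_le_eq)
    have E: "E N \<in> sets \<Omega>" for N
    proof -
      have "(\<Union>r\<in>T N. {f \<in> D. \<bar>f r\<bar> < \<kappa>}) \<in> sets \<Omega>" using finT Tr by (intro sets.finite_UN abs_coord_set) auto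
      moreover have "(\<Union>r\<in>T N. {f \<in> D. \<bar>f r\<bar> < \<kappa>}) = E N" by (auto simp: E_def)
      ultimately show ?thesis by simp
    qed
    have EV: "measure (P 0) (E N) \<le> 2 * measure (P 0) V" for N
      unfolding E_def
    proof (rule grid_visit_bound[OF finT _ V_def])
      show "0 \<le> r \<and> r \<le> 1 + \<omega>" if "r \<in> T N" for r using Tr[OF that] \<omega> by auto
      show "1 / 2 \<le> measure (P z) {f \<in> D. \<bar>f (1 + \<omega> - r)\<bar> < R * (3 * \<omega>) powr (1 / \<gamma>)}"
        if "r \<in> T N" "z \<in> S" "\<bar>z\<bar> < \<kappa>" for r z
        using Tr[OF that(1)] that \<omega> by (intro near) (auto simp: \<kappa>_def)
    qed
    have AE: "A - E N \<in> sets P0c" for N using A sets_P0c[OF E] by auto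
    have "(\<lambda>N. \<integral>f. indicator (A - E N) f \<partial>P0c) \<longlonglongrightarrow> (\<integral>f. (0 :: real) \<partial>P0c)"
    proof (rule integral_dominated_convergence[where w="\<lambda>_. 1"])
      show "AE f in P0c. (\<lambda>N. indicator (A - E N) f :: real) \<longlonglongrightarrow> 0"
        using last_hit_good AE_space
      proof eventually_elim
        case (elim f)
        then have f: "f \<in> D" by (simp add: space_P)
        show ?case
        proof (cases "f \<in> A")
          case True
          have "curve (g f) = 0" unfolding curve_def using c0 by simp
          then have "(f \<longlongrightarrow> 0) (at_left (g f))"
            using cadlag_Lim_left[OF f, of "g f"] elim by simp
          then have "(\<lambda>N. f (grid N f)) \<longlonglongrightarrow> 0" by (rule filterlim_compose[OF _ grid_tendsto])
          from tendstoD[OF this \<kappa>] have 1: "\<forall>\<^sub>F N in sequentially. \<bar>f (grid N f)\<bar> < \<kappa>" by (simp add: dist_real_def)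
          have "(\<lambda>N. grid N f) \<longlonglongrightarrow> g f" using grid_tendsto[of f] by (simp add: filterlim_at)
          then have 2: "\<forall>\<^sub>F N in sequentially. 1 - 2 * \<omega> < grid N f"
            using True \<omega> by (intro order_tendstoD(1)) (auto simp: A_def)
          have "\<forall>\<^sub>F N in sequentially. indicator (A - E N) f = (0 :: real)"
            using 1 2 eventually_gt_at_top[of 0]
          proof eventually_elim
            case (elim N)
            define i where "i = \<lceil>real N * g f\<rceil> - 1"
            have gi: "grid N f = of_int i / real N" by (simp add: grid_def i_def)
            have "0 < grid N f" using elim(2) \<omega> by linarith
            then have i0: "0 < i" using elim(3) by (simp add: gi zero_less_divide_iff)
            have "grid N f < 1" using grid_bounds(1)[OF elim(3), of f] last_hit_bounds(2)[of f] by linarith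
            then have iN: "i < int N" using elim(3) by (simp add: gi pos_divide_less_eq)
            have k: "grid N f = real (nat i) / real N" using i0 by (simp add: gi)
            have "nat i \<le> N \<and> 1 - 2 * \<omega> \<le> real (nat i) / real N" using iN elim(2) k by auto
            then have "grid N f \<in> T N" unfolding T_def k by blast
            then have "f \<in> E N" using elim(1) f by (auto simp: E_def)
            then show ?case by simp
          qed
          then show ?thesis by (rule tendsto_eventually)
        qed simp
      qed
      show "indicator (A - E N) \<in> borel_measurable P0c" for N by (rule borel_measurable_indicator[OF AE])
    qed (auto simp: indicator_def)
    moreover have "(A - E N) \<inter> space (P 0) = A - E N" for N by (auto simp: A_def space_P)
    ultimately have lim: "(\<lambda>N. 2 * measure (P 0) V + measure P0c (A - E N)) \<longlonglongrightarrow> 2 * measure (P 0) V + 0"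
      by (intro tendsto_add tendsto_const) simp
    have "measure P0c A \<le> 2 * measure (P 0) V + measure P0c (A - E N)" for N
    proof -
      have "measure P0c A \<le> measure P0c (E N \<union> (A - E N))"
        using A AE sets_P0c[OF E] by (intro M.finite_measure_mono) auto
      also have "\<dots> = measure P0c (E N) + measure P0c (A - E N)"
        using AE sets_P0c[OF E] by (intro M.finite_measure_Union) auto
      also have "measure P0c (E N) = measure (P 0) (E N)" using E by (simp add: sets_P)
      finally show ?thesis using EV[of N] by linarith
    qed
    then have "measure P0c A \<le> 2 * measure (P 0) V + 0" by (intro LIMSEQ_le_const[OF lim]) auto
    then show ?thesis by (simp add: A_def V_def)
  qed
  then show ?thesis using R(1) by blast
qed

text \<open>This is an inequality for fixed times, with a \<open>u\<close> that depends on none of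
  them and with no endpoint neighbourhood. The bridge limit is used here with the grid restricted to
  times after \<open>\<tau>\<close>.\<close>

lemma far_before_last_hit:
  assumes c0: "c = 0" and \<epsilon>: "0 < \<epsilon>" and \<eta>: "0 < \<eta>"
  shows "\<exists>u>0. u < 1 \<and> (\<forall>s \<tau> \<tau>1 q. u < s \<longrightarrow> s < 1 \<longrightarrow> \<tau> < \<tau>1 \<longrightarrow> 0 < \<tau>1 \<longrightarrow> q \<le> s * \<tau>1 \<longrightarrow>
    measure P0c {f \<in> D. far c u q \<eta> f \<and> \<tau>1 < g f} \<le> \<epsilon> * measure P0c {f \<in> D. \<tau> \<le> g f})"
proof -
  interpret M: prob_space P0c by (rule prob_P0c)
  obtain u where u: "0 < u" "u < 1"
    "\<And>s L. u < s \<Longrightarrow> s < 1 \<Longrightarrow> pinned_limit (indicator {f. far c u s \<eta> f}) L \<Longrightarrow> L \<le> \<epsilon>"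
    using far_pinned_small[OF \<epsilon> \<eta>] by blast
  have "measure P0c {f \<in> D. far c u q \<eta> f \<and> \<tau>1 < g f} \<le> \<epsilon> * measure P0c {f \<in> D. \<tau> \<le> g f}"
    if s: "u < s" "s < 1" and \<tau>: "\<tau> < \<tau>1" "0 < \<tau>1" "q \<le> s * \<tau>1" for s \<tau> \<tau>1 q
  proof -
    define G where "G = (indicator {f. far c u s \<eta> f} :: (real \<Rightarrow> real) \<Rightarrow> real)"
    have Gm: "G \<in> borel_measurable (Ft s)" unfolding G_def using u by (intro far_pred_indicator) auto
    have Gb: "\<bar>G f\<bar> \<le> 1" for f by (simp add: G_def indicator_def)
    have "0 < s" using s u by linarith
    then obtain L where L: "pinned_limit G L" using pinned_limit_exists[OF Gm, of 1] Gb s by blast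
    have Le: "L \<le> \<epsilon>" using u(3)[OF s] L by (simp add: G_def)
    define A where "A = {f \<in> D. far c u q \<eta> f \<and> \<tau>1 < g f}"
    define pp where "pp = measure P0c {f \<in> D. \<tau> \<le> g f}"
    have Am: "A \<in> sets P0c"
    proof -
      have "A = {f \<in> D. far c u q \<eta> f} \<inter> {f \<in> D. \<tau>1 < g f}" by (auto simp: A_def)
      then show ?thesis using sets_P0c[OF far_set[of u c q \<eta>]] last_hit_event(2)[of \<tau>1] u by auto
    qed
    let ?X = "on_grid {\<tau>..} (\<lambda>t f. G (sc t f))"
    let ?Y = "on_grid {\<tau>..} (\<lambda>t f. 1)"
    have G\<Omega>: "G \<in> borel_measurable \<Omega>" by (rule measurable_coord_algebra_mono[OF Gm]) auto
    have Xm: "?X N \<in> borel_measurable P0c" "?Y N \<in> borel_measurable P0c" if "0 < N" for N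
      using that sc_measurable_P0c[OF _ G\<Omega>] by (auto intro!: on_grid_measurable)
    have Xb: "0 \<le> ?X N f" "?X N f \<le> 1" "0 \<le> ?Y N f" "?Y N f \<le> 1" for N f
      by (auto simp: on_grid_def G_def indicator_def)
    define B where "B N = {f \<in> A. ?X (Suc N) f \<noteq> 1}" for N
    have Bm: "B N \<in> sets P0c" for N
    proof -
      have [measurable]: "?X (Suc N) \<in> borel_measurable P0c" by (rule Xm) simp
      have "Measurable.pred P0c (\<lambda>f. ?X (Suc N) f \<noteq> 1)" by measurable
      from predE[OF this] have "{f \<in> D. ?X (Suc N) f \<noteq> 1} \<in> sets P0c" by (simp add: space_P)
      moreover have "B N = A \<inter> {f \<in> D. ?X (Suc N) f \<noteq> 1}" by (auto simp: B_def A_def)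
      ultimately show ?thesis using Am by auto
    qed
    have "(\<lambda>N. \<integral>f. indicator (B N) f \<partial>P0c) \<longlonglongrightarrow> (\<integral>f. (0 :: real) \<partial>P0c)"
    proof (rule integral_dominated_convergence[where w="\<lambda>_. 1"])
      show "AE f in P0c. (\<lambda>N. indicator (B N) f :: real) \<longlonglongrightarrow> 0"
      proof (rule AE_I2)
        fix f
        show "(\<lambda>N. indicator (B N) f :: real) \<longlonglongrightarrow> 0"
        proof (cases "f \<in> A")
          case True
          then obtain r where r: "u < r" "r < q" "\<bar>f r\<bar> > \<eta>" and f: "f \<in> D" "\<tau>1 < g f" by (auto simp: A_def far_def c0)
          have "(\<lambda>N. grid N f) \<longlonglongrightarrow> g f" using grid_tendsto[of f] by (simp add: filterlim_at)
          then have "\<forall>\<^sub>F N in sequentially. \<tau>1 < grid N f" using f(2) by (rule order_tendstoD)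
          then have "\<forall>\<^sub>F N in sequentially. ?X N f = 1"
            using eventually_gt_at_top[of 0]
          proof eventually_elim
            case (elim N)
            define a where "a = grid N f"
            have a: "\<tau>1 < a" "0 < a" "a < 1" using elim \<tau> grid_bounds(1)[of N f] last_hit_bounds(2)[of f]
              by (auto simp: a_def)
            have ra: "sc a f (r / a) = (1 / a) powr (1 / \<gamma>) * f r" using a r u by (simp add: path_scaling_def)
            \<comment> \<open>With target 0 and \<open>a < 1\<close>, rescaling only enlarges
              deviations and moves times to the right. So an excursion of the path before
              \<open>q\<close> is one of the rescaled path, without any loss in
              \<open>\<eta>\<close>.\<close>
            have "1 \<le> (1 / a) powr (1 / \<gamma>)" using a \<gamma> by (intro ge_one_powr_ge_zero) auto
            then have "\<bar>f r\<bar> \<le> \<bar>sc a f (r / a)\<bar>" unfolding ra abs_mult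
              using mult_right_mono[of 1 "(1 / a) powr (1 / \<gamma>)" "\<bar>f r\<bar>"] by simp
            moreover have "u < r / a"
            proof -
              have "u * a < u * 1" using a u by (intro mult_strict_left_mono) auto
              then have "u * a < r" using r by linarith
              then show ?thesis using a by (simp add: pos_less_divide_eq)
            qed
            moreover have "r / a < s"
            proof -
              have "s * \<tau>1 < s * a" using a \<open>0 < s\<close> by simp
              then have "r < s * a" using r \<tau> by linarith
              then show ?thesis using a by (simp add: pos_divide_less_eq)
            qed
            ultimately have "far c u s \<eta> (sc a f)" using r unfolding far_def c0 by (intro exI[of _ "r / a"]) auto
            then show ?case using a \<tau> by (simp add: on_grid_def G_def a_def[symmetric])
          qed
          then have "\<forall>\<^sub>F N in sequentially. ?X (Suc N) f = 1"
            using eventually_sequentially_Suc[of "\<lambda>N. ?X N f = 1"] by simp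
          then have "\<forall>\<^sub>F N in sequentially. indicator (B N) f = (0 :: real)"
            by eventually_elim (simp add: B_def)
          then show ?thesis by (rule tendsto_eventually)
        qed (simp add: B_def)
      qed
    qed (use Bm in \<open>auto simp: indicator_def\<close>)
    moreover have "B N \<inter> space (P 0) = B N" for N by (auto simp: B_def A_def space_P)
    ultimately have Blim: "(\<lambda>N. measure P0c (B N)) \<longlonglongrightarrow> 0" by simp
    have "(\<lambda>N. (\<integral>f. ?X N f \<partial>P0c) - L * (\<integral>f. ?Y N f \<partial>P0c)) \<longlonglongrightarrow> 0"
      by (rule backward_limit[OF Gm _ _ L, of 1]) (use Gb s in auto)
    then have "(\<lambda>N. (\<integral>f. ?X (Suc N) f \<partial>P0c) - L * (\<integral>f. ?Y (Suc N) f \<partial>P0c)) \<longlonglongrightarrow> 0" by (rule LIMSEQ_Suc)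
    from tendsto_add[OF this Blim]
    have lim: "(\<lambda>N. (\<integral>f. ?X (Suc N) f \<partial>P0c) - L * (\<integral>f. ?Y (Suc N) f \<partial>P0c) + measure P0c (B N)) \<longlonglongrightarrow> 0" by simp
    have "measure P0c A - \<epsilon> * pp \<le> (\<integral>f. ?X (Suc N) f \<partial>P0c) - L * (\<integral>f. ?Y (Suc N) f \<partial>P0c) + measure P0c (B N)" for N
    proof -
      have iX: "integrable P0c (?X (Suc N))" "integrable P0c (?Y (Suc N))"
        using Xb[of "Suc N"] by (auto intro!: integrable_P0cI[of _ 1] Xm)
      have iI: "integrable P0c (indicator Z :: _ \<Rightarrow> real)" if "Z \<in> sets P0c" for Z
        by (rule integrable_P0cI[of _ 1]) (use that in \<open>auto simp: indicator_def\<close>)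
      have mI: "(\<integral>f. indicator Z f \<partial>P0c) = measure P0c Z" if "Z \<subseteq> D" for Z
        using that by (simp add: space_P Int_absorb2)
      have "measure P0c A = (\<integral>f. indicator A f \<partial>P0c)" by (rule mI[symmetric]) (auto simp: A_def)
      also have "\<dots> \<le> (\<integral>f. ?X (Suc N) f + indicator (B N) f \<partial>P0c)"
      proof (rule integral_mono[OF iI[OF Am] Bochner_Integration.integrable_add[OF iX(1) iI[OF Bm[of N]]]])
        show "indicator A f \<le> ?X (Suc N) f + indicator (B N) f" for f
          using Xb(1)[of "Suc N" f] by (auto simp: B_def indicator_def)
      qed
      also have "\<dots> = (\<integral>f. ?X (Suc N) f \<partial>P0c) + measure P0c (B N)"
      proof -
        have "B N \<subseteq> D" by (auto simp: B_def A_def)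
        from mI[OF this] show ?thesis using iX(1) iI[OF Bm[of N]] by (simp del: integral_indicator)
      qed
      finally have 1: "measure P0c A \<le> (\<integral>f. ?X (Suc N) f \<partial>P0c) + measure P0c (B N)" .
      \<comment> \<open>A grid point at or after \<open>\<tau>\<close> forces \<open>g\<close> to
        exceed \<open>\<tau>\<close>, so the total mass is at most \<open>pp\<close>.\<close>
      have "(\<integral>f. ?Y (Suc N) f \<partial>P0c) \<le> (\<integral>f. indicator {f \<in> D. \<tau> \<le> g f} f \<partial>P0c)"
      proof (rule integral_mono[OF iX(2) iI[OF last_hit_event(1)]])
        fix f assume "f \<in> space P0c"
        then have "f \<in> D" by (simp add: space_P)
        then show "?Y (Suc N) f \<le> indicator {f \<in> D. \<tau> \<le> g f} f"
          using grid_bounds(1)[of "Suc N" f] by (auto simp: on_grid_def indicator_def)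
      qed
      also have "\<dots> = pp" unfolding pp_def by (rule mI) auto
      finally have 2: "(\<integral>f. ?Y (Suc N) f \<partial>P0c) \<le> pp" .
      have 3: "0 \<le> (\<integral>f. ?Y (Suc N) f \<partial>P0c)" using Xb by (intro integral_nonneg_AE AE_I2) auto
      have "L * (\<integral>f. ?Y (Suc N) f \<partial>P0c) \<le> \<epsilon> * (\<integral>f. ?Y (Suc N) f \<partial>P0c)" using Le 3 by (rule mult_right_mono)
      also have "\<dots> \<le> \<epsilon> * pp" using 2 \<epsilon> by (intro mult_left_mono) auto
      finally show ?thesis using 1 by linarith
    qed
    then have "measure P0c A - \<epsilon> * pp \<le> 0" by (intro LIMSEQ_le_const[OF lim]) auto
    then show ?thesis by (simp add: A_def pp_def)
  qed
  then show ?thesis using u(1,2) by blast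
qed

text \<open>Scaling turns the larger ball at time 1 into the small ball at another time
  \<open>t\<close>. On small balls the density at time \<open>t\<close> is bounded above and the
  density at time 1 is bounded below, so \<open>\<mu>\<close> cancels.\<close>

lemma law_doubling:
  assumes c0: "c = 0" and C: "0 < C"
  shows "\<exists>K>0. \<exists>d>0. \<forall>\<delta>. 0 < \<delta> \<longrightarrow> \<delta> < d \<longrightarrow>
    measure (P 0) {f \<in> D. \<bar>f 1\<bar> < C * \<delta>} \<le> K * measure (P 0) {f \<in> D. \<bar>f 1\<bar> < \<delta>}"
proof -
  \<comment> \<open>Chosen so that \<open>sc t\<close> multiplies space by \<open>C\<close>.\<close>
  define t where "t = C powr (- \<gamma>)"
  have t: "0 < t" using C by (simp add: t_def)
  have tC: "(1 / t) powr (1 / \<gamma>) = C" using C \<gamma> by (simp add: t_def powr_divide powr_powr powr_minus_divide)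
  define q where "q = p 1 0 0"
  have q: "0 < q" using p_pos by (simp add: q_def c0)
  obtain d1 where d1: "0 < d1" "\<And>y. y \<in> S \<Longrightarrow> \<bar>y\<bar> < d1 \<Longrightarrow> \<bar>p t 0 y - p t 0 0\<bar> < 1"
    using p_near_c[of 1 0 t] t by (auto simp: c0)
  have "0 < q / 2" using q by simp
  then obtain d2 where d2: "0 < d2" "\<And>y. y \<in> S \<Longrightarrow> \<bar>y\<bar> < d2 \<Longrightarrow> \<bar>p 1 0 y - q\<bar> < q / 2"
    using p_near_c[of "q / 2" 0 1] by (auto simp: c0 q_def)
  have pt: "0 \<le> p t 0 0" using p_nonneg[of 0 0 t] t by simp
  define K where "K = (p t 0 0 + 1) / (q / 2)"
  have K: "0 < K" "K * (q / 2) = p t 0 0 + 1" using q pt by (auto simp: K_def)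
  have "measure (P 0) {f \<in> D. \<bar>f 1\<bar> < C * \<delta>} \<le> K * measure (P 0) {f \<in> D. \<bar>f 1\<bar> < \<delta>}"
    if \<delta>: "0 < \<delta>" "\<delta> < min d1 d2" for \<delta>
  proof -
    let ?B = "{-\<delta><..<\<delta>}"
    have "measure (P 0) {f \<in> D. \<bar>f 1\<bar> < C * \<delta>} = measure (P 0) {f \<in> D. sc t f \<in> {f \<in> D. \<bar>f 1\<bar> < C * \<delta>}}"
      using t by (intro measure_scaled[symmetric] abs_coord_set) auto
    also have "{f \<in> D. sc t f \<in> {f \<in> D. \<bar>f 1\<bar> < C * \<delta>}} = {f \<in> D. f t \<in> ?B}"
    proof -
      have "sc t f 1 = C * f t" for f using tC by (simp add: path_scaling_def)
      then have "\<bar>sc t f 1\<bar> < C * \<delta> \<longleftrightarrow> f t \<in> ?B" for f using C by (auto simp: abs_mult abs_less_iff)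
      then show ?thesis using sc_in_D[OF _ t] by auto
    qed
    also have "measure (P 0) {f \<in> D. f t \<in> ?B} = (\<integral>y. indicator ?B y * p t 0 y \<partial>\<mu>)"
      by (rule measure_coord[OF t]) simp
    also have "\<dots> \<le> (\<integral>y. K * (indicator ?B y * p 1 0 y) \<partial>\<mu>)"
    proof (rule integral_mono)
      fix y assume "y \<in> space \<mu>"
      then have y: "y \<in> S" by (simp add: space_\<mu>)
      show "indicator ?B y * p t 0 y \<le> K * (indicator ?B y * p 1 0 y)"
      proof (cases "y \<in> ?B")
        case True
        then have ya: "\<bar>y\<bar> < d1" "\<bar>y\<bar> < d2" using \<delta> by auto
        have "p t 0 y \<le> p t 0 0 + 1" using d1(2)[OF y ya(1)] by linarith
        also have "\<dots> \<le> K * p 1 0 y"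
        proof -
          have "q / 2 \<le> p 1 0 y" using d2(2)[OF y ya(2)] by (auto simp: abs_if split: if_splits)
          then have "K * (q / 2) \<le> K * p 1 0 y" using K by (intro mult_left_mono) auto
          then show ?thesis using K(2) by linarith
        qed
        finally show ?thesis using True by simp
      qed simp
    qed (use measure_coord(2)[OF t, of ?B] measure_coord(2)[of 1 ?B] in auto)
    also have "\<dots> = K * measure (P 0) {f \<in> D. f 1 \<in> ?B}" using measure_coord(1)[of 1 ?B] by simp
    also have "{f \<in> D. f 1 \<in> ?B} = {f \<in> D. \<bar>f 1\<bar> < \<delta>}" by auto
    finally show ?thesis .
  qed
  moreover have "0 < min d1 d2" using d1 d2 by simp
  ultimately show ?thesis using K(1) by blast
qed

section \<open>Return to zero after time 1\<close>

definition zero_hits :: "real \<Rightarrow> (real \<Rightarrow> real) set" where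
  "zero_hits w = {f \<in> D. left_hits (\<lambda>_. 0) 0 w f \<noteq> {}}"

lemma zero_hits_iff: "f \<in> zero_hits w \<longleftrightarrow> f \<in> D \<and> (\<exists>t. 0 < t \<and> t \<le> w \<and> Lim (at_left t) f = 0)"
  by (auto simp: zero_hits_def left_hits_def)

lemma zero_hits_mono: "w \<le> w' \<Longrightarrow> zero_hits w \<subseteq> zero_hits w'"
  by (force simp: zero_hits_iff)

lemma zero_hits_scaling:
  assumes f: "f \<in> D" and v: "0 < v" and h: "path_scaling \<gamma> v f \<in> zero_hits w"
  shows "f \<in> zero_hits (w / v)"
proof -
  obtain t where t: "0 < t" "t \<le> w" "Lim (at_left t) (path_scaling \<gamma> v f) = 0" using h by (auto simp: zero_hits_iff)
  then have "Lim (at_left (t / v)) f = 0" using Lim_left_path_scaling[OF f v t(1), of \<gamma>] v by simp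
  then show ?thesis using t v f unfolding zero_hits_iff by (intro conjI exI[of _ "t / v"]) (auto simp: divide_right_mono)
qed

lemma zero_hits_completion: "z \<in> S \<Longrightarrow> zero_hits w \<in> sets (completion (P z))"
proof -
  assume z: "z \<in> S"
  have "Measurable.pred (completion (P z)) (\<lambda>f. left_hits (\<lambda>_. 0) 0 w f \<noteq> {})"
    by (rule left_hits_completion[OF prob_P[OF z] sets_P[OF z]]) auto
  from predE[OF this] show ?thesis using z by (simp add: zero_hits_def space_P)
qed

lemma path_scaling_inverse:
  assumes "f \<in> D" "0 < v" shows "sc v (path_scaling \<gamma> v f) = f"
proof
  fix t
  have "(1 / v) powr (1 / \<gamma>) * v powr (1 / \<gamma>) = 1" using assms(2) by (simp flip: powr_mult)
  then show "sc v (path_scaling \<gamma> v f) t = f t"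
    using assms by (cases "0 \<le> t") (auto simp: path_scaling_def mult.assoc[symmetric] cadlag_paths_def PiE_def extensional_def)
qed

text \<open>Compressing the time interval \<open>[0, T]\<close> to \<open>[0, 1]\<close> turns a
  zero between 1 and \<open>T\<close> into one between \<open>1 / T\<close> and 1. In this way
  \<open>g\<close>, which looks only at times up to 1, describes the behaviour after time 1.\<close>

lemma last_hit_scaled_iff:
  assumes c0: "c = 0" and f: "f \<in> D" and T: "1 < T"
  shows "1 / T < g (sc T f) \<longleftrightarrow> path_shift 1 f \<in> zero_hits (T - 1)"
proof -
  have cz: "curve t = 0" for t unfolding curve_def using c0 by simp
  have lim: "Lim (at_left s) (sc T f) = 0 \<longleftrightarrow> Lim (at_left (s * T)) f = 0" if "0 < s" for s
    using Lim_left_path_scaling[OF f, of "1 / T" s \<gamma>] that T by simp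
  have "1 / T < g (sc T f) \<longleftrightarrow> (\<exists>s. 1 / T < s \<and> s \<le> 1 \<and> Lim (at_left (s * T)) f = 0)"
  proof -
    have "s \<in> hit_times \<gamma> c (sc T f) \<longleftrightarrow> 0 < s \<and> s \<le> 1 \<and> Lim (at_left (s * T)) f = 0" for s
      using lim[of s] by (auto simp: hit_times_eq left_hits_def cz)
    moreover have "0 < s" if "1 / T < s" for s using T that by (meson less_trans zero_less_divide_1_iff zero_less_one)
    ultimately show ?thesis using T by (subst less_last_hit_iff) auto
  qed
  also have "\<dots> \<longleftrightarrow> (\<exists>t. 0 < t \<and> t \<le> T - 1 \<and> Lim (at_left (1 + t)) f = 0)"
  proof
    assume "\<exists>s. 1 / T < s \<and> s \<le> 1 \<and> Lim (at_left (s * T)) f = 0"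
    then obtain s where s: "1 / T < s" "s \<le> 1" "Lim (at_left (s * T)) f = 0" by blast
    have "1 < s * T" "s * T \<le> T" using s T by (auto simp: pos_divide_less_eq)
    then show "\<exists>t. 0 < t \<and> t \<le> T - 1 \<and> Lim (at_left (1 + t)) f = 0" using s by (intro exI[of _ "s * T - 1"]) auto
  next
    assume "\<exists>t. 0 < t \<and> t \<le> T - 1 \<and> Lim (at_left (1 + t)) f = 0"
    then obtain t where t: "0 < t" "t \<le> T - 1" "Lim (at_left (1 + t)) f = 0" by blast
    then show "\<exists>s. 1 / T < s \<and> s \<le> 1 \<and> Lim (at_left (s * T)) f = 0"
      using T by (intro exI[of _ "(1 + t) / T"]) (auto simp: divide_strict_right_mono pos_divide_le_eq)
  qed
  also have "\<dots> \<longleftrightarrow> path_shift 1 f \<in> zero_hits (T - 1)"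
    using Lim_left_path_shift[OF f, of 1] path_shift_cadlag[OF f, of 1] by (auto simp: zero_hits_iff)
  finally show ?thesis .
qed

lemma AE_scaled:
  assumes t: "0 < t" and A: "AE f in P 0. Q f"
  shows "AE f in P 0. Q (sc t f)"
proof -
  have m: "sc t \<in> measurable (P 0) \<Omega>" using measurable_path_scaling[OF _ cone_S, of "1 / t"] t by (simp add: measurable_P)
  have "distr (P 0) \<Omega> (sc t) = P 0" using scaling[OF zero_S, of "1 / t"] t by simp
  then have "AE f in distr (P 0) \<Omega> (sc t). Q f" using A by (simp only:)
  then show ?thesis by (rule AE_distrD[OF m])
qed

text \<open>By scaling, a zero in \<open>(1, n + 2]\<close> has the same probability as
  \<open>g\<close> exceeding \<open>1 / (n + 2)\<close>, and this tends to 1 because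
  \<open>g\<close> is positive almost surely.\<close>

lemma AE_shift_hits_zero:
  assumes c0: "c = 0"
  shows "AE f in P 0. \<exists>n::nat. path_shift 1 f \<in> zero_hits (real n)"
proof -
  interpret P0: prob_space "P 0" by (rule prob_P0)
  obtain R where R: "R \<in> borel_measurable (P 0)" "AE f in P 0. g f = R f \<and> 0 < g f \<and> Lim (at_left (g f)) f = curve (g f)"
    using last_hit_AE by blast
  define A where "A n = {f \<in> D. 1 / real (n + 2) < R f}" for n
  have A: "A n \<in> sets (P 0)" for n
  proof -
    have "Measurable.pred (P 0) (\<lambda>f. 1 / real (n + 2) < R f)" using R(1) by measurable
    from predE[OF this] show ?thesis by (simp add: A_def space_P)
  qed
  have inc: "incseq A"
  proof (rule monoI)
    fix m n :: nat assume "m \<le> n"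
    then have "1 / real (n + 2) \<le> 1 / real (m + 2)" by (simp add: frac_le)
    then show "A m \<le> A n" by (auto simp: A_def)
  qed
  have "AE f in P 0. f \<in> (\<Union>n. A n)"
    using R(2) AE_space
  proof eventually_elim
    case (elim f)
    then have "0 < R f" by simp
    then obtain n where n: "1 / real (Suc n) < R f" using nat_approx_posE by blast
    have "1 / real (n + 2) \<le> 1 / real (Suc n)" by (simp add: frac_le)
    then show ?case using n elim by (auto simp: A_def space_P intro!: exI[of _ n])
  qed
  then have "P0.prob (\<Union>n. A n) = 1" using A by (intro P0.prob_eq_1[THEN iffD2]) auto
  moreover have "(\<lambda>n. P0.prob (A n)) \<longlonglongrightarrow> P0.prob (\<Union>n. A n)"
    by (rule P0.finite_Lim_measure_incseq) (use A inc in auto)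
  ultimately have lim: "(\<lambda>n. P0.prob (A n)) \<longlonglongrightarrow> 1" by simp
  define Z where "Z n = {f \<in> D. sc (real (n + 2)) f \<in> A n}" for n
  have Z: "Z n \<in> sets (P 0)" for n
  proof -
    have "sc (real (n + 2)) -` A n \<inter> space \<Omega> \<in> sets \<Omega>"
      using A[of n] by (intro measurable_sets[OF measurable_path_scaling[OF _ cone_S]]) (auto simp: sets_P)
    then show ?thesis by (simp add: Z_def sets_P vimage_def Int_def conj_commute)
  qed
  have pZ: "P0.prob (Z n) = P0.prob (A n)" for n
    unfolding Z_def using A[of n] by (intro measure_scaled) (auto simp: sets_P)
  have "P0.prob (\<Union>n. Z n) = 1"
  proof (rule antisym)
    have "P0.prob (A n) \<le> P0.prob (\<Union>n. Z n)" for n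
      unfolding pZ[symmetric] using Z by (intro P0.finite_measure_mono) auto
    then show "1 \<le> P0.prob (\<Union>n. Z n)" by (intro LIMSEQ_le_const2[OF lim]) auto
  qed simp
  then have 1: "AE f in P 0. f \<in> (\<Union>n. Z n)" using Z by (intro P0.prob_eq_1[THEN iffD1]) auto
  have "AE f in P 0. \<forall>n::nat. g (sc (real (n + 2)) f) = R (sc (real (n + 2)) f)"
    unfolding AE_all_countable
  proof
    fix n :: nat
    show "AE f in P 0. g (sc (real (n + 2)) f) = R (sc (real (n + 2)) f)"
      by (rule AE_scaled[where Q="\<lambda>f. g f = R f"]) (use R(2) in \<open>auto elim!: eventually_mono\<close>)
  qed
  with 1 AE_space show ?thesis
  proof eventually_elim
    case (elim f)
    then obtain n where "f \<in> Z n" and f: "f \<in> D" by (auto simp: space_P)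
    then have "1 / real (n + 2) < g (sc (real (n + 2)) f)" using elim by (simp add: Z_def A_def)
    then have "path_shift 1 f \<in> zero_hits (real (n + 2) - 1)" using last_hit_scaled_iff[OF c0 f, of "real (n + 2)"] by simp
    then have "path_shift 1 f \<in> zero_hits (real (n + 1))" by simp
    then show ?case by blast
  qed
qed

text \<open>The scale at which a path with nonzero start begins at 1 or at -1. A path started at 0
  is sent to the zero path; this case is treated separately.\<close>

definition normalized :: "(real \<Rightarrow> real) \<Rightarrow> (real \<Rightarrow> real)" where
  "normalized f = sc (\<bar>f 0\<bar> powr \<gamma>) f"

lemma normalized_measurable: "normalized \<in> measurable \<Omega> \<Omega>"
proof -
  have [measurable]: "(\<lambda>f. f 0) \<in> borel_measurable \<Omega>" by (rule measurable_coordinate) simp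
  have "(\<lambda>f. \<bar>f 0\<bar> powr \<gamma>) \<in> borel_measurable \<Omega>" by measurable
  from measurable_random_scaling[OF measurable_ident this] show ?thesis by (simp add: normalized_def[abs_def])
qed

lemma normalized_law:
  assumes \<sigma>: "\<sigma> \<in> {1, -1}" "\<sigma> \<in> S" and z: "z \<in> S" "0 < \<sigma> * z" and U: "U \<in> sets \<Omega>"
  shows "measure (P z) {f \<in> D. normalized f \<in> U} = measure (P \<sigma>) U"
proof -
  interpret P\<sigma>: prob_space "P \<sigma>" by (rule prob_P[OF \<sigma>(2)])
  define v where "v = \<bar>z\<bar> powr \<gamma>"
  have v: "0 < v" using z by (auto simp: v_def)
  have vg: "v powr (1 / \<gamma>) = \<bar>z\<bar>" using \<gamma> by (simp add: v_def powr_powr)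
  have zv: "z = v powr (1 / \<gamma>) * \<sigma>" unfolding vg using \<sigma>(1) z(2) by auto
  have NU: "{f \<in> D. normalized f \<in> U} \<in> sets \<Omega>"
    using measurable_sets[OF normalized_measurable U] by (simp add: vimage_def Int_def conj_commute)
  have "measure (P z) {f \<in> D. normalized f \<in> U} = measure (P \<sigma>) {f \<in> D. path_scaling \<gamma> v f \<in> {f \<in> D. normalized f \<in> U}}"
    by (subst zv) (rule measure_scaled_general[OF \<sigma>(2) v NU])
  also have "\<dots> = measure (P \<sigma>) U"
  proof (rule P\<sigma>.finite_measure_eq_AE)
    have "path_scaling \<gamma> v -` {f \<in> D. normalized f \<in> U} \<inter> space \<Omega> \<in> sets \<Omega>"
      by (rule measurable_sets[OF measurable_path_scaling[OF v cone_S] NU])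
    then show "{f \<in> D. path_scaling \<gamma> v f \<in> {f \<in> D. normalized f \<in> U}} \<in> sets (P \<sigma>)"
      using \<sigma> by (simp add: sets_P vimage_def Int_def conj_commute)
    show "U \<in> sets (P \<sigma>)" using U \<sigma> by (simp add: sets_P)
    show "AE f in P \<sigma>. f \<in> {f \<in> D. path_scaling \<gamma> v f \<in> {f \<in> D. normalized f \<in> U}} \<longleftrightarrow> f \<in> U"
      using AE_start[OF \<sigma>(2)] AE_space
    proof eventually_elim
      case (elim f)
      then have f: "f \<in> D" using \<sigma> by (simp add: space_P)
      have "path_scaling \<gamma> v f 0 = z" using elim(1) zv by (simp add: path_scaling_def)
      then have "normalized (path_scaling \<gamma> v f) = f" using path_scaling_inverse[OF f v] by (simp add: normalized_def v_def)
      then show ?case using f path_scaling_cadlag[OF f v cone_S] by simp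
    qed
  qed
  finally show ?thesis .
qed

lemma normalized_zero_hits:
  assumes f: "f \<in> D" "f 0 \<noteq> 0"
  shows "normalized f \<in> zero_hits w \<Longrightarrow> f \<in> zero_hits (w * \<bar>f 0\<bar> powr \<gamma>)"
    and "f \<in> zero_hits w \<Longrightarrow> normalized f \<in> zero_hits (w / \<bar>f 0\<bar> powr \<gamma>)"
proof -
  define v where "v = \<bar>f 0\<bar> powr \<gamma>"
  have v: "0 < v" using f by (simp add: v_def)
  show "normalized f \<in> zero_hits w \<Longrightarrow> f \<in> zero_hits (w * \<bar>f 0\<bar> powr \<gamma>)"
    using zero_hits_scaling[OF f(1), of "1 / v" w] v by (simp add: normalized_def v_def[symmetric])
  assume h: "f \<in> zero_hits w"
  have "path_scaling \<gamma> v (sc v f) = f" using path_scaling_inverse[OF f(1), of "1 / v"] v by simp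
  then show "normalized f \<in> zero_hits (w / \<bar>f 0\<bar> powr \<gamma>)"
    using zero_hits_scaling[OF sc_in_D[OF f(1) v] v, of w] h by (simp add: normalized_def v_def[symmetric])
qed

text \<open>If paths from \<open>\<sigma>\<close> missed zero forever with probability at least 1/2,
  then so would paths from every point of the same sign. The Markov property at time 1 would
  contradict the certain return to zero, unless that sign is never taken at time 1, which is the
  first alternative.\<close>

lemma sign_hits_zero:
  assumes c0: "c = 0" and \<sigma>: "\<sigma> \<in> {1, -1}"
  shows "\<exists>w>0. \<exists>V\<in>sets \<Omega>. V \<subseteq> zero_hits w \<and>
    (measure (P 0) {f \<in> D. 0 < \<sigma> * f 1} = 0 \<or> \<sigma> \<in> S \<and> 1 / 2 \<le> measure (P \<sigma>) V)"
proof (rule ccontr)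
  assume no: "\<not> ?thesis"
  interpret P0: prob_space "P 0" by (rule prob_P0)
  define N where "N = {f \<in> D. 0 < \<sigma> * f 1}"
  have NF: "N \<in> sets (Ft 1)"
  proof -
    have [measurable]: "(\<lambda>f. f 1) \<in> borel_measurable (Ft 1)" by (rule measurable_coordinate) simp
    have "Measurable.pred (Ft 1) (\<lambda>f. 0 < \<sigma> * f 1)" by measurable
    from predE[OF this] show ?thesis by (simp add: N_def)
  qed
  have pos: "measure (P 0) N \<noteq> 0"
  proof
    assume "measure (P 0) N = 0"
    then have "\<exists>w>0. \<exists>V\<in>sets \<Omega>. V \<subseteq> zero_hits w \<and>
      (measure (P 0) {f \<in> D. 0 < \<sigma> * f 1} = 0 \<or> \<sigma> \<in> S \<and> 1 / 2 \<le> measure (P \<sigma>) V)"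
      by (intro exI[of _ 1] conjI bexI[of _ "{}"]) (auto simp: N_def)
    then show False using no by blast
  qed
  have \<sigma>S: "\<sigma> \<in> S"
  proof (rule ccontr)
    assume n: "\<sigma> \<notin> S"
    then have "S = {0..}" "\<sigma> = -1" using S \<sigma> by auto
    then have "N = {}" using path_in_S[of _ 1] by (force simp: N_def)
    then show False using pos by simp
  qed
  interpret P\<sigma>: prob_space "P \<sigma>" by (rule prob_P[OF \<sigma>S])
  let ?W = "\<lambda>n::nat. zero_hits (real n)"
  have W: "?W n \<in> sets (completion (P \<sigma>))" for n by (rule zero_hits_completion[OF \<sigma>S])
  have small: "emeasure (completion (P \<sigma>)) (?W n) \<le> ennreal (1 / 2)" for n
  proof -
    let ?V = "main_part (P \<sigma>) (?W n)"
    have V: "?V \<in> sets \<Omega>" using main_part_sets[OF W[of n]] by (simp add: sets_P[OF \<sigma>S])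
    have "?V \<subseteq> ?W n" using main_part_null_part_Un[OF W[of n]] by blast
    also have "?W n \<subseteq> zero_hits (real n + 1)" by (rule zero_hits_mono) simp
    finally have "?V \<subseteq> zero_hits (real n + 1)" .
    then have "\<not> 1 / 2 \<le> measure (P \<sigma>) ?V" using no V \<sigma>S by (meson add_nonneg_pos of_nat_0_le_iff zero_less_one)
    then have "ennreal (measure (P \<sigma>) ?V) \<le> ennreal (1 / 2)" by (intro ennreal_leI) simp
    then show ?thesis by (simp only: emeasure_completion[OF W[of n]] P\<sigma>.emeasure_eq_measure)
  qed
  have "(\<lambda>n. emeasure (completion (P \<sigma>)) (?W n)) \<longlonglongrightarrow> emeasure (completion (P \<sigma>)) (\<Union>n. ?W n)"
    by (rule Lim_emeasure_incseq) (use W zero_hits_mono in \<open>auto simp: incseq_def intro!: zero_hits_mono\<close>)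
  then have "emeasure (completion (P \<sigma>)) (\<Union>n. ?W n) \<le> ennreal (1 / 2)"
    by (rule LIMSEQ_le_const2) (use small in auto)
  moreover have WU: "(\<Union>n. ?W n) \<in> sets (completion (P \<sigma>))" using W by blast
  obtain U where U: "U \<in> sets (P \<sigma>)" "(\<Union>n. ?W n) \<subseteq> U"
    "emeasure (completion (P \<sigma>)) (\<Union>n. ?W n) = emeasure (P \<sigma>) U"
    by (rule completion_upper[OF WU]) (rule that; assumption)
  ultimately have "emeasure (P \<sigma>) U \<le> ennreal (1 / 2)" by (simp only:)
  then have Uh: "measure (P \<sigma>) U \<le> 1 / 2" by (simp only: P\<sigma>.emeasure_eq_measure ennreal_le_iff)
  have U\<Omega>: "U \<in> sets \<Omega>" using U(1) by (simp add: sets_P[OF \<sigma>S])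
  \<comment> \<open>\<open>U\<close> is a measurable cover of all paths that ever hit zero, so
    \<open>V\<close> is a measurable event on which the path never does. Normalisation makes its
    probability the same from all starting points of one sign.\<close>
  define V where "V = {f \<in> D. normalized f \<in> D - U}"
  have DU: "D - U \<in> sets \<Omega>" using sets.compl_sets[OF U\<Omega>] by simp
  have V: "V \<in> sets \<Omega>"
    using measurable_sets[OF normalized_measurable DU] by (simp add: V_def vimage_def Int_def conj_commute)
  have "1 / 2 * measure (P 0) N \<le> measure (P 0) {f \<in> N. path_shift 1 f \<in> V}"
  proof (rule markov_lower_bound[OF _ NF V])
    have "1 / 2 \<le> measure (P (f 1)) V" if "f \<in> N" for f
    proof -
      have "f 1 \<in> S" "0 < \<sigma> * f 1" using that path_in_S[of f 1] by (auto simp: N_def)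
      then have "measure (P (f 1)) V = measure (P \<sigma>) (D - U)"
        unfolding V_def using \<sigma> \<sigma>S DU by (intro normalized_law)
      also have "\<dots> = 1 - measure (P \<sigma>) U" using P\<sigma>.prob_compl[OF U(1)] \<sigma>S by (simp add: space_P)
      finally show ?thesis using Uh by simp
    qed
    then show "AE f in P 0. f \<in> N \<longrightarrow> 1 / 2 \<le> measure (P (f 1)) V" by simp
  qed simp_all
  also have "\<dots> = 0"
  proof -
    have NP: "N \<in> sets (P 0)"
    proof -
      have "{f \<in> D. f 1 \<in> {x. 0 < \<sigma> * x}} \<in> sets \<Omega>" by (rule coord_set) auto
      then show ?thesis by (simp add: N_def sets_P)
    qed
    have m: "{f \<in> N. path_shift 1 f \<in> V} \<in> sets (P 0)"
    proof -
      have "path_shift 1 -` V \<inter> space \<Omega> \<in> sets \<Omega>" by (rule measurable_sets[OF measurable_path_shift V]) simp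
      moreover have "{f \<in> N. path_shift 1 f \<in> V} = N \<inter> (path_shift 1 -` V \<inter> space \<Omega>)" by (auto simp: N_def)
      ultimately show ?thesis using NP by (simp add: sets_P)
    qed
    have "AE f in P 0. f \<notin> {f \<in> N. path_shift 1 f \<in> V}"
      using AE_shift_hits_zero[OF c0]
    proof eventually_elim
      case (elim f)
      then obtain n :: nat where n: "path_shift 1 f \<in> zero_hits (real n)" by blast
      show ?case
      proof
        assume "f \<in> {f \<in> N. path_shift 1 f \<in> V}"
        then have f: "f \<in> N" "path_shift 1 f \<in> V" by auto
        have "path_shift 1 f \<in> D" "path_shift 1 f 0 \<noteq> 0" using f \<sigma> by (auto simp: N_def V_def path_shift_def)
        from normalized_zero_hits(2)[OF this n] obtain w where w: "normalized (path_shift 1 f) \<in> zero_hits w" by blast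
        obtain k :: nat where "w \<le> real k" using real_arch_simple by blast
        then have "normalized (path_shift 1 f) \<in> ?W k" using w zero_hits_mono by blast
        then have "normalized (path_shift 1 f) \<in> U" using U(2) by blast
        then show False using f by (simp add: V_def)
      qed
    qed
    then show ?thesis using m by (subst P0.prob_eq_0) auto
  qed
  finally show False using pos by (simp add: measure_le_0_iff)
qed

text \<open>By scaling, a positive last zero in \<open>(0, 1]\<close> becomes a zero in
  \<open>(0, w]\<close> for every \<open>w\<close>, almost surely.\<close>

lemma zero_start_hits_zero:
  assumes c0: "c = 0" and w: "0 < w"
  shows "\<exists>V\<in>sets \<Omega>. V \<subseteq> zero_hits w \<and> measure (P 0) V = 1"
proof -
  interpret P0: prob_space "P 0" by (rule prob_P0)
  have W: "zero_hits w \<in> sets P0c" by (rule zero_hits_completion) simp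
  let ?V = "main_part (P 0) (zero_hits w)"
  have V: "?V \<in> sets (P 0)" by (rule main_part_sets[OF W])
  have "AE f in P 0. 0 < g (sc w f)"
    by (rule AE_scaled[OF w]) (use last_hit_pos in auto)
  then have "AE f in P 0. f \<in> zero_hits w" using AE_space
  proof eventually_elim
    case (elim f)
    then have f: "f \<in> D" by (simp add: space_P)
    have cz: "curve t = 0" for t unfolding curve_def using c0 by simp
    obtain s where s: "s \<in> hit_times \<gamma> c (sc w f)" using less_last_hit_iff[of 0 "sc w f"] elim by auto
    then have "sc w f \<in> zero_hits 1" using sc_in_D[OF f w] by (auto simp: hit_times_eq left_hits_def cz zero_hits_iff)
    then have "f \<in> zero_hits (1 / (1 / w))" using w by (intro zero_hits_scaling[OF f]) auto
    then show ?case by simp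
  qed
  with AE_in_main_part[OF W] have "AE f in P 0. f \<in> ?V" by eventually_elim simp
  then have "measure (P 0) ?V = 1" using V by (intro P0.prob_eq_1[THEN iffD2]) auto
  moreover have "?V \<subseteq> zero_hits w" using main_part_null_part_Un[OF W] by blast
  ultimately show ?thesis using V by (auto simp: sets_P)
qed

text \<open>A start \<open>z\<close> needs a time of order
  \<open>\<bar>z\<bar> powr \<gamma>\<close>, by normalisation. The event \<open>Z\<close> is
  independent of \<open>A\<close>, so the factor 2 holds uniformly over the events of the
  past.\<close>

lemma endpoint_then_zero:
  assumes c0: "c = 0"
  shows "\<exists>K>0. \<forall>\<delta>>0. \<exists>Z\<in>sets \<Omega>. (\<forall>f\<in>Z. path_shift 1 f \<in> zero_hits (K * \<delta> powr \<gamma>)) \<and>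
    (\<forall>A\<in>sets (Ft 1). measure (P 0) {f \<in> A. \<bar>f 1\<bar> < \<delta>} \<le> 2 * measure (P 0) (A \<inter> Z))"
proof -
  interpret P0: prob_space "P 0" by (rule prob_P0)
  obtain w1 V1 where V1: "0 < w1" "V1 \<in> sets \<Omega>" "V1 \<subseteq> zero_hits w1"
    "measure (P 0) {f \<in> D. 0 < 1 * f 1} = 0 \<or> 1 \<in> S \<and> 1 / 2 \<le> measure (P 1) V1"
    using sign_hits_zero[OF c0, of 1] by blast
  obtain w2 V2 where V2: "0 < w2" "V2 \<in> sets \<Omega>" "V2 \<subseteq> zero_hits w2"
    "measure (P 0) {f \<in> D. 0 < - 1 * f 1} = 0 \<or> - 1 \<in> S \<and> 1 / 2 \<le> measure (P (- 1)) V2"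
    using sign_hits_zero[OF c0, of "- 1"] by blast
  define K where "K = max w1 w2"
  have K: "0 < K" "w1 \<le> K" "w2 \<le> K" using V1 by (auto simp: K_def)
  have "\<exists>Z\<in>sets \<Omega>. (\<forall>f\<in>Z. path_shift 1 f \<in> zero_hits (K * \<delta> powr \<gamma>)) \<and>
    (\<forall>A\<in>sets (Ft 1). measure (P 0) {f \<in> A. \<bar>f 1\<bar> < \<delta>} \<le> 2 * measure (P 0) (A \<inter> Z))" if \<delta>: "0 < \<delta>" for \<delta>
  proof -
    have "0 < K * \<delta> powr \<gamma>" using K \<delta> by simp
    from zero_start_hits_zero[OF c0 this] obtain V0 where V0: "V0 \<in> sets \<Omega>" "V0 \<subseteq> zero_hits (K * \<delta> powr \<gamma>)" "measure (P 0) V0 = 1"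
      by blast
    \<comment> \<open>Positive and negative starts are reduced to 1 and -1 by normalisation. The
      start 0 cannot be normalised and needs the almost sure immediate return.\<close>
    define N1 where "N1 = {f \<in> D. 0 < f 0} \<inter> {f \<in> D. normalized f \<in> V1}"
    define N2 where "N2 = {f \<in> D. f 0 < 0} \<inter> {f \<in> D. normalized f \<in> V2}"
    define N3 where "N3 = {f \<in> D. f 0 = 0} \<inter> V0"
    define V where "V = {f \<in> D. \<bar>f 0\<bar> < \<delta>} \<inter> (N1 \<union> N2 \<union> N3)"
    have nm: "{f \<in> D. normalized f \<in> U} \<in> sets \<Omega>" if "U \<in> sets \<Omega>" for U
      using measurable_sets[OF normalized_measurable that] by (simp add: vimage_def Int_def conj_commute)
    have c0s: "{f \<in> D. 0 < f 0} \<in> sets \<Omega>" "{f \<in> D. f 0 < 0} \<in> sets \<Omega>" "{f \<in> D. f 0 = 0} \<in> sets \<Omega>"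
      using coord_set[of 0 "{0<..}"] coord_set[of 0 "{..<0}"] coord_set[of 0 "{0}"] by auto
    have Ns: "N1 \<in> sets \<Omega>" "N2 \<in> sets \<Omega>" "N3 \<in> sets \<Omega>"
      unfolding N1_def N2_def N3_def using c0s nm V1(2) V2(2) V0(1) by auto
    then have V: "V \<in> sets \<Omega>" unfolding V_def using abs_coord_set[of 0 \<delta>] by auto
    have Vsub: "f \<in> zero_hits (K * \<delta> powr \<gamma>)" if f: "f \<in> V" for f
    proof -
      have fD: "f \<in> D" "\<bar>f 0\<bar> < \<delta>" using f by (auto simp: V_def)
      have bound: "zero_hits (w * \<bar>f 0\<bar> powr \<gamma>) \<subseteq> zero_hits (K * \<delta> powr \<gamma>)" if "0 < w" "w \<le> K" for w
        using that fD \<gamma> K by (intro zero_hits_mono mult_mono powr_mono2) auto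
      consider "f \<in> N1" | "f \<in> N2" | "f \<in> N3" using f by (auto simp: V_def)
      then show ?thesis
      proof cases
        case 1
        then have "normalized f \<in> zero_hits w1" "f 0 \<noteq> 0" using V1(3) by (auto simp: N1_def)
        then show ?thesis using normalized_zero_hits(1)[OF fD(1)] bound[OF V1(1) K(2)] by blast
      next
        case 2
        then have "normalized f \<in> zero_hits w2" "f 0 \<noteq> 0" using V2(3) by (auto simp: N2_def)
        then show ?thesis using normalized_zero_hits(1)[OF fD(1)] bound[OF V2(1) K(3)] by blast
      next
        case 3
        then show ?thesis using V0(2) by (auto simp: N3_def)
      qed
    qed
    have sub: "measure (P z) {f \<in> D. normalized f \<in> U} \<le> measure (P z) V"
      if z: "z \<in> S" "\<bar>z\<bar> < \<delta>" and U: "U \<in> sets \<Omega>" and imp: "\<And>f. f \<in> D \<Longrightarrow> f 0 = z \<Longrightarrow> normalized f \<in> U \<Longrightarrow> f \<in> V" for z U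
    proof -
      interpret Pz: prob_space "P z" by (rule prob_P[OF z(1)])
      show ?thesis
      proof (rule Pz.finite_measure_mono_AE)
        show "AE f in P z. f \<in> {f \<in> D. normalized f \<in> U} \<longrightarrow> f \<in> V"
          using AE_start[OF z(1)] by eventually_elim (use imp in auto)
      qed (use V z in \<open>simp add: sets_P\<close>)
    qed
    have low: "1 / 2 \<le> measure (P z) V"
      if z: "z \<in> S" "\<bar>z\<bar> < \<delta>" "0 < z \<Longrightarrow> measure (P 0) {f \<in> D. 0 < 1 * f 1} \<noteq> 0"
        "z < 0 \<Longrightarrow> measure (P 0) {f \<in> D. 0 < - 1 * f 1} \<noteq> 0" for z
    proof -
      consider "0 < z" | "z < 0" | "z = 0" by linarith
      then show ?thesis
      proof cases
        case 1
        then have v: "1 \<in> S" "1 / 2 \<le> measure (P 1) V1" using V1(4) z(3) by auto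
        have "measure (P 1) V1 = measure (P z) {f \<in> D. normalized f \<in> V1}"
          using 1 z v V1 by (intro normalized_law[symmetric]) auto
        also have "\<dots> \<le> measure (P z) V" using 1 z V1(2) by (intro sub) (auto simp: V_def N1_def)
        finally show ?thesis using v by linarith
      next
        case 2
        then have v: "-1 \<in> S" "1 / 2 \<le> measure (P (-1)) V2" using V2(4) z(4) by auto
        have "measure (P (-1)) V2 = measure (P z) {f \<in> D. normalized f \<in> V2}"
          using 2 z v V2 by (intro normalized_law[symmetric]) auto
        also have "\<dots> \<le> measure (P z) V" using 2 z V2(2) by (intro sub) (auto simp: V_def N2_def)
        finally show ?thesis using v by linarith
      next
        case 3
        have "measure (P 0) V0 \<le> measure (P 0) V"
        proof (rule P0.finite_measure_mono_AE)
          show "AE f in P 0. f \<in> V0 \<longrightarrow> f \<in> V"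
            using AE_start[OF zero_S] AE_space by eventually_elim (use \<delta> in \<open>auto simp: V_def N3_def space_P\<close>)
        qed (use V in \<open>simp add: sets_P\<close>)
        then show ?thesis using V0(3) 3 by simp
      qed
    qed
    define Z where "Z = {f \<in> D. path_shift 1 f \<in> V}"
    have Z: "Z \<in> sets \<Omega>"
      using measurable_sets[OF measurable_path_shift V] by (simp add: Z_def vimage_def Int_def conj_commute)
    \<comment> \<open>The estimate from 1 or -1 is available only for a sign that occurs at time 1
      with positive probability; the other sign is excluded almost surely.\<close>
    have sgn: "AE f in P 0. (0 < f 1 \<longrightarrow> measure (P 0) {f \<in> D. 0 < 1 * f 1} \<noteq> 0) \<and>
        (f 1 < 0 \<longrightarrow> measure (P 0) {f \<in> D. 0 < - 1 * f 1} \<noteq> 0)"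
    proof -
      have *: "AE f in P 0. 0 < \<sigma> * f 1 \<longrightarrow> measure (P 0) {f \<in> D. 0 < \<sigma> * f 1} \<noteq> 0" for \<sigma>
      proof (cases "measure (P 0) {f \<in> D. 0 < \<sigma> * f 1} = 0")
        case True
        have "{f \<in> D. f 1 \<in> {x. 0 < \<sigma> * x}} \<in> sets \<Omega>" by (rule coord_set) auto
        then have "{f \<in> D. 0 < \<sigma> * f 1} \<in> sets (P 0)" by (simp add: sets_P)
        then have "AE f in P 0. f \<notin> {f \<in> D. 0 < \<sigma> * f 1}" using True P0.prob_eq_0 by blast
        then show ?thesis using AE_space by eventually_elim (auto simp: space_P)
      qed simp
      show ?thesis using *[of 1] *[of "-1"] by eventually_elim auto
    qed
    have "measure (P 0) {f \<in> A. \<bar>f 1\<bar> < \<delta>} \<le> 2 * measure (P 0) (A \<inter> Z)" if A: "A \<in> sets (Ft 1)" for A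
    proof -
      have AD: "A \<subseteq> D" using sets.sets_into_space[OF A] by simp
      define N where "N = {f \<in> A. \<bar>f 1\<bar> < \<delta>}"
      have N: "N \<in> sets (Ft 1)"
      proof -
        have [measurable]: "(\<lambda>f. f 1) \<in> borel_measurable (Ft 1)" by (rule measurable_coordinate) simp
        have "Measurable.pred (Ft 1) (\<lambda>f. \<bar>f 1\<bar> < \<delta>)" by measurable
        from predE[OF this] have "{f \<in> D. \<bar>f 1\<bar> < \<delta>} \<in> sets (Ft 1)" by simp
        moreover have "N = A \<inter> {f \<in> D. \<bar>f 1\<bar> < \<delta>}" using AD by (auto simp: N_def)
        ultimately show ?thesis using A by auto
      qed
      have "1 / 2 * measure (P 0) N \<le> measure (P 0) {f \<in> N. path_shift 1 f \<in> V}"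
      proof (rule markov_lower_bound[OF _ N V])
        show "AE f in P 0. f \<in> N \<longrightarrow> 1 / 2 \<le> measure (P (f 1)) V"
          using sgn AE_space
        proof eventually_elim
          case (elim f)
          then show ?case using low[of "f 1"] path_in_S[of f 1] by (auto simp: N_def space_P)
        qed
      qed simp_all
      also have "\<dots> \<le> measure (P 0) (A \<inter> Z)"
      proof (rule P0.finite_measure_mono)
        show "{f \<in> N. path_shift 1 f \<in> V} \<subseteq> A \<inter> Z" using AD by (auto simp: N_def Z_def)
        have "(indicator A :: _ \<Rightarrow> real) \<in> borel_measurable \<Omega>"
          by (rule measurable_coord_algebra_mono[of _ _ _ "{0..1}"]) (use A in auto)
        then have "A \<in> sets \<Omega>" using AD by (simp add: borel_measurable_indicator_iff Int_absorb2)
        then show "A \<inter> Z \<in> sets (P 0)" using Z by (simp add: sets_P)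
      qed
      finally show ?thesis by (simp add: N_def)
    qed
    moreover have "path_shift 1 f \<in> zero_hits (K * \<delta> powr \<gamma>)" if "f \<in> Z" for f using that Vsub by (simp add: Z_def)
    ultimately show ?thesis using Z by blast
  qed
  then show ?thesis using K(1) by blast
qed

section \<open>Assembly of the estimates at the origin\<close>

text \<open>An endpoint of size below \<open>\<delta>\<close> is traded for a zero shortly after 1,
  scaling makes it a zero shortly before 1, and the excursion bound before the last zero applies.
  The probability of such a late zero is of the same order as that of the endpoint event, so only
  constants are lost, and these are absorbed into \<open>\<epsilon>\<close>.\<close>

lemma end_tight_zero:
  assumes c0: "c = 0"
  shows end_tight
proof (rule end_tightI)
  interpret P0: prob_space "P 0" by (rule prob_P0)
  fix \<epsilon>0 \<eta>0 :: real assume \<epsilon>0: "0 < \<epsilon>0" and \<eta>0: "0 < \<eta>0"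
  obtain K where K: "0 < K" and hit: "\<And>\<delta>. 0 < \<delta> \<Longrightarrow> \<exists>Z\<in>sets \<Omega>. (\<forall>f\<in>Z. path_shift 1 f \<in> zero_hits (K * \<delta> powr \<gamma>)) \<and>
    (\<forall>A\<in>sets (Ft 1). measure (P 0) {f \<in> A. \<bar>f 1\<bar> < \<delta>} \<le> 2 * measure (P 0) (A \<inter> Z))"
    using endpoint_then_zero[OF c0] by blast
  obtain R where R: "0 < R" and late: "\<And>\<omega>. 0 < \<omega> \<Longrightarrow> \<omega> \<le> 1 / 4 \<Longrightarrow>
    measure P0c {f \<in> D. 1 - \<omega> \<le> g f} \<le> 2 * measure (P 0) {f \<in> D. \<bar>f (1 + \<omega>)\<bar> < R * (3 * \<omega>) powr (1 / \<gamma>)}"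
    using late_zero_bound[OF c0] by blast
  \<comment> \<open>Since \<open>\<omega> \<le> 2 * w\<close>, the radius in the bound for late
    zeros is at most \<open>R\<close> times the power \<open>1 / \<gamma>\<close> of
    \<open>6 * K * \<delta> powr \<gamma>\<close>, which is \<open>C * \<delta>\<close>.\<close>
  define C where "C = R * (6 * K) powr (1 / \<gamma>)"
  have C: "0 < C" using R K by (simp add: C_def)
  obtain K2 d0 where K2: "0 < K2" and d0: "0 < d0" and dbl: "\<And>\<delta>. 0 < \<delta> \<Longrightarrow> \<delta> < d0 \<Longrightarrow>
    measure (P 0) {f \<in> D. \<bar>f 1\<bar> < C * \<delta>} \<le> K2 * measure (P 0) {f \<in> D. \<bar>f 1\<bar> < \<delta>}"
    using law_doubling[OF c0 C] by blast
  \<comment> \<open>The factor 4 collects the 2 from the return to zero and the 2 from the late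
    zeros; \<open>K2\<close> comes from doubling.\<close>
  define \<epsilon> where "\<epsilon> = \<epsilon>0 / (4 * K2)"
  have \<epsilon>: "0 < \<epsilon>" using \<epsilon>0 K2 by (simp add: \<epsilon>_def)
  have "0 < \<eta>0 / 2" using \<eta>0 by simp
  from far_before_last_hit[OF c0 \<epsilon> this] obtain u where u: "0 < u" "u < 1" and
    before: "\<And>s \<tau> \<tau>1 q. u < s \<Longrightarrow> s < 1 \<Longrightarrow> \<tau> < \<tau>1 \<Longrightarrow> 0 < \<tau>1 \<Longrightarrow> q \<le> s * \<tau>1 \<Longrightarrow>
    measure P0c {f \<in> D. far c u q (\<eta>0 / 2) f \<and> \<tau>1 < g f} \<le> \<epsilon> * measure P0c {f \<in> D. \<tau> \<le> g f}" by blast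
  define u' where "u' = (1 + u) / 2"
  have u': "0 < u'" "u' < 1" "u < u'" using u by (auto simp: u'_def)
  have "1 < 2 powr \<gamma>" using \<gamma> by simp
  \<comment> \<open>The bounds ensure in turn that \<open>\<omega> \<le> 1 / 4\<close>, that times
    beyond \<open>u'\<close> stay beyond \<open>u\<close> after division by \<open>T\<close>, and
    that the spatial factor of \<open>sc T\<close> is at least 1/2.\<close>
  define w0 where "w0 = min (1 / 8) (min ((1 - u) / 2) (2 powr \<gamma> - 1))"
  have w0: "0 < w0" "w0 \<le> 1 / 8" "w0 \<le> (1 - u) / 2" "w0 \<le> 2 powr \<gamma> - 1"
  proof -
    show "0 < w0" using u \<open>1 < 2 powr \<gamma>\<close> by (simp add: w0_def)
    show "w0 \<le> 1 / 8" unfolding w0_def by (rule min.cobounded1)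
    show "w0 \<le> (1 - u) / 2" unfolding w0_def by (rule min.coboundedI2[OF min.cobounded1])
    show "w0 \<le> 2 powr \<gamma> - 1" unfolding w0_def by (rule min.coboundedI2[OF min.cobounded2])
  qed
  define d where "d = min d0 ((w0 / K) powr (1 / \<gamma>))"
  have d: "0 < d" "d \<le> d0" "d \<le> (w0 / K) powr (1 / \<gamma>)" using d0 w0 K by (auto simp: d_def)
  have "measure (P 0) {f \<in> D. far c u' s \<eta>0 f \<and> f 1 \<in> ball c \<delta>} \<le> \<epsilon>0 * measure (P 0) {f \<in> D. f 1 \<in> ball c \<delta>}"
    if \<delta>: "0 < \<delta>" "\<delta> < d" and s: "0 < s" "s < 1" for \<delta> s
  proof -
    define w where "w = K * \<delta> powr \<gamma>"
    have w: "0 < w" "w \<le> w0"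
    proof -
      show "0 < w" using K \<delta> by (simp add: w_def)
      have "\<delta> powr \<gamma> \<le> ((w0 / K) powr (1 / \<gamma>)) powr \<gamma>" using \<delta> d \<gamma> by (intro powr_mono2) auto
      also have "\<dots> = w0 / K" using w0 K \<gamma> by (simp add: powr_powr)
      finally show "w \<le> w0" using K by (simp add: w_def pos_le_divide_eq mult.commute)
    qed
    define T where "T = 1 + w"
    have T: "1 < T" using w by (simp add: T_def)
    \<comment> \<open>Chosen so that \<open>1 - \<omega>\<close> lies strictly below
      \<open>1 / T\<close>; this is the gap between the two times that
      \<open>far_before_last_hit\<close> asks for.\<close>
    define \<omega> where "\<omega> = 2 * w / T"
    have \<omega>: "0 < \<omega>" "\<omega> \<le> 2 * w" "1 - \<omega> < 1 / T"
    proof -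
      show "0 < \<omega>" using w T by (simp add: \<omega>_def)
      have "2 * w \<le> 2 * w * T" using w T by simp
      then show "\<omega> \<le> 2 * w" using T by (simp add: \<omega>_def pos_divide_le_eq)
      have "(1 - \<omega>) * T = T - 2 * w" using T by (simp add: \<omega>_def left_diff_distrib)
      then have "(1 - \<omega>) * T < 1" using w by (simp add: T_def)
      then show "1 - \<omega> < 1 / T" using T by (simp add: pos_less_divide_eq)
    qed
    obtain Z where Z: "Z \<in> sets \<Omega>" "\<And>f. f \<in> Z \<Longrightarrow> path_shift 1 f \<in> zero_hits w"
      "\<And>A. A \<in> sets (Ft 1) \<Longrightarrow> measure (P 0) {f \<in> A. \<bar>f 1\<bar> < \<delta>} \<le> 2 * measure (P 0) (A \<inter> Z)"
      using hit[OF \<delta>(1)] unfolding w_def by blast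
    define A where "A = {f \<in> D. far c u' s \<eta>0 f}"
    have AF: "A \<in> sets (Ft 1)"
    proof -
      have "Measurable.pred (Ft 1) (far c u' s \<eta>0)" by (rule far_measurable) (use u' s in auto)
      from predE[OF this] show ?thesis by (simp add: A_def)
    qed
    have A\<Omega>: "A \<in> sets \<Omega>" unfolding A_def using u' by (intro far_set) simp
    \<comment> \<open>The excursion bound requires a final time beyond \<open>u\<close>; enlarging
      \<open>s\<close> to at least \<open>u'\<close> is harmless.\<close>
    define s' where "s' = max s u'"
    have s': "u < s'" "s' < 1" "s \<le> s'" using s u' by (auto simp: s'_def)
    obtain R0 where R0: "R0 \<in> borel_measurable (P 0)" "AE f in P 0. g f = R0 f \<and> 0 < g f \<and> Lim (at_left (g f)) f = curve (g f)"
      using last_hit_AE by blast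
    have gR: "AE f in P 0. g f = R0 f" using R0(2) by eventually_elim simp
    define H where "H = {f \<in> D. far c u (s' * (1 / T)) (\<eta>0 / 2) f} \<inter> {f \<in> D. 1 / T < R0 f}"
    have H: "H \<in> sets \<Omega>"
    proof -
      have "Measurable.pred (P 0) (\<lambda>f. 1 / T < R0 f)" using R0(1) by measurable
      from predE[OF this] have "{f \<in> D. 1 / T < R0 f} \<in> sets \<Omega>" by (simp add: space_P sets_P)
      then show ?thesis unfolding H_def using far_set[of u c "s' * (1 / T)" "\<eta>0 / 2"] u by auto
    qed
    have far: "far c u (s' * (1 / T)) (\<eta>0 / 2) (sc T f)" if f: "far c u' s \<eta>0 f" for f
    proof -
      obtain r where r: "u' < r" "r < s" "\<bar>f r\<bar> > \<eta>0" using f by (auto simp: far_def c0)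
      have k: "1 / 2 \<le> (1 / T) powr (1 / \<gamma>)"
      proof -
        have "T powr (1 / \<gamma>) \<le> (2 powr \<gamma>) powr (1 / \<gamma>)" using T w w0 \<gamma> by (intro powr_mono2) (auto simp: T_def)
        also have "\<dots> = 2" using \<gamma> by (simp add: powr_powr)
        finally show ?thesis using T by (simp add: powr_divide field_simps)
      qed
      have "sc T f (r / T) = (1 / T) powr (1 / \<gamma>) * f r" using r u' T by (simp add: path_scaling_def)
      then have "\<bar>sc T f (r / T)\<bar> = (1 / T) powr (1 / \<gamma>) * \<bar>f r\<bar>" by (simp add: abs_mult)
      moreover have "1 / 2 * \<bar>f r\<bar> \<le> (1 / T) powr (1 / \<gamma>) * \<bar>f r\<bar>" using k by (rule mult_right_mono) simp
      ultimately have "\<eta>0 / 2 < \<bar>sc T f (r / T)\<bar>" using r by linarith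
      moreover have "u < r / T"
      proof -
        have "u * w \<le> 1 * w" using u w by (intro mult_right_mono) auto
        moreover have "u * T = u + u * w" by (simp add: T_def distrib_left)
        ultimately have "u * T \<le> u + (1 - u) / 2" using w w0 by linarith
        also have "\<dots> = u'" by (simp add: u'_def field_simps)
        finally show ?thesis using r T by (simp add: pos_less_divide_eq)
      qed
      moreover have "r / T < s' * (1 / T)" using r s' T by (simp add: divide_strict_right_mono)
      ultimately show ?thesis unfolding far_def c0 by (intro exI[of _ "r / T"]) auto
    qed
    \<comment> \<open>A path in \<open>Z\<close> has a zero in \<open>(1, T]\<close>, so after
      scaling by \<open>T\<close> its last zero exceeds \<open>1 / T\<close> and its excursion ends
      before \<open>s' * (1 / T)\<close>. The law \<open>P 0\<close> does not change under this
      scaling.\<close>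
    have step1: "measure (P 0) (A \<inter> Z) \<le> measure (P 0) H"
    proof -
      have "measure (P 0) (A \<inter> Z) \<le> measure (P 0) {f \<in> D. sc T f \<in> H}"
      proof (rule P0.finite_measure_mono_AE)
        have "AE f in P 0. g (sc T f) = R0 (sc T f)" by (rule AE_scaled[OF _ gR]) (use T in simp)
        then show "AE f in P 0. f \<in> A \<inter> Z \<longrightarrow> f \<in> {f \<in> D. sc T f \<in> H}"
        proof eventually_elim
          case (elim f)
          show ?case
          proof
            assume f: "f \<in> A \<inter> Z"
            then have fD: "f \<in> D" and ff: "far c u' s \<eta>0 f" by (auto simp: A_def)
            have "path_shift 1 f \<in> zero_hits (T - 1)" using f Z(2) by (simp add: T_def)
            then have "1 / T < g (sc T f)" using last_hit_scaled_iff[OF c0 fD T] by simp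
            then show "f \<in> {f \<in> D. sc T f \<in> H}" using elim fD far[OF ff] sc_in_D[OF fD, of T] T by (simp add: H_def)
          qed
        qed
        have "sc T -` H \<inter> space \<Omega> \<in> sets \<Omega>"
          using T by (intro measurable_sets[OF measurable_path_scaling[OF _ cone_S] H]) simp
        then show "{f \<in> D. sc T f \<in> H} \<in> sets (P 0)" by (simp add: sets_P vimage_def Int_def conj_commute)
      qed
      also have "\<dots> = measure (P 0) H" using T by (intro measure_scaled H) simp
      finally show ?thesis .
    qed
    have step2: "measure (P 0) H \<le> \<epsilon> * measure P0c {f \<in> D. 1 - \<omega> \<le> g f}"
    proof -
      interpret M: prob_space P0c by (rule prob_P0c)
      have "measure (P 0) H = measure P0c H" using H by (simp add: sets_P)
      also have "\<dots> \<le> measure P0c {f \<in> D. far c u (s' * (1 / T)) (\<eta>0 / 2) f \<and> 1 / T < g f}"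
      proof (rule M.finite_measure_mono_AE)
        show "AE f in P0c. f \<in> H \<longrightarrow> f \<in> {f \<in> D. far c u (s' * (1 / T)) (\<eta>0 / 2) f \<and> 1 / T < g f}"
          using AE_completion[OF gR] by eventually_elim (auto simp: H_def)
        have "{f \<in> D. far c u (s' * (1 / T)) (\<eta>0 / 2) f \<and> 1 / T < g f} = {f \<in> D. far c u (s' * (1 / T)) (\<eta>0 / 2) f} \<inter> {f \<in> D. 1 / T < g f}" by auto
        then show "{f \<in> D. far c u (s' * (1 / T)) (\<eta>0 / 2) f \<and> 1 / T < g f} \<in> sets P0c"
          using sets_P0c[OF far_set[of u c "s' * (1 / T)" "\<eta>0 / 2"]] last_hit_event(2)[of "1 / T"] u by auto
      qed
      also have "\<dots> \<le> \<epsilon> * measure P0c {f \<in> D. 1 - \<omega> \<le> g f}"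
        using s' \<omega> T by (intro before) auto
      finally show ?thesis .
    qed
    have step3: "measure P0c {f \<in> D. 1 - \<omega> \<le> g f} \<le> 2 * (K2 * measure (P 0) {f \<in> D. \<bar>f 1\<bar> < \<delta>})"
    proof -
      define y where "y = R * (3 * \<omega>) powr (1 / \<gamma>)"
      have "measure P0c {f \<in> D. 1 - \<omega> \<le> g f} \<le> 2 * measure (P 0) {f \<in> D. \<bar>f (1 + \<omega>)\<bar> < y}"
        unfolding y_def using \<omega> w w0 by (intro late) auto
      \<comment> \<open>Passing from time \<open>1 + \<omega>\<close> to time 1 divides space by a
        factor of at least 1, so smallness is preserved.\<close>
      also have "measure (P 0) {f \<in> D. \<bar>f (1 + \<omega>)\<bar> < y} \<le> measure (P 0) {f \<in> D. \<bar>f 1\<bar> < C * \<delta>}"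
      proof -
        have yC: "y \<le> C * \<delta>"
        proof -
          have "(3 * \<omega>) powr (1 / \<gamma>) \<le> (6 * K * \<delta> powr \<gamma>) powr (1 / \<gamma>)"
            using \<omega> \<gamma> by (intro powr_mono2) (auto simp: w_def)
          also have "\<dots> = (6 * K) powr (1 / \<gamma>) * \<delta>" using K \<delta> \<gamma> by (simp add: powr_mult powr_powr)
          finally show ?thesis using R by (simp add: y_def C_def mult.assoc)
        qed
        have "measure (P 0) {f \<in> D. \<bar>f (1 + \<omega>)\<bar> < y} \<le> measure (P 0) {f \<in> D. sc (1 + \<omega>) f \<in> {f \<in> D. \<bar>f 1\<bar> < C * \<delta>}}"
        proof (rule P0.finite_measure_mono)
          show "{f \<in> D. \<bar>f (1 + \<omega>)\<bar> < y} \<subseteq> {f \<in> D. sc (1 + \<omega>) f \<in> {f \<in> D. \<bar>f 1\<bar> < C * \<delta>}}"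
          proof
            fix f assume f: "f \<in> {f \<in> D. \<bar>f (1 + \<omega>)\<bar> < y}"
            have "(1 / (1 + \<omega>)) powr (1 / \<gamma>) \<le> 1" using \<omega> \<gamma> by (intro powr_le1) auto
            then have "(1 / (1 + \<omega>)) powr (1 / \<gamma>) * \<bar>f (1 + \<omega>)\<bar> \<le> 1 * \<bar>f (1 + \<omega>)\<bar>" by (rule mult_right_mono) simp
            then have "\<bar>sc (1 + \<omega>) f 1\<bar> \<le> \<bar>f (1 + \<omega>)\<bar>" using \<omega> by (simp add: path_scaling_def abs_mult)
            also have "\<dots> < C * \<delta>" using f yC by simp
            finally show "f \<in> {f \<in> D. sc (1 + \<omega>) f \<in> {f \<in> D. \<bar>f 1\<bar> < C * \<delta>}}"
              using f sc_in_D[of f "1 + \<omega>"] \<omega> by simp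
          qed
          have "sc (1 + \<omega>) -` {f \<in> D. \<bar>f 1\<bar> < C * \<delta>} \<inter> space \<Omega> \<in> sets \<Omega>"
            using \<omega> by (intro measurable_sets[OF measurable_path_scaling[OF _ cone_S] abs_coord_set]) auto
          then show "{f \<in> D. sc (1 + \<omega>) f \<in> {f \<in> D. \<bar>f 1\<bar> < C * \<delta>}} \<in> sets (P 0)"
            by (simp add: sets_P vimage_def Int_def conj_commute)
        qed
        also have "\<dots> = measure (P 0) {f \<in> D. \<bar>f 1\<bar> < C * \<delta>}" using \<omega> by (intro measure_scaled abs_coord_set) auto
        finally show ?thesis .
      qed
      also have "\<dots> \<le> K2 * measure (P 0) {f \<in> D. \<bar>f 1\<bar> < \<delta>}" using \<delta> d by (intro dbl) auto
      finally show ?thesis by simp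
    qed
    define m where "m = measure (P 0) {f \<in> D. \<bar>f 1\<bar> < \<delta>}"
    have "measure (P 0) {f \<in> A. \<bar>f 1\<bar> < \<delta>} \<le> 2 * (\<epsilon> * (2 * (K2 * m)))"
    proof -
      have "\<epsilon> * measure P0c {f \<in> D. 1 - \<omega> \<le> g f} \<le> \<epsilon> * (2 * (K2 * m))"
        using step3 \<epsilon> unfolding m_def by (intro mult_left_mono) auto
      then show ?thesis using Z(3)[OF AF] step1 step2 by linarith
    qed
    also have "\<dots> = \<epsilon>0 * m" using K2 by (simp add: \<epsilon>_def)
    finally have "measure (P 0) {f \<in> A. \<bar>f 1\<bar> < \<delta>} \<le> \<epsilon>0 * m" .
    moreover have "{f \<in> A. \<bar>f 1\<bar> < \<delta>} = {f \<in> D. far c u' s \<eta>0 f \<and> f 1 \<in> ball c \<delta>}"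
      by (auto simp: A_def dist_real_def c0)
    moreover have "{f \<in> D. \<bar>f 1\<bar> < \<delta>} = {f \<in> D. f 1 \<in> ball c \<delta>}" by (auto simp: dist_real_def c0)
    ultimately show ?thesis by (simp add: m_def)
  qed
  then show "\<exists>u d. 0 < u \<and> u < 1 \<and> 0 < d \<and> (\<forall>\<delta> s. 0 < \<delta> \<longrightarrow> \<delta> < d \<longrightarrow> 0 < s \<longrightarrow> s < 1 \<longrightarrow>
     measure (P 0) {f \<in> D. far c u s \<eta>0 f \<and> f 1 \<in> ball c \<delta>} \<le> \<epsilon>0 * measure (P 0) {f \<in> D. f 1 \<in> ball c \<delta>})"
    using u' d(1) by blast
qed

lemma end_tight_holds: end_tight
  using end_tight_zero end_tight_nonzero by blast

end

theorem theorem3: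
  fixes S :: "real set"
    and P :: "real \<Rightarrow> (real \<Rightarrow> real) measure"
    and \<mu> :: "real measure"
    and p :: "real \<Rightarrow> real \<Rightarrow> real \<Rightarrow> real"
    and \<gamma> c :: real
  assumes "S = {0..} \<or> S = UNIV"
    and "\<gamma> > 0"
    and "feller_family S P"
    and "self_similar S \<gamma> P"
    and "sigma_finite_measure \<mu>"
    and "sets \<mu> = sets (restrict_space borel S)"
    and "transition_densities S P \<mu> p"
    and "\<And>x. x \<in> S \<Longrightarrow> continuous_on ({0<..} \<times> S) (\<lambda>(s, y). p s x y)"
    and "\<And>x y s t. \<lbrakk>x \<in> S; y \<in> S; 0 < s; s < t; p t x y > 0\<rbrakk>
           \<Longrightarrow> p t x y = (\<integral>z. p (t - s) x z * p s z y \<partial>\<mu>)"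
    and "c \<in> S"
    and "p 1 0 c > 0"
    and "AE f in P 0. last_hit \<gamma> c f > 0"
  shows "is_bridge_law S P 1 0 c
           (distr (completion (P 0)) (path_space S {0..1}) (rescaled_path \<gamma> c))"
proof -
  interpret self_similar_bridge S P \<mu> p \<gamma> c
    by (rule self_similar_bridge.intro) (fact assms)+
  show ?thesis by (rule bridge_law_if_end_tight[OF end_tight_holds])
qed

end
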